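(* Let $\mathbf{k}$ be an algebraically closed field with $\operatorname{char}(\mathbf{k})\neq 2$, let $D(H_4)$ be the Drinfeld double of the $4$-dimensional Sweedler Hopf algebra $H_4$ over $\mathbf{k}$, and let $r(D_4)$ be the Green ring of $D(H_4)$. The map $\gamma_{\operatorname{max}}$ induces a homomorphism from $r(D_4)_{\geq 0}$ to $\mathbb{Z}_{\geq 0}$; that is, $\gamma_{\operatorname{max}}$ takes values in $\mathbb{Z}_{\geq 0}$ on $r(D_4)_{\geq 0}$ and, for any $x,y\in r(D_4)_{\geq 0}$, $$\gamma_{\operatorname{max}}(x+y)=\gamma_{\operatorname{max}}(x)+\gamma_{\operatorname{max}}(y),\qquad \gamma_{\operatorname{max}}(xy)=\gamma_{\operatorname{max}}(x)\gamma_{\operatorname{max}}(y).$$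
   Context: All modules are finite-dimensional left modules. For a finite-dimensional Hopf algebra $H$ over $\mathbf{k}$, the Green ring $r(H)$ is the abelian group generated by isomorphism classes $[V]$ of $H$-modules with relations $[U\oplus V]=[U]+[V]$ and product $[U][V]=[U\otimes V]$; it has $\mathbb{Z}$-basis $\{x_i\}_{i\in\mathfrak{I}}$, the isomorphism classes of indecomposable modules. $r(H)_{\geq 0}$ is the set of elements with all coefficients in this basis non-negative. The duality operator $*$ is the additive map with $[V]^*=[V^*]$, $V^*=\operatorname{Hom}_{\mathbf{k}}(V,\mathbf{k})$ with $(hf)(v)=f(S(h)v)$. A representation ideal is an ideal $I_{\mathfrak{X}}$ that is the $\mathbb{Z}$-span of $\{x_i\}_{i\in\mathfrak{X}}$ for some proper subset $\mathfrak{X}\subsetneq\mathfrak{I}$ and is closed under $*$; $I_{\operatorname{max}}=I_{\mathfrak{X}_{\operatorname{max}}}$ is the maximal (largest) one. For $x=\sum_i a_ix_i\in r(H)_{\geq0}$ put $\operatorname{core}_{\operatorname{max}}(x)=\sum_{i\in\mathfrak{I}\setminus\mathfrak{X}_{\operatorname{max}}}a_ix_i$, extend $\dim_{\mathbf{k}}$ linearly to $r(H)$, and define $\gamma_{\operatorname{max}}(x)=\limsup_{n\to\infty}\sqrt[n]{\dim_{\mathbf{k}}\operatorname{core}_{\operatorname{max}}(x^n)}$. The Drinfeld double $D(H_4)$ can be presented as the algebra generated by $a,b,c,d$ with relations $ba=-ab$, $db=-bd$, $ca=-ac$, $dc=-cd$, $bc=cb$, $a^2=d^2=0$, $b^2=c^2=1$,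 $da+ad=1-bc$, with $\Delta(a)=a\otimes b+1\otimes a$, $\Delta(d)=d\otimes c+1\otimes d$, and $b,c$ group-like. *)

theory Defs
  imports
    "HOL-Algebra.QuotRing"
    "HOL-Algebra.Generated_Groups"
    "HOL-Library.Poly_Mapping"
    "HOL-Library.Extended_Real"
    "HOL-Computational_Algebra.Polynomial"
    "Jordan_Normal_Form.Matrix"
begin

section \<open>Hopf algebras given by generators and relations\<close>

text \<open>
  Expressions for elements of the free algebra on the generators \<open>'g\<close> over \<open>'k\<close>.  They are
  only ever evaluated in a representation, so different expressions for the same element of the
  free algebra are never compared.
\<close>

datatype ('g, 'k) ncpoly =
    Gen 'g
  | Const 'k
  | Add "('g, 'k) ncpoly" "('g, 'k) ncpoly"
  | Neg "('g, 'k) ncpoly"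
  | Mul "('g, 'k) ncpoly" "('g, 'k) ncpoly"

instantiation ncpoly :: (type, zero) zero
begin
definition zero_ncpoly :: "('a, 'b) ncpoly" where "zero_ncpoly = Const 0"
instance ..
end

instantiation ncpoly :: (type, one) one
begin
definition one_ncpoly :: "('a, 'b) ncpoly" where "one_ncpoly = Const 1"
instance ..
end

instantiation ncpoly :: (type, type) plus
begin
definition plus_ncpoly :: "('a, 'b) ncpoly \<Rightarrow> ('a, 'b) ncpoly \<Rightarrow> ('a, 'b) ncpoly"
  where "plus_ncpoly = Add"
instance ..
end

instantiation ncpoly :: (type, type) uminus
begin
definition uminus_ncpoly :: "('a, 'b) ncpoly \<Rightarrow> ('a, 'b) ncpoly"
  where "uminus_ncpoly = Neg"
instance ..
end

instantiation ncpoly :: (type, type) minus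
begin
definition minus_ncpoly :: "('a, 'b) ncpoly \<Rightarrow> ('a, 'b) ncpoly \<Rightarrow> ('a, 'b) ncpoly"
  where "minus_ncpoly p q = Add p (Neg q)"
instance ..
end

instantiation ncpoly :: (type, type) times
begin
definition times_ncpoly :: "('a, 'b) ncpoly \<Rightarrow> ('a, 'b) ncpoly \<Rightarrow> ('a, 'b) ncpoly"
  where "times_ncpoly = Mul"
instance ..
end

text \<open>
  The algebra is the free algebra modulo \<open>p = q\<close> for \<open>(p, q) \<in> relations\<close>.  The comultiplication
  and counit (algebra maps) and the antipode (an algebra anti-map) are given by their values on
  the generators; \<open>[(u\<^sub>1, v\<^sub>1), \<dots>]\<close> stands for the tensor \<open>u\<^sub>1 \<otimes> v\<^sub>1 + \<dots>\<close>.
\<close>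

record ('g, 'k) hopf_presentation =
  relations :: "(('g, 'k) ncpoly \<times> ('g, 'k) ncpoly) set"
  comult :: "'g \<Rightarrow> (('g, 'k) ncpoly \<times> ('g, 'k) ncpoly) list"
  counit :: "'g \<Rightarrow> 'k"
  antipode :: "'g \<Rightarrow> ('g, 'k) ncpoly"

datatype dh4_gen = gen_a | gen_b | gen_c | gen_d

text \<open>
  The Drinfeld double of Sweedler's 4-dimensional Hopf algebra.  The counit and the antipode are
  forced by the comultiplication: the group-likes \<open>b\<close>, \<open>c\<close> have counit 1 and are self-inverse,
  and \<open>\<Delta>(a) = a \<otimes> b + 1 \<otimes> a\<close> gives \<open>\<epsilon>(a) = 0\<close> and \<open>S(a) b + a = 0\<close>, so
  \<open>S(a) = - a b\<close>; likewise \<open>S(d) = - d c\<close>.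
\<close>

definition D_H4 :: "(dh4_gen, 'k::field) hopf_presentation" where
  "D_H4 = (let a = Gen gen_a; b = Gen gen_b; c = Gen gen_c; d = Gen gen_d in
    \<lparr> relations =
        {(b * a, - (a * b)), (d * b, - (b * d)), (c * a, - (a * c)), (d * c, - (c * d)),
         (b * c, c * b), (a * a, 0), (d * d, 0), (b * b, 1), (c * c, 1),
         (d * a + a * d, 1 - b * c)},
      comult = (\<lambda>g. case g of
          gen_a \<Rightarrow> [(a, b), (1, a)]
        | gen_b \<Rightarrow> [(b, b)]
        | gen_c \<Rightarrow> [(c, c)]
        | gen_d \<Rightarrow> [(d, c), (1, d)]),
      counit = (\<lambda>g. case g of gen_a \<Rightarrow> 0 | gen_b \<Rightarrow> 1 | gen_c \<Rightarrow> 1 | gen_d \<Rightarrow> 0),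
      antipode = (\<lambda>g. case g of
          gen_a \<Rightarrow> - (a * b)
        | gen_b \<Rightarrow> b
        | gen_c \<Rightarrow> c
        | gen_d \<Rightarrow> - (d * c)) \<rparr>)"


section \<open>Finite-dimensional left modules\<close>

text \<open>
  A module of dimension \<open>n\<close> is taken on the vector space \<open>'k\<^sup>n\<close>, that is, after the choice of a
  basis: it is the family of matrices by which the generators act on column vectors.  Every
  finite-dimensional module is isomorphic to one of this form.
\<close>

datatype ('g, 'k) rep = Rep (rdim: nat) (act: "'g \<Rightarrow> 'k mat")

primrec eval_rep :: "('g, 'k::field) rep \<Rightarrow> ('g, 'k) ncpoly \<Rightarrow> 'k mat" where
  "eval_rep V (Gen g) = act V g"
| "eval_rep V (Const r) = r \<cdot>\<^sub>m 1\<^sub>m (rdim V)"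
| "eval_rep V (Add p q) = eval_rep V p + eval_rep V q"
| "eval_rep V (Neg p) = - eval_rep V p"
| "eval_rep V (Mul p q) = eval_rep V p * eval_rep V q"

definition reps :: "('g, 'k::field) hopf_presentation \<Rightarrow> ('g, 'k) rep set" where
  "reps H = {V. (\<forall>g. act V g \<in> carrier_mat (rdim V) (rdim V)) \<and>
                (\<forall>(p, q) \<in> relations H. eval_rep V p = eval_rep V q)}"

definition rep_iso :: "('g, 'k::field) rep \<Rightarrow> ('g, 'k) rep \<Rightarrow> bool" where
  "rep_iso V W \<longleftrightarrow> (\<exists>P Q. P \<in> carrier_mat (rdim W) (rdim V) \<and> Q \<in> carrier_mat (rdim V) (rdim W) \<and>
      Q * P = 1\<^sub>m (rdim V) \<and> P * Q = 1\<^sub>m (rdim W) \<and> (\<forall>g. P * act V g = act W g * P))"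

definition rep_sum :: "('g, 'k::field) rep \<Rightarrow> ('g, 'k) rep \<Rightarrow> ('g, 'k) rep" where
  "rep_sum V W = Rep (rdim V + rdim W) (\<lambda>g. four_block_mat
      (act V g) (0\<^sub>m (rdim V) (rdim W)) (0\<^sub>m (rdim W) (rdim V)) (act W g))"

definition kronecker :: "'k::field mat \<Rightarrow> 'k mat \<Rightarrow> 'k mat" where
  "kronecker A B = mat (dim_row A * dim_row B) (dim_col A * dim_col B)
      (\<lambda>(i, j). A $$ (i div dim_row B, j div dim_col B) * B $$ (i mod dim_row B, j mod dim_col B))"

text \<open>The basis vector \<open>e\<^sub>i \<otimes> e\<^sub>j\<close> of \<open>V \<otimes> W\<close> has index \<open>i * rdim W + j\<close>; \<open>g\<close> acts through \<open>\<Delta>(g)\<close>.\<close>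

definition rep_tensor ::
  "('g, 'k::field) hopf_presentation \<Rightarrow> ('g, 'k) rep \<Rightarrow> ('g, 'k) rep \<Rightarrow> ('g, 'k) rep" where
  "rep_tensor H V W = Rep (rdim V * rdim W) (\<lambda>g.
      foldr (\<lambda>(u, v) M. kronecker (eval_rep V u) (eval_rep W v) + M) (comult H g)
        (0\<^sub>m (rdim V * rdim W) (rdim V * rdim W)))"

definition rep_unit :: "('g, 'k::field) hopf_presentation \<Rightarrow> ('g, 'k) rep" where
  "rep_unit H = Rep 1 (\<lambda>g. counit H g \<cdot>\<^sub>m 1\<^sub>m 1)"

text \<open>\<open>(g f)(v) = f(S(g) v)\<close>, written in the dual basis.\<close>

definition rep_dual :: "('g, 'k::field) hopf_presentation \<Rightarrow> ('g, 'k) rep \<Rightarrow> ('g, 'k) rep" where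
  "rep_dual H V = Rep (rdim V) (\<lambda>g. transpose_mat (eval_rep V (antipode H g)))"

definition indecomposable :: "('g, 'k::field) hopf_presentation \<Rightarrow> ('g, 'k) rep \<Rightarrow> bool" where
  "indecomposable H V \<longleftrightarrow> V \<in> reps H \<and> rdim V \<noteq> 0 \<and>
     \<not> (\<exists>U \<in> reps H. \<exists>W \<in> reps H. rdim U \<noteq> 0 \<and> rdim W \<noteq> 0 \<and> rep_iso V (rep_sum U W))"


section \<open>The Green ring\<close>

text \<open>
  The ring of formal \<open>\<int>\<close>-combinations of modules, before any relations are imposed.  Its product
  is neither associative nor unital on the nose for a general presentation; it becomes so in the
  quotient.
\<close>

definition formal_ring :: "('g, 'k::field) hopf_presentation \<Rightarrow> (('g, 'k) rep \<Rightarrow>\<^sub>0 int) ring" where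
  "formal_ring H = \<lparr>
     carrier = {f. Poly_Mapping.keys f \<subseteq> reps H},
     monoid.mult = (\<lambda>f g. frag_extend (\<lambda>V. frag_extend (\<lambda>W. frag_of (rep_tensor H V W)) g) f),
     one = frag_of (rep_unit H),
     zero = 0,
     add = (+) \<rparr>"

text \<open>The first family of generators identifies isomorphic modules, i.e. passes to isomorphism classes.\<close>

definition green_relations :: "('g, 'k::field) hopf_presentation \<Rightarrow> (('g, 'k) rep \<Rightarrow>\<^sub>0 int) set" where
  "green_relations H = generate (add_monoid (formal_ring H))
     ({frag_of U - frag_of V | U V. U \<in> reps H \<and> V \<in> reps H \<and> rep_iso U V} \<union>
      {frag_of (rep_sum U V) - frag_of U - frag_of V | U V. U \<in> reps H \<and> V \<in> reps H})"

definition green_ring :: "('g, 'k::field) hopf_presentation \<Rightarrow> (('g, 'k) rep \<Rightarrow>\<^sub>0 int) set ring" where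
  "green_ring H = formal_ring H Quot green_relations H"

definition green_class ::
  "('g, 'k::field) hopf_presentation \<Rightarrow> ('g, 'k) rep \<Rightarrow> (('g, 'k) rep \<Rightarrow>\<^sub>0 int) set" where
  "green_class H V = green_relations H +>\<^bsub>formal_ring H\<^esub> frag_of V"

text \<open>
  The linear extensions of duality and dimension respect the relations, so the images of a coset
  below are singletons.
\<close>

definition green_dual ::
  "('g, 'k::field) hopf_presentation \<Rightarrow> (('g, 'k) rep \<Rightarrow>\<^sub>0 int) set \<Rightarrow> (('g, 'k) rep \<Rightarrow>\<^sub>0 int) set" where
  "green_dual H x = the_elem
     ((\<lambda>f. green_relations H +>\<^bsub>formal_ring H\<^esub> frag_extend (\<lambda>V. frag_of (rep_dual H V)) f) ` x)"

definition green_dim :: "(('g, 'k::field) rep \<Rightarrow>\<^sub>0 int) set \<Rightarrow> int" where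
  "green_dim x = the_elem
     ((\<lambda>f. \<Sum>V\<in>Poly_Mapping.keys f. Poly_Mapping.lookup f V * int (rdim V)) ` x)"

definition green_basis :: "('g, 'k::field) hopf_presentation \<Rightarrow> (('g, 'k) rep \<Rightarrow>\<^sub>0 int) set set" where
  "green_basis H = green_class H ` {V. indecomposable H V}"

text \<open>
  The coefficients \<open>a\<^sub>i\<close> in \<open>x = \<Sum> a\<^sub>i x\<^sub>i\<close>; the basis is indexed by itself.
\<close>

definition green_coeffs :: "('g, 'k::field) hopf_presentation \<Rightarrow>
    (('g, 'k) rep \<Rightarrow>\<^sub>0 int) set \<Rightarrow> ((('g, 'k) rep \<Rightarrow>\<^sub>0 int) set \<Rightarrow>\<^sub>0 int)" where
  "green_coeffs H x = (THE a. Poly_Mapping.keys a \<subseteq> green_basis H \<and>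
     x = (\<Oplus>\<^bsub>green_ring H\<^esub>i\<in>Poly_Mapping.keys a.
            add_pow (green_ring H) (Poly_Mapping.lookup a i) i))"

definition green_nonneg :: "('g, 'k::field) hopf_presentation \<Rightarrow> (('g, 'k) rep \<Rightarrow>\<^sub>0 int) set set" where
  "green_nonneg H = {x \<in> carrier (green_ring H). \<forall>i\<in>green_basis H.
      0 \<le> Poly_Mapping.lookup (green_coeffs H x) i}"


section \<open>Representation ideals and the asymptotic invariant\<close>

definition rep_ideal ::
  "('g, 'k::field) hopf_presentation \<Rightarrow> (('g, 'k) rep \<Rightarrow>\<^sub>0 int) set set \<Rightarrow> bool" where
  "rep_ideal H I \<longleftrightarrow> ideal I (green_ring H) \<and>
     (\<exists>X. X \<subset> green_basis H \<and> I = generate (add_monoid (green_ring H)) X) \<and>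
     (\<forall>x\<in>I. green_dual H x \<in> I)"

text \<open>\<open>Greatest\<close> for the inclusion order.\<close>

definition max_rep_ideal ::
  "('g, 'k::field) hopf_presentation \<Rightarrow> (('g, 'k) rep \<Rightarrow>\<^sub>0 int) set set" where
  "max_rep_ideal H = (GREATEST I. rep_ideal H I)"

text \<open>As the \<open>x\<^sub>i\<close> are linearly independent, the index set of a representation ideal
  consists of the basis elements that lie in it.\<close>

definition max_rep_index ::
  "('g, 'k::field) hopf_presentation \<Rightarrow> (('g, 'k) rep \<Rightarrow>\<^sub>0 int) set set" where
  "max_rep_index H = green_basis H \<inter> max_rep_ideal H"

definition core_max :: "('g, 'k::field) hopf_presentation \<Rightarrow>
    (('g, 'k) rep \<Rightarrow>\<^sub>0 int) set \<Rightarrow> (('g, 'k) rep \<Rightarrow>\<^sub>0 int) set" where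
  "core_max H x = (\<Oplus>\<^bsub>green_ring H\<^esub>i\<in>Poly_Mapping.keys (green_coeffs H x) - max_rep_index H.
      add_pow (green_ring H) (Poly_Mapping.lookup (green_coeffs H x) i) i)"

definition gamma_max ::
  "('g, 'k::field) hopf_presentation \<Rightarrow> (('g, 'k) rep \<Rightarrow>\<^sub>0 int) set \<Rightarrow> ereal" where
  "gamma_max H x = limsup (\<lambda>n. ereal (root n
      (of_int (green_dim (core_max H (x [^]\<^bsub>green_ring H\<^esub> n))))))"

end

theory Submission
  imports Defs "Jordan_Normal_Form.Determinant" "Jordan_Normal_Form.Char_Poly"
begin

text \<open>
  For \<open>t \<in> k\<close> the element \<open>\<theta>\<^sub>t = a + t d\<close> acts on every module, and \<open>\<theta>\<^sub>t\<^sup>2 = t (1 - b c)\<close>.  Call a module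
  contractible if \<open>\<theta>\<^sub>t s + s \<theta>\<^sub>t = 1\<close> for some linear map \<open>s\<close> and some \<open>t \<noteq> 0\<close>.  The contractible indecomposables
  span a representation ideal.  An indecomposable that is not contractible satisfies \<open>c = b\<close> and \<open>a d = 0\<close>, hence is a
  Kronecker module whose pencil is singular for all \<open>t\<close>, and Kronecker's theorem shows that this pencil is one of the
  blocks \<open>L\<^sub>n\<close> or \<open>L\<^sub>n\<^sup>T\<close>.  Such a module \<open>V\<close> has the unit as a direct summand of \<open>V \<otimes> V\<^sup>*\<close>, since \<open>b\<close> has trace \<open>\<plusminus>1\<close> on it,
  so it lies in no representation ideal, and the contractible indecomposables span the maximal one.

  The homology of \<open>\<theta>\<^sub>0\<close> on \<open>L\<^sub>n\<close> and \<open>L\<^sub>n\<^sup>T\<close> is one-dimensional and multiplicative, which leaves at most one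
  summand of \<open>V \<otimes> W\<close> that is not contractible; a cycle and a cocycle polynomial in \<open>t\<close> show that there is one, and that
  its dimension minus 1 is at most the sum of those of \<open>V\<close> and \<open>W\<close>.  Thus the number \<open>h(x)\<close> of summands outside the maximal ideal
  is additive and multiplicative, and \<open>h(x)\<^sup>n \<le> dim core(x\<^sup>n) \<le> h(x)\<^sup>n (n B + 1)\<close>, so that the growth rate is \<open>h(x)\<close>.
\<close>

text \<open>Contractibility stands in for a list of the indecomposables: explicit homotopies carry
  it to summands, tensor products and duals, so the ideal is found without naming its members. The
  obstacle is its dependence on t. A regular pencil is contractible except at finitely many t, so no
  fixed t recognises all contractible modules, and such a module may still have homology at t = 0.
  Homology at 0 can therefore only bound the number of other summands from above. Existence needs a
  class that survives for all but finitely many t, which is why cycles and cocycles are polynomial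
  vectors over an infinite field. Their degrees also give the dimension bound: the kernel of L_n is
  spanned by (1, t, ..., t^n), the module has dimension 2n + 1, and degrees add in tensor products.
  The resulting bound for n factors is linear in n and disappears under the n-th root. That the
  classes of indecomposables form a basis of the quotient group is part of the proof; it rests on
  cancellation over local endomorphism rings.\<close>

section \<open>Matrix identities with dimension side conditions\<close>

lemma mat_assoc: "dim_col A = dim_row B \<Longrightarrow> dim_col B = dim_row C \<Longrightarrow> (A * B) * C = A * (B * C)"
  for A B C :: "'a::semiring_0 mat"
  by (rule assoc_mult_mat[of _ "dim_row A" "dim_row B" _ "dim_row C" _ "dim_col C"]) auto

lemma mat_distrib_right: "dim_row A = dim_row B \<Longrightarrow> dim_col A = dim_col B \<Longrightarrow> dim_col B = dim_row C \<Longrightarrow>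
  (A + B) * C = A * C + B * C" for A B C :: "'a::semiring_0 mat"
  by (rule add_mult_distrib_mat[of _ "dim_row A" "dim_col A" _ _ "dim_col C"]) auto

lemma mat_distrib_left: "dim_row B = dim_row C \<Longrightarrow> dim_col B = dim_col C \<Longrightarrow> dim_col A = dim_row C \<Longrightarrow>
  A * (B + C) = A * B + A * C" for A B C :: "'a::semiring_0 mat"
  by (rule mult_add_distrib_mat[of _ "dim_row A" "dim_col A" _ "dim_col B"]) auto

lemma mat_diff_right: "dim_row A = dim_row B \<Longrightarrow> dim_col A = dim_col B \<Longrightarrow> dim_col B = dim_row C \<Longrightarrow>
  (A - B) * C = A * C - B * C" for A B C :: "'a::ring mat"
  by (rule minus_mult_distrib_mat[of _ "dim_row A" "dim_col A" _ _ "dim_col C"]) auto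

lemma mat_diff_left: "dim_row B = dim_row C \<Longrightarrow> dim_col B = dim_col C \<Longrightarrow> dim_col A = dim_row C \<Longrightarrow>
  A * (B - C) = A * B - A * C" for A B C :: "'a::ring mat"
  by (rule mult_minus_distrib_mat[of _ "dim_row A" "dim_col A" _ "dim_col B"]) auto

lemma mat_one_left: "dim_row A = n \<Longrightarrow> 1\<^sub>m n * A = A" for A :: "'a::semiring_1 mat"
  by (rule left_mult_one_mat[of _ _ "dim_col A"]) auto

lemma mat_one_right: "dim_col A = n \<Longrightarrow> A * 1\<^sub>m n = A" for A :: "'a::semiring_1 mat"
  by (rule right_mult_one_mat[of _ "dim_row A"]) auto

lemma mat_zero_left: "dim_row A = m \<Longrightarrow> 0\<^sub>m n m * A = 0\<^sub>m n (dim_col A)" for A :: "'a::semiring_0 mat"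
  by (rule left_mult_zero_mat[of _ _ "dim_col A"]) auto

lemma mat_zero_right: "dim_col A = n \<Longrightarrow> A * 0\<^sub>m n m = 0\<^sub>m (dim_row A) m" for A :: "'a::semiring_0 mat"
  by (rule right_mult_zero_mat[of _ "dim_row A"]) auto

lemma mat_smult_left: "dim_col A = dim_row B \<Longrightarrow> (c \<cdot>\<^sub>m A) * B = c \<cdot>\<^sub>m (A * B)" for A B :: "'a::comm_ring_1 mat"
  by (rule mult_smult_assoc_mat[of _ "dim_row A" "dim_col A" _ "dim_col B"]) auto

lemma mat_smult_right: "dim_col A = dim_row B \<Longrightarrow> A * (c \<cdot>\<^sub>m B) = c \<cdot>\<^sub>m (A * B)" for A B :: "'a::comm_ring_1 mat"
  by (rule mult_smult_distrib[of _ "dim_row A" "dim_col A" _ "dim_col B"]) auto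

lemma mat_uminus_left: "dim_col A = dim_row B \<Longrightarrow> (- A) * B = - (A * B)" for A B :: "'a::comm_ring_1 mat"
  by simp

lemma mat_uminus_right: "dim_col A = dim_row B \<Longrightarrow> A * (- B) = - (A * B)" for A B :: "'a::comm_ring_1 mat"
  by simp

lemma mat_transpose_mult: "dim_col A = dim_row B \<Longrightarrow> transpose_mat (A * B) = transpose_mat B * transpose_mat A"
  for A B :: "'a::comm_semiring_0 mat"
  by (rule transpose_mult[of _ "dim_row A" "dim_col A" _ "dim_col B"]) auto

lemma mat_add_assoc: "dim_row A = dim_row B \<Longrightarrow> dim_row B = dim_row C \<Longrightarrow> dim_col A = dim_col B \<Longrightarrow>
  dim_col B = dim_col C \<Longrightarrow> (A + B) + C = A + (B + C)" for A B C :: "'a::semiring_0 mat"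
  by (rule eq_matI) (auto simp: add.assoc)

lemma mat_add_comm: "dim_row A = dim_row B \<Longrightarrow> dim_col A = dim_col B \<Longrightarrow> A + B = B + A"
  for A B :: "'a::semiring_0 mat"
  by (rule eq_matI) (auto simp: add.commute)

lemma mat_add_left_comm: "dim_row A = dim_row B \<Longrightarrow> dim_row B = dim_row C \<Longrightarrow> dim_col A = dim_col B \<Longrightarrow>
  dim_col B = dim_col C \<Longrightarrow> A + (B + C) = B + (A + C)" for A B C :: "'a::semiring_0 mat"
  by (rule eq_matI) (auto simp: add.left_commute)

lemma mat_add_zero: "dim_row A = n \<Longrightarrow> dim_col A = m \<Longrightarrow> A + 0\<^sub>m n m = A"
  "dim_row A = n \<Longrightarrow> dim_col A = m \<Longrightarrow> 0\<^sub>m n m + A = A" for A :: "'a::semiring_0 mat"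
  by (rule eq_matI; simp)+

lemma mat_diff_zero: "dim_row A = n \<Longrightarrow> dim_col A = m \<Longrightarrow> A - 0\<^sub>m n m = A" for A :: "'a::ring mat"
  by (rule eq_matI) auto

lemma mat_diff_self: "A - A = 0\<^sub>m (dim_row A) (dim_col A)" for A :: "'a::ring mat"
  by (rule eq_matI) auto

lemmas mat_add_ac = mat_add_assoc mat_add_comm mat_add_left_comm

text \<open>The rewrite set distributes products, nests them to the right and pulls scalars out; its
  side conditions are equations between dimensions. What remains is often an additive identity,
  settled by comparing entries with \<open>index_mult_mat(1)\<close> removed, so that entries of
  products stay atomic.\<close>

lemmas mat_alg = mat_diff_zero mat_diff_self mat_assoc mat_add_zero mat_distrib_right mat_distrib_left mat_diff_right mat_diff_left mat_one_left
  mat_one_right mat_zero_left mat_zero_right mat_smult_left mat_smult_right mat_uminus_left mat_uminus_right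

lemma mult_mat_entry: "i < dim_row A \<Longrightarrow> j < dim_col B \<Longrightarrow> dim_col A = dim_row B \<Longrightarrow>
   (A * B) $$ (i, j) = (\<Sum>k<dim_row B. A $$ (i,k) * B $$ (k,j))"
  by (simp add: scalar_prod_def lessThan_atLeast0)

section \<open>Rank factorizations, idempotents and the Fitting decomposition\<close>

definition skip_index :: "nat \<Rightarrow> nat \<Rightarrow> nat" where
  "skip_index k i = (if i < k then i else Suc i)"

lemma bij_betw_skip_index:
  assumes "k < r"
  shows "bij_betw (skip_index k) {..<r - 1} ({..<r} - {k})"
proof (rule bij_betwI[where g = "\<lambda>i. if i < k then i else i - 1"])
qed (use assms in \<open>auto simp: skip_index_def split: if_splits\<close>)

text \<open>A kernel vector \<open>v\<close> with \<open>v $ k \<noteq> 0\<close> expresses column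
  \<open>k\<close> through the other columns, so \<open>P\<close> may omit this column and
  \<open>Q\<close> restores it.\<close>

lemma singular_factor:
  fixes Z :: "'a::field mat"
  assumes Z: "Z \<in> carrier_mat r r" and "det Z = 0"
  shows "\<exists>P Q. P \<in> carrier_mat r (r - 1) \<and> Q \<in> carrier_mat (r - 1) r \<and> Z = P * Q \<and> 0 < r"
proof -
  obtain v where v: "v \<in> carrier_vec r" "v \<noteq> 0\<^sub>v r" "Z *\<^sub>v v = 0\<^sub>v r"
    using det_0_iff_vec_prod_zero_field[OF Z] assms(2) by auto
  obtain k where k: "k < r" "v $ k \<noteq> 0"
    using v(1,2) by (metis eq_vecI carrier_vecD index_zero_vec)
  have Zv: "(\<Sum>m<r. Z $$ (i, m) * v $ m) = 0" if "i < r" for i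
  proof -
    have "(Z *\<^sub>v v) $ i = 0" using v that by simp
    then show ?thesis using that Z v(1) by (simp add: scalar_prod_def lessThan_atLeast0)
  qed
  define P where "P = mat r (r - 1) (\<lambda>(i, j). Z $$ (i, skip_index k j))"
  \<comment> \<open>Column \<open>k\<close> of \<open>Z\<close> is the combination of the columns
    \<open>m\<close> with coefficients \<open>- v $ m / v $ k\<close>.\<close>
  define f where "f m j = (if m = j then 1 else 0) - (if j = k then v $ m / v $ k else 0)" for m j
  define Q where "Q = mat (r - 1) r (\<lambda>(i, j). f (skip_index k i) j)"
  have "Z = P * Q"
  proof (rule eq_matI)
    fix i j assume "i < dim_row (P * Q)" "j < dim_col (P * Q)"
    then have ij: "i < r" "j < r" by (auto simp: P_def Q_def)
    have "(P * Q) $$ (i, j) = (\<Sum>l<r - 1. Z $$ (i, skip_index k l) * f (skip_index k l) j)"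
      using ij by (subst mult_mat_entry) (auto simp: P_def Q_def)
    also have "\<dots> = (\<Sum>m\<in>{..<r} - {k}. Z $$ (i, m) * f m j)"
      by (rule sum.reindex_bij_betw[OF bij_betw_skip_index[OF k(1)]])
    also have "\<dots> = Z $$ (i, j)"
    proof (cases "j = k")
      case True
      have "(\<Sum>m\<in>{..<r} - {k}. Z $$ (i, m) * f m j) = (\<Sum>m\<in>{..<r} - {k}. - (Z $$ (i, m) * v $ m) / v $ k)"
        using True by (intro sum.cong) (auto simp: f_def)
      also have "\<dots> = - (\<Sum>m\<in>{..<r} - {k}. Z $$ (i, m) * v $ m) / v $ k"
        by (simp add: sum_divide_distrib sum_negf)
      also have "(\<Sum>m\<in>{..<r} - {k}. Z $$ (i, m) * v $ m) = - (Z $$ (i, k) * v $ k)"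
        using Zv[OF ij(1)] k(1) by (subst (asm) sum.remove[of _ k]) (auto simp: eq_neg_iff_add_eq_0 add.commute)
      finally show ?thesis using k True by simp
    next
      case False
      have "(\<Sum>m\<in>{..<r} - {k}. Z $$ (i, m) * f m j) = (\<Sum>m\<in>{..<r} - {k}. if m = j then Z $$ (i, m) else 0)"
        using False by (intro sum.cong) (auto simp: f_def)
      then show ?thesis using False ij by (simp add: sum.delta)
    qed
    finally show "Z $$ (i, j) = (P * Q) $$ (i, j)" by simp
  qed (use Z in \<open>auto simp: P_def Q_def\<close>)
  moreover have "P \<in> carrier_mat r (r - 1)" "Q \<in> carrier_mat (r - 1) r"
    by (auto simp: P_def Q_def)
  ultimately show ?thesis using k by (intro exI[of _ P] exI[of _ Q]) auto
qed

definition factors_through :: "'a::semiring_0 mat \<Rightarrow> nat \<Rightarrow> bool" where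
  "factors_through A r \<longleftrightarrow> (\<exists>P Q. P \<in> carrier_mat (dim_row A) r \<and> Q \<in> carrier_mat r (dim_col A) \<and> A = P * Q)"

lemma det_nonzero_inverse:
  fixes Z :: "'a::field mat"
  assumes Z: "Z \<in> carrier_mat r r" and "det Z \<noteq> 0"
  obtains W where "W \<in> carrier_mat r r" "Z * W = 1\<^sub>m r" "W * Z = 1\<^sub>m r"
  using det_non_zero_imp_unit[OF Z assms(2)] that
  by (auto simp: Units_def ring_mat_def)

text \<open>If the middle factor were singular, \<open>singular_factor\<close> would push
  \<open>A\<close> through size \<open>r - 1\<close>.\<close>

lemma minimal_factorization_unit:
  fixes A :: "'a::field mat"
  assumes "\<forall>s. factors_through A s \<longrightarrow> r \<le> s"
    and X: "X \<in> carrier_mat (dim_row A) r" and Z: "Z \<in> carrier_mat r r" and Y: "Y \<in> carrier_mat r (dim_col A)"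
    and A: "A = X * Z * Y"
  obtains W where "W \<in> carrier_mat r r" "Z * W = 1\<^sub>m r" "W * Z = 1\<^sub>m r"
proof (cases "det Z = 0")
  case True
  then obtain P Q where PQ: "P \<in> carrier_mat r (r - 1)" "Q \<in> carrier_mat (r - 1) r" "Z = P * Q" "0 < r"
    using singular_factor[OF Z] by auto
  have "A = (X * P) * (Q * Y)"
    using X Y PQ A by (simp add: mat_assoc)
  moreover have "X * P \<in> carrier_mat (dim_row A) (r - 1)" "Q * Y \<in> carrier_mat (r - 1) (dim_col A)"
    using X Y PQ by auto
  ultimately have "factors_through A (r - 1)"
    unfolding factors_through_def by blast
  with assms(1)[rule_format, of "r - 1"] PQ(4) show ?thesis by simp
qed (use det_nonzero_inverse[OF Z] that in blast)

lemma minimal_factorization: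
  fixes A :: "'a::field mat"
  obtains r P Q where "P \<in> carrier_mat (dim_row A) r" "Q \<in> carrier_mat r (dim_col A)" "A = P * Q"
    "\<forall>s. factors_through A s \<longrightarrow> r \<le> s"
proof -
  have "factors_through A (dim_row A)"
    unfolding factors_through_def by (intro exI[of _ "1\<^sub>m (dim_row A)"] exI[of _ A]) auto
  then have 1: "factors_through A (LEAST r. factors_through A r)" by (rule LeastI)
  then obtain P Q where "P \<in> carrier_mat (dim_row A) (LEAST r. factors_through A r)"
    "Q \<in> carrier_mat (LEAST r. factors_through A r) (dim_col A)" "A = P * Q"
    unfolding factors_through_def[of A "LEAST r. factors_through A r"] by blast
  from that[OF this] Least_le[of "factors_through A"] show ?thesis by simp
qed

text \<open>In a minimal factorization \<open>E = P * Q\<close> the equation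
  \<open>E * E = E\<close> reads \<open>P * (Q * P) * Q = P * Q\<close>, so \<open>Q * P\<close> is
  invertible. Multiplying by \<open>Q\<close> and \<open>P\<close> gives (QP)^3 = (QP)^2 and hence
  \<open>Q * P = 1\<close>.\<close>

lemma idempotent_split:
  fixes E :: "'a::field mat"
  assumes E: "E \<in> carrier_mat n n" "E * E = E"
  obtains r P Q where "P \<in> carrier_mat n r" "Q \<in> carrier_mat r n" "P * Q = E" "Q * P = 1\<^sub>m r"
proof -
  obtain r P Q where PQ': "P \<in> carrier_mat (dim_row E) r" "Q \<in> carrier_mat r (dim_col E)" "E = P * Q"
    "\<forall>s. factors_through E s \<longrightarrow> r \<le> s"
    by (rule minimal_factorization[of E])
  note PQ = PQ'[unfolded carrier_matD[OF E(1)]]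
  note [simp] = carrier_matD[OF PQ(1)] carrier_matD[OF PQ(2)]
  have "E = P * (Q * P) * Q" using E(2) unfolding PQ(3) by (simp add: mat_assoc)
  then obtain W where W: "W \<in> carrier_mat r r" "Q * P * W = 1\<^sub>m r" "W * (Q * P) = 1\<^sub>m r"
    using minimal_factorization_unit[OF PQ'(4,1) _ PQ'(2)] PQ(1,2) by (metis mult_carrier_mat)
  note [simp] = carrier_matD[OF W(1)]
  have WQP: "W * (Q * (P * Y)) = Y" if "dim_row Y = r" for Y
  proof -
    have "W * (Q * (P * Y)) = (W * (Q * P)) * Y" using that by (simp add: mat_assoc)
    then show ?thesis using W(3) that by (simp add: mat_one_left)
  qed
  have "W * (Q * ((P * Q) * ((P * Q) * (P * W)))) = W * (Q * (((P * Q) * (P * Q)) * (P * W)))"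
    by (simp add: mat_assoc)
  also have "(P * Q) * (P * Q) = P * Q" using E(2) unfolding PQ(3) .
  finally have "W * (Q * (P * (Q * (P * (Q * (P * W)))))) = W * (Q * (P * (Q * (P * W))))"
    by (simp add: mat_assoc)
  moreover have "Q * (P * W) = 1\<^sub>m r" using W(2) by (simp add: mat_assoc)
  ultimately have "Q * P = 1\<^sub>m r" using W(3) by (simp add: WQP mat_one_right mat_one_left)
  from that[OF PQ(1,2) PQ(3)[symmetric] this] show ?thesis .
qed

lemma pow_mat_commute:
  fixes f :: "'a::comm_ring_1 mat"
  assumes "f \<in> carrier_mat n n" "h \<in> carrier_mat n n" "h * f = f * h"
  shows "h * f ^\<^sub>m k = f ^\<^sub>m k * h"
proof (induction k)
  case (Suc k)
  note [simp] = carrier_matD[OF assms(1)] carrier_matD[OF assms(2)]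
  have [simp]: "dim_row (f ^\<^sub>m k) = n" "dim_col (f ^\<^sub>m k) = n"
    using pow_carrier_mat[OF assms(1), of k] by auto
  have "h * f ^\<^sub>m Suc k = (h * f ^\<^sub>m k) * f" by (simp add: mat_assoc)
  also have "\<dots> = f ^\<^sub>m k * (f * h)" unfolding Suc by (simp add: mat_assoc assms(3))
  finally show ?case by (simp add: mat_assoc)
qed (use assms in auto)

lemma pow_mat_add:
  fixes f :: "'a::comm_ring_1 mat"
  assumes "f \<in> carrier_mat n n"
  shows "f ^\<^sub>m (i + j) = f ^\<^sub>m i * f ^\<^sub>m j"
proof (induction j)
  case (Suc j)
  then show ?case using assms pow_carrier_mat[OF assms] 
    by (simp add: assoc_mult_mat[of _ n n _ n _ n])
qed (use assms in auto)

text \<open>Choose \<open>k > 0\<close> with the rank of f^k minimal. Then f^(2k) has the same rank,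
  so f^k is bijective on its image; \<open>e\<close> is the projection onto this image along the
  kernel, and \<open>X\<close> inverts f^k there. By the last clause \<open>e\<close> is an
  endomorphism of a module whenever \<open>f\<close> is one.\<close>

lemma fitting_idempotent:
  fixes f :: "'a::field mat"
  assumes f: "f \<in> carrier_mat n n"
  obtains k e X where "e \<in> carrier_mat n n" "X \<in> carrier_mat n n" "e * e = e"
    "e * f ^\<^sub>m k = f ^\<^sub>m k" "f ^\<^sub>m k * X = e" "X * f ^\<^sub>m k = e" "0 < k"
    "\<And>h. h \<in> carrier_mat n n \<Longrightarrow> h * f = f * h \<Longrightarrow> h * e = e * h"
proof -
  define R where "R = (\<lambda>r. \<exists>k>0. factors_through (f ^\<^sub>m k) r)"
  have fk: "f ^\<^sub>m k \<in> carrier_mat n n" for k using f by auto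
  obtain r where r: "R r" "\<And>s. R s \<Longrightarrow> r \<le> s"
  proof -
    have "factors_through (f ^\<^sub>m 1) n"
      unfolding factors_through_def using f by (intro exI[of _ f] exI[of _ "1\<^sub>m n"]) auto
    then have "R n" unfolding R_def by (intro exI[of _ 1]) simp
    from that[OF LeastI[of R, OF this] Least_le[of R]] show ?thesis .
  qed
  obtain k where k: "k > 0" "factors_through (f ^\<^sub>m k) r" using r(1) by (auto simp: R_def)
  define g where "g = f ^\<^sub>m k"
  have g[simp]: "g \<in> carrier_mat n n" "dim_row g = n" "dim_col g = n" using fk[of k] by (auto simp: g_def)
  obtain P Q where PQ: "P \<in> carrier_mat n r" "Q \<in> carrier_mat r n" "g = P * Q"
    using k(2) unfolding factors_through_def g_def[symmetric] by auto
  note [simp] = carrier_matD[OF PQ(1)] carrier_matD[OF PQ(2)]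
  have gg: "g * g = f ^\<^sub>m (k + k)" unfolding g_def by (rule pow_mat_add[OF f, symmetric])
  have "g * g = P * (Q * P) * Q" unfolding PQ(3) by (simp add: mat_assoc)
  \<comment> \<open>The square of \<open>g\<close> is again a positive power of \<open>f\<close>, so
    \<open>r\<close> is minimal for it as well.\<close>
  moreover have "R s" if "factors_through (g * g) s" for s
    unfolding R_def using that k(1) by (intro exI[of _ "k + k"]) (simp add: gg)
  moreover have "P \<in> carrier_mat (dim_row (g * g)) r" "Q \<in> carrier_mat r (dim_col (g * g))"
    "Q * P \<in> carrier_mat r r"
    using PQ(1,2) by auto
  ultimately obtain W where W: "W \<in> carrier_mat r r" "Q * P * W = 1\<^sub>m r" "W * (Q * P) = 1\<^sub>m r"
    using minimal_factorization_unit[of "g * g" r P "Q * P" Q] r(2) by metis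
  note [simp] = carrier_matD[OF W(1)]
  have WQP: "W * (Q * (P * Y)) = Y" "Q * (P * (W * Y)) = Y" if "dim_row Y = r" for Y
  proof -
    have "W * (Q * (P * Y)) = (W * (Q * P)) * Y" "Q * (P * (W * Y)) = (Q * P * W) * Y"
      using that by (simp_all add: mat_assoc)
    then show "W * (Q * (P * Y)) = Y" "Q * (P * (W * Y)) = Y" using W(2,3) that by (simp_all add: mat_one_left)
  qed
  have WQP': "W * (Q * P) = 1\<^sub>m r" "Q * (P * W) = 1\<^sub>m r"
    using W(2,3) by (simp_all add: mat_alg)
  define X where "X = P * W * W * Q"
  define e where "e = P * W * Q"
  have X: "X \<in> carrier_mat n n" "e \<in> carrier_mat n n"
    unfolding X_def e_def by (auto intro!: carrier_matI)
  have gX: "g * X = e" "X * g = e" "e * g = g" "e * e = e"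
    unfolding X_def e_def PQ(3) by (simp_all add: mat_assoc WQP)
  have comm: "h * e = e * h" if h: "h \<in> carrier_mat n n" "h * f = f * h" for h
  proof -
    have hg: "h * g = g * h" unfolding g_def by (rule pow_mat_commute[OF f h])
    note [simp] = carrier_matD[OF h(1)] carrier_matD[OF X(1)] carrier_matD[OF X(2)]
    \<comment> \<open>The image of \<open>e\<close>, which is that of \<open>g\<close>, is stable
      under \<open>h\<close>; the companion equation below says the same of the kernel.\<close>
    have "h * e = e * (h * e)"
    proof -
      have "h * e = (h * g) * X" by (simp add: mat_assoc flip: gX(1))
      also have "\<dots> = (e * g) * (h * X)" unfolding hg gX(3) by (simp add: mat_assoc)
      also have "\<dots> = e * ((g * h) * X)" by (simp add: mat_assoc)
      also have "\<dots> = e * (h * (g * X))" unfolding hg[symmetric] by (simp add: mat_assoc)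
      finally show ?thesis unfolding gX(1) .
    qed
    moreover have "e * h = e * (h * e)"
    proof -
      have ge: "g * e = g" unfolding e_def PQ(3) by (simp add: mat_assoc WQP WQP' mat_alg)
      have "e * h = X * (g * h)" by (simp add: mat_assoc flip: gX(2))
      also have "\<dots> = X * (h * (g * e))" by (simp add: ge hg)
      also have "\<dots> = X * ((h * g) * e)" by (simp add: mat_assoc)
      also have "\<dots> = (X * g) * (h * e)" unfolding hg by (simp add: mat_assoc)
      also have "\<dots> = e * (h * e)" unfolding gX(2) ..
      finally show ?thesis .
    qed
    ultimately show ?thesis by simp
  qed
  note res = that[OF X(2) X(1) gX(4) gX(3)[unfolded g_def] gX(1)[unfolded g_def] gX(2)[unfolded g_def] k(1) comm]
  show ?thesis by (rule res)
qed

section \<open>Homomorphisms and direct sums\<close>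

text \<open>Only shapes are required, not the relations of an algebra: homomorphisms and sums can be
  formed first, and \<open>reps_retract\<close> supplies the relations afterwards.\<close>

definition rep_wf :: "('g, 'k::field) rep \<Rightarrow> bool" where
  "rep_wf V \<longleftrightarrow> (\<forall>g. act V g \<in> carrier_mat (rdim V) (rdim V))"

definition rep_hom :: "('g, 'k::field) rep \<Rightarrow> ('g, 'k) rep \<Rightarrow> 'k mat set" where
  "rep_hom V W = {P \<in> carrier_mat (rdim W) (rdim V). \<forall>g. P * act V g = act W g * P}"

lemma rep_wf_dim[simp]: "rep_wf V \<Longrightarrow> dim_row (act V g) = rdim V" "rep_wf V \<Longrightarrow> dim_col (act V g) = rdim V"
  and rep_wf_carrier: "rep_wf V \<Longrightarrow> act V g \<in> carrier_mat (rdim V) (rdim V)"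
  by (auto simp: rep_wf_def)

lemma reps_wf: "V \<in> reps H \<Longrightarrow> rep_wf V"
  by (auto simp: reps_def rep_wf_def)

lemma repsI:
  "rep_wf V \<Longrightarrow> (\<And>p q. (p, q) \<in> relations H \<Longrightarrow> eval_rep V p = eval_rep V q) \<Longrightarrow> V \<in> reps H"
  by (auto simp: reps_def rep_wf_def)

lemma reps_rel: "V \<in> reps H \<Longrightarrow> (p, q) \<in> relations H \<Longrightarrow> eval_rep V p = eval_rep V q"
  by (auto simp: reps_def)

lemma rep_homD:
  assumes "P \<in> rep_hom V W"
  shows "dim_row P = rdim W" "dim_col P = rdim V" "P * act V g = act W g * P" "P \<in> carrier_mat (rdim W) (rdim V)"
  using assms by (auto simp: rep_hom_def)

lemma rep_homI: "P \<in> carrier_mat (rdim W) (rdim V) \<Longrightarrow> (\<And>g. P * act V g = act W g * P) \<Longrightarrow> P \<in> rep_hom V W"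
  by (auto simp: rep_hom_def)

lemma rep_hom_one: "rep_wf V \<Longrightarrow> 1\<^sub>m (rdim V) \<in> rep_hom V V"
  by (auto intro!: rep_homI simp: mat_alg)

lemma rep_hom_comp:
  assumes "Q \<in> rep_hom W X" "P \<in> rep_hom V W" "rep_wf V" "rep_wf W" "rep_wf X"
  shows "Q * P \<in> rep_hom V X"
proof (rule rep_homI)
  note [simp] = rep_homD(1,2)[OF assms(1)] rep_homD(1,2)[OF assms(2)] assms(3-5)
  show "Q * P \<in> carrier_mat (rdim X) (rdim V)" by (auto intro!: carrier_matI)
  fix g
  have "Q * P * act V g = Q * act W g * P" by (simp add: mat_assoc rep_homD(3)[OF assms(2)])
  then show "Q * P * act V g = act X g * (Q * P)" by (simp add: mat_assoc rep_homD(3)[OF assms(1)])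
qed

lemma rep_hom_add:
  assumes "P \<in> rep_hom V W" "Q \<in> rep_hom V W" "rep_wf V" "rep_wf W"
  shows "P + Q \<in> rep_hom V W" "P - Q \<in> rep_hom V W"
proof -
  note [simp] = rep_homD(1,2)[OF assms(1)] rep_homD(1,2)[OF assms(2)] assms(3,4)
  show "P + Q \<in> rep_hom V W" "P - Q \<in> rep_hom V W"
    by (auto intro!: rep_homI carrier_matI simp: mat_alg rep_homD(3)[OF assms(1)] rep_homD(3)[OF assms(2)])
qed

lemma eval_rep_carrier: "rep_wf V \<Longrightarrow> eval_rep V p \<in> carrier_mat (rdim V) (rdim V)"
  by (induction p) (auto simp: rep_wf_def)

lemma eval_rep_dim[simp]: "rep_wf V \<Longrightarrow> dim_row (eval_rep V p) = rdim V" "rep_wf V \<Longrightarrow> dim_col (eval_rep V p) = rdim V"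
  using eval_rep_carrier[of V p] by auto

lemma eval_rep_hom:
  assumes P: "P \<in> rep_hom V W" and [simp]: "rep_wf V" "rep_wf W"
  shows "P * eval_rep V p = eval_rep W p * P"
proof (induction p)
  case (Mul p q)
  note [simp] = rep_homD(1,2)[OF P]
  have "P * (eval_rep V p * eval_rep V q) = (P * eval_rep V p) * eval_rep V q" by (simp add: mat_assoc)
  also have "\<dots> = eval_rep W p * (P * eval_rep V q)" unfolding Mul(1) by (simp add: mat_assoc)
  finally show ?case unfolding Mul(2) by (simp add: mat_assoc)
qed (use rep_homD[OF P] in \<open>simp_all add: mat_alg\<close>)

text \<open>Every expression acts on \<open>U\<close> as \<open>Q\<close> times its action on
  \<open>V\<close> times \<open>P\<close>, so each relation is inherited. \<open>Q\<close> is just a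
  linear left inverse.\<close>

lemma reps_retract:
  assumes V: "V \<in> reps H" and U: "rep_wf U" and P: "P \<in> rep_hom U V"
    and Q: "Q \<in> carrier_mat (rdim U) (rdim V)" "Q * P = 1\<^sub>m (rdim U)"
  shows "U \<in> reps H"
proof -
  note [simp] = rep_homD(1,2)[OF P] carrier_matD[OF Q(1)] U reps_wf[OF V]
  have ev: "eval_rep U p = Q * (eval_rep V p * P)" for p
  proof -
    have "eval_rep U p = Q * P * eval_rep U p" unfolding Q(2) by (simp add: mat_one_left)
    also have "\<dots> = Q * (eval_rep V p * P)" using eval_rep_hom[OF P, of p] by (simp add: mat_assoc)
    finally show ?thesis .
  qed
  show ?thesis by (rule repsI) (simp_all add: ev reps_rel[OF V])
qed

lemma rep_iso_hom:
  "rep_iso V W \<longleftrightarrow> (\<exists>P Q. P \<in> rep_hom V W \<and> Q \<in> carrier_mat (rdim V) (rdim W) \<and>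
      Q * P = 1\<^sub>m (rdim V) \<and> P * Q = 1\<^sub>m (rdim W))"
  unfolding rep_iso_def rep_hom_def by auto

lemma rep_isoE:
  assumes "rep_iso V W" and [simp]: "rep_wf V" "rep_wf W"
  obtains P Q where "P \<in> rep_hom V W" "Q \<in> rep_hom W V" "Q * P = 1\<^sub>m (rdim V)" "P * Q = 1\<^sub>m (rdim W)"
proof -
  obtain P Q where P: "P \<in> rep_hom V W" and Q: "Q \<in> carrier_mat (rdim V) (rdim W)"
    and QP: "Q * P = 1\<^sub>m (rdim V)" "P * Q = 1\<^sub>m (rdim W)"
    using assms(1) unfolding rep_iso_hom by blast
  note [simp] = rep_homD(1,2)[OF P] carrier_matD[OF Q]
  have "Q \<in> rep_hom W V"
  proof (rule rep_homI)
    fix g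
    have "Q * act W g = Q * act W g * (P * Q)" unfolding QP by (simp add: mat_one_right)
    also have "\<dots> = Q * ((act W g * P) * Q)" by (simp add: mat_assoc)
    also have "\<dots> = (Q * P) * (act V g * Q)" unfolding rep_homD(3)[OF P, symmetric] by (simp add: mat_assoc)
    finally show "Q * act W g = act V g * Q" unfolding QP by (simp add: mat_one_left)
  qed (use Q in auto)
  with P QP show ?thesis using that by auto
qed

lemma rep_isoI:
  assumes "P \<in> rep_hom V W" "Q \<in> rep_hom W V" "Q * P = 1\<^sub>m (rdim V)" "P * Q = 1\<^sub>m (rdim W)"
  shows "rep_iso V W"
  unfolding rep_iso_hom using assms rep_homD(4)[OF assms(2)] by blast

lemma rep_iso_refl: "rep_wf V \<Longrightarrow> rep_iso V V"
  by (rule rep_isoI[OF rep_hom_one rep_hom_one]) auto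

lemma rep_iso_sym: "rep_iso V W \<Longrightarrow> rep_wf V \<Longrightarrow> rep_wf W \<Longrightarrow> rep_iso W V"
  by (elim rep_isoE) (auto intro: rep_isoI)

lemma mat_cancel: "A * B = 1\<^sub>m n \<Longrightarrow> dim_col A = dim_row B \<Longrightarrow> dim_col B = dim_row C \<Longrightarrow> dim_row C = n \<Longrightarrow> A * (B * C) = C"
  for A B C :: "'a::comm_ring_1 mat"
  by (simp add: mat_assoc[symmetric] mat_one_left del: assoc_mult_mat)

lemma rep_iso_trans:
  assumes "rep_iso U V" "rep_iso V W" and [simp]: "rep_wf U" "rep_wf V" "rep_wf W"
  shows "rep_iso U W"
proof -
  obtain P Q where PQ: "P \<in> rep_hom U V" "Q \<in> rep_hom V U" "Q * P = 1\<^sub>m (rdim U)" "P * Q = 1\<^sub>m (rdim V)"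
    using assms by (elim rep_isoE)
  obtain R S where RS: "R \<in> rep_hom V W" "S \<in> rep_hom W V" "S * R = 1\<^sub>m (rdim V)" "R * S = 1\<^sub>m (rdim W)"
    using assms by (elim rep_isoE[of V W])
  note [simp] = rep_homD(1,2)[OF PQ(1)] rep_homD(1,2)[OF PQ(2)] rep_homD(1,2)[OF RS(1)] rep_homD(1,2)[OF RS(2)]
  show ?thesis
    by (rule rep_isoI[of "R * P" _ _ "Q * S"])
      (auto intro: rep_hom_comp PQ RS assms simp: mat_assoc mat_cancel[OF PQ(4)] mat_cancel[OF RS(3)] PQ RS)
qed

text \<open>If \<open>m < n\<close>, padding both factors with zeros to size \<open>n\<close> keeps
  the product 1. The padded matrices are then inverse in the other order too, although row
  \<open>m\<close> of the second one vanishes.\<close>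

lemma left_inverse_dim:
  fixes A B :: "'a::field mat"
  assumes A: "A \<in> carrier_mat n m" "B \<in> carrier_mat m n" "A * B = 1\<^sub>m n"
  shows "n \<le> m"
proof -
  have False if "m < n"
  proof -
    note \<open>m < n\<close>
    define A' where "A' = mat n n (\<lambda>(i, j). if j < m then A $$ (i, j) else 0)"
    define B' where "B' = mat n n (\<lambda>(i, j). if i < m then B $$ (i, j) else 0)"
    have AB': "A' \<in> carrier_mat n n" "B' \<in> carrier_mat n n" by (auto simp: A'_def B'_def)
    have "A' * B' = A * B"
    proof (rule eq_matI)
      fix i j assume ij: "i < dim_row (A * B)" "j < dim_col (A * B)"
      have "(A' * B') $$ (i, j) = (\<Sum>k<n. if k < m then A $$ (i, k) * B $$ (k, j) else 0)"
        using ij A AB' by (subst mult_mat_entry) (auto simp: A'_def B'_def intro!: sum.cong)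
      also have "\<dots> = (\<Sum>k<m. A $$ (i, k) * B $$ (k, j))"
        using \<open>m < n\<close> by (subst sum.inter_filter[symmetric]) (auto intro!: sum.cong)
      also have "\<dots> = (A * B) $$ (i, j)"
        using ij A(1,2) by (subst mult_mat_entry) auto
      finally show "(A' * B') $$ (i, j) = (A * B) $$ (i, j)" .
    qed (use A AB' in auto)
    then have "B' * A' = 1\<^sub>m n" using A mat_mult_left_right_inverse[OF AB'] by simp
    then have "(B' * A') $$ (m, m) = 1" using \<open>m < n\<close> by simp
    moreover have "(B' * A') $$ (m, m) = 0"
      using \<open>m < n\<close> AB' by (subst mult_mat_entry) (auto simp: B'_def intro!: sum.neutral)
    ultimately show False by simp
  qed
  then show ?thesis by force
qed

lemma rep_iso_dim:
  fixes V W :: "('g, 'k::field) rep"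
  assumes "rep_iso V W"
  shows "rdim V = rdim W"
proof -
  obtain P Q :: "'k mat" where P: "P \<in> carrier_mat (rdim W) (rdim V)" and Q: "Q \<in> carrier_mat (rdim V) (rdim W)"
    and "Q * P = 1\<^sub>m (rdim V)" "P * Q = 1\<^sub>m (rdim W)"
    using assms unfolding rep_iso_def by auto
  from left_inverse_dim[OF P Q] left_inverse_dim[OF Q P] \<open>Q * P = _\<close> \<open>P * Q = _\<close> show ?thesis by simp
qed

section \<open>Biproduct diagrams\<close>

text \<open>Inclusions and projections take the place of block matrices, because additive
  constructions such as tensor products and duals send one such diagram to another.\<close>

definition biprod :: "('g, 'k::field) rep \<Rightarrow> ('g, 'k) rep \<Rightarrow> ('g, 'k) rep \<Rightarrow> 'k mat \<Rightarrow> 'k mat \<Rightarrow> 'k mat \<Rightarrow> 'k mat \<Rightarrow> bool" where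
  "biprod X A B i1 i2 p1 p2 \<longleftrightarrow> i1 \<in> rep_hom A X \<and> i2 \<in> rep_hom B X \<and> p1 \<in> rep_hom X A \<and> p2 \<in> rep_hom X B \<and>
     p1 * i1 = 1\<^sub>m (rdim A) \<and> p2 * i2 = 1\<^sub>m (rdim B) \<and> i1 * p1 + i2 * p2 = 1\<^sub>m (rdim X) \<and>
     p1 * i2 = 0\<^sub>m (rdim A) (rdim B) \<and> p2 * i1 = 0\<^sub>m (rdim B) (rdim A)"

lemma biprod_dims:
  assumes "biprod X A B i1 i2 p1 p2"
  shows "dim_row i1 = rdim X" "dim_col i1 = rdim A" "dim_row i2 = rdim X" "dim_col i2 = rdim B"
    "dim_row p1 = rdim A" "dim_col p1 = rdim X" "dim_row p2 = rdim B" "dim_col p2 = rdim X"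
  using assms unfolding biprod_def by (auto dest: rep_homD)

lemma biprodD:
  assumes "biprod X A B i1 i2 p1 p2"
  shows "i1 \<in> rep_hom A X" "i2 \<in> rep_hom B X" "p1 \<in> rep_hom X A" "p2 \<in> rep_hom X B"
    "p1 * i1 = 1\<^sub>m (rdim A)" "p2 * i2 = 1\<^sub>m (rdim B)" "i1 * p1 + i2 * p2 = 1\<^sub>m (rdim X)"
    "p1 * i2 = 0\<^sub>m (rdim A) (rdim B)" "p2 * i1 = 0\<^sub>m (rdim B) (rdim A)"
  using assms unfolding biprod_def by auto

lemma biprod_swap:
  assumes "biprod X A B i1 i2 p1 p2"
  shows "biprod X B A i2 i1 p2 p1"
proof -
  have "i2 * p2 + i1 * p1 = i1 * p1 + i2 * p2"
    by (rule comm_add_mat[of _ "rdim X" "rdim X"]) (use biprod_dims[OF assms] in \<open>auto intro!: carrier_matI\<close>)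
  then show ?thesis using assms unfolding biprod_def by simp
qed

lemma mat_add_right_cancel:
  fixes A B :: "'a::ring mat"
  assumes "A + B = A" "A \<in> carrier_mat n m" "B \<in> carrier_mat n m"
  shows "B = 0\<^sub>m n m"
proof (rule eq_matI)
  fix i j assume "i < dim_row (0\<^sub>m n m :: 'a mat)" "j < dim_col (0\<^sub>m n m :: 'a mat)"
  then show "B $$ (i, j) = 0\<^sub>m n m $$ (i, j)"
    using arg_cong[OF assms(1), of "\<lambda>M. M $$ (i, j)"] assms(2,3) by simp
qed (use assms in auto)

text \<open>The mixed composites vanish automatically: \<open>p1 = p1 * (i1 * p1 + i2 * p2)\<close>
  gives \<open>p1 * (i2 * p2) = 0\<close>, and multiplying by \<open>i2\<close> cancels
  \<open>p2\<close>.\<close>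

lemma biprodI:
  assumes i: "i1 \<in> rep_hom A X" "i2 \<in> rep_hom B X" "p1 \<in> rep_hom X A" "p2 \<in> rep_hom X B"
    and e: "p1 * i1 = 1\<^sub>m (rdim A)" "p2 * i2 = 1\<^sub>m (rdim B)" "i1 * p1 + i2 * p2 = 1\<^sub>m (rdim X)"
  shows "biprod X A B i1 i2 p1 p2"
proof -
  note [simp] = rep_homD(1,2)[OF i(1)] rep_homD(1,2)[OF i(2)] rep_homD(1,2)[OF i(3)] rep_homD(1,2)[OF i(4)]
  have "p1 = p1 * (i1 * p1 + i2 * p2)" unfolding e by (simp add: mat_one_right)
  also have "\<dots> = p1 + p1 * (i2 * p2)"
    by (simp add: mat_distrib_left mat_cancel[OF e(1)])
  finally have "p1 + p1 * (i2 * p2) = p1" by simp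
  then have "p1 * (i2 * p2) = 0\<^sub>m (rdim A) (rdim X)"
    by (rule mat_add_right_cancel) (auto intro!: carrier_matI)
  then have "p1 * (i2 * p2) * i2 = 0\<^sub>m (rdim A) (rdim B)" by (simp add: mat_zero_left)
  moreover have "p1 * (i2 * p2) * i2 = p1 * i2" by (simp add: mat_assoc e mat_one_right)
  ultimately have 1: "p1 * i2 = 0\<^sub>m (rdim A) (rdim B)" by simp
  have e': "i2 * p2 + i1 * p1 = 1\<^sub>m (rdim X)"
    unfolding e(3)[symmetric] by (rule comm_add_mat[of _ "rdim X" "rdim X"]) (auto intro!: carrier_matI)
  have "p2 = p2 * (i2 * p2 + i1 * p1)" unfolding e' by (simp add: mat_one_right)
  also have "\<dots> = p2 + p2 * (i1 * p1)"
    by (simp add: mat_distrib_left mat_cancel[OF e(2)])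
  finally have "p2 + p2 * (i1 * p1) = p2" by simp
  then have "p2 * (i1 * p1) = 0\<^sub>m (rdim B) (rdim X)"
    by (rule mat_add_right_cancel) (auto intro!: carrier_matI)
  then have "p2 * (i1 * p1) * i1 = 0\<^sub>m (rdim B) (rdim A)" by (simp add: mat_zero_left)
  moreover have "p2 * (i1 * p1) * i1 = p2 * i1" by (simp add: mat_assoc e mat_one_right)
  ultimately have 2: "p2 * i1 = 0\<^sub>m (rdim B) (rdim A)" by simp
  show ?thesis unfolding biprod_def using i e 1 2 by blast
qed

lemma rdim_rep_sum[simp]: "rdim (rep_sum A B) = rdim A + rdim B"
  by (simp add: rep_sum_def)

lemma act_rep_sum: "act (rep_sum A B) g = four_block_mat
      (act A g) (0\<^sub>m (rdim A) (rdim B)) (0\<^sub>m (rdim B) (rdim A)) (act B g)"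
  by (simp add: rep_sum_def)

lemma rep_wf_sum[simp]: "rep_wf A \<Longrightarrow> rep_wf B \<Longrightarrow> rep_wf (rep_sum A B)"
  by (auto simp: rep_wf_def act_rep_sum)

lemma biprod_rep_sum:
  assumes [simp]: "rep_wf A" "rep_wf B"
  obtains i1 i2 p1 p2 where "biprod (rep_sum A B) A B i1 i2 p1 p2"
proof -
  let ?a = "rdim A" and ?b = "rdim B"
  \<comment> \<open>Empty blocks of width or height 0 make every map a block matrix, so that block
    multiplication applies throughout.\<close>
  define i1 :: "'b mat" where "i1 = four_block_mat (1\<^sub>m ?a) (0\<^sub>m ?a 0) (0\<^sub>m ?b ?a) (0\<^sub>m ?b 0)"
  define i2 :: "'b mat" where "i2 = four_block_mat (0\<^sub>m ?a ?b) (0\<^sub>m ?a 0) (1\<^sub>m ?b) (0\<^sub>m ?b 0)"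
  define p1 :: "'b mat" where "p1 = four_block_mat (1\<^sub>m ?a) (0\<^sub>m ?a ?b) (0\<^sub>m 0 ?a) (0\<^sub>m 0 ?b)"
  define p2 :: "'b mat" where "p2 = four_block_mat (0\<^sub>m ?b ?a) (1\<^sub>m ?b) (0\<^sub>m 0 ?a) (0\<^sub>m 0 ?b)"
  note defs = i1_def i2_def p1_def p2_def
  have dims: "i1 \<in> carrier_mat (?a + ?b) ?a" "i2 \<in> carrier_mat (?a + ?b) ?b"
    "p1 \<in> carrier_mat ?a (?a + ?b)" "p2 \<in> carrier_mat ?b (?a + ?b)"
    unfolding defs by (auto intro!: carrier_matI)
  have pad: "four_block_mat M (0\<^sub>m n 0) (0\<^sub>m 0 m) (0\<^sub>m 0 0) = M" if "M \<in> carrier_mat n m" for M :: "'b mat" and n m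
    using that by (intro eq_matI) auto
  have act: "act A g \<in> carrier_mat ?a ?a" "act B g \<in> carrier_mat ?b ?b" for g
    by (auto intro: rep_wf_carrier)
  have h1: "i1 * act A g = act (rep_sum A B) g * i1" for g
  proof -
    have "i1 * four_block_mat (act A g) (0\<^sub>m ?a 0) (0\<^sub>m 0 ?a) (0\<^sub>m 0 0) = act (rep_sum A B) g * i1"
      unfolding i1_def act_rep_sum using act[of g]
      by (subst (1 2) mult_four_block_mat) auto
    then show ?thesis by (simp add: pad act)
  qed
  have h2: "i2 * act B g = act (rep_sum A B) g * i2" for g
  proof -
    have "i2 * four_block_mat (act B g) (0\<^sub>m ?b 0) (0\<^sub>m 0 ?b) (0\<^sub>m 0 0) = act (rep_sum A B) g * i2"
      unfolding i2_def act_rep_sum using act[of g]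
      by (subst (1 2) mult_four_block_mat) auto
    then show ?thesis by (simp add: pad act)
  qed
  have h3: "p1 * act (rep_sum A B) g = act A g * p1" for g
  proof -
    have "p1 * act (rep_sum A B) g = four_block_mat (act A g) (0\<^sub>m ?a 0) (0\<^sub>m 0 ?a) (0\<^sub>m 0 0) * p1"
      unfolding p1_def act_rep_sum using act[of g]
      by (subst (1 2) mult_four_block_mat) auto
    then show ?thesis by (simp add: pad act)
  qed
  have h4: "p2 * act (rep_sum A B) g = act B g * p2" for g
  proof -
    have "p2 * act (rep_sum A B) g = four_block_mat (act B g) (0\<^sub>m ?b 0) (0\<^sub>m 0 ?b) (0\<^sub>m 0 0) * p2"
      unfolding p2_def act_rep_sum using act[of g]
      by (subst (1 2) mult_four_block_mat) auto
    then show ?thesis by (simp add: pad act)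
  qed
  have "p1 * i1 = four_block_mat (1\<^sub>m ?a) (0\<^sub>m ?a 0) (0\<^sub>m 0 ?a) (0\<^sub>m 0 0)"
    unfolding p1_def i1_def by (subst mult_four_block_mat) auto
  then have e1: "p1 * i1 = 1\<^sub>m ?a" by (simp add: pad)
  have "p2 * i2 = four_block_mat (1\<^sub>m ?b) (0\<^sub>m ?b 0) (0\<^sub>m 0 ?b) (0\<^sub>m 0 0)"
    unfolding p2_def i2_def by (subst mult_four_block_mat) auto
  then have e2: "p2 * i2 = 1\<^sub>m ?b" by (simp add: pad)
  have "i1 * p1 = four_block_mat (1\<^sub>m ?a) (0\<^sub>m ?a ?b) (0\<^sub>m ?b ?a) (0\<^sub>m ?b ?b)"
    unfolding p1_def i1_def by (subst mult_four_block_mat) auto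
  moreover have "i2 * p2 = four_block_mat (0\<^sub>m ?a ?a) (0\<^sub>m ?a ?b) (0\<^sub>m ?b ?a) (1\<^sub>m ?b)"
    unfolding p2_def i2_def by (subst mult_four_block_mat) auto
  ultimately have e3: "i1 * p1 + i2 * p2 = 1\<^sub>m (?a + ?b)"
    by (simp add: add_four_block_mat[of _ ?a ?a _ ?b _ ?b])
  have "biprod (rep_sum A B) A B i1 i2 p1 p2"
    by (rule biprodI) (use dims h1 h2 h3 h4 e1 e2 e3 in \<open>auto intro!: rep_homI\<close>)
  then show ?thesis by (rule that)
qed

lemma biprod_transport:
  assumes "biprod X A B i1 i2 p1 p2" and [simp]: "rep_wf X" "rep_wf Y" "rep_wf A" "rep_wf B"
    and "P \<in> rep_hom X Y" "Q \<in> rep_hom Y X" and QP: "Q * P = 1\<^sub>m (rdim X)" "P * Q = 1\<^sub>m (rdim Y)"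
  shows "biprod Y A B (P * i1) (P * i2) (p1 * Q) (p2 * Q)"
proof (rule biprodI)
  note [simp] = biprod_dims[OF assms(1)] rep_homD(1,2)[OF assms(6)] rep_homD(1,2)[OF assms(7)]
  note b = biprodD[OF assms(1)]
  show "P * i1 \<in> rep_hom A Y" "P * i2 \<in> rep_hom B Y" "p1 * Q \<in> rep_hom Y A" "p2 * Q \<in> rep_hom Y B"
    by (auto intro!: rep_hom_comp b assms)
  show "p1 * Q * (P * i1) = 1\<^sub>m (rdim A)" "p2 * Q * (P * i2) = 1\<^sub>m (rdim B)"
    using b by (simp_all add: mat_assoc mat_cancel[OF QP(1)])
  have "P * i1 * (p1 * Q) + P * i2 * (p2 * Q) = P * (i1 * p1 + i2 * p2) * Q"
    by (simp add: mat_alg)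
  then show "P * i1 * (p1 * Q) + P * i2 * (p2 * Q) = 1\<^sub>m (rdim Y)"
    unfolding b by (simp add: mat_one_right QP)
qed

lemma biprod_iso:
  assumes b: "biprod X A B i1 i2 p1 p2" and b': "biprod Y A B j1 j2 q1 q2"
    and [simp]: "rep_wf X" "rep_wf Y" "rep_wf A" "rep_wf B"
  shows "rep_iso X Y"
proof (rule rep_isoI)
  note [simp] = biprod_dims[OF b] biprod_dims[OF b']
  show "j1 * p1 + j2 * p2 \<in> rep_hom X Y"
    by (rule rep_hom_add; (rule rep_hom_comp)?) (use biprodD[OF b] biprodD[OF b'] in auto)
  show "i1 * q1 + i2 * q2 \<in> rep_hom Y X"
    by (rule rep_hom_add; (rule rep_hom_comp)?) (use biprodD[OF b] biprodD[OF b'] in auto)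
  have "(i1 * q1 + i2 * q2) * (j1 * p1 + j2 * p2) =
    i1 * ((q1 * j1) * p1) + i1 * ((q1 * j2) * p2) + (i2 * ((q2 * j1) * p1) + i2 * ((q2 * j2) * p2))"
    by (simp add: mat_alg mat_add_ac)
  also have "\<dots> = i1 * p1 + i2 * p2"
    unfolding biprodD[OF b'] by (simp add: mat_alg)
  finally show "(i1 * q1 + i2 * q2) * (j1 * p1 + j2 * p2) = 1\<^sub>m (rdim X)"
    unfolding biprodD[OF b] .
  have "(j1 * p1 + j2 * p2) * (i1 * q1 + i2 * q2) =
    j1 * ((p1 * i1) * q1) + j1 * ((p1 * i2) * q2) + (j2 * ((p2 * i1) * q1) + j2 * ((p2 * i2) * q2))"
    by (simp add: mat_alg mat_add_ac)
  also have "\<dots> = j1 * q1 + j2 * q2"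
    unfolding biprodD[OF b] by (simp add: mat_alg)
  finally show "(j1 * p1 + j2 * p2) * (i1 * q1 + i2 * q2) = 1\<^sub>m (rdim Y)"
    unfolding biprodD[OF b'] .
qed

lemma rep_iso_sum_iff:
  assumes [simp]: "rep_wf X" "rep_wf A" "rep_wf B"
  shows "rep_iso X (rep_sum A B) \<longleftrightarrow> (\<exists>i1 i2 p1 p2. biprod X A B i1 i2 p1 p2)"
proof
  assume "rep_iso X (rep_sum A B)"
  then obtain P Q where PQ: "P \<in> rep_hom X (rep_sum A B)" "Q \<in> rep_hom (rep_sum A B) X"
      "Q * P = 1\<^sub>m (rdim X)" "P * Q = 1\<^sub>m (rdim (rep_sum A B))"
    by (elim rep_isoE) auto
  obtain i1 i2 p1 p2 where b: "biprod (rep_sum A B) A B i1 i2 p1 p2"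
    by (rule biprod_rep_sum[of A B]) auto
  from biprod_transport[OF b _ _ _ _ PQ(2) PQ(1) PQ(4) PQ(3)] show "\<exists>i1 i2 p1 p2. biprod X A B i1 i2 p1 p2"
    by auto
next
  assume "\<exists>i1 i2 p1 p2. biprod X A B i1 i2 p1 p2"
  then obtain i1 i2 p1 p2 where b: "biprod X A B i1 i2 p1 p2" by auto
  obtain j1 j2 q1 q2 where b': "biprod (rep_sum A B) A B j1 j2 q1 q2"
    by (rule biprod_rep_sum[of A B]) auto
  from biprod_iso[OF b b'] show "rep_iso X (rep_sum A B)" by auto
qed

lemma rep_sum_comm: "rep_wf A \<Longrightarrow> rep_wf B \<Longrightarrow> rep_iso (rep_sum A B) (rep_sum B A)"
  by (meson biprod_rep_sum biprod_swap rep_iso_sum_iff rep_wf_sum)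

lemma rep_sum_cong:
  assumes "rep_iso A A'" "rep_iso B B'" and [simp]: "rep_wf A" "rep_wf B" "rep_wf A'" "rep_wf B'"
  shows "rep_iso (rep_sum A B) (rep_sum A' B')"
proof -
  obtain P Q where PQ: "P \<in> rep_hom A A'" "Q \<in> rep_hom A' A" "Q * P = 1\<^sub>m (rdim A)" "P * Q = 1\<^sub>m (rdim A')"
    using assms by (elim rep_isoE)
  obtain R S where RS: "R \<in> rep_hom B B'" "S \<in> rep_hom B' B" "S * R = 1\<^sub>m (rdim B)" "R * S = 1\<^sub>m (rdim B')"
    using assms by (elim rep_isoE[of B B'])
  obtain i1 i2 p1 p2 where b: "biprod (rep_sum A B) A B i1 i2 p1 p2"
    by (rule biprod_rep_sum[of A B]) auto
  note [simp] = rep_homD(1,2)[OF PQ(1)] rep_homD(1,2)[OF PQ(2)] rep_homD(1,2)[OF RS(1)] rep_homD(1,2)[OF RS(2)]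
    biprod_dims[OF b, simplified]
  have "biprod (rep_sum A B) A' B' (i1 * Q) (i2 * S) (P * p1) (R * p2)"
  proof (rule biprodI)
    show "i1 * Q \<in> rep_hom A' (rep_sum A B)" "i2 * S \<in> rep_hom B' (rep_sum A B)"
      "P * p1 \<in> rep_hom (rep_sum A B) A'" "R * p2 \<in> rep_hom (rep_sum A B) B'"
      by (auto intro!: rep_hom_comp biprodD[OF b] PQ RS)
    have "P * p1 * (i1 * Q) = P * ((p1 * i1) * Q)" "R * p2 * (i2 * S) = R * ((p2 * i2) * S)"
      by (simp_all add: mat_assoc)
    then show "P * p1 * (i1 * Q) = 1\<^sub>m (rdim A')" "R * p2 * (i2 * S) = 1\<^sub>m (rdim B')"
      unfolding biprodD[OF b] by (simp_all add: mat_one_left PQ RS)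
    have "i1 * Q * (P * p1) = i1 * p1" "i2 * S * (R * p2) = i2 * p2"
      by (simp_all add: mat_assoc mat_cancel[OF PQ(3)] mat_cancel[OF RS(3)])
    then show "i1 * Q * (P * p1) + i2 * S * (R * p2) = 1\<^sub>m (rdim (rep_sum A B))"
      using biprodD(7)[OF b] by simp
  qed
  then show ?thesis by (auto simp: rep_iso_sum_iff)
qed

lemma rep_sum_assoc:
  assumes [simp]: "rep_wf A" "rep_wf B" "rep_wf C"
  shows "rep_sum (rep_sum A B) C = rep_sum A (rep_sum B C)"
  unfolding rep_sum_def using assoc_four_block_mat[of "act A _" "act B _" "act C _"]
  by (simp add: add.assoc fun_eq_iff)

definition rep_zero :: "('g, 'k::field) rep" where
  "rep_zero = Rep 0 (\<lambda>g. 0\<^sub>m 0 0)"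

lemma rep_zero_simps[simp]: "rdim rep_zero = 0" "act rep_zero g = 0\<^sub>m 0 0" "rep_wf rep_zero"
  by (auto simp: rep_zero_def rep_wf_def)

lemma rep_eqI:
  "rdim V = rdim W \<Longrightarrow> rep_wf V \<Longrightarrow> rep_wf W \<Longrightarrow>
   (\<And>g i j. i < rdim W \<Longrightarrow> j < rdim W \<Longrightarrow> act V g $$ (i, j) = act W g $$ (i, j)) \<Longrightarrow> V = W"
  by (rule rep.expand) (auto intro!: eq_matI ext)

lemma rep_dim0_eq: "rep_wf V \<Longrightarrow> rdim V = 0 \<Longrightarrow> V = rep_zero"
  by (rule rep_eqI) auto

lemma rep_sum_zero: "rep_wf V \<Longrightarrow> rep_sum V rep_zero = V" "rep_wf V \<Longrightarrow> rep_sum rep_zero V = V"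
  by (rule rep_eqI; simp add: act_rep_sum)+

lemma reps_sum:
  assumes A: "A \<in> reps H" and B: "B \<in> reps H"
  shows "rep_sum A B \<in> reps H"
proof -
  note [simp] = reps_wf[OF A] reps_wf[OF B]
  have ev: "eval_rep (rep_sum A B) p = four_block_mat
      (eval_rep A p) (0\<^sub>m (rdim A) (rdim B)) (0\<^sub>m (rdim B) (rdim A)) (eval_rep B p)" for p
  proof (induction p)
    case (Add p q)
    then show ?case using eval_rep_carrier[of A] eval_rep_carrier[of B]
      by (simp add: add_four_block_mat[of _ "rdim A" "rdim A" _ "rdim B" _ "rdim B"])
  next
    case (Mul p q)
    have *: "eval_rep A r \<in> carrier_mat (rdim A) (rdim A)" "eval_rep B r \<in> carrier_mat (rdim B) (rdim B)" for r
      by (auto intro: eval_rep_carrier)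
    show ?case unfolding eval_rep.simps Mul
      by (subst mult_four_block_mat[OF *(1) _ _ *(2) *(1) _ _ *(2)])
        (use *[of p] *[of q] in \<open>auto intro!: cong_four_block_mat\<close>)
  next
    case (Const c)
    have "1\<^sub>m (rdim A + rdim B) = four_block_mat (1\<^sub>m (rdim A)) (0\<^sub>m (rdim A) (rdim B)) (0\<^sub>m (rdim B) (rdim A)) (1\<^sub>m (rdim B) :: 'b mat)"
      by simp
    then show ?case by (simp add: smult_four_block_mat[of _ "rdim A" "rdim A" _ "rdim B" _ "rdim B"] del: four_block_one_mat)
  next
    case (Neg p)
    show ?case unfolding eval_rep.simps Neg by (rule eq_matI) auto
  qed (simp add: act_rep_sum)
  show ?thesis
    by (rule repsI) (simp_all add: ev reps_rel[OF A] reps_rel[OF B])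
qed

lemma reps_zero: "rep_zero \<in> reps H"
  by (rule repsI) (auto intro!: eq_matI)

text \<open>The complement is the image of the idempotent \<open>1 - P * Q\<close>. It commutes with
  the action because both maps are homomorphisms, so the action can be compressed to its
  image.\<close>

lemma retract_split:
  assumes V: "V \<in> reps H" and U: "rep_wf U" and P: "P \<in> rep_hom U V" and Q: "Q \<in> rep_hom V U"
    and QP: "Q * P = 1\<^sub>m (rdim U)"
  shows "\<exists>W\<in>reps H. rep_iso V (rep_sum U W)"
proof -
  note [simp] = rep_homD(1,2)[OF P] rep_homD(1,2)[OF Q] U reps_wf[OF V]
  let ?n = "rdim V"
  define E where "E = 1\<^sub>m ?n - P * Q"
  have Ehom: "E \<in> rep_hom V V"
    unfolding E_def by (intro rep_hom_add rep_hom_one rep_hom_comp[OF P Q]) auto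
  have PQPQ: "P * (Q * (P * Q)) = P * Q" by (simp add: mat_cancel[OF QP])
  have "E * E = E"
    unfolding E_def by (simp add: mat_alg PQPQ)
  then obtain r R S where RS: "R \<in> carrier_mat ?n r" "S \<in> carrier_mat r ?n" "R * S = E" "S * R = 1\<^sub>m r"
    using idempotent_split[of E ?n] rep_homD(4)[OF Ehom] by metis
  note [simp] = carrier_matD[OF RS(1)] carrier_matD[OF RS(2)]
  define W where "W = Rep r (\<lambda>g. S * act V g * R)"
  have W[simp]: "rdim W = r" "rep_wf W" "act W g = S * act V g * R" for g
    by (auto simp: W_def rep_wf_def intro!: carrier_matI)
  have ER: "E * R = R" "S * E = S"
    unfolding RS(3)[symmetric] by (simp_all add: mat_assoc RS(4) mat_one_right mat_cancel[OF RS(4)])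
  have R: "R \<in> rep_hom W V"
  proof (rule rep_homI)
    fix g
    have "R * act W g = (R * S) * act V g * R" by (simp add: mat_assoc)
    also have "\<dots> = act V g * (E * R)" unfolding RS(3) rep_homD(3)[OF Ehom] using rep_homD(1,2)[OF Ehom] by (simp add: mat_assoc)
    finally show "R * act W g = act V g * R" unfolding ER .
  qed auto
  have S: "S \<in> rep_hom V W"
  proof (rule rep_homI)
    fix g
    have "act W g * S = S * act V g * (R * S)" by (simp add: mat_assoc)
    also have "\<dots> = S * (act V g * E)" unfolding RS(3) using rep_homD(1,2)[OF Ehom] by (simp add: mat_assoc)
    also have "\<dots> = (S * E) * act V g"
      unfolding rep_homD(3)[OF Ehom, symmetric] using rep_homD(1,2)[OF Ehom] by (simp add: mat_assoc)
    finally show "S * act V g = act W g * S" unfolding ER ..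
  qed (auto simp: RS)
  have "P * Q + R * S = 1\<^sub>m ?n" unfolding RS(3) E_def
    by (rule eq_matI) (auto simp del: index_mult_mat(1))
  then have "biprod V U W P R Q S"
    by (intro biprodI P Q R S QP) (auto simp: RS)
  then have "rep_iso V (rep_sum U W)" by (auto simp: rep_iso_sum_iff)
  moreover have "W \<in> reps H" by (rule reps_retract[OF V _ R, of S]) (auto simp: RS)
  ultimately show ?thesis by auto
qed

section \<open>The Krull-Schmidt theorem\<close>

lemma indecomposable_reps: "indecomposable H V \<Longrightarrow> V \<in> reps H"
  and indecomposable_wf: "indecomposable H V \<Longrightarrow> rep_wf V"
  and indecomposable_dim: "indecomposable H V \<Longrightarrow> 0 < rdim V"
  by (auto simp: indecomposable_def reps_wf)

lemma indecomposableD: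
  "indecomposable H V \<Longrightarrow> rep_iso V (rep_sum U W) \<Longrightarrow> U \<in> reps H \<Longrightarrow> W \<in> reps H \<Longrightarrow> rdim U = 0 \<or> rdim W = 0"
  unfolding indecomposable_def by blast

lemma indecomposable_dim_one:
  assumes "V \<in> reps H" "rdim V = 1"
  shows "indecomposable H V"
  unfolding indecomposable_def
proof (intro conjI notI assms(1))
  show "rdim V = 0 \<Longrightarrow> False" using assms by simp
  assume "\<exists>U\<in>reps H. \<exists>W\<in>reps H. rdim U \<noteq> 0 \<and> rdim W \<noteq> 0 \<and> rep_iso V (rep_sum U W)"
  then obtain U W where "rdim U \<noteq> 0" "rdim W \<noteq> 0" "rep_iso V (rep_sum U W)" by blast
  then show False using rep_iso_dim[of V "rep_sum U W"] assms by simp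
qed

lemma indecomposable_retract:
  assumes V: "indecomposable H V" and U: "rep_wf U" "rdim U \<noteq> 0"
    and P: "P \<in> rep_hom U V" and Q: "Q \<in> rep_hom V U" "Q * P = 1\<^sub>m (rdim U)"
  shows "rep_iso V U"
proof -
  obtain W where W: "W \<in> reps H" "rep_iso V (rep_sum U W)"
    using retract_split[OF indecomposable_reps[OF V] U(1) P Q] by auto
  have "U \<in> reps H"
    by (rule reps_retract[OF indecomposable_reps[OF V] U(1) P, of Q]) (use Q rep_homD(4) in auto)
  with indecomposableD[OF V W(2) _ W(1)] U have "rdim W = 0" by auto
  then have "W = rep_zero" using W reps_wf rep_dim0_eq by auto
  with W(2) show ?thesis by (simp add: rep_sum_zero U)
qed

text \<open>The image of \<open>E\<close> is a retract of \<open>V\<close>: either it is zero, or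
  indecomposability gives it the full dimension.\<close>

lemma indecomposable_idempotent:
  assumes V: "indecomposable H V" and E: "E \<in> rep_hom V V" "E * E = E"
  shows "E = 0\<^sub>m (rdim V) (rdim V) \<or> E = 1\<^sub>m (rdim V)"
proof -
  let ?n = "rdim V"
  note [simp] = rep_homD(1,2)[OF E(1)] indecomposable_wf[OF V]
  obtain r R S where RS: "R \<in> carrier_mat ?n r" "S \<in> carrier_mat r ?n" "R * S = E" "S * R = 1\<^sub>m r"
    using idempotent_split[of E ?n] rep_homD(4)[OF E(1)] E(2) by metis
  note [simp] = carrier_matD[OF RS(1)] carrier_matD[OF RS(2)]
  define W where "W = Rep r (\<lambda>g. S * act V g * R)"
  have W[simp]: "rdim W = r" "rep_wf W" "act W g = S * act V g * R" for g
    by (auto simp: W_def rep_wf_def intro!: carrier_matI)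
  have ER: "E * R = R" "S * E = S"
    unfolding RS(3)[symmetric] by (simp_all add: mat_assoc RS(4) mat_one_right mat_cancel[OF RS(4)])
  have R: "R \<in> rep_hom W V"
  proof (rule rep_homI)
    fix g
    have "R * act W g = (R * S) * act V g * R" by (simp add: mat_assoc)
    also have "\<dots> = act V g * (E * R)" unfolding RS(3) rep_homD(3)[OF E(1)] by (simp add: mat_assoc)
    finally show "R * act W g = act V g * R" unfolding ER .
  qed auto
  have S: "S \<in> rep_hom V W"
  proof (rule rep_homI)
    fix g
    have "act W g * S = S * act V g * (R * S)" by (simp add: mat_assoc)
    also have "\<dots> = S * (act V g * E)" unfolding RS(3) by (simp add: mat_assoc)
    also have "\<dots> = (S * E) * act V g"
      unfolding rep_homD(3)[OF E(1), symmetric] by (simp add: mat_assoc)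
    finally show "S * act V g = act W g * S" unfolding ER ..
  qed (auto simp: RS)
  show ?thesis
  proof (cases "r = 0")
    case True
    then have "E = 0\<^sub>m ?n ?n" unfolding RS(3)[symmetric] by (auto intro!: eq_matI simp: scalar_prod_def)
    then show ?thesis ..
  next
    case False
    have "rep_iso V W" by (rule indecomposable_retract[OF V _ _ R S]) (use False RS in auto)
    then have "r = ?n" using rep_iso_dim[of V W] by simp
    then have "R * S = 1\<^sub>m ?n" using mat_mult_left_right_inverse[of S ?n R] RS by simp
    then show ?thesis using RS by simp
  qed
qed

section \<open>Local endomorphism rings and cancellation\<close>

definition unit_mat :: "nat \<Rightarrow> 'k::field mat \<Rightarrow> bool" where
  "unit_mat n f \<longleftrightarrow> (\<exists>g. g \<in> carrier_mat n n \<and> g * f = 1\<^sub>m n \<and> f * g = 1\<^sub>m n)"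

lemma unit_matE:
  assumes "unit_mat n f"
  obtains g where "g \<in> carrier_mat n n" "g * f = 1\<^sub>m n" "f * g = 1\<^sub>m n"
  using assms unfolding unit_mat_def by blast

lemma unit_matI_left:
  assumes "g \<in> carrier_mat n n" "f \<in> carrier_mat n n" "g * f = 1\<^sub>m n"
  shows "unit_mat n f"
  unfolding unit_mat_def using assms mat_mult_left_right_inverse[OF assms] by blast

lemma unit_matI_right:
  assumes "g \<in> carrier_mat n n" "f \<in> carrier_mat n n" "f * g = 1\<^sub>m n"
  shows "unit_mat n f"
  unfolding unit_mat_def using assms mat_mult_left_right_inverse[OF assms(2,1,3)] by blast

lemma unit_mat_one: "unit_mat n (1\<^sub>m n)"
  by (rule unit_matI_left[of "1\<^sub>m n"]) auto

lemma unit_mat_factor: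
  assumes "unit_mat n (f * g)" "f \<in> carrier_mat n n" "g \<in> carrier_mat n n"
  shows "unit_mat n f" "unit_mat n g"
proof -
  obtain h where h: "h \<in> carrier_mat n n" "h * (f * g) = 1\<^sub>m n" "f * g * h = 1\<^sub>m n"
    using assms(1) unfolding unit_mat_def by blast
  note [simp] = carrier_matD[OF assms(2)] carrier_matD[OF assms(3)] carrier_matD[OF h(1)]
  show "unit_mat n f" by (rule unit_matI_right[of "g * h"]) (use assms h in \<open>auto simp: mat_assoc\<close>)
  show "unit_mat n g" by (rule unit_matI_left[of "h * f"]) (use assms h in \<open>auto simp: mat_assoc\<close>)
qed

lemma unit_mat_uminus:
  assumes "unit_mat n (- f)" "f \<in> carrier_mat n n"
  shows "unit_mat n f"
proof -
  obtain h where h: "h \<in> carrier_mat n n" "h * (- f) = 1\<^sub>m n" using assms unfolding unit_mat_def by blast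
  show ?thesis by (rule unit_matI_left[of "- h"]) (use assms h in auto)
qed

lemma rep_hom_inverse:
  assumes f: "f \<in> rep_hom V V" and g: "g \<in> carrier_mat (rdim V) (rdim V)"
    "g * f = 1\<^sub>m (rdim V)" "f * g = 1\<^sub>m (rdim V)" and [simp]: "rep_wf V"
  shows "g \<in> rep_hom V V"
proof (rule rep_homI[OF g(1)])
  note [simp] = rep_homD(1,2)[OF f] carrier_matD[OF g(1)]
  fix x
  have "g * act V x = g * act V x * (f * g)" unfolding g by (simp add: mat_one_right)
  also have "\<dots> = g * ((act V x * f) * g)" by (simp add: mat_assoc)
  also have "\<dots> = (g * f) * (act V x * g)" unfolding rep_homD(3)[OF f, symmetric] by (simp add: mat_assoc)
  finally show "g * act V x = act V x * g" unfolding g by (simp add: mat_one_left)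
qed

text \<open>The Fitting idempotent of \<open>f\<close> is an endomorphism, hence 0 or 1. In the
  first case f^k = 0; in the second, as \<open>k > 0\<close>, a factor \<open>f\<close> can be split
  off from f^k and the rest inverts it.\<close>

lemma indecomposable_fitting:
  assumes V: "indecomposable H V" and f: "f \<in> rep_hom V V"
  shows "unit_mat (rdim V) f \<or> (\<exists>k. f ^\<^sub>m k = 0\<^sub>m (rdim V) (rdim V))"
proof -
  let ?n = "rdim V"
  have fc: "f \<in> carrier_mat ?n ?n" by (rule rep_homD(4)[OF f])
  obtain k e X where e: "e \<in> carrier_mat ?n ?n" "X \<in> carrier_mat ?n ?n" "e * e = e"
    "e * f ^\<^sub>m k = f ^\<^sub>m k" "f ^\<^sub>m k * X = e" "X * f ^\<^sub>m k = e" "0 < k"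
    "\<And>h. h \<in> carrier_mat ?n ?n \<Longrightarrow> h * f = f * h \<Longrightarrow> h * e = e * h"
    using fitting_idempotent[OF fc] by metis
  have "e \<in> rep_hom V V"
    using e(8) rep_homD(3)[OF f] rep_wf_carrier[OF indecomposable_wf[OF V]]
    by (intro rep_homI e) metis
  from indecomposable_idempotent[OF V this e(3)] show ?thesis
  proof
    assume "e = 0\<^sub>m ?n ?n"
    then have "f ^\<^sub>m k = 0\<^sub>m ?n ?n" using e(4) carrier_matD[OF pow_carrier_mat[OF fc, of k]] by (simp add: mat_zero_left)
    then show ?thesis by blast
  next
    assume e1: "e = 1\<^sub>m ?n"
    obtain l where l: "k = Suc l" using e(7) gr0_conv_Suc by auto
    have fl: "f ^\<^sub>m l \<in> carrier_mat ?n ?n" using fc by simp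
    have "(X * f ^\<^sub>m l) * f = X * f ^\<^sub>m k"
      unfolding l pow_mat.simps by (rule assoc_mult_mat[OF e(2) fl fc])
    then have "(X * f ^\<^sub>m l) * f = 1\<^sub>m ?n" unfolding e(6) e1 .
    then show ?thesis using unit_matI_left[OF mult_carrier_mat[OF e(2) fl] fc] by blast
  qed
qed

text \<open>Let \<open>f\<close> have nilpotency index j + 1. Then f^j = f^j (f + g) = f^j g, so f^j
  is unchanged by multiplication with powers of \<open>g\<close> and vanishes, unless the space is
  zero.\<close>

lemma nilpotent_complement:
  fixes f :: "'k::field mat"
  assumes f: "f \<in> carrier_mat n n" and k: "f ^\<^sub>m k = 0\<^sub>m n n"
    and g: "g \<in> carrier_mat n n" and fg: "f + g = 1\<^sub>m n" and l: "g ^\<^sub>m l = 0\<^sub>m n n"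
  shows "n = 0"
proof -
  note [simp] = carrier_matD[OF f] carrier_matD[OF g]
  have pw[simp]: "dim_row (f ^\<^sub>m i) = n" "dim_col (f ^\<^sub>m i) = n" "dim_row (g ^\<^sub>m i) = n" "dim_col (g ^\<^sub>m i) = n" for i
    using pow_carrier_mat[OF f, of i] pow_carrier_mat[OF g, of i] by auto
  define m where "m = (LEAST k. f ^\<^sub>m k = 0\<^sub>m n n)"
  have m: "f ^\<^sub>m m = 0\<^sub>m n n" unfolding m_def by (rule LeastI[of "\<lambda>k. f ^\<^sub>m k = 0\<^sub>m n n", OF k])
  show ?thesis
  proof (cases m)
    case 0
    then have "1\<^sub>m n = (0\<^sub>m n n :: 'k mat)" using m by simp
    then have "1\<^sub>m n $$ (0, 0) = (0\<^sub>m n n :: 'k mat) $$ (0, 0)" by simp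
    then show "n = 0" by (cases n) simp_all
  next
    case (Suc j)
    have nz: "f ^\<^sub>m j \<noteq> 0\<^sub>m n n"
      using not_less_Least[of j "\<lambda>k. f ^\<^sub>m k = 0\<^sub>m n n"] Suc unfolding m_def by auto
    have "f ^\<^sub>m j = f ^\<^sub>m j * (f + g)" unfolding fg by (simp add: mat_one_right)
    also have "\<dots> = f ^\<^sub>m Suc j + f ^\<^sub>m j * g" by (simp add: mat_distrib_left)
    also have "\<dots> = f ^\<^sub>m j * g" using m Suc by (simp add: mat_add_zero)
    finally have 1: "f ^\<^sub>m j * g = f ^\<^sub>m j" by simp
    have "f ^\<^sub>m j * g ^\<^sub>m i = f ^\<^sub>m j" for i
    proof (induction i)
      case (Suc i)
      have "f ^\<^sub>m j * g ^\<^sub>m Suc i = (f ^\<^sub>m j * g ^\<^sub>m i) * g" by (simp add: mat_assoc)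
      then show ?case unfolding Suc 1 .
    qed (simp add: mat_one_right)
    from this[of l] nz show ?thesis unfolding l by (simp add: mat_zero_right)
  qed
qed

text \<open>Multiplication by the inverse of \<open>f + g\<close> makes the two terms add up to 1;
  by Fitting two non-units would both be nilpotent.\<close>

lemma indecomposable_local:
  assumes V: "indecomposable H V" and f: "f \<in> rep_hom V V" and g: "g \<in> rep_hom V V"
    and u: "unit_mat (rdim V) (f + g)"
  shows "unit_mat (rdim V) f \<or> unit_mat (rdim V) g"
proof -
  let ?n = "rdim V"
  note [simp] = rep_homD(1,2)[OF f] rep_homD(1,2)[OF g] indecomposable_wf[OF V]
  obtain h where h: "h \<in> carrier_mat ?n ?n" "h * (f + g) = 1\<^sub>m ?n" "(f + g) * h = 1\<^sub>m ?n"
    by (rule unit_matE[OF u])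
  have hh: "h \<in> rep_hom V V"
    by (rule rep_hom_inverse[of "f + g"]) (use h in \<open>auto intro: rep_hom_add f g\<close>)
  have hf: "h * f \<in> rep_hom V V" "h * g \<in> rep_hom V V" by (auto intro: rep_hom_comp hh f g)
  have sum: "h * f + h * g = 1\<^sub>m ?n" using h carrier_matD[OF h(1)] by (simp add: mat_distrib_left)
  have "unit_mat ?n (h * f) \<or> unit_mat ?n (h * g)"
    using indecomposable_fitting[OF V hf(1)] indecomposable_fitting[OF V hf(2)] indecomposable_dim[OF V]
      nilpotent_complement[OF rep_homD(4)[OF hf(1)] _ rep_homD(4)[OF hf(2)] sum] by auto
  then show ?thesis using unit_mat_factor(2) h(1) rep_homD(4)[OF f] rep_homD(4)[OF g] by blast
qed

text \<open>If \<open>qU * iU\<close> is invertible, the copy \<open>iU\<close> of \<open>U\<close>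
  is complementary to \<open>jN\<close> as well as to \<open>iM\<close>, and two complements of one
  submodule are isomorphic.\<close>

lemma biprod_cancel_unit:
  assumes b: "biprod X U M iU iM pU pM" and c: "biprod X U N jU jN qU qN"
    and [simp]: "rep_wf X" "rep_wf U" "rep_wf M" "rep_wf N"
    and u: "unit_mat (rdim U) (qU * iU)"
  shows "rep_iso M N"
proof -
  note bd = biprodD[OF b] and cd = biprodD[OF c]
  note [simp] = biprod_dims[OF b] biprod_dims[OF c]
  obtain w where w: "w \<in> carrier_mat (rdim U) (rdim U)" "w * (qU * iU) = 1\<^sub>m (rdim U)" "qU * iU * w = 1\<^sub>m (rdim U)"
    by (rule unit_matE[OF u])
  have qi: "qU * iU \<in> rep_hom U U" by (auto intro: rep_hom_comp bd cd)
  have wh: "w \<in> rep_hom U U" by (rule rep_hom_inverse[OF qi w]) auto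
  note [simp] = carrier_matD[OF w(1)]
  \<comment> \<open>This corrects \<open>iM\<close> inside the image of \<open>iU\<close> so that it
    lands in the kernel of \<open>qU\<close>, which is the image of \<open>jN\<close>.\<close>
  define y where "y = iM - iU * (w * (qU * iM))"
  have yh: "y \<in> rep_hom M X" unfolding y_def by (auto intro!: rep_hom_add rep_hom_comp bd cd wh)
  have [simp]: "dim_row y = rdim X" "dim_col y = rdim M" using rep_homD[OF yh] by auto
  have qy: "qU * y = 0\<^sub>m (rdim U) (rdim M)"
  proof -
    have "qU * y = qU * iM - (qU * iU * w) * (qU * iM)" unfolding y_def by (simp add: mat_alg)
    then show ?thesis unfolding w(3) by (simp add: mat_alg)
  qed
  have py: "pM * y = 1\<^sub>m (rdim M)"
  proof -
    have "pM * y = pM * iM - (pM * iU) * (w * (qU * iM))" unfolding y_def by (simp add: mat_alg)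
    then show ?thesis unfolding bd by (simp add: mat_alg)
  qed
  have jq: "jN * (qN * y) = y"
  proof -
    have "y = (jU * qU + jN * qN) * y" unfolding cd by (simp add: mat_one_left)
    also have "\<dots> = jU * (qU * y) + jN * (qN * y)" by (simp add: mat_alg)
    finally show ?thesis unfolding qy by (simp add: mat_alg)
  qed
  define z where "z = iU * (pU * jN)"
  have [simp]: "dim_row z = rdim X" "dim_col z = rdim N" by (simp_all add: z_def)
  have ipj: "iM * (pM * jN) = jN - z"
  proof -
    have "jN = (iU * pU + iM * pM) * jN" unfolding bd by (simp add: mat_one_left)
    also have "\<dots> = z + iM * (pM * jN)" by (simp add: mat_alg z_def)
    finally have "jN = z + iM * (pM * jN)" .
    then have "jN - z = z + iM * (pM * jN) - z" by simp
    also have "\<dots> = iM * (pM * jN)" by (rule eq_matI) (auto simp del: index_mult_mat(1))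
    finally show ?thesis by simp
  qed
  show ?thesis
  proof (rule rep_isoI)
    show "qN * y \<in> rep_hom M N" "pM * jN \<in> rep_hom N M" by (auto intro: rep_hom_comp bd cd yh)
    show "pM * jN * (qN * y) = 1\<^sub>m (rdim M)" by (simp add: mat_assoc jq py)
    have "y * (pM * jN) = iM * (pM * jN) - iU * (w * (qU * (iM * (pM * jN))))"
      unfolding y_def by (simp add: mat_alg)
    also have "\<dots> = jN - z - iU * (w * (qU * jN - qU * z))" unfolding ipj by (simp add: mat_diff_left)
    also have "qU * jN = 0\<^sub>m (rdim U) (rdim N)" by (rule cd)
    also have "iU * (w * (0\<^sub>m (rdim U) (rdim N) - qU * z)) = iU * (w * 0\<^sub>m (rdim U) (rdim N)) - iU * ((w * (qU * iU)) * (pU * jN))"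
      unfolding z_def by (simp add: mat_diff_left mat_assoc del: right_mult_zero_mat)
    also have "\<dots> = 0\<^sub>m (rdim X) (rdim N) - z" unfolding w(2) by (simp add: mat_alg z_def)
    also have "jN - z - (0\<^sub>m (rdim X) (rdim N) - z) = jN" by (rule eq_matI) auto
    finally have "y * (pM * jN) = jN" .
    then show "qN * y * (pM * jN) = 1\<^sub>m (rdim N)" by (simp add: mat_assoc cd)
  qed
qed

text \<open>A shear: the complement becomes the graph of \<open>- s\<close> and the projection to
  \<open>U\<close> gains the term \<open>s * qN\<close>. It serves to repair a projection that is
  not invertible on the other copy of \<open>U\<close>.\<close>

lemma biprod_modify:
  assumes c: "biprod X U N jU jN qU qN" and s: "s \<in> rep_hom N U"
    and [simp]: "rep_wf X" "rep_wf U" "rep_wf N"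
  shows "biprod X U N jU (jN - jU * s) (qU + s * qN) qN"
proof (rule biprodI)
  note cd = biprodD[OF c]
  note [simp] = biprod_dims[OF c] rep_homD(1,2)[OF s]
  show "jU \<in> rep_hom U X" "qN \<in> rep_hom X N" by (rule cd)+
  show "jN - jU * s \<in> rep_hom N X" "qU + s * qN \<in> rep_hom X U"
    by (auto intro!: rep_hom_add rep_hom_comp cd s)
  show "(qU + s * qN) * jU = 1\<^sub>m (rdim U)" by (simp add: mat_alg cd)
  have "qN * (jN - jU * s) = qN * jN - (qN * jU) * s" by (simp add: mat_alg)
  then show "qN * (jN - jU * s) = 1\<^sub>m (rdim N)" unfolding cd by (simp add: mat_alg)
  have "jU * (qU + s * qN) + (jN - jU * s) * qN = jU * qU + jU * (s * qN) + (jN * qN - jU * (s * qN))"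
    by (simp add: mat_alg)
  also have "\<dots> = jU * qU + jN * qN" by (rule eq_matI) (auto simp del: index_mult_mat(1))
  finally show "jU * (qU + s * qN) + (jN - jU * s) * qN = 1\<^sub>m (rdim X)" unfolding cd .
qed

lemma rep_sum_cancel:
  assumes U: "indecomposable H U" and M[simp]: "rep_wf M" and N[simp]: "rep_wf N"
    and iso: "rep_iso (rep_sum U M) (rep_sum U N)"
  shows "rep_iso M N"
proof -
  note [simp] = indecomposable_wf[OF U]
  let ?X = "rep_sum U M"
  obtain iU iM pU pM where b: "biprod ?X U M iU iM pU pM"
    by (rule biprod_rep_sum[of U M]) auto
  obtain jU jN qU qN where c: "biprod ?X U N jU jN qU qN"
    using iso by (auto simp: rep_iso_sum_iff)
  note bd = biprodD[OF b] and cd = biprodD[OF c]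
  note [simp] = biprod_dims[OF b] biprod_dims[OF c]
  show ?thesis
  proof (cases "unit_mat (rdim U) (qU * iU)")
    case True
    then show ?thesis using biprod_cancel_unit[OF b c] by simp
  next
    case False
    have homs: "pU * jU \<in> rep_hom U U" "qU * iU \<in> rep_hom U U" "pU * jN \<in> rep_hom N U" "qN * iU \<in> rep_hom U N"
      by (auto intro: rep_hom_comp bd cd)
    have "1\<^sub>m (rdim U) = pU * ((jU * qU + jN * qN) * iU)" unfolding cd by (simp add: mat_one_left bd)
    also have "\<dots> = (pU * jU) * (qU * iU) + (pU * jN) * (qN * iU)" by (simp add: mat_alg)
    finally have "unit_mat (rdim U) ((pU * jU) * (qU * iU) + (pU * jN) * (qN * iU))"
      using unit_mat_one by metis
    moreover have "\<not> unit_mat (rdim U) ((pU * jU) * (qU * iU))"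
      using False unit_mat_factor(2)[of "rdim U" "pU * jU" "qU * iU"] homs(1,2)[THEN rep_homD(4)] by auto
    ultimately have v: "unit_mat (rdim U) ((pU * jN) * (qN * iU))"
      using indecomposable_local[OF U, of "(pU * jU) * (qU * iU)" "(pU * jN) * (qN * iU)"]
        rep_hom_comp[OF homs(1,2)] rep_hom_comp[OF homs(3,4)] by auto
    \<comment> \<open>The part of the identity of \<open>U\<close> that passes through
      \<open>jU\<close> is not a unit, so by locality the part through \<open>N\<close> is one.
      Shearing with this \<open>s\<close> adds that unit to the non-unit \<open>qU * iU\<close>, and
      in a local ring the sum is a unit.\<close>
    define s where "s = pU * jN"
    have s: "s \<in> rep_hom N U" using homs(3) by (simp add: s_def)
    note [simp] = rep_homD(1,2)[OF s]
    from biprod_modify[OF c s] have c': "biprod ?X U N jU (jN - jU * s) (qU + s * qN) qN" by simp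
    have h1: "(qU + s * qN) * iU \<in> rep_hom U U" by (rule rep_hom_comp[OF biprodD(3)[OF c'] bd(1)]) auto
    have h2: "- (qU * iU) \<in> rep_hom U U"
      using rep_homD[OF homs(2)] by (auto intro!: rep_homI)
    have "(qU + s * qN) * iU + - (qU * iU) = qU * iU + s * (qN * iU) + - (qU * iU)" by (simp add: mat_alg)
    also have "\<dots> = (pU * jN) * (qN * iU)" unfolding s_def by (rule eq_matI) (auto simp del: index_mult_mat(1))
    finally have "unit_mat (rdim U) ((qU + s * qN) * iU) \<or> unit_mat (rdim U) (- (qU * iU))"
      using indecomposable_local[OF U h1 h2] v by simp
    with False have "unit_mat (rdim U) ((qU + s * qN) * iU)"
      using unit_mat_uminus rep_homD(4)[OF homs(2)] by blast
    then show ?thesis using biprod_cancel_unit[OF b c'] by simp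
  qed
qed

section \<open>Multiplicities of indecomposable summands\<close>

definition rep_summand :: "('g, 'k::field) hopf_presentation \<Rightarrow> ('g, 'k) rep \<Rightarrow> ('g, 'k) rep \<Rightarrow> bool" where
  "rep_summand H U M \<longleftrightarrow> (\<exists>M'\<in>reps H. rep_iso M (rep_sum U M'))"

text \<open>Indecomposables behave like primes: the identity of \<open>U\<close> is a sum of an
  endomorphism through \<open>A\<close> and one through \<open>B\<close>, locality makes one of them
  a unit, and then \<open>U\<close> is a retract of that summand.\<close>

lemma rep_summand_sum:
  assumes U: "indecomposable H U" and A: "A \<in> reps H" and B: "B \<in> reps H"
    and d: "rep_summand H U (rep_sum A B)"
  shows "rep_summand H U A \<or> rep_summand H U B"
proof -
  note [simp] = indecomposable_wf[OF U] reps_wf[OF A] reps_wf[OF B]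
  let ?X = "rep_sum A B"
  obtain M where M: "M \<in> reps H" "rep_iso ?X (rep_sum U M)" using d unfolding rep_summand_def by auto
  note [simp] = reps_wf[OF M(1)]
  obtain iU iM pU pM where b: "biprod ?X U M iU iM pU pM" using M(2) by (auto simp: rep_iso_sum_iff)
  obtain jA jB qA qB where c: "biprod ?X A B jA jB qA qB"
    by (rule biprod_rep_sum[of A B]) auto
  note bd = biprodD[OF b] and cd = biprodD[OF c]
  note [simp] = biprod_dims[OF b] biprod_dims[OF c]
  have homs: "pU * jA \<in> rep_hom A U" "qA * iU \<in> rep_hom U A" "pU * jB \<in> rep_hom B U" "qB * iU \<in> rep_hom U B"
    by (auto intro: rep_hom_comp bd cd)
  have "1\<^sub>m (rdim U) = pU * ((jA * qA + jB * qB) * iU)" unfolding cd by (simp add: mat_one_left bd)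
  also have "\<dots> = (pU * jA) * (qA * iU) + (pU * jB) * (qB * iU)" by (simp add: mat_alg)
  finally have "unit_mat (rdim U) ((pU * jA) * (qA * iU) + (pU * jB) * (qB * iU))"
    using unit_mat_one by metis
  then have "unit_mat (rdim U) ((pU * jA) * (qA * iU)) \<or> unit_mat (rdim U) ((pU * jB) * (qB * iU))"
    using indecomposable_local[OF U] rep_hom_comp[OF homs(1,2)] rep_hom_comp[OF homs(3,4)] by auto
  moreover have summand: "rep_summand H U C" if u: "unit_mat (rdim U) (p * i)" and p: "p \<in> rep_hom C U" and i: "i \<in> rep_hom U C"
    and C: "C \<in> reps H" for C p i
  proof -
    note [simp] = reps_wf[OF C] rep_homD(1,2)[OF p] rep_homD(1,2)[OF i]
    obtain w where w: "w \<in> carrier_mat (rdim U) (rdim U)" "w * (p * i) = 1\<^sub>m (rdim U)" "p * i * w = 1\<^sub>m (rdim U)"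
      by (rule unit_matE[OF u])
    have "p * i \<in> rep_hom U U" by (rule rep_hom_comp[OF p i]) simp_all
    from rep_hom_inverse[OF this w] have "w \<in> rep_hom U U" by simp
    then have "w * p \<in> rep_hom C U" by (rule rep_hom_comp[OF _ p]) simp_all
    moreover have "w * p * i = 1\<^sub>m (rdim U)" using w(2) carrier_matD[OF w(1)] by (simp add: mat_assoc)
    ultimately show ?thesis using retract_split[OF C _ i] unfolding rep_summand_def by auto
  qed
  ultimately show ?thesis using summand[OF _ homs(1,2) A] summand[OF _ homs(3,4) B] by blast
qed

primrec rep_sums :: "('g, 'k::field) rep list \<Rightarrow> ('g, 'k) rep" where
  "rep_sums [] = rep_zero"
| "rep_sums (V # Vs) = rep_sum V (rep_sums Vs)"

lemma rep_wf_sums[simp]: "(\<And>V. V \<in> set Vs \<Longrightarrow> rep_wf V) \<Longrightarrow> rep_wf (rep_sums Vs)"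
  by (induction Vs) auto

lemma rep_wf_sums_replicate[simp]: "rep_wf U \<Longrightarrow> rep_wf (rep_sums (replicate m U))"
  by (induction m) auto

lemma reps_sums: "set Vs \<subseteq> reps H \<Longrightarrow> rep_sums Vs \<in> reps H"
  by (induction Vs) (auto intro: reps_zero reps_sum)

lemma rep_sums_append:
  "(\<And>V. V \<in> set Vs \<union> set Ws \<Longrightarrow> rep_wf V) \<Longrightarrow> rep_sums (Vs @ Ws) = rep_sum (rep_sums Vs) (rep_sums Ws)"
  by (induction Vs) (simp_all add: rep_sum_zero rep_sum_assoc)

lemma rep_sums_replicate_add:
  "rep_wf U \<Longrightarrow> rep_sums (replicate (m + n) U) = rep_sum (rep_sums (replicate m U)) (rep_sums (replicate n U))"
  by (induction m) (simp_all add: rep_sum_zero rep_sum_assoc)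

lemma rep_sum_medial:
  assumes [simp]: "rep_wf A" "rep_wf B" "rep_wf C" "rep_wf D"
  shows "rep_iso (rep_sum (rep_sum A B) (rep_sum C D)) (rep_sum (rep_sum A C) (rep_sum B D))"
proof -
  have "rep_iso (rep_sum A (rep_sum (rep_sum B C) D)) (rep_sum A (rep_sum (rep_sum C B) D))"
    by (intro rep_sum_cong rep_iso_refl rep_sum_comm) auto
  then show ?thesis by (simp add: rep_sum_assoc)
qed

definition rep_mult_rel :: "('g, 'k::field) hopf_presentation \<Rightarrow> ('g, 'k) rep \<Rightarrow> ('g, 'k) rep \<Rightarrow> nat \<Rightarrow> bool" where
  "rep_mult_rel H U M m \<longleftrightarrow> (\<exists>M'\<in>reps H. rep_iso M (rep_sum (rep_sums (replicate m U)) M') \<and> \<not> rep_summand H U M')"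

lemma rep_mult_rel_exists:
  assumes U: "indecomposable H U" and "M \<in> reps H"
  shows "\<exists>m. rep_mult_rel H U M m"
  using assms(2)
proof (induction "rdim M" arbitrary: M rule: less_induct)
  case less
  note [simp] = indecomposable_wf[OF U] reps_wf[OF less.prems]
  show ?case
  proof (cases "rep_summand H U M")
    case False
    then have "rep_mult_rel H U M 0"
      unfolding rep_mult_rel_def using less.prems by (intro bexI[of _ M]) (auto simp: rep_sum_zero rep_iso_refl)
    then show ?thesis by blast
  next
    case True
    then obtain M1 where M1: "M1 \<in> reps H" "rep_iso M (rep_sum U M1)" unfolding rep_summand_def by auto
    note [simp] = reps_wf[OF M1(1)]
    have "rdim M1 < rdim M" using rep_iso_dim[OF M1(2)] indecomposable_dim[OF U] by simp
    from less.hyps[OF this M1(1)] obtain m M' where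
      M': "M' \<in> reps H" "rep_iso M1 (rep_sum (rep_sums (replicate m U)) M')" "\<not> rep_summand H U M'"
      unfolding rep_mult_rel_def by auto
    note [simp] = reps_wf[OF M'(1)]
    have "rep_iso (rep_sum U M1) (rep_sum U (rep_sum (rep_sums (replicate m U)) M'))"
      by (intro rep_sum_cong rep_iso_refl M') auto
    then have "rep_iso M (rep_sum (rep_sums (replicate (Suc m) U)) M')"
      using rep_iso_trans[OF M1(2)] by (simp add: rep_sum_assoc)
    then show ?thesis using M' unfolding rep_mult_rel_def by blast
  qed
qed

text \<open>If two multiplicities differed, cancelling the common copies of \<open>U\<close> would
  exhibit \<open>U\<close> as a summand of a remainder that has none.\<close>

lemma rep_mult_rel_unique:
  assumes U: "indecomposable H U" and "M \<in> reps H"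
  shows "rep_mult_rel H U M m \<Longrightarrow> rep_mult_rel H U M n \<Longrightarrow> m = n"
proof -
  note [simp] = indecomposable_wf[OF U]
  have *: False if lt: "m < n" and r: "rep_mult_rel H U M m" "rep_mult_rel H U M n" for m n
  proof -
    obtain A where A: "A \<in> reps H" "rep_iso M (rep_sum (rep_sums (replicate m U)) A)" "\<not> rep_summand H U A"
      using r(1) unfolding rep_mult_rel_def by auto
    obtain B where B: "B \<in> reps H" "rep_iso M (rep_sum (rep_sums (replicate n U)) B)"
      using r(2) unfolding rep_mult_rel_def by auto
    note [simp] = reps_wf[OF A(1)] reps_wf[OF B(1)] reps_wf[OF assms(2)]
    have cancel: "rep_iso C D" if "rep_iso (rep_sum (rep_sums (replicate k U)) C) (rep_sum (rep_sums (replicate k U)) D)"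
      "rep_wf C" "rep_wf D" for k C D
      using that(1)
    proof (induction k)
      case (Suc k)
      then have "rep_iso (rep_sum U (rep_sum (rep_sums (replicate k U)) C)) (rep_sum U (rep_sum (rep_sums (replicate k U)) D))"
        using that(2,3) by (simp add: rep_sum_assoc)
      then have "rep_iso (rep_sum (rep_sums (replicate k U)) C) (rep_sum (rep_sums (replicate k U)) D)"
        by (rule rep_sum_cancel[OF U, rotated 2]) (use that(2,3) in auto)
      then show ?case by (rule Suc.IH)
    qed (use that(2,3) in \<open>simp add: rep_sum_zero\<close>)
    obtain k where n: "n = m + Suc k" using lt less_imp_Suc_add by auto
    let ?B = "rep_sum (rep_sums (replicate (Suc k) U)) B"
    have iso: "rep_iso (rep_sum (rep_sums (replicate m U)) A) (rep_sum (rep_sums (replicate n U)) B)"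
      by (rule rep_iso_trans[OF rep_iso_sym[OF A(2)] B(2)]) simp_all
    have eq: "rep_sum (rep_sums (replicate n U)) B = rep_sum (rep_sums (replicate m U)) ?B"
      unfolding n rep_sums_replicate_add[OF indecomposable_wf[OF U]] by (rule rep_sum_assoc) simp_all
    have "rep_iso A ?B" by (rule cancel[OF iso[unfolded eq]]) simp_all
    then have "rep_iso A (rep_sum U (rep_sum (rep_sums (replicate k U)) B))"
      by (simp add: rep_sum_assoc)
    moreover have "rep_sum (rep_sums (replicate k U)) B \<in> reps H"
      by (intro reps_sum reps_sums B) (use indecomposable_reps[OF U] in auto)
    ultimately show False using A(3) unfolding rep_summand_def by blast
  qed
  show "rep_mult_rel H U M m \<Longrightarrow> rep_mult_rel H U M n \<Longrightarrow> m = n"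
    using *[of m n] *[of n m] by (cases m n rule: linorder_cases) auto
qed

definition rep_mult :: "('g, 'k::field) hopf_presentation \<Rightarrow> ('g, 'k) rep \<Rightarrow> ('g, 'k) rep \<Rightarrow> nat" where
  "rep_mult H U M = (THE m. rep_mult_rel H U M m)"

lemma rep_mult_eqI:
  "indecomposable H U \<Longrightarrow> M \<in> reps H \<Longrightarrow> rep_mult_rel H U M m \<Longrightarrow> rep_mult H U M = m"
  unfolding rep_mult_def using rep_mult_rel_unique by blast

lemma rep_mult_rel: "indecomposable H U \<Longrightarrow> M \<in> reps H \<Longrightarrow> rep_mult_rel H U M (rep_mult H U M)"
  using rep_mult_rel_exists rep_mult_eqI by blast

lemma rep_mult_iso:
  assumes U: "indecomposable H U" and M: "M \<in> reps H" and N: "N \<in> reps H" and iso: "rep_iso M N"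
  shows "rep_mult H U M = rep_mult H U N"
proof (rule rep_mult_eqI[OF U M])
  note [simp] = reps_wf[OF M] reps_wf[OF N] indecomposable_wf[OF U]
  obtain M' where M': "M' \<in> reps H" "rep_iso N (rep_sum (rep_sums (replicate (rep_mult H U N) U)) M')"
    "\<not> rep_summand H U M'"
    using rep_mult_rel[OF U N] unfolding rep_mult_rel_def by blast
  have "rep_iso M (rep_sum (rep_sums (replicate (rep_mult H U N) U)) M')"
    by (rule rep_iso_trans[OF iso M'(2)]) (simp_all add: reps_wf[OF M'(1)])
  with M' show "rep_mult_rel H U M (rep_mult H U N)" unfolding rep_mult_rel_def by blast
qed

text \<open>By \<open>rep_summand_sum\<close> the two remainders add up to a module without summand
  \<open>U\<close>. Additivity is what lets the multiplicity descend to the Green ring.\<close>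

lemma rep_mult_sum:
  assumes U: "indecomposable H U" and M: "M \<in> reps H" and N: "N \<in> reps H"
  shows "rep_mult H U (rep_sum M N) = rep_mult H U M + rep_mult H U N"
proof (rule rep_mult_eqI[OF U reps_sum[OF M N]])
  note [simp] = reps_wf[OF M] reps_wf[OF N] indecomposable_wf[OF U]
  let ?m = "rep_mult H U M" and ?n = "rep_mult H U N"
  obtain A where A: "A \<in> reps H" "rep_iso M (rep_sum (rep_sums (replicate ?m U)) A)" "\<not> rep_summand H U A"
    using rep_mult_rel[OF U M] unfolding rep_mult_rel_def by auto
  obtain B where B: "B \<in> reps H" "rep_iso N (rep_sum (rep_sums (replicate ?n U)) B)" "\<not> rep_summand H U B"
    using rep_mult_rel[OF U N] unfolding rep_mult_rel_def by auto
  note [simp] = reps_wf[OF A(1)] reps_wf[OF B(1)]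
  have "rep_iso (rep_sum M N) (rep_sum (rep_sum (rep_sums (replicate ?m U)) A) (rep_sum (rep_sums (replicate ?n U)) B))"
    by (intro rep_sum_cong A B) auto
  then have "rep_iso (rep_sum M N) (rep_sum (rep_sum (rep_sums (replicate ?m U)) (rep_sums (replicate ?n U))) (rep_sum A B))"
    by (rule rep_iso_trans[OF _ rep_sum_medial]) auto
  then have "rep_iso (rep_sum M N) (rep_sum (rep_sums (replicate (?m + ?n) U)) (rep_sum A B))"
    by (simp add: rep_sums_replicate_add)
  moreover have "\<not> rep_summand H U (rep_sum A B)" using rep_summand_sum[OF U A(1) B(1)] A B by blast
  ultimately show "rep_mult_rel H U (rep_sum M N) (?m + ?n)"
    unfolding rep_mult_rel_def using reps_sum[OF A(1) B(1)] by blast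
qed

lemma rep_mult_indecomposable:
  assumes U: "indecomposable H U" and V: "indecomposable H V"
  shows "rep_mult H U V = (if rep_iso U V then 1 else 0)"
proof (rule rep_mult_eqI[OF U indecomposable_reps[OF V]])
  note [simp] = indecomposable_wf[OF U] indecomposable_wf[OF V]
  show "rep_mult_rel H U V (if rep_iso U V then 1 else 0)"
  proof (cases "rep_iso U V")
    case True
    have "\<not> rep_summand H U rep_zero"
      unfolding rep_summand_def using indecomposable_dim[OF U] rep_iso_dim by fastforce
    then show ?thesis unfolding rep_mult_rel_def using True
      by (intro bexI[of _ rep_zero]) (auto simp: rep_sum_zero intro: rep_iso_sym reps_zero)
  next
    case False
    have "\<not> rep_summand H U V"
    proof
      assume "rep_summand H U V"
      then obtain W where W: "W \<in> reps H" "rep_iso V (rep_sum U W)" unfolding rep_summand_def by auto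
      then have "rdim W = 0"
        using indecomposableD[OF V W(2) indecomposable_reps[OF U] W(1)] indecomposable_dim[OF U] by auto
      then have "W = rep_zero" using rep_dim0_eq reps_wf W by blast
      then have "rep_iso V U" using W by (simp add: rep_sum_zero)
      then show False using False by (auto intro: rep_iso_sym)
    qed
    then show ?thesis unfolding rep_mult_rel_def using False indecomposable_reps[OF V]
      by (intro bexI[of _ V]) (auto simp: rep_sum_zero rep_iso_refl)
  qed
qed

lemma rep_decomposition:
  assumes "M \<in> reps H"
  shows "\<exists>Us. (\<forall>U\<in>set Us. indecomposable H U) \<and> rep_iso M (rep_sums Us)"
  using assms
proof (induction "rdim M" arbitrary: M rule: less_induct)
  case less
  note [simp] = reps_wf[OF less.prems]
  consider "rdim M = 0" | "indecomposable H M" |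
    U W where "U \<in> reps H" "W \<in> reps H" "rdim U \<noteq> 0" "rdim W \<noteq> 0" "rep_iso M (rep_sum U W)"
    using less.prems unfolding indecomposable_def by blast
  then show ?case
  proof cases
    case 1
    then have "M = rep_zero" by (simp add: rep_dim0_eq)
    then show ?thesis by (intro exI[of _ "[]"]) (simp add: rep_iso_refl)
  next
    case 2
    then show ?thesis by (intro exI[of _ "[M]"]) (simp add: rep_sum_zero rep_iso_refl)
  next
    case (3 U W)
    note [simp] = reps_wf[OF 3(1)] reps_wf[OF 3(2)]
    obtain As where As: "\<forall>U\<in>set As. indecomposable H U" "rep_iso U (rep_sums As)"
      using less.hyps[of U] 3 rep_iso_dim[OF 3(5)] by auto
    obtain Bs where Bs: "\<forall>U\<in>set Bs. indecomposable H U" "rep_iso W (rep_sums Bs)"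
      using less.hyps[of W] 3 rep_iso_dim[OF 3(5)] by auto
    have wf: "V \<in> set As \<union> set Bs \<Longrightarrow> rep_wf V" for V using As Bs indecomposable_wf by auto
    then have [simp]: "rep_wf (rep_sums As)" "rep_wf (rep_sums Bs)" by auto
    have "rep_iso (rep_sum U W) (rep_sum (rep_sums As) (rep_sums Bs))"
      by (intro rep_sum_cong As Bs) auto
    then have "rep_iso M (rep_sum (rep_sums As) (rep_sums Bs))"
      using rep_iso_trans[OF 3(5)] by simp
    moreover have "rep_sums (As @ Bs) = rep_sum (rep_sums As) (rep_sums Bs)"
      by (rule rep_sums_append) (rule wf)
    ultimately have "rep_iso M (rep_sums (As @ Bs))" by simp
    then show ?thesis using As Bs by (intro exI[of _ "As @ Bs"]) auto
  qed
qed

section \<open>The additive group of the Green ring\<close>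

lemma formal_ring_simps[simp]:
  "carrier (formal_ring H) = {f. Poly_Mapping.keys f \<subseteq> reps H}"
  "add (formal_ring H) = (+)" "zero (formal_ring H) = 0" "one (formal_ring H) = frag_of (rep_unit H)"
  "monoid.mult (formal_ring H) = (\<lambda>f g. frag_extend (\<lambda>V. frag_extend (\<lambda>W. frag_of (rep_tensor H V W)) g) f)"
  by (simp_all add: formal_ring_def)

lemma formal_closed:
  "Poly_Mapping.keys (f :: 'a \<Rightarrow>\<^sub>0 int) \<subseteq> S \<Longrightarrow> Poly_Mapping.keys g \<subseteq> S \<Longrightarrow> Poly_Mapping.keys (f + g) \<subseteq> S"
  "Poly_Mapping.keys (f :: 'a \<Rightarrow>\<^sub>0 int) \<subseteq> S \<Longrightarrow> Poly_Mapping.keys g \<subseteq> S \<Longrightarrow> Poly_Mapping.keys (f - g) \<subseteq> S"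
  "Poly_Mapping.keys (f :: 'a \<Rightarrow>\<^sub>0 int) \<subseteq> S \<Longrightarrow> Poly_Mapping.keys (- f) \<subseteq> S"
  "x \<in> S \<Longrightarrow> Poly_Mapping.keys (frag_of x) \<subseteq> S"
  using Poly_Mapping.keys_add[of f g] keys_diff[of f g] by (auto simp: keys_frag_of)

lemma formal_extend_closed:
  assumes "Poly_Mapping.keys f \<subseteq> S" "\<And>x. x \<in> S \<Longrightarrow> Poly_Mapping.keys (h x) \<subseteq> T"
  shows "Poly_Mapping.keys (frag_extend h f) \<subseteq> T"
  using keys_frag_extend[of h f] assms by blast

lemma abelian_group_formal: "abelian_group (formal_ring H)"
proof (rule abelian_groupI)
  fix x assume "x \<in> carrier (formal_ring H)"
  then show "\<exists>y\<in>carrier (formal_ring H). y \<oplus>\<^bsub>formal_ring H\<^esub> x = \<zero>\<^bsub>formal_ring H\<^esub>"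
    by (intro bexI[of _ "- x"]) auto
qed (auto simp: add_ac dest: formal_closed(1))

lemma green_relations_gens:
  "{frag_of U - frag_of V | U V. U \<in> reps H \<and> V \<in> reps H \<and> rep_iso U V} \<union>
   {frag_of (rep_sum U V) - frag_of U - frag_of V | U V. U \<in> reps H \<and> V \<in> reps H} \<subseteq> carrier (formal_ring H)"
  by (auto dest!: subsetD[OF keys_diff] simp: keys_frag_of reps_sum)

lemma formal_inv:
  assumes "Poly_Mapping.keys x \<subseteq> reps H"
  shows "inv\<^bsub>add_monoid (formal_ring H)\<^esub> x = - x"
proof -
  interpret abelian_group "formal_ring H" by (rule abelian_group_formal)
  have "\<ominus>\<^bsub>formal_ring H\<^esub> x = - x" by (rule minus_equality) (use assms in auto)
  then show ?thesis by (simp add: a_inv_def)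
qed

lemma green_relations_carrier: "x \<in> green_relations H \<Longrightarrow> Poly_Mapping.keys x \<subseteq> reps H"
proof -
  assume "x \<in> green_relations H"
  interpret abelian_group "formal_ring H" by (rule abelian_group_formal)
  have "green_relations H \<subseteq> carrier (add_monoid (formal_ring H))"
    unfolding green_relations_def using group.generate_incl[OF a_group] green_relations_gens[of H] by simp
  with \<open>x \<in> _\<close> show ?thesis by auto
qed

lemma green_relations_zero: "0 \<in> green_relations H"
  using generate.one[of "add_monoid (formal_ring H)"] unfolding green_relations_def by simp

lemma green_relations_add: "x \<in> green_relations H \<Longrightarrow> y \<in> green_relations H \<Longrightarrow> x + y \<in> green_relations H"
  using generate.eng[of _ "add_monoid (formal_ring H)"] unfolding green_relations_def by simp

lemma green_relations_uminus: "x \<in> green_relations H \<Longrightarrow> - x \<in> green_relations H"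
proof -
  assume x: "x \<in> green_relations H"
  interpret abelian_group "formal_ring H" by (rule abelian_group_formal)
  have "inv\<^bsub>add_monoid (formal_ring H)\<^esub> x \<in> green_relations H"
    unfolding green_relations_def
    by (rule group.generate_m_inv_closed[OF a_group]) (use x green_relations_gens[of H] in \<open>simp_all add: green_relations_def\<close>)
  then show ?thesis using formal_inv[OF green_relations_carrier[OF x]] by simp
qed

lemma green_relations_diff: "x \<in> green_relations H \<Longrightarrow> y \<in> green_relations H \<Longrightarrow> x - y \<in> green_relations H"
  using green_relations_add[of x H "- y"] green_relations_uminus[of y H] by simp


lemma green_relations_iso:
  "U \<in> reps H \<Longrightarrow> V \<in> reps H \<Longrightarrow> rep_iso U V \<Longrightarrow> frag_of U - frag_of V \<in> green_relations H"
  unfolding green_relations_def by (rule generate.incl) auto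

lemma green_relations_sum:
  "U \<in> reps H \<Longrightarrow> V \<in> reps H \<Longrightarrow> frag_of (rep_sum U V) - frag_of U - frag_of V \<in> green_relations H"
  unfolding green_relations_def by (rule generate.incl) auto

lemma green_relations_induct:
  assumes "x \<in> green_relations H" "P 0"
    and iso: "\<And>U V. U \<in> reps H \<Longrightarrow> V \<in> reps H \<Longrightarrow> rep_iso U V \<Longrightarrow> P (frag_of U - frag_of V)"
    and sum: "\<And>U V. U \<in> reps H \<Longrightarrow> V \<in> reps H \<Longrightarrow> P (frag_of (rep_sum U V) - frag_of U - frag_of V)"
    and "\<And>a b. P a \<Longrightarrow> P b \<Longrightarrow> P (a + b)" and "\<And>a. P a \<Longrightarrow> P (- a)"
  shows "P x"
  using assms(1) unfolding green_relations_def
proof (induction rule: generate.induct)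
  case (incl h)
  then show ?case using iso sum by auto
next
  case (inv h)
  then have "h \<in> carrier (formal_ring H)" by (rule subsetD[OF green_relations_gens])
  then have eq: "inv\<^bsub>add_monoid (formal_ring H)\<^esub> h = - h"
    by (intro formal_inv) simp
  have "P h" using inv iso sum by auto
  then show ?case unfolding eq by (rule assms(6))
qed (use assms in auto)

text \<open>\<open>S\<close> will be the zero subgroup when an invariant is carried to the quotient,
  and \<open>green_relations H\<close> itself for products and duals.\<close>

lemma green_relations_extend:
  assumes "x \<in> green_relations H" "0 \<in> S"
    and "\<And>U V. U \<in> reps H \<Longrightarrow> V \<in> reps H \<Longrightarrow> rep_iso U V \<Longrightarrow> h U - h V \<in> S"
    and "\<And>U V. U \<in> reps H \<Longrightarrow> V \<in> reps H \<Longrightarrow> h (rep_sum U V) - h U - h V \<in> S"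
    and "\<And>a b. a \<in> S \<Longrightarrow> b \<in> S \<Longrightarrow> a + b \<in> S" and "\<And>a. a \<in> S \<Longrightarrow> - a \<in> S"
  shows "frag_extend h x \<in> S"
  using assms(1) by (rule green_relations_induct) (use assms in \<open>auto simp: frag_extend_diff frag_extend_add frag_extend_minus\<close>)

section \<open>Cosets of the relations\<close>

definition green_coset :: "('g, 'k::field) hopf_presentation \<Rightarrow> (('g, 'k) rep \<Rightarrow>\<^sub>0 int) \<Rightarrow> (('g, 'k) rep \<Rightarrow>\<^sub>0 int) set" where
  "green_coset H f = green_relations H +>\<^bsub>formal_ring H\<^esub> f"

lemma green_coset_eq: "green_coset H f = (\<lambda>h. h + f) ` green_relations H"
  unfolding green_coset_def a_r_coset_def' by auto

lemma green_class_coset: "green_class H V = green_coset H (frag_of V)"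
  by (simp add: green_class_def green_coset_def)

lemma mem_green_coset: "g \<in> green_coset H f \<longleftrightarrow> g - f \<in> green_relations H"
  unfolding green_coset_eq by (auto simp: image_iff) (metis diff_add_cancel)

lemma green_coset_self: "f \<in> green_coset H f"
  by (simp add: mem_green_coset green_relations_zero)

lemma green_coset_eq_iff: "green_coset H f = green_coset H g \<longleftrightarrow> f - g \<in> green_relations H"
proof
  assume "f - g \<in> green_relations H"
  moreover have "h - g = (h - f) + (f - g)" "h - f = (h - g) - (f - g)" for h by simp_all
  ultimately have "h - f \<in> green_relations H \<longleftrightarrow> h - g \<in> green_relations H" for h
    by (metis green_relations_add green_relations_diff)
  then show "green_coset H f = green_coset H g" by (auto simp: mem_green_coset)
qed (use green_coset_self[of f H] in \<open>auto simp: mem_green_coset\<close>)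

lemma the_elem_green_coset:
  assumes "\<And>g. g - f \<in> green_relations H \<Longrightarrow> F g = F f"
  shows "the_elem (F ` green_coset H f) = F f"
proof -
  have "F ` green_coset H f = {F f}"
  proof (intro equalityI subsetI)
    fix y assume "y \<in> F ` green_coset H f"
    then obtain g where "y = F g" "g - f \<in> green_relations H" by (auto simp: mem_green_coset)
    with assms[of g] show "y \<in> {F f}" by simp
  qed (use green_coset_self[of f H] in auto)
  then show ?thesis by simp
qed

lemma green_ring_carrier: "carrier (green_ring H) = green_coset H ` {f. Poly_Mapping.keys f \<subseteq> reps H}"
  unfolding green_ring_def FactRing_def A_RCOSETS_def' green_coset_def by auto

lemma green_ring_add: "green_coset H f \<oplus>\<^bsub>green_ring H\<^esub> green_coset H g = green_coset H (f + g)"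
proof -
  have "green_coset H f \<oplus>\<^bsub>green_ring H\<^esub> green_coset H g = {a + b | a b. a \<in> green_coset H f \<and> b \<in> green_coset H g}"
    unfolding green_ring_def FactRing_def set_add_def' by auto
  also have "\<dots> = green_coset H (f + g)"
  proof (intro equalityI subsetI)
    fix x assume "x \<in> {a + b | a b. a \<in> green_coset H f \<and> b \<in> green_coset H g}"
    then obtain a b where ab: "x = a + b" "a - f \<in> green_relations H" "b - g \<in> green_relations H"
      by (auto simp: mem_green_coset)
    have eq: "x - (f + g) = (a - f) + (b - g)" using ab(1) by simp
    show "x \<in> green_coset H (f + g)" unfolding mem_green_coset eq by (rule green_relations_add[OF ab(2,3)])
  next
    fix x assume "x \<in> green_coset H (f + g)"
    then have "x - g \<in> green_coset H f" by (simp add: mem_green_coset algebra_simps)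
    moreover have "g \<in> green_coset H g" by (rule green_coset_self)
    ultimately show "x \<in> {a + b | a b. a \<in> green_coset H f \<and> b \<in> green_coset H g}"
      by (intro CollectI exI[of _ "x - g"] exI[of _ g]) auto
  qed
  finally show ?thesis .
qed

lemma green_ring_zero: "\<zero>\<^bsub>green_ring H\<^esub> = green_coset H 0"
  unfolding green_ring_def FactRing_def green_coset_eq by auto

lemma green_ring_one: "\<one>\<^bsub>green_ring H\<^esub> = green_class H (rep_unit H)"
  unfolding green_ring_def FactRing_def green_class_def by simp

lemma green_coset_carrier: "Poly_Mapping.keys f \<subseteq> reps H \<Longrightarrow> green_coset H f \<in> carrier (green_ring H)"
  by (auto simp: green_ring_carrier)

lemma green_class_carrier: "V \<in> reps H \<Longrightarrow> green_class H V \<in> carrier (green_ring H)"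
  unfolding green_class_coset by (rule green_coset_carrier) (simp add: keys_frag_of)

lemma green_ring_cases:
  assumes "x \<in> carrier (green_ring H)"
  obtains f where "Poly_Mapping.keys f \<subseteq> reps H" "x = green_coset H f"
  using assms by (auto simp: green_ring_carrier)

text \<open>The additive structure suffices for the basis theorem and holds for every presentation;
  multiplication is treated in the locale \<open>tensor_reps\<close>.\<close>

lemma abelian_group_green: "abelian_group (green_ring H)"
proof (rule abelian_groupI)
  fix x y assume "x \<in> carrier (green_ring H)" "y \<in> carrier (green_ring H)"
  then show "x \<oplus>\<^bsub>green_ring H\<^esub> y \<in> carrier (green_ring H)"
    by (elim green_ring_cases) (simp add: green_ring_add green_coset_carrier formal_closed(1))
next
  fix x assume "x \<in> carrier (green_ring H)"
  then obtain f where f: "Poly_Mapping.keys f \<subseteq> reps H" "x = green_coset H f" by (rule green_ring_cases)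
  then show "\<exists>y\<in>carrier (green_ring H). y \<oplus>\<^bsub>green_ring H\<^esub> x = \<zero>\<^bsub>green_ring H\<^esub>"
    by (intro bexI[of _ "green_coset H (- f)"]) (simp_all add: green_ring_add green_ring_zero green_coset_carrier)
qed (auto elim!: green_ring_cases simp: green_ring_add green_ring_zero add_ac intro: green_coset_carrier)

lemma green_ring_uminus:
  "Poly_Mapping.keys f \<subseteq> reps H \<Longrightarrow> \<ominus>\<^bsub>green_ring H\<^esub> green_coset H f = green_coset H (- f)"
  by (rule abelian_group.minus_equality[OF abelian_group_green])
    (simp_all add: green_ring_add green_ring_zero green_coset_carrier)

lemma green_class_iso: "U \<in> reps H \<Longrightarrow> V \<in> reps H \<Longrightarrow> rep_iso U V \<Longrightarrow> green_class H U = green_class H V"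
  by (simp add: green_class_coset green_coset_eq_iff green_relations_iso)

lemma green_ring_finsum:
  assumes "finite A" "\<And>i. i \<in> A \<Longrightarrow> Poly_Mapping.keys (h i) \<subseteq> reps H"
  shows "(\<Oplus>\<^bsub>green_ring H\<^esub>i\<in>A. green_coset H (h i)) = green_coset H (sum h A)"
proof -
  interpret abelian_group "green_ring H" by (rule abelian_group_green)
  show ?thesis using assms
  proof (induction A rule: finite_induct)
    case (insert a A)
    have "(\<Oplus>\<^bsub>green_ring H\<^esub>i\<in>insert a A. green_coset H (h i)) =
      green_coset H (h a) \<oplus>\<^bsub>green_ring H\<^esub> (\<Oplus>\<^bsub>green_ring H\<^esub>i\<in>A. green_coset H (h i))"
      by (rule finsum_insert) (use insert in \<open>auto intro: green_coset_carrier\<close>)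
    then show ?case using insert by (simp add: green_ring_add)
  qed (simp add: green_ring_zero)
qed

lemma green_ring_add_pow:
  assumes f: "Poly_Mapping.keys f \<subseteq> reps H"
  shows "add_pow (green_ring H) (n::int) (green_coset H f) = green_coset H (frag_cmul n f)"
proof -
  interpret abelian_group "green_ring H" by (rule abelian_group_green)
  have nat: "add_pow (green_ring H) (k::nat) (green_coset H f) = green_coset H (frag_cmul (int k) f)" for k
    by (induction k) (simp_all add: green_ring_zero green_ring_add frag_cmul_distrib add.commute)
  show ?thesis
  proof (cases "0 \<le> n")
    case True
    then obtain k where "n = int k" using nonneg_int_cases by blast
    then show ?thesis using nat[of k] by (simp add: add_pow_int_ge)
  next
    case False
    then obtain k where n: "n = - int k" by (metis int_cases2 linorder_le_cases of_nat_0_le_iff)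
    have "add_pow (green_ring H) n (green_coset H f) = \<ominus>\<^bsub>green_ring H\<^esub> (add_pow (green_ring H) k (green_coset H f))"
      unfolding n using False n by (subst add_pow_int_lt) auto
    also have "\<dots> = green_coset H (frag_cmul n f)"
      unfolding nat n using f keys_cmul[of "int k" f] by (subst green_ring_uminus) auto
    finally show ?thesis .
  qed
qed

section \<open>Linear extension of functions on modules\<close>

lemma frag_extend_frag_extend: "frag_extend h (frag_extend k c) = frag_extend (\<lambda>x. frag_extend h (k x)) c"
proof -
  have "Poly_Mapping.keys c \<subseteq> UNIV" by simp
  then show ?thesis by (induction c rule: frag_induction) (auto simp: frag_extend_diff)
qed

lemma frag_extend_fun_diff: "frag_extend (\<lambda>x. h x - k x) c = frag_extend h c - frag_extend k c"
proof -
  have "Poly_Mapping.keys c \<subseteq> UNIV" by simp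
  then show ?thesis by (induction c rule: frag_induction) (auto simp: frag_extend_diff)
qed

lemma frag_extend_cong_keys:
  "Poly_Mapping.keys c \<subseteq> S \<Longrightarrow> (\<And>x. x \<in> S \<Longrightarrow> h x = k x) \<Longrightarrow> frag_extend h c = frag_extend k c"
  by (rule frag_extend_eq) auto

definition formal_eval :: "('a \<Rightarrow> int) \<Rightarrow> ('a \<Rightarrow>\<^sub>0 int) \<Rightarrow> int" where
  "formal_eval \<phi> f = (\<Sum>V\<in>Poly_Mapping.keys f. Poly_Mapping.lookup f V * \<phi> V)"

text \<open>Integers are read as multiples of the generator of the free group on the unit type, so
  that additivity comes from \<open>frag_extend\<close>.\<close>

lemma formal_eval_extend: "formal_eval \<phi> f = Poly_Mapping.lookup (frag_extend (\<lambda>V. frag_cmul (\<phi> V) (frag_of ())) f) ()"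
  unfolding formal_eval_def frag_extend_def by (simp add: lookup_sum)

lemma formal_eval_add: "formal_eval \<phi> (f + g) = formal_eval \<phi> f + formal_eval \<phi> g"
  and formal_eval_diff: "formal_eval \<phi> (f - g) = formal_eval \<phi> f - formal_eval \<phi> g"
  and formal_eval_of[simp]: "formal_eval \<phi> (frag_of x) = \<phi> x"
  and formal_eval_zero[simp]: "formal_eval \<phi> 0 = 0"
  by (simp_all add: formal_eval_extend frag_extend_add frag_extend_diff lookup_add lookup_minus)

lemma formal_eval_relations:
  assumes x: "x \<in> green_relations H"
    and "\<And>U V. U \<in> reps H \<Longrightarrow> V \<in> reps H \<Longrightarrow> rep_iso U V \<Longrightarrow> \<phi> U = \<phi> V"
    and "\<And>U V. U \<in> reps H \<Longrightarrow> V \<in> reps H \<Longrightarrow> \<phi> (rep_sum U V) = \<phi> U + \<phi> V"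
  shows "formal_eval \<phi> x = 0"
proof -
  have "frag_extend (\<lambda>V. frag_cmul (\<phi> V) (frag_of ())) x \<in> {0}"
    by (rule green_relations_extend[OF x]) (use assms in \<open>auto simp: frag_cmul_distrib\<close>)
  then show ?thesis by (simp add: formal_eval_extend)
qed

lemma green_dim_coset: "green_dim (green_coset H f) = formal_eval (\<lambda>V. int (rdim V)) f"
  unfolding green_dim_def formal_eval_def[symmetric]
proof (rule the_elem_green_coset)
  fix g assume "g - f \<in> green_relations H"
  then have "formal_eval (\<lambda>V. int (rdim V)) (g - f) = 0"
    by (rule formal_eval_relations) (auto dest: rep_iso_dim)
  then show "formal_eval (\<lambda>V. int (rdim V)) g = formal_eval (\<lambda>V. int (rdim V)) f"
    by (simp add: formal_eval_diff)
qed

lemma green_dim_class: "green_dim (green_class H V) = int (rdim V)"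
  by (simp add: green_class_coset green_dim_coset)

text \<open>The multiplicity of \<open>U\<close> is additive and invariant under isomorphism, hence
  defined on classes, and it separates \<open>U\<close> from every indecomposable not isomorphic to
  it.\<close>

lemma green_class_eq_iff:
  assumes U: "indecomposable H U" and V: "indecomposable H V"
  shows "green_class H U = green_class H V \<longleftrightarrow> rep_iso U V"
proof
  assume "green_class H U = green_class H V"
  then have "frag_of U - frag_of V \<in> green_relations H" by (simp add: green_class_coset green_coset_eq_iff)
  then have "formal_eval (\<lambda>M. int (rep_mult H U M)) (frag_of U - frag_of V) = 0"
    by (rule formal_eval_relations) (auto intro: rep_mult_iso[OF U] simp: rep_mult_sum[OF U])
  then have "rep_mult H U U = rep_mult H U V" by (simp add: formal_eval_diff)
  then show "rep_iso U V"
    using rep_iso_refl[OF indecomposable_wf[OF U]]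
    by (simp add: rep_mult_indecomposable[OF U U] rep_mult_indecomposable[OF U V] split: if_splits)
qed (use green_class_iso indecomposable_reps U V in blast)

section \<open>The basis of indecomposable classes\<close>

definition class_sum :: "('g, 'k::field) hopf_presentation \<Rightarrow> ('g, 'k) rep list \<Rightarrow> ((('g, 'k) rep \<Rightarrow>\<^sub>0 int) set \<Rightarrow>\<^sub>0 int)" where
  "class_sum H Us = sum_list (map (\<lambda>U. frag_of (green_class H U)) Us)"

lemma keys_class_sum: "\<forall>U\<in>set Us. indecomposable H U \<Longrightarrow> Poly_Mapping.keys (class_sum H Us) \<subseteq> green_basis H"
  unfolding class_sum_def green_basis_def
  by (induction Us) (auto dest!: subsetD[OF Poly_Mapping.keys_add] simp: keys_frag_of)

lemma rep_mult_zero: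
  assumes U: "indecomposable H U"
  shows "rep_mult H U rep_zero = 0"
  using rep_mult_sum[OF U reps_zero reps_zero] by (simp add: rep_sum_zero)

lemma lookup_class_sum:
  assumes W: "indecomposable H W" and "\<forall>U\<in>set Us. indecomposable H U"
  shows "Poly_Mapping.lookup (class_sum H Us) (green_class H W) = int (rep_mult H W (rep_sums Us))"
  using assms(2) unfolding class_sum_def
proof (induction Us)
  case (Cons U Us)
  have "set Us \<subseteq> reps H" using Cons.prems indecomposable_reps by auto
  then have "rep_mult H W (rep_sums (U # Us)) = rep_mult H W U + rep_mult H W (rep_sums Us)"
    using Cons.prems by (simp add: rep_mult_sum[OF W indecomposable_reps reps_sums])
  moreover have "Poly_Mapping.lookup (frag_of (green_class H U)) (green_class H W) = int (rep_mult H W U)"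
    using Cons.prems green_class_eq_iff[of H U W] W
    by (auto simp: rep_mult_indecomposable when_def intro: rep_iso_sym indecomposable_wf)
  ultimately show ?case using Cons by (simp add: lookup_add)
qed (simp add: rep_mult_zero[OF W])

text \<open>The chosen decomposition is immaterial, because the coefficients are multiplicities; see
  \<open>rep_coeffs_eq\<close>.\<close>

definition rep_coeffs :: "('g, 'k::field) hopf_presentation \<Rightarrow> ('g, 'k) rep \<Rightarrow> ((('g, 'k) rep \<Rightarrow>\<^sub>0 int) set \<Rightarrow>\<^sub>0 int)" where
  "rep_coeffs H V = class_sum H (SOME Us. (\<forall>U\<in>set Us. indecomposable H U) \<and> rep_iso V (rep_sums Us))"

lemma basis_mapping_eqI:
  assumes "Poly_Mapping.keys a \<subseteq> green_basis H" "Poly_Mapping.keys b \<subseteq> green_basis H"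
    and "\<And>W. indecomposable H W \<Longrightarrow> Poly_Mapping.lookup a (green_class H W) = Poly_Mapping.lookup b (green_class H W)"
  shows "a = b"
proof (rule poly_mapping_eqI)
  fix i
  show "Poly_Mapping.lookup a i = Poly_Mapping.lookup b i"
  proof (cases "i \<in> green_basis H")
    case True
    then show ?thesis using assms(3) unfolding green_basis_def by auto
  next
    case False
    then show ?thesis using assms(1,2) by (metis in_keys_iff subsetD)
  qed
qed

lemma rep_coeffs_eq:
  assumes V: "V \<in> reps H" and Us: "\<forall>U\<in>set Us. indecomposable H U" "rep_iso V (rep_sums Us)"
  shows "rep_coeffs H V = class_sum H Us"
proof -
  define Ws where "Ws = (SOME Us. (\<forall>U\<in>set Us. indecomposable H U) \<and> rep_iso V (rep_sums Us))"
  have Ws: "\<forall>U\<in>set Ws. indecomposable H U" "rep_iso V (rep_sums Ws)"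
    using someI_ex[OF rep_decomposition[OF V]] unfolding Ws_def by auto
  have "class_sum H Ws = class_sum H Us"
  proof (rule basis_mapping_eqI)
    fix W assume W: "indecomposable H W"
    have "rep_sums Ws \<in> reps H" "rep_sums Us \<in> reps H"
      using Ws Us indecomposable_reps by (auto intro!: reps_sums)
    then have "rep_mult H W (rep_sums Ws) = rep_mult H W (rep_sums Us)"
      using rep_mult_iso[OF W V _ Ws(2)] rep_mult_iso[OF W V _ Us(2)] by metis
    then show "Poly_Mapping.lookup (class_sum H Ws) (green_class H W) = Poly_Mapping.lookup (class_sum H Us) (green_class H W)"
      unfolding lookup_class_sum[OF W Ws(1)] lookup_class_sum[OF W Us(1)] by simp
  qed (rule keys_class_sum[OF Ws(1)] keys_class_sum[OF Us(1)])+
  then show ?thesis by (simp add: rep_coeffs_def Ws_def)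
qed

lemma lookup_rep_coeffs:
  assumes V: "V \<in> reps H" and W: "indecomposable H W"
  shows "Poly_Mapping.lookup (rep_coeffs H V) (green_class H W) = int (rep_mult H W V)"
proof -
  obtain Us where Us: "\<forall>U\<in>set Us. indecomposable H U" "rep_iso V (rep_sums Us)"
    using rep_decomposition[OF V] by auto
  have "rep_sums Us \<in> reps H" using Us indecomposable_reps by (auto intro!: reps_sums)
  then show ?thesis
    by (simp add: rep_coeffs_eq[OF V Us] lookup_class_sum[OF W Us(1)] rep_mult_iso[OF W V _ Us(2)])
qed

lemma keys_rep_coeffs: "V \<in> reps H \<Longrightarrow> Poly_Mapping.keys (rep_coeffs H V) \<subseteq> green_basis H"
  using rep_decomposition[of V H] rep_coeffs_eq[of V H] keys_class_sum[of _ H] by metis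

lemma rep_coeffs_iso: "U \<in> reps H \<Longrightarrow> V \<in> reps H \<Longrightarrow> rep_iso U V \<Longrightarrow> rep_coeffs H U = rep_coeffs H V"
  by (rule basis_mapping_eqI[of _ H]) (simp_all add: lookup_rep_coeffs keys_rep_coeffs rep_mult_iso)

lemma rep_coeffs_sum:
  "U \<in> reps H \<Longrightarrow> V \<in> reps H \<Longrightarrow> rep_coeffs H (rep_sum U V) = rep_coeffs H U + rep_coeffs H V"
  by (rule basis_mapping_eqI[of _ H])
    (simp_all add: lookup_rep_coeffs keys_rep_coeffs lookup_add rep_mult_sum reps_sum formal_closed(1))

lemma rep_coeffs_indecomposable: "indecomposable H U \<Longrightarrow> rep_coeffs H U = frag_of (green_class H U)"
  by (subst rep_coeffs_eq[of _ _ "[U]"])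
    (auto simp: class_sum_def rep_sum_zero indecomposable_wf indecomposable_reps rep_iso_refl)

definition formal_coeffs :: "('g, 'k::field) hopf_presentation \<Rightarrow> (('g, 'k) rep \<Rightarrow>\<^sub>0 int) \<Rightarrow> ((('g, 'k) rep \<Rightarrow>\<^sub>0 int) set \<Rightarrow>\<^sub>0 int)" where
  "formal_coeffs H f = frag_extend (rep_coeffs H) f"

lemma formal_coeffs_relations: "x \<in> green_relations H \<Longrightarrow> formal_coeffs H x = 0"
proof -
  assume x: "x \<in> green_relations H"
  have "formal_coeffs H x \<in> {0}"
    unfolding formal_coeffs_def
    by (rule green_relations_extend[OF x]) (auto simp: rep_coeffs_sum intro: rep_coeffs_iso)
  then show ?thesis by simp
qed

lemma keys_formal_coeffs: "Poly_Mapping.keys f \<subseteq> reps H \<Longrightarrow> Poly_Mapping.keys (formal_coeffs H f) \<subseteq> green_basis H"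
  unfolding formal_coeffs_def by (rule formal_extend_closed) (auto dest: keys_rep_coeffs)

definition basis_rep :: "('g, 'k::field) hopf_presentation \<Rightarrow> (('g, 'k) rep \<Rightarrow>\<^sub>0 int) set \<Rightarrow> ('g, 'k) rep" where
  "basis_rep H i = (SOME V. indecomposable H V \<and> green_class H V = i)"

lemma basis_rep: "i \<in> green_basis H \<Longrightarrow> indecomposable H (basis_rep H i)" "i \<in> green_basis H \<Longrightarrow> green_class H (basis_rep H i) = i"
proof -
  assume "i \<in> green_basis H"
  then have "\<exists>V. indecomposable H V \<and> green_class H V = i" by (auto simp: green_basis_def)
  from someI_ex[OF this] show "indecomposable H (basis_rep H i)" "green_class H (basis_rep H i) = i"
    unfolding basis_rep_def by auto
qed

lemma basis_rep_reps: "i \<in> green_basis H \<Longrightarrow> basis_rep H i \<in> reps H"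
  by (rule indecomposable_reps[OF basis_rep(1)])

lemma green_basis_carrier: "i \<in> green_basis H \<Longrightarrow> i \<in> carrier (green_ring H)"
  unfolding green_basis_def by (auto intro: green_class_carrier indecomposable_reps)

text \<open>A section of \<open>formal_coeffs\<close>. The two maps are inverse to each other modulo
  the relations, and this is the basis theorem.\<close>

definition formal_lift :: "('g, 'k::field) hopf_presentation \<Rightarrow> ((('g, 'k) rep \<Rightarrow>\<^sub>0 int) set \<Rightarrow>\<^sub>0 int) \<Rightarrow> (('g, 'k) rep \<Rightarrow>\<^sub>0 int)" where
  "formal_lift H a = frag_extend (\<lambda>i. frag_of (basis_rep H i)) a"

lemma keys_formal_lift: "Poly_Mapping.keys a \<subseteq> green_basis H \<Longrightarrow> Poly_Mapping.keys (formal_lift H a) \<subseteq> reps H"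
  unfolding formal_lift_def by (rule formal_extend_closed) (auto simp: keys_frag_of basis_rep_reps)

lemma formal_coeffs_lift:
  assumes "Poly_Mapping.keys a \<subseteq> green_basis H"
  shows "formal_coeffs H (formal_lift H a) = a"
proof -
  have "formal_coeffs H (formal_lift H a) = frag_extend (\<lambda>i. rep_coeffs H (basis_rep H i)) a"
    by (simp add: formal_coeffs_def formal_lift_def frag_extend_frag_extend)
  also have "\<dots> = frag_extend frag_of a"
    by (rule frag_extend_cong_keys[OF assms]) (simp add: rep_coeffs_indecomposable basis_rep)
  finally show ?thesis by (simp add: frag_expansion[symmetric])
qed

lemma green_relations_sums:
  assumes "set Us \<subseteq> reps H"
  shows "frag_of (rep_sums Us) - sum_list (map frag_of Us) \<in> green_relations H"
  using assms
proof (induction Us)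
  case Nil
  have "frag_of (rep_sum rep_zero rep_zero) - frag_of rep_zero - frag_of rep_zero \<in> green_relations H"
    by (rule green_relations_sum) (rule reps_zero)+
  from green_relations_uminus[OF this] show ?case by (simp add: rep_sum_zero)
next
  case (Cons U Us)
  have "frag_of (rep_sums (U # Us)) - sum_list (map frag_of (U # Us)) =
    (frag_of (rep_sum U (rep_sums Us)) - frag_of U - frag_of (rep_sums Us)) + (frag_of (rep_sums Us) - sum_list (map frag_of Us))"
    by simp
  also have "\<dots> \<in> green_relations H"
    by (intro green_relations_add green_relations_sum) (use Cons in \<open>auto intro: reps_sums\<close>)
  finally show ?case .
qed

lemma formal_lift_rep_coeffs:
  assumes V: "V \<in> reps H"
  shows "frag_of V - formal_lift H (rep_coeffs H V) \<in> green_relations H"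
proof -
  obtain Us where Us: "\<forall>U\<in>set Us. indecomposable H U" "rep_iso V (rep_sums Us)"
    using rep_decomposition[OF V] by auto
  have Ur: "set Us \<subseteq> reps H" using Us indecomposable_reps by auto
  have lift: "sum_list (map frag_of Us) - formal_lift H (class_sum H Us) \<in> green_relations H"
    using Us(1) unfolding class_sum_def formal_lift_def
  proof (induction Us)
    case Nil
    then show ?case by (simp add: green_relations_zero)
  next
    case (Cons U Us)
    have bU: "green_class H U \<in> green_basis H" using Cons.prems by (auto simp: green_basis_def)
    have 1: "frag_of U - frag_of (basis_rep H (green_class H U)) \<in> green_relations H"
      using basis_rep(2)[OF bU, symmetric]
      unfolding green_class_coset[of H U] green_class_coset[of H "basis_rep H _"] green_coset_eq_iff .
    have 2: "sum_list (map frag_of Us) - frag_extend (\<lambda>i. frag_of (basis_rep H i)) (\<Sum>U\<leftarrow>Us. frag_of (green_class H U))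
      \<in> green_relations H" using Cons by auto
    show ?case using green_relations_add[OF 1 2]
      by (simp add: frag_extend_add) (simp only: add_diff_add)
  qed
  have "frag_of V - formal_lift H (rep_coeffs H V) = (frag_of V - frag_of (rep_sums Us)) +
    (frag_of (rep_sums Us) - sum_list (map frag_of Us)) + (sum_list (map frag_of Us) - formal_lift H (class_sum H Us))"
    by (simp add: rep_coeffs_eq[OF V Us])
  also have "\<dots> \<in> green_relations H"
    by (intro green_relations_add green_relations_iso green_relations_sums lift V Us Ur reps_sums)
  finally show ?thesis .
qed

lemma green_coset_lift:
  assumes "Poly_Mapping.keys f \<subseteq> reps H"
  shows "green_coset H (formal_lift H (formal_coeffs H f)) = green_coset H f"
proof -
  have "f - formal_lift H (formal_coeffs H f) \<in> green_relations H"
    using assms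
  proof (induction f rule: frag_induction)
    case (diff a b)
    have eq: "(a - b) - formal_lift H (formal_coeffs H (a - b)) =
      (a - formal_lift H (formal_coeffs H a)) - (b - formal_lift H (formal_coeffs H b))"
      by (simp add: formal_coeffs_def formal_lift_def frag_extend_diff)
    show ?case unfolding eq by (rule green_relations_diff[OF diff])
  next
    case (one V)
    then show ?case using formal_lift_rep_coeffs by (simp add: formal_coeffs_def)
  qed (simp add: formal_coeffs_def formal_lift_def green_relations_zero)
  then show ?thesis by (metis green_coset_eq_iff)
qed

text \<open>A part \<open>A\<close> of the support is allowed because the core omits the indices of
  the maximal ideal.\<close>

lemma green_ring_expansion:
  assumes "A \<subseteq> Poly_Mapping.keys a" and a: "Poly_Mapping.keys a \<subseteq> green_basis H"
  shows "(\<Oplus>\<^bsub>green_ring H\<^esub>i\<in>A. add_pow (green_ring H) (Poly_Mapping.lookup a i) i) =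
    green_coset H (\<Sum>i\<in>A. frag_cmul (Poly_Mapping.lookup a i) (frag_of (basis_rep H i)))"
proof -
  interpret abelian_group "green_ring H" by (rule abelian_group_green)
  have AB: "A \<subseteq> green_basis H" using assms by auto
  have *: "add_pow (green_ring H) (Poly_Mapping.lookup a i) i =
      green_coset H (frag_cmul (Poly_Mapping.lookup a i) (frag_of (basis_rep H i)))" if "i \<in> A" for i
  proof -
    have "i \<in> green_basis H" using that AB by auto
    then show ?thesis using green_ring_add_pow[of "frag_of (basis_rep H i)" H "Poly_Mapping.lookup a i"]
      by (simp add: green_class_coset[symmetric] basis_rep basis_rep_reps keys_frag_of)
  qed
  have k: "Poly_Mapping.keys (frag_cmul (Poly_Mapping.lookup a i) (frag_of (basis_rep H i))) \<subseteq> reps H" if "i \<in> A" for i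
    using that AB basis_rep_reps keys_cmul by (fastforce simp: keys_frag_of)
  have "(\<Oplus>\<^bsub>green_ring H\<^esub>i\<in>A. add_pow (green_ring H) (Poly_Mapping.lookup a i) i) =
    (\<Oplus>\<^bsub>green_ring H\<^esub>i\<in>A. green_coset H (frag_cmul (Poly_Mapping.lookup a i) (frag_of (basis_rep H i))))"
    by (rule finsum_cong'[OF refl _ *]) (intro Pi_I green_coset_carrier k)
  also have "\<dots> = green_coset H (\<Sum>i\<in>A. frag_cmul (Poly_Mapping.lookup a i) (frag_of (basis_rep H i)))"
    by (rule green_ring_finsum) (use k finite_subset[OF assms(1)] in auto)
  finally show ?thesis .
qed

lemma green_ring_expansion_keys:
  "Poly_Mapping.keys a \<subseteq> green_basis H \<Longrightarrow>
   (\<Oplus>\<^bsub>green_ring H\<^esub>i\<in>Poly_Mapping.keys a. add_pow (green_ring H) (Poly_Mapping.lookup a i) i) = green_coset H (formal_lift H a)"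
  unfolding formal_lift_def frag_extend_def by (rule green_ring_expansion) auto

text \<open>Existence of the expansion is \<open>green_coset_lift\<close>, uniqueness is
  \<open>formal_coeffs_lift\<close>. From here on the definite description is replaced by a linear
  map.\<close>

lemma green_coeffs_coset:
  assumes f: "Poly_Mapping.keys f \<subseteq> reps H"
  shows "green_coeffs H (green_coset H f) = formal_coeffs H f"
  unfolding green_coeffs_def
proof (rule the_equality)
  show "Poly_Mapping.keys (formal_coeffs H f) \<subseteq> green_basis H \<and> green_coset H f =
     (\<Oplus>\<^bsub>green_ring H\<^esub>i\<in>Poly_Mapping.keys (formal_coeffs H f). add_pow (green_ring H) (Poly_Mapping.lookup (formal_coeffs H f) i) i)"
    using keys_formal_coeffs[OF f] by (simp add: green_ring_expansion_keys green_coset_lift[OF f])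
  fix a :: "(('a, 'b) rep \<Rightarrow>\<^sub>0 int) set \<Rightarrow>\<^sub>0 int"
  assume a: "Poly_Mapping.keys a \<subseteq> green_basis H \<and> green_coset H f =
     (\<Oplus>\<^bsub>green_ring H\<^esub>i\<in>Poly_Mapping.keys a. add_pow (green_ring H) (Poly_Mapping.lookup a i) i)"
  then have "green_coset H f = green_coset H (formal_lift H a)"
    using green_ring_expansion_keys[of a H] by metis
  then have "f - formal_lift H a \<in> green_relations H" unfolding green_coset_eq_iff .
  from formal_coeffs_relations[OF this] show "a = formal_coeffs H f"
    using formal_coeffs_lift[of a H] a by (simp add: formal_coeffs_def frag_extend_diff)
qed

lemma green_coeffs_class: "V \<in> reps H \<Longrightarrow> green_coeffs H (green_class H V) = rep_coeffs H V"
  by (simp add: green_class_coset green_coeffs_coset keys_frag_of formal_coeffs_def)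

lemma green_coeffs_basis: "i \<in> green_basis H \<Longrightarrow> green_coeffs H i = frag_of i"
  using green_coeffs_class[of "basis_rep H i" H]
  by (simp add: basis_rep basis_rep_reps rep_coeffs_indecomposable)

lemma keys_green_coeffs: "x \<in> carrier (green_ring H) \<Longrightarrow> Poly_Mapping.keys (green_coeffs H x) \<subseteq> green_basis H"
  by (elim green_ring_cases) (simp add: green_coeffs_coset keys_formal_coeffs)

lemma green_coeffs_add:
  "x \<in> carrier (green_ring H) \<Longrightarrow> y \<in> carrier (green_ring H) \<Longrightarrow>
    green_coeffs H (x \<oplus>\<^bsub>green_ring H\<^esub> y) = green_coeffs H x + green_coeffs H y"
  by (elim green_ring_cases) (simp add: green_ring_add green_coeffs_coset formal_closed(1) formal_coeffs_def frag_extend_add)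

lemma green_coeffs_uminus:
  "x \<in> carrier (green_ring H) \<Longrightarrow> green_coeffs H (\<ominus>\<^bsub>green_ring H\<^esub> x) = - green_coeffs H x"
  by (elim green_ring_cases) (simp add: green_ring_uminus green_coeffs_coset formal_closed(3) formal_coeffs_def frag_extend_minus)

lemma green_coeffs_zero: "green_coeffs H \<zero>\<^bsub>green_ring H\<^esub> = 0"
  by (simp add: green_ring_zero green_coeffs_coset formal_coeffs_def)

lemma green_coset_lift_coeffs:
  "x \<in> carrier (green_ring H) \<Longrightarrow> green_coset H (formal_lift H (green_coeffs H x)) = x"
  by (elim green_ring_cases) (simp add: green_coeffs_coset green_coset_lift)

text \<open>Membership in a span becomes a condition on supports, the form in which ideals are
  handled below.\<close>

lemma green_span:
  assumes X: "X \<subseteq> green_basis H"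
  shows "generate (add_monoid (green_ring H)) X = {x \<in> carrier (green_ring H). Poly_Mapping.keys (green_coeffs H x) \<subseteq> X}"
proof (intro equalityI subsetI)
  interpret abelian_group "green_ring H" by (rule abelian_group_green)
  fix x assume "x \<in> generate (add_monoid (green_ring H)) X"
  then show "x \<in> {x \<in> carrier (green_ring H). Poly_Mapping.keys (green_coeffs H x) \<subseteq> X}"
  proof (induction rule: generate.induct)
    case one
    then show ?case using zero_closed by (simp add: green_coeffs_zero)
  next
    case (incl h)
    then show ?case using X by (auto simp: green_coeffs_basis keys_frag_of green_basis_carrier)
  next
    case (inv h)
    then have "h \<in> green_basis H" using X by auto
    moreover have "inv\<^bsub>add_monoid (green_ring H)\<^esub> h = \<ominus>\<^bsub>green_ring H\<^esub> h" by (simp add: a_inv_def)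
    ultimately show ?case using inv
      by (auto simp: green_coeffs_basis keys_frag_of green_basis_carrier green_coeffs_uminus)
  next
    case (eng h1 h2)
    then show ?case by (auto simp: green_coeffs_add dest!: subsetD[OF Poly_Mapping.keys_add])
  qed
next
  interpret abelian_group "green_ring H" by (rule abelian_group_green)
  have Xc: "X \<subseteq> carrier (add_monoid (green_ring H))" using X green_basis_carrier by auto
  fix x assume "x \<in> {x \<in> carrier (green_ring H). Poly_Mapping.keys (green_coeffs H x) \<subseteq> X}"
  then have x: "x \<in> carrier (green_ring H)" and k: "Poly_Mapping.keys (green_coeffs H x) \<subseteq> X" by auto
  have "Poly_Mapping.keys a \<subseteq> X \<Longrightarrow> green_coset H (formal_lift H a) \<in> generate (add_monoid (green_ring H)) X" for a
  proof -
    assume a: "Poly_Mapping.keys a \<subseteq> X"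
    have "green_coset H (formal_lift H a) \<in> generate (add_monoid (green_ring H)) X \<and> Poly_Mapping.keys a \<subseteq> X"
      using a
    proof (induction a rule: frag_induction)
      case zero
      then show ?case using generate.one[of "add_monoid (green_ring H)" X] by (simp add: formal_lift_def green_ring_zero)
    next
      case (one i)
      then show ?case using X generate.incl[of i X "add_monoid (green_ring H)"]
        by (auto simp: formal_lift_def green_class_coset[symmetric] basis_rep keys_frag_of)
    next
      case (diff a b)
      have kb: "Poly_Mapping.keys (formal_lift H b) \<subseteq> reps H" using diff X by (intro keys_formal_lift) auto
      have "\<ominus>\<^bsub>green_ring H\<^esub> green_coset H (formal_lift H b) \<in> generate (add_monoid (green_ring H)) X"
        unfolding a_inv_def by (rule group.generate_m_inv_closed[OF a_group Xc]) (use diff in auto)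
      then have "green_coset H (- formal_lift H b) \<in> generate (add_monoid (green_ring H)) X"
        using green_ring_uminus[OF kb] by simp
      from generate.eng[OF diff(1)[THEN conjunct1] this]
      have "green_coset H (formal_lift H a) \<oplus>\<^bsub>green_ring H\<^esub> green_coset H (- formal_lift H b) \<in> generate (add_monoid (green_ring H)) X"
        by simp
      then show ?case using diff formal_closed(2)
        by (auto simp: green_ring_add formal_lift_def frag_extend_diff)
    qed
    then show ?thesis ..
  qed
  from this[OF k] green_coset_lift_coeffs[OF x] show "x \<in> generate (add_monoid (green_ring H)) X" by simp
qed

lemma core_max_dim:
  assumes x: "x \<in> carrier (green_ring H)"
  shows "green_dim (core_max H x) =
    (\<Sum>i\<in>Poly_Mapping.keys (green_coeffs H x) - max_rep_index H. Poly_Mapping.lookup (green_coeffs H x) i * green_dim i)"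
proof -
  let ?a = "green_coeffs H x" and ?A = "Poly_Mapping.keys (green_coeffs H x) - max_rep_index H"
  have k: "Poly_Mapping.keys ?a \<subseteq> green_basis H" by (rule keys_green_coeffs[OF x])
  have fin: "finite ?A" by simp
  have "green_dim (core_max H x) = formal_eval (\<lambda>V. int (rdim V)) (\<Sum>i\<in>?A. frag_cmul (Poly_Mapping.lookup ?a i) (frag_of (basis_rep H i)))"
    unfolding core_max_def by (subst green_ring_expansion[OF _ k]) (auto simp: green_dim_coset)
  also have "\<dots> = (\<Sum>i\<in>?A. Poly_Mapping.lookup ?a i * int (rdim (basis_rep H i)))"
    using fin by (induction ?A rule: infinite_finite_induct)
      (auto simp: formal_eval_extend frag_extend_sum frag_extend_cmul lookup_sum)
  also have "\<dots> = (\<Sum>i\<in>?A. Poly_Mapping.lookup ?a i * green_dim i)"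
  proof (rule sum.cong[OF refl])
    fix i assume "i \<in> ?A"
    then have "i \<in> green_basis H" using k by auto
    from green_dim_class[of H "basis_rep H i"] basis_rep(2)[OF this]
    show "Poly_Mapping.lookup ?a i * int (rdim (basis_rep H i)) = Poly_Mapping.lookup ?a i * green_dim i" by simp
  qed
  finally show ?thesis .
qed

section \<open>The multiplicative structure of the Green ring\<close>

abbreviation formal_mult :: "('g, 'k::field) hopf_presentation \<Rightarrow> (('g, 'k) rep \<Rightarrow>\<^sub>0 int) \<Rightarrow> (('g, 'k) rep \<Rightarrow>\<^sub>0 int) \<Rightarrow> (('g, 'k) rep \<Rightarrow>\<^sub>0 int)" where
  "formal_mult H f g \<equiv> frag_extend (\<lambda>V. frag_extend (\<lambda>W. frag_of (rep_tensor H V W)) g) f"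

text \<open>These facts make the quotient a ring with a well-defined duality. Isomorphisms are
  enough, since isomorphic modules have the same class.\<close>

locale tensor_reps =
  fixes H :: "('g, 'k::field) hopf_presentation"
  assumes tensor_closed: "\<And>V W. V \<in> reps H \<Longrightarrow> W \<in> reps H \<Longrightarrow> rep_tensor H V W \<in> reps H"
    and tensor_iso: "\<And>V V' W W'. V \<in> reps H \<Longrightarrow> V' \<in> reps H \<Longrightarrow> W \<in> reps H \<Longrightarrow> W' \<in> reps H \<Longrightarrow>
      rep_iso V V' \<Longrightarrow> rep_iso W W' \<Longrightarrow> rep_iso (rep_tensor H V W) (rep_tensor H V' W')"
    and tensor_sum_left: "\<And>U V W. U \<in> reps H \<Longrightarrow> V \<in> reps H \<Longrightarrow> W \<in> reps H \<Longrightarrow>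
      rep_iso (rep_tensor H (rep_sum U V) W) (rep_sum (rep_tensor H U W) (rep_tensor H V W))"
    and tensor_sum_right: "\<And>U V W. U \<in> reps H \<Longrightarrow> V \<in> reps H \<Longrightarrow> W \<in> reps H \<Longrightarrow>
      rep_iso (rep_tensor H U (rep_sum V W)) (rep_sum (rep_tensor H U V) (rep_tensor H U W))"
    and tensor_assoc: "\<And>U V W. U \<in> reps H \<Longrightarrow> V \<in> reps H \<Longrightarrow> W \<in> reps H \<Longrightarrow>
      rep_iso (rep_tensor H (rep_tensor H U V) W) (rep_tensor H U (rep_tensor H V W))"
    and unit_closed: "rep_unit H \<in> reps H"
    and tensor_unit_left: "\<And>V. V \<in> reps H \<Longrightarrow> rep_iso (rep_tensor H (rep_unit H) V) V"
    and tensor_unit_right: "\<And>V. V \<in> reps H \<Longrightarrow> rep_iso (rep_tensor H V (rep_unit H)) V"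
    and dual_closed: "\<And>V. V \<in> reps H \<Longrightarrow> rep_dual H V \<in> reps H"
    and dual_iso: "\<And>V W. V \<in> reps H \<Longrightarrow> W \<in> reps H \<Longrightarrow> rep_iso V W \<Longrightarrow> rep_iso (rep_dual H V) (rep_dual H W)"
    and dual_sum: "\<And>V W. V \<in> reps H \<Longrightarrow> W \<in> reps H \<Longrightarrow>
      rep_iso (rep_dual H (rep_sum V W)) (rep_sum (rep_dual H V) (rep_dual H W))"
begin

lemma formal_mult_closed:
  "Poly_Mapping.keys f \<subseteq> reps H \<Longrightarrow> Poly_Mapping.keys g \<subseteq> reps H \<Longrightarrow> Poly_Mapping.keys (formal_mult H f g) \<subseteq> reps H"
  by (rule formal_extend_closed, assumption, rule formal_extend_closed, assumption)
    (simp add: keys_frag_of tensor_closed)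

lemma formal_mult_relations_left:
  assumes r: "r \<in> green_relations H" and g: "Poly_Mapping.keys g \<subseteq> reps H"
  shows "formal_mult H r g \<in> green_relations H"
proof (rule green_relations_extend[OF r green_relations_zero])
  fix U V assume UV: "U \<in> reps H" "V \<in> reps H"
  show "frag_extend (\<lambda>W. frag_of (rep_tensor H U W)) g - frag_extend (\<lambda>W. frag_of (rep_tensor H V W)) g \<in> green_relations H"
    if iso: "rep_iso U V"
    unfolding frag_extend_fun_diff[symmetric] using g
  proof (induction g rule: frag_induction)
    case (one W)
    then show ?case using UV iso
      by (auto intro!: green_relations_iso tensor_closed tensor_iso rep_iso_refl reps_wf)
  qed (auto simp: green_relations_zero frag_extend_diff green_relations_diff)
  show "frag_extend (\<lambda>W. frag_of (rep_tensor H (rep_sum U V) W)) g - frag_extend (\<lambda>W. frag_of (rep_tensor H U W)) g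
      - frag_extend (\<lambda>W. frag_of (rep_tensor H V W)) g \<in> green_relations H"
    unfolding frag_extend_fun_diff[symmetric] using g
  proof (induction g rule: frag_induction)
    case (one W)
    have "frag_of (rep_tensor H (rep_sum U V) W) - frag_of (rep_tensor H U W) - frag_of (rep_tensor H V W) =
      (frag_of (rep_tensor H (rep_sum U V) W) - frag_of (rep_sum (rep_tensor H U W) (rep_tensor H V W)))
      + (frag_of (rep_sum (rep_tensor H U W) (rep_tensor H V W)) - frag_of (rep_tensor H U W) - frag_of (rep_tensor H V W))"
      by simp
    also have "\<dots> \<in> green_relations H"
      by (intro green_relations_add green_relations_iso green_relations_sum tensor_closed tensor_sum_left reps_sum UV one)
    finally show ?case by simp
  qed (auto simp: green_relations_zero frag_extend_diff green_relations_diff)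
qed (auto intro: green_relations_add green_relations_uminus)

lemma formal_mult_relations_right:
  assumes f: "Poly_Mapping.keys f \<subseteq> reps H" and r: "r \<in> green_relations H"
  shows "formal_mult H f r \<in> green_relations H"
  using f
proof (induction f rule: frag_induction)
  case (one U)
  have "frag_extend (\<lambda>W. frag_of (rep_tensor H U W)) r \<in> green_relations H"
  proof (rule green_relations_extend[OF r green_relations_zero])
    fix V W assume VW: "V \<in> reps H" "W \<in> reps H"
    show "frag_of (rep_tensor H U V) - frag_of (rep_tensor H U W) \<in> green_relations H" if "rep_iso V W"
      using VW one that by (auto intro!: green_relations_iso tensor_closed tensor_iso rep_iso_refl reps_wf)
    have "frag_of (rep_tensor H U (rep_sum V W)) - frag_of (rep_tensor H U V) - frag_of (rep_tensor H U W) =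
      (frag_of (rep_tensor H U (rep_sum V W)) - frag_of (rep_sum (rep_tensor H U V) (rep_tensor H U W)))
      + (frag_of (rep_sum (rep_tensor H U V) (rep_tensor H U W)) - frag_of (rep_tensor H U V) - frag_of (rep_tensor H U W))"
      by simp
    also have "\<dots> \<in> green_relations H"
      by (intro green_relations_add green_relations_iso green_relations_sum tensor_closed tensor_sum_right reps_sum VW one)
    finally show "frag_of (rep_tensor H U (rep_sum V W)) - frag_of (rep_tensor H U V) - frag_of (rep_tensor H U W) \<in> green_relations H" .
  qed (auto intro: green_relations_add green_relations_uminus)
  then show ?case by simp
qed (auto simp: green_relations_zero frag_extend_diff green_relations_diff)

lemma formal_mult_diff_right: "formal_mult H f (g - g') = formal_mult H f g - formal_mult H f g'"
  by (simp add: frag_extend_diff frag_extend_fun_diff)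

lemma formal_mult_add_right: "formal_mult H f (g + g') = formal_mult H f g + formal_mult H f g'"
  using formal_mult_diff_right[where g = "g + g'" and g' = g'] by (simp add: algebra_simps)

text \<open>The product of two cosets is a union over all pairs of representatives; since the
  relations absorb products on both sides, all cosets in this union coincide.\<close>

lemma green_ring_mult:
  assumes f: "Poly_Mapping.keys f \<subseteq> reps H" and g: "Poly_Mapping.keys g \<subseteq> reps H"
  shows "green_coset H f \<otimes>\<^bsub>green_ring H\<^esub> green_coset H g = green_coset H (formal_mult H f g)"
proof -
  have *: "green_coset H (formal_mult H a b) = green_coset H (formal_mult H f g)"
    if "a \<in> green_coset H f" "b \<in> green_coset H g" for a b
  proof -
    have ab: "a - f \<in> green_relations H" "b - g \<in> green_relations H" using that by (auto simp: mem_green_coset)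
    have b: "Poly_Mapping.keys b \<subseteq> reps H"
      using formal_closed(1)[OF green_relations_carrier[OF ab(2)] g] by simp
    have "formal_mult H a b - formal_mult H f g = formal_mult H (a - f) b + formal_mult H f (b - g)"
      unfolding formal_mult_diff_right by (simp add: frag_extend_diff)
    also have "\<dots> \<in> green_relations H"
      by (intro green_relations_add formal_mult_relations_left formal_mult_relations_right ab b f)
    finally show ?thesis by (simp add: green_coset_eq_iff)
  qed
  have "green_coset H f \<otimes>\<^bsub>green_ring H\<^esub> green_coset H g =
    (\<Union>a\<in>green_coset H f. \<Union>b\<in>green_coset H g. green_coset H (formal_mult H a b))"
    unfolding green_ring_def FactRing_def by (simp add: rcoset_mult_def green_coset_def)
  also have "\<dots> = (\<Union>a\<in>green_coset H f. \<Union>b\<in>green_coset H g. green_coset H (formal_mult H f g))"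
    using * by auto
  also have "\<dots> = green_coset H (formal_mult H f g)" using green_coset_self by blast
  finally show ?thesis .
qed

lemma green_class_tensor:
  "V \<in> reps H \<Longrightarrow> W \<in> reps H \<Longrightarrow> green_class H (rep_tensor H V W) = green_class H V \<otimes>\<^bsub>green_ring H\<^esub> green_class H W"
  by (simp add: green_class_coset green_ring_mult keys_frag_of)

lemma formal_mult_assoc:
  assumes f: "Poly_Mapping.keys f \<subseteq> reps H" and g: "Poly_Mapping.keys g \<subseteq> reps H" and h: "Poly_Mapping.keys h \<subseteq> reps H"
  shows "formal_mult H (formal_mult H f g) h - formal_mult H f (formal_mult H g h) \<in> green_relations H"
  using f
proof (induction f rule: frag_induction)
  case (one U)
  show ?case using g
  proof (induction g rule: frag_induction)
    case (one V)
    show ?case using h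
    proof (induction h rule: frag_induction)
      case (one W)
      then show ?case using \<open>U \<in> _\<close> \<open>V \<in> _\<close>
        by (auto intro!: green_relations_iso tensor_closed tensor_assoc)
    next
      case (diff a b)
      from green_relations_diff[OF diff] show ?case by (simp add: frag_extend_diff algebra_simps)
    qed (simp add: green_relations_zero)
  next
    case (diff a b)
    from green_relations_diff[OF diff] show ?case by (simp add: frag_extend_diff algebra_simps)
  qed (simp add: green_relations_zero)
next
  case (diff a b)
  from green_relations_diff[OF diff] show ?case by (simp add: frag_extend_diff algebra_simps)
qed (simp add: green_relations_zero)

lemma formal_mult_unit:
  assumes "Poly_Mapping.keys f \<subseteq> reps H"
  shows "formal_mult H (frag_of (rep_unit H)) f - f \<in> green_relations H"
    "formal_mult H f (frag_of (rep_unit H)) - f \<in> green_relations H"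
proof -
  show "formal_mult H (frag_of (rep_unit H)) f - f \<in> green_relations H" using assms
  proof (induction f rule: frag_induction)
    case (one V)
    then show ?case by (auto intro!: green_relations_iso tensor_closed unit_closed tensor_unit_left)
  next
    case (diff a b)
    from green_relations_diff[OF diff] show ?case by (simp add: frag_extend_diff algebra_simps)
  qed (simp add: green_relations_zero)
  show "formal_mult H f (frag_of (rep_unit H)) - f \<in> green_relations H" using assms
  proof (induction f rule: frag_induction)
    case (one V)
    then show ?case by (auto intro!: green_relations_iso tensor_closed unit_closed tensor_unit_right)
  next
    case (diff a b)
    from green_relations_diff[OF diff] show ?case by (simp add: frag_extend_diff algebra_simps)
  qed (simp add: green_relations_zero)
qed

sublocale green: ring "green_ring H"
proof (rule ringI)
  show "abelian_group (green_ring H)" by (rule abelian_group_green)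
  show "Group.monoid (green_ring H)"
  proof (rule monoidI)
    fix x y assume x: "x \<in> carrier (green_ring H)" and y: "y \<in> carrier (green_ring H)"
    obtain f where f: "Poly_Mapping.keys f \<subseteq> reps H" "x = green_coset H f" using x by (rule green_ring_cases)
    obtain g where g: "Poly_Mapping.keys g \<subseteq> reps H" "y = green_coset H g" using y by (rule green_ring_cases)
    show "x \<otimes>\<^bsub>green_ring H\<^esub> y \<in> carrier (green_ring H)"
      by (simp add: f g green_ring_mult green_coset_carrier formal_mult_closed)
    fix z assume z: "z \<in> carrier (green_ring H)"
    obtain h where h: "Poly_Mapping.keys h \<subseteq> reps H" "z = green_coset H h" using z by (rule green_ring_cases)
    show "x \<otimes>\<^bsub>green_ring H\<^esub> y \<otimes>\<^bsub>green_ring H\<^esub> z = x \<otimes>\<^bsub>green_ring H\<^esub> (y \<otimes>\<^bsub>green_ring H\<^esub> z)"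
      using formal_mult_assoc[OF f(1) g(1) h(1)]
      by (simp add: f g h green_ring_mult formal_mult_closed green_coset_eq_iff)
  next
    show "\<one>\<^bsub>green_ring H\<^esub> \<in> carrier (green_ring H)"
      by (simp add: green_ring_one green_class_carrier unit_closed)
  next
    fix x assume "x \<in> carrier (green_ring H)"
    then obtain f where f: "Poly_Mapping.keys f \<subseteq> reps H" "x = green_coset H f" by (rule green_ring_cases)
    have u: "Poly_Mapping.keys (frag_of (rep_unit H)) \<subseteq> reps H" by (simp add: keys_frag_of unit_closed)
    show "\<one>\<^bsub>green_ring H\<^esub> \<otimes>\<^bsub>green_ring H\<^esub> x = x" "x \<otimes>\<^bsub>green_ring H\<^esub> \<one>\<^bsub>green_ring H\<^esub> = x"
      unfolding green_ring_one green_class_coset f(2) green_ring_mult[OF u f(1)] green_ring_mult[OF f(1) u]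
      using formal_mult_unit[OF f(1)] by (simp_all add: green_coset_eq_iff)
  qed
next
  fix x y z assume xyz: "x \<in> carrier (green_ring H)" "y \<in> carrier (green_ring H)" "z \<in> carrier (green_ring H)"
  obtain f where f: "Poly_Mapping.keys f \<subseteq> reps H" "x = green_coset H f" using xyz(1) by (rule green_ring_cases)
  obtain g where g: "Poly_Mapping.keys g \<subseteq> reps H" "y = green_coset H g" using xyz(2) by (rule green_ring_cases)
  obtain h where h: "Poly_Mapping.keys h \<subseteq> reps H" "z = green_coset H h" using xyz(3) by (rule green_ring_cases)
  show "(x \<oplus>\<^bsub>green_ring H\<^esub> y) \<otimes>\<^bsub>green_ring H\<^esub> z = x \<otimes>\<^bsub>green_ring H\<^esub> z \<oplus>\<^bsub>green_ring H\<^esub> y \<otimes>\<^bsub>green_ring H\<^esub> z"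
    by (simp add: f g h green_ring_mult green_ring_add formal_mult_closed formal_closed(1) frag_extend_add)
  show "z \<otimes>\<^bsub>green_ring H\<^esub> (x \<oplus>\<^bsub>green_ring H\<^esub> y) = z \<otimes>\<^bsub>green_ring H\<^esub> x \<oplus>\<^bsub>green_ring H\<^esub> z \<otimes>\<^bsub>green_ring H\<^esub> y"
    using formal_mult_add_right[where f = h and g = f and g' = g]
    by (simp add: f g h green_ring_mult green_ring_add formal_mult_closed formal_closed(1))
qed

lemma green_coeffs_mult:
  assumes x: "x \<in> carrier (green_ring H)" and y: "y \<in> carrier (green_ring H)"
  shows "green_coeffs H (x \<otimes>\<^bsub>green_ring H\<^esub> y) =
    frag_extend (\<lambda>i. frag_extend (\<lambda>j. green_coeffs H (i \<otimes>\<^bsub>green_ring H\<^esub> j)) (green_coeffs H y)) (green_coeffs H x)"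
proof -
  let ?a = "green_coeffs H x" and ?b = "green_coeffs H y"
  have a: "Poly_Mapping.keys ?a \<subseteq> green_basis H" and b: "Poly_Mapping.keys ?b \<subseteq> green_basis H"
    using x y by (auto dest: keys_green_coeffs)
  have la: "Poly_Mapping.keys (formal_lift H ?a) \<subseteq> reps H" and lb: "Poly_Mapping.keys (formal_lift H ?b) \<subseteq> reps H"
    using a b by (auto dest: keys_formal_lift)
  have "x \<otimes>\<^bsub>green_ring H\<^esub> y = green_coset H (formal_mult H (formal_lift H ?a) (formal_lift H ?b))"
    using green_ring_mult[OF la lb] by (simp add: green_coset_lift_coeffs x y)
  then have "green_coeffs H (x \<otimes>\<^bsub>green_ring H\<^esub> y) = formal_coeffs H (formal_mult H (formal_lift H ?a) (formal_lift H ?b))"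
    by (simp add: green_coeffs_coset formal_mult_closed la lb)
  also have "\<dots> = frag_extend (\<lambda>i. frag_extend (\<lambda>j. rep_coeffs H (rep_tensor H (basis_rep H i) (basis_rep H j))) ?b) ?a"
    by (simp add: formal_coeffs_def formal_lift_def frag_extend_frag_extend)
  also have "\<dots> = frag_extend (\<lambda>i. frag_extend (\<lambda>j. green_coeffs H (i \<otimes>\<^bsub>green_ring H\<^esub> j)) ?b) ?a"
  proof (intro frag_extend_cong_keys[OF a] frag_extend_cong_keys[OF b])
    fix i j assume ij: "i \<in> green_basis H" "j \<in> green_basis H"
    have "green_class H (rep_tensor H (basis_rep H i) (basis_rep H j)) = i \<otimes>\<^bsub>green_ring H\<^esub> j"
      by (simp add: green_class_tensor basis_rep_reps basis_rep ij)
    then show "rep_coeffs H (rep_tensor H (basis_rep H i) (basis_rep H j)) = green_coeffs H (i \<otimes>\<^bsub>green_ring H\<^esub> j)"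
      using green_coeffs_class[OF tensor_closed[OF basis_rep_reps[OF ij(1)] basis_rep_reps[OF ij(2)]]] by simp
  qed
  finally show ?thesis .
qed

lemma green_dual_coset:
  assumes f: "Poly_Mapping.keys f \<subseteq> reps H"
  shows "green_dual H (green_coset H f) = green_coset H (frag_extend (\<lambda>V. frag_of (rep_dual H V)) f)"
  unfolding green_dual_def green_coset_def[symmetric]
proof (rule the_elem_green_coset)
  fix g assume "g - f \<in> green_relations H"
  then have "frag_extend (\<lambda>V. frag_of (rep_dual H V)) (g - f) \<in> green_relations H"
  proof (rule green_relations_extend[OF _ green_relations_zero])
    fix V W assume VW: "V \<in> reps H" "W \<in> reps H"
    show "frag_of (rep_dual H V) - frag_of (rep_dual H W) \<in> green_relations H" if "rep_iso V W"
      using VW that by (intro green_relations_iso dual_closed dual_iso)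
    have "frag_of (rep_dual H (rep_sum V W)) - frag_of (rep_dual H V) - frag_of (rep_dual H W) =
      (frag_of (rep_dual H (rep_sum V W)) - frag_of (rep_sum (rep_dual H V) (rep_dual H W)))
      + (frag_of (rep_sum (rep_dual H V) (rep_dual H W)) - frag_of (rep_dual H V) - frag_of (rep_dual H W))" by simp
    also have "\<dots> \<in> green_relations H"
      by (intro green_relations_add green_relations_iso green_relations_sum dual_closed dual_sum reps_sum VW)
    finally show "frag_of (rep_dual H (rep_sum V W)) - frag_of (rep_dual H V) - frag_of (rep_dual H W) \<in> green_relations H" .
  qed (auto intro: green_relations_add green_relations_uminus)
  then show "green_coset H (frag_extend (\<lambda>V. frag_of (rep_dual H V)) g) = green_coset H (frag_extend (\<lambda>V. frag_of (rep_dual H V)) f)"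
    by (simp add: green_coset_eq_iff frag_extend_diff)
qed

lemma green_dual_class: "V \<in> reps H \<Longrightarrow> green_dual H (green_class H V) = green_class H (rep_dual H V)"
  by (simp add: green_class_coset green_dual_coset keys_frag_of)

lemma green_dual_carrier: "x \<in> carrier (green_ring H) \<Longrightarrow> green_dual H x \<in> carrier (green_ring H)"
proof (erule green_ring_cases)
  fix f assume f: "Poly_Mapping.keys f \<subseteq> reps H" "x = green_coset H f"
  have "Poly_Mapping.keys (frag_extend (\<lambda>V. frag_of (rep_dual H V)) f) \<subseteq> reps H"
    by (rule formal_extend_closed[OF f(1)]) (simp add: keys_frag_of dual_closed)
  then show ?thesis by (simp add: f green_dual_coset green_coset_carrier)
qed

lemma green_coeffs_dual:
  assumes x: "x \<in> carrier (green_ring H)"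
  shows "green_coeffs H (green_dual H x) = frag_extend (\<lambda>i. green_coeffs H (green_dual H i)) (green_coeffs H x)"
proof -
  let ?a = "green_coeffs H x"
  have a: "Poly_Mapping.keys ?a \<subseteq> green_basis H" by (rule keys_green_coeffs[OF x])
  have la: "Poly_Mapping.keys (formal_lift H ?a) \<subseteq> reps H" using a by (rule keys_formal_lift)
  have k: "Poly_Mapping.keys (frag_extend (\<lambda>V. frag_of (rep_dual H V)) (formal_lift H ?a)) \<subseteq> reps H"
    by (rule formal_extend_closed[OF la]) (simp add: keys_frag_of dual_closed)
  have "green_dual H x = green_coset H (frag_extend (\<lambda>V. frag_of (rep_dual H V)) (formal_lift H ?a))"
    using green_dual_coset[OF la] by (simp add: green_coset_lift_coeffs x)
  then have "green_coeffs H (green_dual H x) = frag_extend (\<lambda>i. rep_coeffs H (rep_dual H (basis_rep H i))) ?a"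
    using green_coeffs_coset[OF k] by (simp add: formal_coeffs_def formal_lift_def frag_extend_frag_extend)
  also have "\<dots> = frag_extend (\<lambda>i. green_coeffs H (green_dual H i)) ?a"
  proof (rule frag_extend_cong_keys[OF a])
    fix i assume i: "i \<in> green_basis H"
    show "rep_coeffs H (rep_dual H (basis_rep H i)) = green_coeffs H (green_dual H i)"
      using green_dual_class[OF basis_rep_reps[OF i]] green_coeffs_class[OF dual_closed[OF basis_rep_reps[OF i]]]
      by (simp add: basis_rep i)
  qed
  finally show ?thesis .
qed

section \<open>Representation ideals\<close>

text \<open>Products and duals are determined by the basis through \<open>green_coeffs_mult\<close>
  and \<open>green_coeffs_dual\<close>, so closure is tested on basis elements only.\<close>

lemma span_ideal:
  assumes X: "X \<subset> green_basis H"
    and mult: "\<And>i j. i \<in> green_basis H \<Longrightarrow> j \<in> green_basis H \<Longrightarrow> i \<in> X \<or> j \<in> X \<Longrightarrow>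
      Poly_Mapping.keys (green_coeffs H (i \<otimes>\<^bsub>green_ring H\<^esub> j)) \<subseteq> X"
    and dual: "\<And>i. i \<in> X \<Longrightarrow> Poly_Mapping.keys (green_coeffs H (green_dual H i)) \<subseteq> X"
  shows "rep_ideal H (generate (add_monoid (green_ring H)) X)"
  unfolding rep_ideal_def
proof (intro conjI ballI)
  let ?I = "generate (add_monoid (green_ring H)) X"
  have span: "?I = {x \<in> carrier (green_ring H). Poly_Mapping.keys (green_coeffs H x) \<subseteq> X}"
    by (rule green_span) (use X in auto)
  show "ideal ?I (green_ring H)"
  proof (rule idealI)
    show "ring (green_ring H)" by unfold_locales
    show "subgroup ?I (add_monoid (green_ring H))"
      by (rule group.generate_is_subgroup[OF green.a_group]) (use X green_basis_carrier in auto)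
    fix a x assume a: "a \<in> ?I" and x: "x \<in> carrier (green_ring H)"
    have ac: "a \<in> carrier (green_ring H)" and ka: "Poly_Mapping.keys (green_coeffs H a) \<subseteq> X" using a span by auto
    have kx: "Poly_Mapping.keys (green_coeffs H x) \<subseteq> green_basis H" by (rule keys_green_coeffs[OF x])
    have "Poly_Mapping.keys (green_coeffs H (x \<otimes>\<^bsub>green_ring H\<^esub> a)) \<subseteq> X"
      unfolding green_coeffs_mult[OF x ac]
      by (rule formal_extend_closed[OF kx], rule formal_extend_closed[OF ka]) (use mult X in auto)
    then show "x \<otimes>\<^bsub>green_ring H\<^esub> a \<in> ?I" using x ac span by simp
    have "Poly_Mapping.keys (green_coeffs H (a \<otimes>\<^bsub>green_ring H\<^esub> x)) \<subseteq> X"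
      unfolding green_coeffs_mult[OF ac x]
      by (rule formal_extend_closed[OF ka], rule formal_extend_closed[OF kx]) (use mult X in auto)
    then show "a \<otimes>\<^bsub>green_ring H\<^esub> x \<in> ?I" using x ac span by simp
  qed
  show "\<exists>Y. Y \<subset> green_basis H \<and> ?I = generate (add_monoid (green_ring H)) Y" using X by blast
  fix x assume "x \<in> ?I"
  then have x: "x \<in> carrier (green_ring H)" "Poly_Mapping.keys (green_coeffs H x) \<subseteq> X" using span by auto
  have "Poly_Mapping.keys (green_coeffs H (green_dual H x)) \<subseteq> X"
    unfolding green_coeffs_dual[OF x(1)] by (rule formal_extend_closed[OF x(2) dual])
  then show "green_dual H x \<in> ?I" using span green_dual_carrier[OF x(1)] by simp
qed

text \<open>A representation ideal containing \<open>[V]\<close> also contains \<open>[V \<otimes> V\<^sup>*]\<close>, hence it would contain the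
  unit as soon as the unit is a direct summand of \<open>V \<otimes> V\<^sup>*\<close>.\<close>

lemma rep_ideal_unit_summand:
  assumes I: "rep_ideal H I" and V: "V \<in> reps H" "green_class H V \<in> I"
    and W: "W \<in> reps H" "rep_iso (rep_tensor H V (rep_dual H V)) (rep_sum (rep_unit H) W)"
  shows False
proof -
  obtain X where X: "X \<subset> green_basis H" "I = generate (add_monoid (green_ring H)) X"
    using I unfolding rep_ideal_def by blast
  have span: "I = {x \<in> carrier (green_ring H). Poly_Mapping.keys (green_coeffs H x) \<subseteq> X}"
    unfolding X(2) by (rule green_span) (use X in auto)
  interpret ideal I "green_ring H" using I unfolding rep_ideal_def by blast
  let ?u = "rep_unit H"
  have u: "indecomposable H ?u" by (rule indecomposable_dim_one[OF unit_closed]) (simp add: rep_unit_def)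
  have "green_class H V \<otimes>\<^bsub>green_ring H\<^esub> green_dual H (green_class H V) \<in> I"
    by (rule I_r_closed[OF V(2)]) (simp add: green_dual_carrier green_class_carrier V)
  then have "green_class H (rep_tensor H V (rep_dual H V)) \<in> I"
    by (simp add: green_dual_class green_class_tensor dual_closed V)
  then have "green_class H (rep_sum ?u W) \<in> I"
    using green_class_iso[OF tensor_closed[OF V(1) dual_closed[OF V(1)]] reps_sum[OF unit_closed W(1)] W(2)] by simp
  then have "Poly_Mapping.keys (green_coeffs H (green_class H (rep_sum ?u W))) \<subseteq> X" unfolding span by simp
  then have k: "Poly_Mapping.keys (rep_coeffs H (rep_sum ?u W)) \<subseteq> X"
    unfolding green_coeffs_class[OF reps_sum[OF unit_closed W(1)]] .
  have "Poly_Mapping.lookup (rep_coeffs H (rep_sum ?u W)) (green_class H ?u) = int (rep_mult H ?u (rep_sum ?u W))"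
    by (rule lookup_rep_coeffs[OF reps_sum[OF unit_closed W(1)] u])
  also have "\<dots> = int (1 + rep_mult H ?u W)"
    using rep_iso_refl[OF indecomposable_wf[OF u]]
    by (simp add: rep_mult_sum[OF u unit_closed W(1)] rep_mult_indecomposable[OF u u])
  finally have "green_class H ?u \<in> X" using k by (auto simp: in_keys_iff)
  then have "green_class H ?u \<in> I" unfolding X(2) by (rule generate.incl)
  then have "\<one>\<^bsub>green_ring H\<^esub> \<in> I" by (simp add: green_ring_one)
  then have Ic: "I = carrier (green_ring H)" by (rule one_imp_carrier)
  \<comment> \<open>An ideal equal to the whole ring would need every basis element as a generator,
    against the properness of \<open>X\<close>.\<close>
  have "i \<in> X" if i: "i \<in> green_basis H" for i
  proof -
    have "i \<in> I" unfolding Ic by (rule green_basis_carrier[OF i])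
    then have "Poly_Mapping.keys (green_coeffs H i) \<subseteq> X" unfolding span by blast
    then show ?thesis by (simp add: green_coeffs_basis[OF i] keys_frag_of)
  qed
  then show False using X(1) by blast
qed

text \<open>A representation ideal is spanned by basis elements, so the last assumption bounds all
  of them by the span of \<open>X\<close>. Applied to that span itself, it shows that no further
  basis element lies in it.\<close>

lemma max_rep_index_eqI:
  assumes "rep_ideal H (generate (add_monoid (green_ring H)) X)" "X \<subseteq> green_basis H"
    and max: "\<And>I i. rep_ideal H I \<Longrightarrow> i \<in> green_basis H \<Longrightarrow> i \<in> I \<Longrightarrow> i \<in> X"
  shows "max_rep_index H = X"
proof -
  let ?I = "generate (add_monoid (green_ring H)) X"
  have sub: "J \<subseteq> ?I" if J: "rep_ideal H J" for J
  proof -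
    obtain Y where Y: "Y \<subset> green_basis H" "J = generate (add_monoid (green_ring H)) Y"
      using J unfolding rep_ideal_def by blast
    have "Y \<subseteq> X"
    proof
      fix i assume "i \<in> Y"
      then show "i \<in> X" using max[OF J, of i] Y generate.incl[of i Y] by auto
    qed
    then show ?thesis unfolding Y(2) by (rule group.mono_generate[OF green.a_group])
  qed
  have "max_rep_ideal H = ?I"
    unfolding max_rep_ideal_def by (rule Greatest_equality) (use assms(1) sub in auto)
  moreover have "green_basis H \<inter> ?I = X"
  proof (intro equalityI subsetI)
    fix i assume "i \<in> green_basis H \<inter> ?I"
    then show "i \<in> X" using max[OF assms(1), of i] by auto
  qed (use assms(2) in \<open>auto intro: generate.incl\<close>)
  ultimately show ?thesis by (simp add: max_rep_index_def)
qed

end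

section \<open>Kronecker products\<close>

text \<open>\<open>k = i * m + j\<close> is the row-major numbering of pairs, the one used for the
  basis vectors e_i \<otimes> e_j.\<close>

lemma sum_div_mod:
  fixes f :: "nat \<Rightarrow> nat \<Rightarrow> 'a::comm_monoid_add"
  shows "(\<Sum>k<n * m. f (k div m) (k mod m)) = (\<Sum>i<n. \<Sum>j<m. f i j)"
proof (cases "m = 0")
  case False
  have "(\<Sum>i<n. \<Sum>j<m. f i j) = (\<Sum>(i, j)\<in>{..<n} \<times> {..<m}. f i j)"
    by (simp add: sum.cartesian_product)
  also have "\<dots> = (\<Sum>k<n * m. f (k div m) (k mod m))"
  proof (rule sum.reindex_bij_witness[where i = "\<lambda>k. (k div m, k mod m)" and j = "\<lambda>(i, j). i * m + j"])
    fix p assume "p \<in> {..<n} \<times> {..<m}"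
    then obtain i j where p: "p = (i, j)" "i < n" "j < m" by auto
    have "i * m + j < i * m + m" using p by simp
    also have "\<dots> \<le> n * m" using p(2) by (metis Suc_leI add.commute mult_Suc mult_le_mono1)
    finally show "(case p of (i, j) \<Rightarrow> i * m + j) \<in> {..<n * m}" using p by simp
  qed (use False in \<open>auto simp: less_mult_imp_div_less\<close>)
  finally show ?thesis by simp
qed simp

lemma dim_kronecker[simp]:
  "dim_row (kronecker A B) = dim_row A * dim_row B" "dim_col (kronecker A B) = dim_col A * dim_col B"
  by (simp_all add: kronecker_def)

lemma kronecker_entry:
  "i < dim_row A * dim_row B \<Longrightarrow> j < dim_col A * dim_col B \<Longrightarrow> kronecker A B $$ (i, j) =
    A $$ (i div dim_row B, j div dim_col B) * B $$ (i mod dim_row B, j mod dim_col B)"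
  by (simp add: kronecker_def)

lemma kronecker_mult:
  assumes "dim_col A = dim_row C" "dim_col B = dim_row D"
  shows "kronecker A B * kronecker C D = kronecker (A * C) (B * D)"
proof (rule eq_matI)
  fix i j assume "i < dim_row (kronecker (A * C) (B * D))" "j < dim_col (kronecker (A * C) (B * D))"
  then have i: "i < dim_row A * dim_row B" and j: "j < dim_col C * dim_col D" by auto
  have pos: "0 < dim_row B" "0 < dim_col D" using i j by (auto intro: gr0I)
  have ij: "i div dim_row B < dim_row A" "i mod dim_row B < dim_row B" "j div dim_col D < dim_col C" "j mod dim_col D < dim_col D"
    using i j pos by (simp_all add: less_mult_imp_div_less)
  let ?f = "\<lambda>p q. (A $$ (i div dim_row B, p) * C $$ (p, j div dim_col D)) * (B $$ (i mod dim_row B, q) * D $$ (q, j mod dim_col D))"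
  have "(kronecker A B * kronecker C D) $$ (i, j) = (\<Sum>k<dim_row C * dim_row D. ?f (k div dim_row D) (k mod dim_row D))"
    using i j assms by (subst mult_mat_entry) (auto simp: kronecker_entry intro!: sum.cong)
  also have "\<dots> = (\<Sum>p<dim_row C. A $$ (i div dim_row B, p) * C $$ (p, j div dim_col D)) * (\<Sum>q<dim_row D. B $$ (i mod dim_row B, q) * D $$ (q, j mod dim_col D))"
    by (subst sum_div_mod[of ?f]) (simp add: sum_product)
  also have "\<dots> = kronecker (A * C) (B * D) $$ (i, j)"
    using i j ij assms by (simp add: kronecker_entry mult_mat_entry del: index_mult_mat(1))
  finally show "(kronecker A B * kronecker C D) $$ (i, j) = kronecker (A * C) (B * D) $$ (i, j)" .
qed auto

lemma kronecker_bounds: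
  fixes i r s :: nat
  assumes "i < r * s"
  shows "i div s < r" "i mod s < s"
proof -
  have "0 < s" using assms by (auto intro: gr0I)
  then show "i div s < r" "i mod s < s"
    using assms by (simp_all add: less_mult_imp_div_less)
qed

lemma kronecker_add_left: "dim_row A = dim_row A' \<Longrightarrow> dim_col A = dim_col A' \<Longrightarrow>
  kronecker (A + A') B = kronecker A B + kronecker A' B"
  by (rule eq_matI) (auto simp: kronecker_entry distrib_right simp: kronecker_bounds)

lemma kronecker_add_right: "dim_row B = dim_row B' \<Longrightarrow> dim_col B = dim_col B' \<Longrightarrow>
  kronecker A (B + B') = kronecker A B + kronecker A B'"
  by (rule eq_matI) (auto simp: kronecker_entry distrib_left simp: kronecker_bounds)

lemma kronecker_diff_left: "dim_row A = dim_row A' \<Longrightarrow> dim_col A = dim_col A' \<Longrightarrow>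
  kronecker (A - A') B = kronecker A B - kronecker A' B"
  by (rule eq_matI) (auto simp: kronecker_entry left_diff_distrib simp: kronecker_bounds)

lemma kronecker_diff_right: "dim_row B = dim_row B' \<Longrightarrow> dim_col B = dim_col B' \<Longrightarrow>
  kronecker A (B - B') = kronecker A B - kronecker A B'"
  by (rule eq_matI) (auto simp: kronecker_entry right_diff_distrib simp: kronecker_bounds)

lemma kronecker_uminus: "kronecker (- A) B = - kronecker A B" "kronecker A (- B) = - kronecker A B"
  by (rule eq_matI; auto simp: kronecker_entry simp: kronecker_bounds)+

lemma kronecker_smult: "kronecker (x \<cdot>\<^sub>m A) B = x \<cdot>\<^sub>m kronecker A B" "kronecker A (x \<cdot>\<^sub>m B) = x \<cdot>\<^sub>m kronecker A B"
  by (rule eq_matI; auto simp: kronecker_entry simp: kronecker_bounds)+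

lemma kronecker_zero: "kronecker (0\<^sub>m n m) B = 0\<^sub>m (n * dim_row B) (m * dim_col B)"
  "kronecker A (0\<^sub>m n m) = 0\<^sub>m (dim_row A * n) (dim_col A * m)"
  by (rule eq_matI; auto simp: kronecker_entry simp: kronecker_bounds)+

lemma kronecker_one: "kronecker (1\<^sub>m n) (1\<^sub>m m) = 1\<^sub>m (n * m)"
proof (rule eq_matI)
  fix i j assume "i < dim_row (1\<^sub>m (n * m) :: 'a mat)" "j < dim_col (1\<^sub>m (n * m) :: 'a mat)"
  moreover have "i = j \<longleftrightarrow> i div m = j div m \<and> i mod m = j mod m" by (metis div_mult_mod_eq)
  ultimately show "kronecker (1\<^sub>m n) (1\<^sub>m m) $$ (i, j) = (1\<^sub>m (n * m) :: 'a mat) $$ (i, j)"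
    by (auto simp: kronecker_entry kronecker_bounds)
qed auto

lemma kronecker_transpose: "transpose_mat (kronecker A B) = kronecker (transpose_mat A) (transpose_mat B)"
  by (rule eq_matI) (auto simp: kronecker_entry simp: kronecker_bounds)

lemma kronecker_assoc: "kronecker (kronecker A B) C = kronecker A (kronecker B C)"
proof (rule eq_matI)
  fix i j assume "i < dim_row (kronecker A (kronecker B C))" "j < dim_col (kronecker A (kronecker B C))"
  then have i: "i < dim_row A * dim_row B * dim_row C" and j: "j < dim_col A * dim_col B * dim_col C"
    by (auto simp: mult.assoc)
  have i': "i < dim_row A * (dim_row B * dim_row C)" and j': "j < dim_col A * (dim_col B * dim_col C)"
    using i j by (auto simp: mult.assoc)
  \<comment> \<open>The index of the middle factor is read off in two ways: divide and then reduce,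
    or reduce and then divide.\<close>
  have dm: "x mod (r * s) div s = x div s mod r" "x mod (r * s) mod s = x mod s" if "x < q * s" for x r s q :: nat
  proof -
    have s: "0 < s" using that by (auto intro: gr0I)
    have "x mod (r * s) = s * (x div s mod r) + x mod s" by (simp add: mult.commute[of r] mod_mult2_eq)
    then show "x mod (r * s) div s = x div s mod r" "x mod (r * s) mod s = x mod s" using s by simp_all
  qed
  show "kronecker (kronecker A B) C $$ (i, j) = kronecker A (kronecker B C) $$ (i, j)"
    using i j i' j' kronecker_bounds[OF i] kronecker_bounds[OF j] kronecker_bounds[OF i'] kronecker_bounds[OF j'] dm[OF i] dm[OF j]
      div_mult2_eq[of i "dim_row C" "dim_row B"] div_mult2_eq[of j "dim_col C" "dim_col B"]
    by (simp add: kronecker_entry mult.commute[of "dim_row C" "dim_row B"] mult.commute[of "dim_col C" "dim_col B"])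
qed (auto simp: mult.assoc)

lemma kronecker_one_unit: "kronecker (1\<^sub>m 1) A = A" "kronecker A (1\<^sub>m 1) = A"
  by (rule eq_matI; auto simp: kronecker_entry)+

lemmas kronecker_alg = kronecker_mult kronecker_add_left kronecker_add_right kronecker_diff_left kronecker_diff_right
  kronecker_uminus kronecker_smult kronecker_zero kronecker_one


section \<open>Modules over the double of the Sweedler algebra\<close>

lemma mat_left: "A * B = C \<Longrightarrow> dim_col A = dim_row B \<Longrightarrow> dim_col B = dim_row X \<Longrightarrow> A * (B * X) = C * X"
  for A B C X :: "'a::semiring_0 mat"
  by (simp add: mat_assoc[symmetric] del: assoc_mult_mat)

locale dh4_mats =
  fixes n :: nat and a b c d :: "'k::field mat"
  assumes carrier: "a \<in> carrier_mat n n" "b \<in> carrier_mat n n" "c \<in> carrier_mat n n" "d \<in> carrier_mat n n"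
    and rel_ba: "b * a = - (a * b)" and rel_db: "d * b = - (b * d)" and rel_ca: "c * a = - (a * c)"
    and rel_dc: "d * c = - (c * d)" and rel_bc: "b * c = c * b" and rel_aa: "a * a = 0\<^sub>m n n" and rel_dd: "d * d = 0\<^sub>m n n"
    and rel_bb: "b * b = 1\<^sub>m n" and rel_cc: "c * c = 1\<^sub>m n" and rel_da: "d * a + a * d = 1\<^sub>m n - b * c"
begin

lemma dims: "dim_row a = n" "dim_col a = n" "dim_row b = n" "dim_col b = n" "dim_row c = n" "dim_col c = n"
  "dim_row d = n" "dim_col d = n"
  using carrier by auto

lemma rel_da': "d * a = 1\<^sub>m n - b * c - a * d"
proof -
  have "d * a = (d * a + a * d) - a * d" by (rule eq_matI) (auto simp: dims simp del: index_mult_mat(1))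
  then show ?thesis unfolding rel_da .
qed

text \<open>Oriented like this, the relations move \<open>a\<close> to the front and
  \<open>d\<close> to the back, with the normal form a, b, c, d for monomials. The variants in
  \<open>rels_left\<close> apply inside products nested to the right.\<close>

lemmas rels = rel_ba rel_db rel_ca rel_dc rel_bc[symmetric] rel_aa rel_dd rel_bb rel_cc rel_da'

lemmas rels_left = mat_left[OF rel_ba] mat_left[OF rel_db] mat_left[OF rel_ca] mat_left[OF rel_dc] mat_left[OF rel_bc[symmetric]]
  mat_left[OF rel_aa] mat_left[OF rel_dd] mat_left[OF rel_bb] mat_left[OF rel_cc] mat_left[OF rel_da']

lemmas nf = rels rels_left dims mat_alg

end

lemma mat_plus_uminus: "dim_row A = dim_row B \<Longrightarrow> dim_col A = dim_col B \<Longrightarrow> A + - B = A - B" for A B :: "'a::ring mat"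
  by (rule eq_matI) auto

lemma reps_D_H4_iff:
  fixes V :: "(dh4_gen, 'k::field) rep"
  shows "V \<in> reps D_H4 \<longleftrightarrow> dh4_mats (rdim V) (act V gen_a) (act V gen_b) (act V gen_c) (act V gen_d)"
proof -
  have ev: "eval_rep V 0 = 0\<^sub>m (rdim V) (rdim V)" "eval_rep V 1 = 1\<^sub>m (rdim V)"
    by (auto simp: zero_ncpoly_def one_ncpoly_def intro!: eq_matI)
  have wf: "(\<forall>g. act V g \<in> carrier_mat (rdim V) (rdim V)) \<longleftrightarrow>
    act V gen_a \<in> carrier_mat (rdim V) (rdim V) \<and> act V gen_b \<in> carrier_mat (rdim V) (rdim V) \<and>
    act V gen_c \<in> carrier_mat (rdim V) (rdim V) \<and> act V gen_d \<in> carrier_mat (rdim V) (rdim V)"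
    by (metis dh4_gen.exhaust)
  show ?thesis
    unfolding reps_def D_H4_def dh4_mats_def mem_Collect_eq wf
    by (auto simp: Let_def ev times_ncpoly_def uminus_ncpoly_def plus_ncpoly_def minus_ncpoly_def mat_plus_uminus)
qed

lemma rdim_tensor[simp]: "rdim (rep_tensor H V W) = rdim V * rdim W"
  by (simp add: rep_tensor_def)

lemma act_tensor:
  fixes V W :: "(dh4_gen, 'k::field) rep"
  assumes "rep_wf V" "rep_wf W"
  shows "act (rep_tensor D_H4 V W) gen_a = kronecker (act V gen_a) (act W gen_b) + kronecker (1\<^sub>m (rdim V)) (act W gen_a)"
    "act (rep_tensor D_H4 V W) gen_b = kronecker (act V gen_b) (act W gen_b)"
    "act (rep_tensor D_H4 V W) gen_c = kronecker (act V gen_c) (act W gen_c)"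
    "act (rep_tensor D_H4 V W) gen_d = kronecker (act V gen_d) (act W gen_c) + kronecker (1\<^sub>m (rdim V)) (act W gen_d)"
proof -
  have "1 \<cdot>\<^sub>m 1\<^sub>m (rdim V) = (1\<^sub>m (rdim V) :: 'k mat)" by (rule eq_matI) auto
  then show "act (rep_tensor D_H4 V W) gen_a = kronecker (act V gen_a) (act W gen_b) + kronecker (1\<^sub>m (rdim V)) (act W gen_a)"
    "act (rep_tensor D_H4 V W) gen_b = kronecker (act V gen_b) (act W gen_b)"
    "act (rep_tensor D_H4 V W) gen_c = kronecker (act V gen_c) (act W gen_c)"
    "act (rep_tensor D_H4 V W) gen_d = kronecker (act V gen_d) (act W gen_c) + kronecker (1\<^sub>m (rdim V)) (act W gen_d)"
    using assms by (simp_all add: rep_tensor_def D_H4_def Let_def one_ncpoly_def mat_add_zero)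
qed

lemma rep_unit_D_H4:
  "act (rep_unit D_H4 :: (dh4_gen, 'k::field) rep) gen_a = 0\<^sub>m 1 1" "act (rep_unit D_H4 :: (dh4_gen, 'k) rep) gen_b = 1\<^sub>m 1"
  "act (rep_unit D_H4 :: (dh4_gen, 'k) rep) gen_c = 1\<^sub>m 1" "act (rep_unit D_H4 :: (dh4_gen, 'k) rep) gen_d = 0\<^sub>m 1 1"
  "rdim (rep_unit D_H4 :: (dh4_gen, 'k) rep) = 1"
proof -
  have "counit (D_H4 :: (dh4_gen, 'k) hopf_presentation) gen_a = 0" "counit (D_H4 :: (dh4_gen, 'k) hopf_presentation) gen_b = 1"
    "counit (D_H4 :: (dh4_gen, 'k) hopf_presentation) gen_c = 1" "counit (D_H4 :: (dh4_gen, 'k) hopf_presentation) gen_d = 0"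
    by (simp_all add: D_H4_def Let_def)
  then show "act (rep_unit D_H4 :: (dh4_gen, 'k::field) rep) gen_a = 0\<^sub>m 1 1" "act (rep_unit D_H4 :: (dh4_gen, 'k) rep) gen_b = 1\<^sub>m 1"
    "act (rep_unit D_H4 :: (dh4_gen, 'k) rep) gen_c = 1\<^sub>m 1" "act (rep_unit D_H4 :: (dh4_gen, 'k) rep) gen_d = 0\<^sub>m 1 1"
    "rdim (rep_unit D_H4 :: (dh4_gen, 'k) rep) = 1"
    by (auto simp: rep_unit_def intro!: eq_matI)
qed

lemma rdim_dual[simp]: "rdim (rep_dual H V) = rdim V"
  by (simp add: rep_dual_def)

lemma act_dual:
  fixes V :: "(dh4_gen, 'k::field) rep"
  assumes "rep_wf V"
  shows "act (rep_dual D_H4 V) gen_a = - (transpose_mat (act V gen_b) * transpose_mat (act V gen_a))"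
    "act (rep_dual D_H4 V) gen_b = transpose_mat (act V gen_b)"
    "act (rep_dual D_H4 V) gen_c = transpose_mat (act V gen_c)"
    "act (rep_dual D_H4 V) gen_d = - (transpose_mat (act V gen_c) * transpose_mat (act V gen_d))"
  using assms
  by (simp_all add: rep_dual_def D_H4_def Let_def times_ncpoly_def uminus_ncpoly_def mat_transpose_mult[symmetric] transpose_uminus)

text \<open>This is the compatibility of the comultiplication with the defining relations; both
  sides are compared in normal form.\<close>

lemma dh4_tensor:
  assumes "dh4_mats n a b c d" "dh4_mats m a' b' c' d'"
  shows "dh4_mats (n * m) (kronecker a b' + kronecker (1\<^sub>m n) a') (kronecker b b') (kronecker c c') (kronecker d c' + kronecker (1\<^sub>m n) d')"
proof -
  interpret V: dh4_mats n a b c d by fact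
  interpret W: dh4_mats m a' b' c' d' by fact
  show ?thesis
    by unfold_locales
      ((auto simp: V.dims W.dims intro!: carrier_matI; fail) |
       (simp add: V.nf W.nf kronecker_alg; fail) |
       (simp add: V.nf W.nf kronecker_alg, rule eq_matI; simp add: V.dims W.dims del: index_mult_mat(1)))+
qed

text \<open>Transposition reverses products as the antipode does, so the transposed relations serve
  as rewrite rules for the dual.\<close>

lemma dh4_dual:
  assumes "dh4_mats n a b c d"
  shows "dh4_mats n (- (transpose_mat b * transpose_mat a)) (transpose_mat b) (transpose_mat c) (- (transpose_mat c * transpose_mat d))"
proof -
  interpret V: dh4_mats n a b c d by fact
  let ?a = "transpose_mat a" and ?b = "transpose_mat b" and ?c = "transpose_mat c" and ?d = "transpose_mat d"
  note t = V.rels[THEN arg_cong[where f = transpose_mat]]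
  have r: "?a * ?b = - (?b * ?a)" "?b * ?d = - (?d * ?b)" "?a * ?c = - (?c * ?a)" "?c * ?d = - (?d * ?c)"
    "?b * ?c = ?c * ?b" "?a * ?a = 0\<^sub>m n n" "?d * ?d = 0\<^sub>m n n" "?b * ?b = 1\<^sub>m n" "?c * ?c = 1\<^sub>m n"
    "?a * ?d = 1\<^sub>m n - ?c * ?b - ?d * ?a"
    using t by (simp_all add: mat_transpose_mult V.dims transpose_uminus transpose_minus[of _ n n] carrier_matI)
  have dims: "dim_row ?a = n" "dim_col ?a = n" "dim_row ?b = n" "dim_col ?b = n" "dim_row ?c = n" "dim_col ?c = n"
    "dim_row ?d = n" "dim_col ?d = n"
    by (simp_all add: V.dims)
  note nf = r r[THEN mat_left] dims V.dims mat_alg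
  show ?thesis
    by unfold_locales
      ((auto simp: V.dims intro!: carrier_matI; fail) |
       (simp add: nf; fail) |
       (simp add: nf, rule eq_matI; simp add: V.dims del: index_mult_mat(1)))+
qed

lemma tensor_hom:
  fixes V W V' W' :: "(dh4_gen, 'k::field) rep"
  assumes P: "P \<in> rep_hom V V'" and Q: "Q \<in> rep_hom W W'" and [simp]: "rep_wf V" "rep_wf W" "rep_wf V'" "rep_wf W'"
  shows "kronecker P Q \<in> rep_hom (rep_tensor D_H4 V W) (rep_tensor D_H4 V' W')"
proof (rule rep_homI)
  note [simp] = rep_homD(1,2)[OF P] rep_homD(1,2)[OF Q]
  show "kronecker P Q \<in> carrier_mat (rdim (rep_tensor D_H4 V' W')) (rdim (rep_tensor D_H4 V W))"
    by (auto intro!: carrier_matI)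
  fix g
  show "kronecker P Q * act (rep_tensor D_H4 V W) g = act (rep_tensor D_H4 V' W') g * kronecker P Q"
    by (cases g) (simp_all add: act_tensor mat_alg kronecker_alg rep_homD(3)[OF P] rep_homD(3)[OF Q])
qed

lemma dual_hom:
  fixes V W :: "(dh4_gen, 'k::field) rep"
  assumes P: "P \<in> rep_hom V W" and [simp]: "rep_wf V" "rep_wf W"
  shows "transpose_mat P \<in> rep_hom (rep_dual D_H4 W) (rep_dual D_H4 V)"
proof (rule rep_homI)
  note [simp] = rep_homD(1,2)[OF P]
  show "transpose_mat P \<in> carrier_mat (rdim (rep_dual D_H4 V)) (rdim (rep_dual D_H4 W))"
    by (auto intro!: carrier_matI)
  have t: "transpose_mat P * transpose_mat (act W g) = transpose_mat (act V g) * transpose_mat P" for g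
    using rep_homD(3)[OF P, of g, THEN arg_cong[where f = transpose_mat]] by (simp add: mat_transpose_mult)
  fix g
  show "transpose_mat P * act (rep_dual D_H4 W) g = act (rep_dual D_H4 V) g * transpose_mat P"
    by (cases g) (simp_all add: act_dual mat_alg t t[THEN mat_left])
qed

lemma reps_tensor: "V \<in> reps D_H4 \<Longrightarrow> W \<in> reps D_H4 \<Longrightarrow> rep_tensor D_H4 V W \<in> reps D_H4"
  using dh4_tensor reps_wf[of V D_H4] reps_wf[of W D_H4] by (simp add: reps_D_H4_iff act_tensor)

lemma reps_dual: "V \<in> reps D_H4 \<Longrightarrow> rep_dual D_H4 V \<in> reps D_H4"
  using dh4_dual reps_wf[of V D_H4] by (simp add: reps_D_H4_iff act_dual)

lemma biprod_tensor_left: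
  fixes X :: "(dh4_gen, 'k::field) rep"
  assumes b: "biprod X A B i1 i2 p1 p2" and [simp]: "rep_wf X" "rep_wf A" "rep_wf B" "rep_wf W"
  shows "biprod (rep_tensor D_H4 X W) (rep_tensor D_H4 A W) (rep_tensor D_H4 B W)
    (kronecker i1 (1\<^sub>m (rdim W))) (kronecker i2 (1\<^sub>m (rdim W))) (kronecker p1 (1\<^sub>m (rdim W))) (kronecker p2 (1\<^sub>m (rdim W)))"
proof (rule biprodI)
  note bd = biprodD[OF b] and [simp] = biprod_dims[OF b]
  have "kronecker (i1 * p1) (1\<^sub>m (rdim W)) + kronecker (i2 * p2) (1\<^sub>m (rdim W)) = kronecker (i1 * p1 + i2 * p2) (1\<^sub>m (rdim W))"
    by (simp add: kronecker_add_left)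
  then show "kronecker i1 (1\<^sub>m (rdim W)) * kronecker p1 (1\<^sub>m (rdim W)) + kronecker i2 (1\<^sub>m (rdim W)) * kronecker p2 (1\<^sub>m (rdim W)) =
    1\<^sub>m (rdim (rep_tensor D_H4 X W))"
    unfolding bd by (simp add: kronecker_mult kronecker_one)
qed (auto intro!: tensor_hom rep_hom_one biprodD[OF b] simp: kronecker_mult kronecker_one biprodD[OF b] biprod_dims[OF b])

lemma biprod_tensor_right:
  fixes X :: "(dh4_gen, 'k::field) rep"
  assumes b: "biprod X A B i1 i2 p1 p2" and [simp]: "rep_wf X" "rep_wf A" "rep_wf B" "rep_wf W"
  shows "biprod (rep_tensor D_H4 W X) (rep_tensor D_H4 W A) (rep_tensor D_H4 W B)
    (kronecker (1\<^sub>m (rdim W)) i1) (kronecker (1\<^sub>m (rdim W)) i2) (kronecker (1\<^sub>m (rdim W)) p1) (kronecker (1\<^sub>m (rdim W)) p2)"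
proof (rule biprodI)
  note bd = biprodD[OF b] and [simp] = biprod_dims[OF b]
  have "kronecker (1\<^sub>m (rdim W)) (i1 * p1) + kronecker (1\<^sub>m (rdim W)) (i2 * p2) = kronecker (1\<^sub>m (rdim W)) (i1 * p1 + i2 * p2)"
    by (simp add: kronecker_add_right)
  then show "kronecker (1\<^sub>m (rdim W)) i1 * kronecker (1\<^sub>m (rdim W)) p1 + kronecker (1\<^sub>m (rdim W)) i2 * kronecker (1\<^sub>m (rdim W)) p2 =
    1\<^sub>m (rdim (rep_tensor D_H4 W X))"
    unfolding bd by (simp add: kronecker_mult kronecker_one)
qed (auto intro!: tensor_hom rep_hom_one biprodD[OF b] simp: kronecker_mult kronecker_one biprodD[OF b] biprod_dims[OF b])

lemma biprod_dual:
  fixes X :: "(dh4_gen, 'k::field) rep"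
  assumes b: "biprod X A B i1 i2 p1 p2" and [simp]: "rep_wf X" "rep_wf A" "rep_wf B"
  shows "biprod (rep_dual D_H4 X) (rep_dual D_H4 A) (rep_dual D_H4 B)
    (transpose_mat p1) (transpose_mat p2) (transpose_mat i1) (transpose_mat i2)"
proof (rule biprodI)
  note bd = biprodD[OF b] and [simp] = biprod_dims[OF b]
  show "transpose_mat p1 * transpose_mat i1 + transpose_mat p2 * transpose_mat i2 = 1\<^sub>m (rdim (rep_dual D_H4 X))"
    using bd(7)[THEN arg_cong[where f = transpose_mat]]
    by (simp add: mat_transpose_mult transpose_add[of _ "rdim X" "rdim X"] carrier_matI)
qed (auto intro!: dual_hom biprodD[OF b] simp: mat_transpose_mult[symmetric] biprodD[OF b] biprod_dims[OF b])

interpretation dh4: tensor_reps "D_H4 :: (dh4_gen, 'k::field) hopf_presentation"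
proof
  fix U V W V' W' :: "(dh4_gen, 'k) rep"
  show "rep_tensor D_H4 V W \<in> reps D_H4" if "V \<in> reps D_H4" "W \<in> reps D_H4" by (rule reps_tensor[OF that])
  show "rep_dual D_H4 V \<in> reps D_H4" if "V \<in> reps D_H4" by (rule reps_dual[OF that])
  show "rep_iso (rep_tensor D_H4 V W) (rep_tensor D_H4 V' W')"
    if r: "V \<in> reps D_H4" "V' \<in> reps D_H4" "W \<in> reps D_H4" "W' \<in> reps D_H4" "rep_iso V V'" "rep_iso W W'"
  proof -
    note [simp] = r(1-4)[THEN reps_wf]
    obtain P Q where PQ: "P \<in> rep_hom V V'" "Q \<in> rep_hom V' V" "Q * P = 1\<^sub>m (rdim V)" "P * Q = 1\<^sub>m (rdim V')"
      by (rule rep_isoE[OF r(5)]) auto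
    obtain R S where RS: "R \<in> rep_hom W W'" "S \<in> rep_hom W' W" "S * R = 1\<^sub>m (rdim W)" "R * S = 1\<^sub>m (rdim W')"
      by (rule rep_isoE[OF r(6)]) auto
    note [simp] = rep_homD(1,2)[OF PQ(1)] rep_homD(1,2)[OF PQ(2)] rep_homD(1,2)[OF RS(1)] rep_homD(1,2)[OF RS(2)]
    show ?thesis
      by (rule rep_isoI[OF tensor_hom[OF PQ(1) RS(1)] tensor_hom[OF PQ(2) RS(2)]])
        (simp_all add: kronecker_mult kronecker_one PQ RS)
  qed
  show "rep_iso (rep_dual D_H4 V) (rep_dual D_H4 W)" if r: "V \<in> reps D_H4" "W \<in> reps D_H4" "rep_iso V W"
  proof -
    note [simp] = r(1,2)[THEN reps_wf]
    obtain P Q where PQ: "P \<in> rep_hom V W" "Q \<in> rep_hom W V" "Q * P = 1\<^sub>m (rdim V)" "P * Q = 1\<^sub>m (rdim W)"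
      by (rule rep_isoE[OF r(3)]) auto
    note [simp] = rep_homD(1,2)[OF PQ(1)] rep_homD(1,2)[OF PQ(2)]
    show ?thesis
      by (rule rep_isoI[OF dual_hom[OF PQ(2)] dual_hom[OF PQ(1)]]) (simp_all add: mat_transpose_mult[symmetric] PQ)
  qed
  show "rep_iso (rep_tensor D_H4 (rep_sum U V) W) (rep_sum (rep_tensor D_H4 U W) (rep_tensor D_H4 V W))"
    if r: "U \<in> reps D_H4" "V \<in> reps D_H4" "W \<in> reps D_H4"
  proof -
    note [simp] = r[THEN reps_wf] reps_tensor[THEN reps_wf] r
    obtain i1 i2 p1 p2 where b: "biprod (rep_sum U V) U V i1 i2 p1 p2" by (rule biprod_rep_sum[of U V]) auto
    have [simp]: "rep_wf (rep_tensor D_H4 (rep_sum U V) W)" by (intro reps_wf[OF reps_tensor] reps_sum r)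
    from biprod_tensor_left[OF b, of W] show ?thesis by (auto simp: rep_iso_sum_iff)
  qed
  show "rep_iso (rep_tensor D_H4 U (rep_sum V W)) (rep_sum (rep_tensor D_H4 U V) (rep_tensor D_H4 U W))"
    if r: "U \<in> reps D_H4" "V \<in> reps D_H4" "W \<in> reps D_H4"
  proof -
    note [simp] = r[THEN reps_wf] reps_tensor[THEN reps_wf] r
    obtain i1 i2 p1 p2 where b: "biprod (rep_sum V W) V W i1 i2 p1 p2" by (rule biprod_rep_sum[of V W]) auto
    have [simp]: "rep_wf (rep_tensor D_H4 U (rep_sum V W))" by (intro reps_wf[OF reps_tensor] reps_sum r)
    from biprod_tensor_right[OF b, of U] show ?thesis by (auto simp: rep_iso_sum_iff)
  qed
  show "rep_iso (rep_dual D_H4 (rep_sum V W)) (rep_sum (rep_dual D_H4 V) (rep_dual D_H4 W))"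
    if r: "V \<in> reps D_H4" "W \<in> reps D_H4"
  proof -
    note [simp] = r[THEN reps_wf] reps_dual[THEN reps_wf] r
    obtain i1 i2 p1 p2 where b: "biprod (rep_sum V W) V W i1 i2 p1 p2" by (rule biprod_rep_sum[of V W]) auto
    have [simp]: "rep_wf (rep_dual D_H4 (rep_sum V W))" by (intro reps_wf[OF reps_dual] reps_sum r)
    from biprod_dual[OF b] show ?thesis by (auto simp: rep_iso_sum_iff)
  qed
  show "rep_iso (rep_tensor D_H4 (rep_tensor D_H4 U V) W) (rep_tensor D_H4 U (rep_tensor D_H4 V W))"
    if r: "U \<in> reps D_H4" "V \<in> reps D_H4" "W \<in> reps D_H4"
  proof -
    note [simp] = r[THEN reps_wf] reps_tensor[THEN reps_wf] r
    \<comment> \<open>Kronecker products are associative as matrices, so the isomorphism is an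
      equality.\<close>
    have "rep_tensor D_H4 (rep_tensor D_H4 U V) W = rep_tensor D_H4 U (rep_tensor D_H4 V W)"
    proof (rule rep.expand, intro conjI ext)
      fix g
      show "act (rep_tensor D_H4 (rep_tensor D_H4 U V) W) g = act (rep_tensor D_H4 U (rep_tensor D_H4 V W)) g"
        by (cases g) (simp_all add: act_tensor kronecker_add_left kronecker_add_right kronecker_assoc
            kronecker_one[symmetric] mat_add_assoc mult.assoc del: kronecker_one)
    qed (simp add: mult.assoc)
    then show ?thesis using rep_iso_refl[OF reps_wf[OF reps_tensor[OF r(1) reps_tensor[OF r(2,3)]]]] by simp
  qed
  show unit: "(rep_unit D_H4 :: (dh4_gen, 'k) rep) \<in> reps D_H4"
    unfolding reps_D_H4_iff rep_unit_D_H4 by unfold_locales (auto intro!: eq_matI)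
  have one_zero: "kronecker (0\<^sub>m 1 1) A = 0\<^sub>m (dim_row A) (dim_col A)" "kronecker A (0\<^sub>m 1 1) = 0\<^sub>m (dim_row A) (dim_col A)" for A :: "'k mat"
    by (simp_all add: kronecker_zero)
  show "rep_iso (rep_tensor D_H4 (rep_unit D_H4) V) V" if r: "V \<in> reps D_H4"
  proof -
    note [simp] = r[THEN reps_wf] unit[THEN reps_wf]
    have "rep_tensor D_H4 (rep_unit D_H4) V = V"
    proof (rule rep.expand, intro conjI ext)
      fix g
      show "act (rep_tensor D_H4 (rep_unit D_H4) V) g = act V g"
        by (cases g) (simp_all add: act_tensor rep_unit_D_H4 kronecker_one_unit one_zero mat_alg del: One_nat_def)
    qed (simp add: rep_unit_D_H4)
    then show ?thesis by (simp add: rep_iso_refl)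
  qed
  show "rep_iso (rep_tensor D_H4 V (rep_unit D_H4)) V" if r: "V \<in> reps D_H4"
  proof -
    note [simp] = r[THEN reps_wf] unit[THEN reps_wf]
    have "rep_tensor D_H4 V (rep_unit D_H4) = V"
    proof (rule rep.expand, intro conjI ext)
      fix g
      show "act (rep_tensor D_H4 V (rep_unit D_H4)) g = act V g"
        by (cases g) (simp_all add: act_tensor rep_unit_D_H4 kronecker_one_unit one_zero mat_alg del: One_nat_def)
    qed (simp add: rep_unit_D_H4)
    then show ?thesis by (simp add: rep_iso_refl)
  qed
qed

section \<open>Contractible modules\<close>

definition theta :: "(dh4_gen, 'k::field) rep \<Rightarrow> 'k \<Rightarrow> 'k mat" where
  "theta V t = act V gen_a + t \<cdot>\<^sub>m act V gen_d"

definition contractible_at :: "'k::field \<Rightarrow> (dh4_gen, 'k) rep \<Rightarrow> bool" where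
  "contractible_at t V \<longleftrightarrow> (\<exists>s\<in>carrier_mat (rdim V) (rdim V). theta V t * s + s * theta V t = 1\<^sub>m (rdim V))"

text \<open>The value 0 is excluded so that a module with \<open>bc = -1\<close>, on which
  \<open>theta V t\<close> squares to 2t, is contractible at every admissible \<open>t\<close>. This
  provides a common parameter for two tensor factors.\<close>

definition contractible :: "(dh4_gen, 'k::field) rep \<Rightarrow> bool" where
  "contractible V \<longleftrightarrow> (\<exists>t. t \<noteq> 0 \<and> contractible_at t V)"

lemma theta_dim[simp]: "rep_wf V \<Longrightarrow> dim_row (theta V t) = rdim V" "rep_wf V \<Longrightarrow> dim_col (theta V t) = rdim V"
  by (simp_all add: theta_def)

lemma theta_hom:
  assumes P: "P \<in> rep_hom V W" and [simp]: "rep_wf V" "rep_wf W"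
  shows "P * theta V t = theta W t * P"
  using rep_homD(1,2)[OF P] by (simp add: theta_def mat_alg rep_homD(3)[OF P])

text \<open>Homomorphisms commute with \<open>theta\<close>, so the homotopy \<open>s\<close> can be
  compressed to \<open>Q * s * P\<close>.\<close>

lemma contractible_at_retract:
  assumes c: "contractible_at t V" and P: "P \<in> rep_hom U V" and Q: "Q \<in> rep_hom V U" "Q * P = 1\<^sub>m (rdim U)"
    and [simp]: "rep_wf U" "rep_wf V"
  shows "contractible_at t U"
proof -
  obtain s where s: "s \<in> carrier_mat (rdim V) (rdim V)" "theta V t * s + s * theta V t = 1\<^sub>m (rdim V)"
    using c unfolding contractible_at_def by blast
  note [simp] = rep_homD(1,2)[OF P] rep_homD(1,2)[OF Q(1)] carrier_matD[OF s(1)]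
  have "theta U t * (Q * s * P) + (Q * s * P) * theta U t = (theta U t * Q) * s * P + Q * s * (P * theta U t)"
    by (simp add: mat_assoc)
  also have "\<dots> = Q * (theta V t * s + s * theta V t) * P"
    unfolding theta_hom[OF P assms(5,6)] theta_hom[OF Q(1) assms(6,5), symmetric] by (simp add: mat_alg)
  also have "\<dots> = 1\<^sub>m (rdim U)" unfolding s(2) by (simp add: mat_one_right Q)
  finally show ?thesis unfolding contractible_at_def
    by (intro bexI[of _ "Q * s * P"]) (auto intro!: carrier_matI)
qed

lemma contractible_at_iso:
  assumes "rep_iso V W" "rep_wf V" "rep_wf W" "contractible_at t V"
  shows "contractible_at t W"
proof -
  obtain P Q where "P \<in> rep_hom V W" "Q \<in> rep_hom W V" "P * Q = 1\<^sub>m (rdim W)"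
    using assms by (elim rep_isoE)
  then show ?thesis using contractible_at_retract[OF assms(4), of Q W P] assms by simp
qed

lemma contractible_iso:
  assumes "rep_iso V W" "rep_wf V" "rep_wf W"
  shows "contractible V \<longleftrightarrow> contractible W"
  unfolding contractible_def
  using contractible_at_iso[OF assms] contractible_at_iso[OF rep_iso_sym[OF assms] assms(3,2)] by blast

lemma contractible_at_sum:
  assumes A: "contractible_at t A" and B: "contractible_at t B" and [simp]: "rep_wf A" "rep_wf B"
  shows "contractible_at t (rep_sum A B)"
proof -
  obtain s where s: "s \<in> carrier_mat (rdim A) (rdim A)" "theta A t * s + s * theta A t = 1\<^sub>m (rdim A)"
    using A unfolding contractible_at_def by blast
  obtain s' where s': "s' \<in> carrier_mat (rdim B) (rdim B)" "theta B t * s' + s' * theta B t = 1\<^sub>m (rdim B)"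
    using B unfolding contractible_at_def by blast
  obtain i1 i2 p1 p2 where b: "biprod (rep_sum A B) A B i1 i2 p1 p2" by (rule biprod_rep_sum[of A B]) auto
  note [simp] = biprod_dims[OF b, simplified] carrier_matD[OF s(1)] carrier_matD[OF s'(1)]
  let ?X = "rep_sum A B"
  let ?s = "i1 * s * p1 + i2 * s' * p2"
  have c: "theta ?X t * i1 = i1 * theta A t" "theta ?X t * i2 = i2 * theta B t"
      "p1 * theta ?X t = theta A t * p1" "p2 * theta ?X t = theta B t * p2"
    using theta_hom[OF biprodD(1)[OF b]] theta_hom[OF biprodD(2)[OF b]] theta_hom[OF biprodD(3)[OF b]]
      theta_hom[OF biprodD(4)[OF b]] by simp_all
  have "theta ?X t * ?s + ?s * theta ?X t =
    ((theta ?X t * i1) * s * p1 + (theta ?X t * i2) * s' * p2) + (i1 * s * (p1 * theta ?X t) + i2 * s' * (p2 * theta ?X t))"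
    by (simp add: mat_alg)
  also have "\<dots> = i1 * (theta A t * s + s * theta A t) * p1 + i2 * (theta B t * s' + s' * theta B t) * p2"
    unfolding c by (simp add: mat_alg mat_add_ac)
  also have "\<dots> = 1\<^sub>m (rdim ?X)" unfolding s(2) s'(2) using biprodD(7)[OF b] by (simp add: mat_one_right)
  finally show ?thesis unfolding contractible_at_def by (intro bexI[of _ ?s]) (auto intro!: carrier_matI)
qed

lemma contractible_at_zero: "contractible_at t rep_zero"
  unfolding contractible_at_def by (intro bexI[of _ "0\<^sub>m 0 0"]) auto

lemma mat_entry_eqI:
  "A \<in> carrier_mat n m \<Longrightarrow> B \<in> carrier_mat n m \<Longrightarrow> (\<And>i j. i < n \<Longrightarrow> j < m \<Longrightarrow> A $$ (i, j) = B $$ (i, j)) \<Longrightarrow> A = B"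
  by (rule eq_matI) auto

lemma four_nonzero:
  assumes two: "(2::'k::field) \<noteq> 0"
  shows "(4::'k) \<noteq> 0" "(8::'k) \<noteq> 0" "(16::'k) \<noteq> 0"
proof -
  have mult: "x * 2 \<noteq> 0" if "x \<noteq> 0" for x :: 'k using that two unfolding mult_eq_0_iff by blast
  have "(4::'k) = 2 * 2" "(8::'k) = 2 * 2 * 2" "(16::'k) = 2 * 2 * 2 * 2" by simp_all
  then show "(4::'k) \<noteq> 0" "(8::'k) \<noteq> 0" "(16::'k) \<noteq> 0" using mult two by metis+
qed

text \<open>Averaging over the involution \<open>x\<close>, which anticommutes with \<open>\<theta>\<close>, makes a contraction odd.\<close>

lemma odd_contraction:
  fixes th :: "'k::field mat"
  assumes th: "th \<in> carrier_mat n n" and s: "s \<in> carrier_mat n n" and x: "x \<in> carrier_mat n n"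
    and two: "(2::'k) \<noteq> 0"
    and h: "th * s + s * th = 1\<^sub>m n" and xx: "x * x = 1\<^sub>m n" and anti: "x * th = - (th * x)"
  defines "s' \<equiv> (1/2) \<cdot>\<^sub>m (s - x * s * x)"
  shows "s' \<in> carrier_mat n n" "th * s' + s' * th = 1\<^sub>m n" "x * s' = - (s' * x)"
proof -
  note [simp] = carrier_matD[OF th] carrier_matD[OF s] carrier_matD[OF x]
  show s': "s' \<in> carrier_mat n n" unfolding s'_def using s x by (auto intro!: carrier_matI)
  have "th * (x * (s * x)) = - (x * th) * (s * x)" unfolding anti by (simp add: mat_alg)
  then have 1: "th * (x * (s * x)) = - (x * (th * (s * x)))" by (simp add: mat_alg)
  have "x * (s * (x * th)) = - (x * (s * (th * x)))" unfolding anti by (simp add: mat_alg)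
  then have 2: "x * s * x * th = - (x * (s * (th * x)))" by (simp add: mat_alg)
  have "x * ((th * s + s * th) * x) = 1\<^sub>m n" unfolding h by (simp add: mat_one_left xx)
  then have 3: "x * (th * (s * x)) + x * (s * (th * x)) = 1\<^sub>m n" by (simp add: mat_alg)
  have "th * s' + s' * th = (1/2) \<cdot>\<^sub>m (th * s + s * th + (x * (th * (s * x)) + x * (s * (th * x))))"
    unfolding s'_def using 1 2
    by (simp add: mat_alg) (rule eq_matI, auto simp: algebra_simps simp del: index_mult_mat(1))
  also have "\<dots> = 1\<^sub>m n" unfolding h 3 by (rule eq_matI) (auto simp: two)
  finally show "th * s' + s' * th = 1\<^sub>m n" .
  have "x * (x * (s * x)) = s * x" using mat_left[OF xx, of "s * x"] by (simp add: mat_one_left)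
  moreover have "x * s * x * x = x * s" by (simp add: mat_assoc xx mat_one_right)
  ultimately show "x * s' = - (s' * x)"
    unfolding s'_def by (simp add: mat_alg) (rule eq_matI, auto simp: field_simps simp del: index_mult_mat(1))
qed

context dh4_mats
begin

definition th :: "'k \<Rightarrow> 'k mat" where "th t = a + t \<cdot>\<^sub>m d"

lemma th_carrier: "th t \<in> carrier_mat n n" and th_dims: "dim_row (th t) = n" "dim_col (th t) = n"
  using carrier by (auto simp: th_def)

lemma b_th: "b * th t = - (th t * b)" and c_th: "c * th t = - (th t * c)"
  unfolding th_def by (simp_all add: nf) (rule eq_matI; simp add: dims del: index_mult_mat(1))+

lemma th_sq: "th t * th t = t \<cdot>\<^sub>m (1\<^sub>m n - b * c)"
  unfolding th_def by (simp add: nf) (rule eq_matI; simp add: dims algebra_simps del: index_mult_mat(1))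

end

lemma theta_th:
  assumes "V \<in> reps D_H4"
  shows "theta V t = dh4_mats.th (act V gen_a) (act V gen_d) t"
  using assms unfolding reps_D_H4_iff by (simp add: theta_def dh4_mats.th_def)

text \<open>The homotopy is averaged over \<open>b\<close> and then over \<open>c\<close>; the
  second average keeps the sign under \<open>b\<close> because \<open>b\<close> and \<open>c\<close>
  commute.\<close>

lemma odd_contractible:
  fixes V :: "(dh4_gen, 'k::field) rep"
  assumes V: "V \<in> reps D_H4" and c: "contractible_at t V" and two: "(2::'k) \<noteq> 0"
  obtains s where "s \<in> carrier_mat (rdim V) (rdim V)" "theta V t * s + s * theta V t = 1\<^sub>m (rdim V)"
    "act V gen_b * s = - (s * act V gen_b)" "act V gen_c * s = - (s * act V gen_c)"
proof -
  interpret V: dh4_mats "rdim V" "act V gen_a" "act V gen_b" "act V gen_c" "act V gen_d"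
    using V by (simp add: reps_D_H4_iff)
  let ?n = "rdim V" and ?b = "act V gen_b" and ?c = "act V gen_c"
  note th = theta_th[OF V]
  obtain s where s: "s \<in> carrier_mat ?n ?n" "V.th t * s + s * V.th t = 1\<^sub>m ?n"
    using c unfolding contractible_at_def th by blast
  define s1 where "s1 = (1/2) \<cdot>\<^sub>m (s - ?b * s * ?b)"
  note o1 = odd_contraction[OF V.th_carrier s(1) V.carrier(2) two s(2) V.rel_bb V.b_th, folded s1_def]
  define s2 where "s2 = (1/2) \<cdot>\<^sub>m (s1 - ?c * s1 * ?c)"
  note o2 = odd_contraction[OF V.th_carrier o1(1) V.carrier(3) two o1(2) V.rel_cc V.c_th, folded s2_def]
  note [simp] = V.dims carrier_matD[OF o1(1)]
  have bcl: "?b * (?c * X) = ?c * (?b * X)" if "dim_row X = ?n" for X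
    using that by (simp add: mat_assoc[symmetric] V.rel_bc del: assoc_mult_mat)
  have bsl: "?b * (s1 * X) = - (s1 * (?b * X))" if "dim_row X = ?n" for X
    using mat_left[OF o1(3), of X] that by (simp add: mat_alg)
  have "?b * s2 = - (s2 * ?b)"
    unfolding s2_def by (simp add: mat_alg bcl bsl o1(3) V.rel_bc)
      (rule eq_matI, auto simp: field_simps simp del: index_mult_mat(1))
  with o2 show ?thesis using that th by simp
qed

lemma theta_tensor:
  assumes [simp]: "rep_wf V" "rep_wf W"
  shows "theta (rep_tensor D_H4 V W) t = kronecker (act V gen_a) (act W gen_b) + t \<cdot>\<^sub>m kronecker (act V gen_d) (act W gen_c)
    + kronecker (1\<^sub>m (rdim V)) (theta W t)"
  unfolding theta_def by (simp add: act_tensor kronecker_alg) (rule eq_matI, auto simp: algebra_simps)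

text \<open>With \<open>c = b\<close> on \<open>W\<close> this is the differential of a tensor
  product of complexes, \<open>b\<close> being the sign operator.\<close>

lemma theta_tensor_eq:
  assumes [simp]: "rep_wf V" "rep_wf W" and bc: "act W gen_c = act W gen_b"
  shows "theta (rep_tensor D_H4 V W) t = kronecker (theta V t) (act W gen_b) + kronecker (1\<^sub>m (rdim V)) (theta W t)"
  unfolding theta_tensor[OF assms(1,2)] bc by (simp add: theta_def kronecker_alg)

text \<open>\<open>1 \<otimes> s\<close> works for every \<open>V\<close>: the terms with
  \<open>b\<close> and \<open>c\<close> cancel because an odd \<open>s\<close> anticommutes with
  both.\<close>

lemma contractible_at_tensor_right:
  fixes V W :: "(dh4_gen, 'k::field) rep"
  assumes V: "V \<in> reps D_H4" and W: "W \<in> reps D_H4" and c: "contractible_at t W" and two: "(2::'k) \<noteq> 0"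
  shows "contractible_at t (rep_tensor D_H4 V W)"
proof -
  note wf[simp] = reps_wf[OF V] reps_wf[OF W]
  obtain s where s: "s \<in> carrier_mat (rdim W) (rdim W)" "theta W t * s + s * theta W t = 1\<^sub>m (rdim W)"
    "act W gen_b * s = - (s * act W gen_b)" "act W gen_c * s = - (s * act W gen_c)"
    using odd_contractible[OF W c two] .
  note [simp] = carrier_matD[OF s(1)]
  let ?X = "rep_tensor D_H4 V W" and ?s = "kronecker (1\<^sub>m (rdim V)) s"
  have "theta ?X t * ?s + ?s * theta ?X t = kronecker (1\<^sub>m (rdim V)) (theta W t * s) + kronecker (1\<^sub>m (rdim V)) (s * theta W t)"
    unfolding theta_tensor[OF wf] by (simp add: mat_alg kronecker_alg s(3,4))
      (rule eq_matI, auto simp: algebra_simps simp del: index_mult_mat(1))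
  also have "\<dots> = kronecker (1\<^sub>m (rdim V)) (theta W t * s + s * theta W t)" by (simp add: kronecker_add_right)
  also have "\<dots> = 1\<^sub>m (rdim ?X)" unfolding s(2) by (simp add: kronecker_one)
  finally show ?thesis unfolding contractible_at_def by (intro bexI[of _ ?s]) (auto intro!: carrier_matI)
qed

text \<open>\<open>s \<otimes> b\<close> works because \<open>b\<close> squares to 1 and
  anticommutes with \<open>theta W t\<close>. The condition \<open>c = b\<close> is what makes
  \<open>theta V t\<close> appear as a tensor factor.\<close>

lemma contractible_at_tensor_left:
  fixes V W :: "(dh4_gen, 'k::field) rep"
  assumes V: "V \<in> reps D_H4" and W: "W \<in> reps D_H4" and c: "contractible_at t V" and bc: "act W gen_c = act W gen_b"
  shows "contractible_at t (rep_tensor D_H4 V W)"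
proof -
  note wf[simp] = reps_wf[OF V] reps_wf[OF W]
  interpret W: dh4_mats "rdim W" "act W gen_a" "act W gen_b" "act W gen_c" "act W gen_d"
    using W by (simp add: reps_D_H4_iff)
  obtain s where s: "s \<in> carrier_mat (rdim V) (rdim V)" "theta V t * s + s * theta V t = 1\<^sub>m (rdim V)"
    using c unfolding contractible_at_def by blast
  note [simp] = carrier_matD[OF s(1)]
  let ?X = "rep_tensor D_H4 V W" and ?s = "kronecker s (act W gen_b)"
  have bth: "act W gen_b * theta W t = - (theta W t * act W gen_b)" using W.b_th by (simp add: theta_th[OF W])
  have "theta ?X t * ?s + ?s * theta ?X t = kronecker (theta V t * s) (1\<^sub>m (rdim W)) + kronecker (s * theta V t) (1\<^sub>m (rdim W))"
    unfolding theta_tensor_eq[OF wf bc] by (simp add: mat_alg kronecker_alg bth W.rel_bb)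
      (rule eq_matI, auto simp: algebra_simps simp del: index_mult_mat(1))
  also have "\<dots> = kronecker (theta V t * s + s * theta V t) (1\<^sub>m (rdim W))" by (simp add: kronecker_add_left)
  also have "\<dots> = 1\<^sub>m (rdim ?X)" unfolding s(2) by (simp add: kronecker_one)
  finally show ?thesis unfolding contractible_at_def by (intro bexI[of _ ?s]) (auto intro!: carrier_matI)
qed

lemma contractible_at_bc_minus:
  fixes V :: "(dh4_gen, 'k::field) rep"
  assumes V: "V \<in> reps D_H4" and bc: "act V gen_b * act V gen_c = - 1\<^sub>m (rdim V)" and two: "(2::'k) \<noteq> 0" and t: "t \<noteq> 0"
  shows "contractible_at t V"
proof -
  interpret V: dh4_mats "rdim V" "act V gen_a" "act V gen_b" "act V gen_c" "act V gen_d"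
    using V by (simp add: reps_D_H4_iff)
  have sq: "theta V t * theta V t = (2 * t) \<cdot>\<^sub>m 1\<^sub>m (rdim V)"
    unfolding theta_th[OF V] V.th_sq bc by (rule eq_matI) auto
  \<comment> \<open>As \<open>theta V t\<close> squares to 2t, each of the two products contributes
    one half.\<close>
  let ?s = "(1 / (4 * t)) \<cdot>\<^sub>m theta V t"
  note [simp] = reps_wf[OF V]
  have "theta V t * ?s + ?s * theta V t = 1\<^sub>m (rdim V)"
    using t four_nonzero[OF two] by (simp add: mat_alg sq) (rule eq_matI, auto simp: field_simps)
  then show ?thesis unfolding contractible_at_def by (intro bexI[of _ ?s]) (auto intro!: carrier_matI)
qed

text \<open>\<open>bc\<close> is a central involution, since \<open>a\<close> and \<open>d\<close>
  anticommute with both \<open>b\<close> and \<open>c\<close>. Hence (1 + bc)/2 is an idempotent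
  endomorphism.\<close>

lemma indecomposable_bc:
  fixes V :: "(dh4_gen, 'k::field) rep"
  assumes V: "indecomposable D_H4 V" and two: "(2::'k) \<noteq> 0"
  shows "act V gen_b * act V gen_c = - 1\<^sub>m (rdim V) \<or> act V gen_c = act V gen_b"
proof -
  let ?n = "rdim V" and ?z = "act V gen_b * act V gen_c"
  interpret V: dh4_mats ?n "act V gen_a" "act V gen_b" "act V gen_c" "act V gen_d"
    using indecomposable_reps[OF V] by (simp add: reps_D_H4_iff)
  note [simp] = V.dims
  define e where "e = (1/2) \<cdot>\<^sub>m (1\<^sub>m ?n + ?z)"
  have "e \<in> rep_hom V V"
  proof (rule rep_homI)
    fix g
    show "e * act V g = act V g * e"
      unfolding e_def by (cases g) (simp_all add: V.nf)
  qed (simp add: e_def carrier_matI)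
  moreover have "e * e = e"
    unfolding e_def using two four_nonzero[OF two]
    by (simp add: V.nf) (rule eq_matI, auto simp: field_simps simp del: index_mult_mat(1))
  ultimately have e01: "e = 0\<^sub>m ?n ?n \<or> e = 1\<^sub>m ?n" by (rule indecomposable_idempotent[OF V])
  have ze: "?z = 2 \<cdot>\<^sub>m e - 1\<^sub>m ?n" unfolding e_def
    by (rule eq_matI) (auto simp: field_simps two simp del: index_mult_mat(1))
  from e01 show ?thesis
  proof
    assume e0: "e = 0\<^sub>m ?n ?n"
    have "?z = - 1\<^sub>m ?n" unfolding ze e0 by (rule eq_matI) auto
    then show ?thesis ..
  next
    assume e1: "e = 1\<^sub>m ?n"
    have "?z = 1\<^sub>m ?n" unfolding ze e1 by (rule eq_matI) auto
    then have "act V gen_b * ?z = act V gen_b" by (simp add: mat_one_right)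
    moreover have "act V gen_b * ?z = act V gen_c" by (simp add: V.nf)
    ultimately show ?thesis by simp
  qed
qed

text \<open>If \<open>bc = -1\<close> on \<open>W\<close>, then \<open>W\<close> is contractible at
  the given parameter, whichever factor that parameter came from. Otherwise \<open>c = b\<close> on
  \<open>W\<close>, and both one-sided homotopies are available.\<close>

lemma contractible_tensor:
  fixes V W :: "(dh4_gen, 'k::field) rep"
  assumes V: "V \<in> reps D_H4" and W: "indecomposable D_H4 W" and two: "(2::'k) \<noteq> 0" and c: "contractible V \<or> contractible W"
  shows "contractible (rep_tensor D_H4 V W)"
proof -
  note Wr = indecomposable_reps[OF W]
  obtain t where t: "t \<noteq> 0" "contractible_at t V \<or> contractible_at t W" using c unfolding contractible_def by blast
  have "contractible_at t (rep_tensor D_H4 V W)"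
    using indecomposable_bc[OF W two]
  proof
    assume "act W gen_b * act W gen_c = - 1\<^sub>m (rdim W)"
    then show ?thesis using contractible_at_tensor_right[OF V Wr contractible_at_bc_minus[OF Wr _ two t(1)] two] by simp
  next
    assume "act W gen_c = act W gen_b"
    then show ?thesis using t(2) contractible_at_tensor_right[OF V Wr _ two] contractible_at_tensor_left[OF V Wr] by blast
  qed
  then show ?thesis using t(1) unfolding contractible_def by blast
qed

lemma contractible_dual:
  fixes V :: "(dh4_gen, 'k::field) rep"
  assumes V: "indecomposable D_H4 V" and two: "(2::'k) \<noteq> 0" and c: "contractible V"
  shows "contractible (rep_dual D_H4 V)"
proof -
  note Vr = indecomposable_reps[OF V]
  interpret V: dh4_mats "rdim V" "act V gen_a" "act V gen_b" "act V gen_c" "act V gen_d"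
    using Vr by (simp add: reps_D_H4_iff)
  note wf[simp] = reps_wf[OF Vr] and [simp] = V.dims
  let ?n = "rdim V" and ?B = "transpose_mat (act V gen_b)"
  obtain t where t: "t \<noteq> 0" "contractible_at t V" using c unfolding contractible_def by blast
  have "contractible_at t (rep_dual D_H4 V)"
    using indecomposable_bc[OF V two]
  proof
    assume "act V gen_b * act V gen_c = - 1\<^sub>m ?n"
    then have "transpose_mat (act V gen_c * act V gen_b) = transpose_mat (- 1\<^sub>m ?n)" by (simp add: V.rel_bc)
    then have "act (rep_dual D_H4 V) gen_b * act (rep_dual D_H4 V) gen_c = - 1\<^sub>m (rdim (rep_dual D_H4 V))"
      by (simp add: act_dual mat_transpose_mult transpose_uminus)
    then show ?thesis by (rule contractible_at_bc_minus[OF reps_dual[OF Vr] _ two t(1)])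
  next
    assume bc: "act V gen_c = act V gen_b"
    obtain s where s: "s \<in> carrier_mat ?n ?n" "theta V t * s + s * theta V t = 1\<^sub>m ?n"
      "act V gen_b * s = - (s * act V gen_b)" "act V gen_c * s = - (s * act V gen_c)"
      using odd_contractible[OF Vr t(2) two] .
    note [simp] = carrier_matD[OF s(1)]
    let ?T = "transpose_mat (theta V t)" and ?S = "transpose_mat s"
    have BB: "?B * ?B = 1\<^sub>m ?n" using V.rel_bb by (simp add: mat_transpose_mult[symmetric])
    have "act V gen_b * theta V t = - (theta V t * act V gen_b)" using V.b_th by (simp add: theta_th[OF Vr])
    then have TB: "?T * ?B = - (?B * ?T)"
      by (simp add: mat_transpose_mult[symmetric] transpose_uminus)
    have SB: "?S * ?B = - (?B * ?S)"
      using s(3) by (simp add: mat_transpose_mult[symmetric] transpose_uminus)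
    let ?A = "transpose_mat (act V gen_a)" and ?D = "transpose_mat (act V gen_d)"
    have T: "?T = ?A + t \<cdot>\<^sub>m ?D"
      unfolding theta_def by (rule eq_matI) auto
    have "?B * ?T = ?B * ?A + t \<cdot>\<^sub>m (?B * ?D)"
      unfolding T by (simp add: mat_distrib_left mat_smult_right)
    \<comment> \<open>Up to the factor \<open>- ?B\<close> the operator on the dual is the
      transpose; the signs in \<open>TB\<close> and \<open>SB\<close> then make
      \<open>?B * ?S\<close> a contraction.\<close>
    then have TT: "theta (rep_dual D_H4 V) t = - (?B * ?T)"
      unfolding theta_def[of "rep_dual D_H4 V"] act_dual[OF wf(1)] bc
      by (auto intro!: eq_matI simp del: index_mult_mat(1))
    have h: "?S * ?T + ?T * ?S = 1\<^sub>m ?n"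
    proof -
      have "transpose_mat (theta V t * s + s * theta V t) = transpose_mat (theta V t * s) + transpose_mat (s * theta V t)"
        by (rule transpose_add[of _ ?n ?n]) (auto intro!: carrier_matI)
      also have "\<dots> = ?S * ?T + ?T * ?S" by (simp add: mat_transpose_mult)
      finally show ?thesis unfolding s(2) by simp
    qed
    have "theta (rep_dual D_H4 V) t * (?B * ?S) + (?B * ?S) * theta (rep_dual D_H4 V) t = ?S * ?T + ?T * ?S"
      unfolding TT by (simp add: mat_alg TB SB mat_left[OF TB] mat_left[OF SB] mat_left[OF BB])
        (rule mat_add_comm, simp_all)
    then show ?thesis unfolding contractible_at_def h
      by (intro bexI[of _ "?B * ?S"]) (auto intro!: carrier_matI)
  qed
  then show ?thesis using t(1) unfolding contractible_def by blast
qed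

section \<open>Dependence of contractibility on the parameter\<close>

text \<open>A kernel vector of 1 + xF is an eigenvector of \<open>F\<close> for -1/x; at x = 0 the
  matrix is the identity.\<close>

lemma finite_singular:
  fixes F :: "'k::field mat"
  assumes F: "F \<in> carrier_mat n n"
  shows "finite {x. det (1\<^sub>m n + x \<cdot>\<^sub>m F) = 0}"
proof (rule finite_subset)
  have "char_poly F \<noteq> 0" using degree_monic_char_poly[OF F] by auto
  then show "finite ((\<lambda>k. - 1 / k) ` {k. poly (char_poly F) k = 0})" by (intro finite_imageI poly_roots_finite)
  show "{x. det (1\<^sub>m n + x \<cdot>\<^sub>m F) = 0} \<subseteq> (\<lambda>k. - 1 / k) ` {k. poly (char_poly F) k = 0}"
  proof
    fix x assume "x \<in> {x. det (1\<^sub>m n + x \<cdot>\<^sub>m F) = 0}"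
    moreover have E: "1\<^sub>m n + x \<cdot>\<^sub>m F \<in> carrier_mat n n" using F by auto
    ultimately obtain v where v: "v \<in> carrier_vec n" "v \<noteq> 0\<^sub>v n" "(1\<^sub>m n + x \<cdot>\<^sub>m F) *\<^sub>v v = 0\<^sub>v n"
      using det_0_iff_vec_prod_zero_field[OF E] by auto
    have "(x \<cdot>\<^sub>m F) *\<^sub>v v = x \<cdot>\<^sub>v (F *\<^sub>v v)" using v(1) F by (intro eq_vecI) auto
    then have eq: "v + x \<cdot>\<^sub>v (F *\<^sub>v v) = 0\<^sub>v n"
      using v F by (simp add: add_mult_distrib_mat_vec[of _ n n])
    have x0: "x \<noteq> 0"
    proof
      assume "x = 0"
      then have "v = 0\<^sub>v n" using eq v(1) F by (auto simp: vec_eq_iff)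
      with v(2) show False ..
    qed
    have "F *\<^sub>v v = (- 1 / x) \<cdot>\<^sub>v v"
    proof (rule eq_vecI)
      fix i assume "i < dim_vec ((- 1 / x) \<cdot>\<^sub>v v)"
      then have i: "i < n" using v(1) by simp
      have "(v + x \<cdot>\<^sub>v (F *\<^sub>v v)) $ i = 0" using eq i by simp
      then have "v $ i + x * (F *\<^sub>v v) $ i = 0" using i v(1) F by (simp del: index_mult_mat_vec)
      then show "(F *\<^sub>v v) $ i = ((- 1 / x) \<cdot>\<^sub>v v) $ i"
        using x0 i v(1) by (simp add: field_simps eq_neg_iff_add_eq_0 del: index_mult_mat_vec)
    qed (use v(1) F in auto)
    then have "eigenvalue F (- 1 / x)" using v F unfolding eigenvalue_def eigenvector_def by auto
    then have "poly (char_poly F) (- 1 / x) = 0" using eigenvalue_root_char_poly[OF F] by simp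
    then show "x \<in> (\<lambda>k. - 1 / k) ` {k. poly (char_poly F) k = 0}"
      using x0 by (intro image_eqI[of _ _ "- 1 / x"]) auto
  qed
qed

text \<open>If \<open>s\<close> contracts \<open>\<theta>\<^sub>u\<close>, then \<open>\<theta>\<^sub>t s + s \<theta>\<^sub>t\<close> commutes with \<open>\<theta>\<^sub>t\<close> and is affine linear in \<open>t\<close>, with value 1 at \<open>t = u\<close>.\<close>

lemma contractible_generic:
  fixes V :: "(dh4_gen, 'k::field) rep"
  assumes V: "indecomposable D_H4 V" and two: "(2::'k) \<noteq> 0" and c: "contractible V"
  shows "finite {t. \<not> contractible_at t V}"
  using indecomposable_bc[OF V two]
proof
  assume "act V gen_b * act V gen_c = - 1\<^sub>m (rdim V)"
  then have "{t. \<not> contractible_at t V} \<subseteq> {0}"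
    using contractible_at_bc_minus[OF indecomposable_reps[OF V] _ two] by blast
  then show ?thesis by (rule finite_subset) simp
next
  note Vr = indecomposable_reps[OF V]
  interpret V: dh4_mats "rdim V" "act V gen_a" "act V gen_b" "act V gen_c" "act V gen_d"
    using Vr by (simp add: reps_D_H4_iff)
  let ?n = "rdim V"
  assume bc: "act V gen_c = act V gen_b"
  obtain u where "contractible_at u V" using c unfolding contractible_def by blast
  then obtain s where s: "s \<in> carrier_mat ?n ?n" "theta V u * s + s * theta V u = 1\<^sub>m ?n"
    unfolding contractible_at_def by blast
  note [simp] = carrier_matD[OF s(1)] V.dims reps_wf[OF Vr]
  define F where "F = act V gen_d * s + s * act V gen_d"
  have F: "F \<in> carrier_mat ?n ?n" unfolding F_def by (auto intro!: carrier_matI)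
  have "contractible_at t V" if t: "det (1\<^sub>m ?n + (t - u) \<cdot>\<^sub>m F) \<noteq> 0" for t
  proof -
    let ?E = "1\<^sub>m ?n + (t - u) \<cdot>\<^sub>m F"
    have E: "?E = theta V t * s + s * theta V t"
      unfolding s(2)[symmetric] F_def theta_def
      by (simp add: mat_alg) (rule eq_matI, auto simp: algebra_simps simp del: index_mult_mat(1))
    have sq: "theta V t * theta V t = 0\<^sub>m ?n ?n"
      unfolding theta_th[OF Vr] V.th_sq bc by (simp add: V.rel_bb mat_diff_self)
    have comm: "theta V t * ?E = ?E * theta V t"
      unfolding E by (simp add: mat_alg sq mat_left[OF sq])
    have Ec: "?E \<in> carrier_mat ?n ?n" using F by auto
    obtain W where W: "W \<in> carrier_mat ?n ?n" "?E * W = 1\<^sub>m ?n" "W * ?E = 1\<^sub>m ?n"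
      by (rule det_nonzero_inverse[OF Ec t])
    note [simp] = carrier_matD[OF W(1)] carrier_matD[OF F]
    have "W * theta V t = W * theta V t * (?E * W)" unfolding W(2) by (simp add: mat_one_right)
    also have "\<dots> = W * (theta V t * ?E) * W" by (simp add: mat_assoc)
    also have "\<dots> = (W * ?E) * theta V t * W" unfolding comm by (simp add: mat_assoc)
    also have "\<dots> = theta V t * W" unfolding W(3) by (simp add: mat_one_left)
    finally have WT: "W * theta V t = theta V t * W" .
    \<comment> \<open>\<open>s\<close> contracts up to the factor \<open>?E\<close>, whose inverse
      \<open>W\<close> commutes with \<open>theta V t\<close>.\<close>
    have "theta V t * (s * W) + (s * W) * theta V t = (theta V t * s + s * theta V t) * W"
      by (simp add: mat_alg WT)
    also have "\<dots> = 1\<^sub>m ?n" unfolding E[symmetric] by (rule W(2))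
    finally show ?thesis unfolding contractible_at_def
      by (intro bexI[of _ "s * W"]) (auto intro!: carrier_matI)
  qed
  then have "t \<in> (\<lambda>x. x + u) ` {x. det (1\<^sub>m ?n + x \<cdot>\<^sub>m F) = 0}" if "\<not> contractible_at t V" for t
    using that by (intro image_eqI[of _ _ "t - u"]) auto
  then have "{t. \<not> contractible_at t V} \<subseteq> (\<lambda>x. x + u) ` {x. det (1\<^sub>m ?n + x \<cdot>\<^sub>m F) = 0}" by auto
  then show ?thesis by (rule finite_subset) (intro finite_imageI finite_singular[OF F])
qed


section \<open>Homology classes\<close>

definition poly_col :: "nat \<Rightarrow> (nat \<Rightarrow> 'k::field poly) \<Rightarrow> 'k \<Rightarrow> 'k mat" where
  "poly_col n v t = mat n 1 (\<lambda>(i, j). poly (v i) t)"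

definition poly_row :: "nat \<Rightarrow> (nat \<Rightarrow> 'k::field poly) \<Rightarrow> 'k \<Rightarrow> 'k mat" where
  "poly_row n v t = mat 1 n (\<lambda>(i, j). poly (v j) t)"

text \<open>A cycle \<open>v\<close> of degree at most \<open>p\<close> in the parameter of \<open>\<theta>\<close> and a cocycle \<open>f\<close> of degree at most \<open>q\<close>
  pairing nontrivially with it.\<close>

definition class_bound :: "nat \<Rightarrow> nat \<Rightarrow> (dh4_gen, 'k::field) rep \<Rightarrow> bool" where
  "class_bound p q V \<longleftrightarrow> (\<exists>v f. (\<forall>i. degree (v i) \<le> p \<and> degree (f i) \<le> q) \<and>
     (\<forall>t. theta V t * poly_col (rdim V) v t = 0\<^sub>m (rdim V) 1 \<and> poly_row (rdim V) f t * theta V t = 0\<^sub>m 1 (rdim V)) \<and>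
     (\<Sum>i<rdim V. f i * v i) \<noteq> 0)"

lemma poly_col_dim[simp]: "dim_row (poly_col n v t) = n" "dim_col (poly_col n v t) = 1"
  and poly_row_dim[simp]: "dim_row (poly_row n v t) = 1" "dim_col (poly_row n v t) = n"
  by (simp_all add: poly_col_def poly_row_def)

lemma poly_row_col: "poly_row n f t * poly_col n v t = mat 1 1 (\<lambda>_. poly (\<Sum>i<n. f i * v i) t)"
  by (rule eq_matI) (auto simp: poly_row_def poly_col_def scalar_prod_def poly_sum lessThan_atLeast0)

lemma poly_col_tensor: "poly_col (n * m) (\<lambda>i. v (i div m) * w (i mod m)) t = kronecker (poly_col n v t) (poly_col m w t)"
  by (rule eq_matI) (auto simp: kronecker_entry poly_col_def kronecker_bounds)

lemma poly_row_tensor: "poly_row (n * m) (\<lambda>i. v (i div m) * w (i mod m)) t = kronecker (poly_row n v t) (poly_row m w t)"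
  by (rule eq_matI) (auto simp: kronecker_entry poly_row_def kronecker_bounds)

text \<open>v \<otimes> w and f \<otimes> g are again a cycle and a cocycle, and degrees add. Their
  pairing is the product of the two pairings, nonzero because polynomials over a field form a
  domain.\<close>

lemma class_bound_tensor:
  assumes V: "V \<in> reps D_H4" and W: "W \<in> reps D_H4" and bc: "act W gen_c = act W gen_b"
    and cV: "class_bound p q V" and cW: "class_bound p' q' W"
  shows "class_bound (p + p') (q + q') (rep_tensor D_H4 V W)"
proof -
  note wf[simp] = reps_wf[OF V] reps_wf[OF W]
  let ?n = "rdim V" and ?m = "rdim W"
  obtain v f where v: "\<forall>i. degree (v i) \<le> p \<and> degree (f i) \<le> q"
    "\<forall>t. theta V t * poly_col ?n v t = 0\<^sub>m ?n 1 \<and> poly_row ?n f t * theta V t = 0\<^sub>m 1 ?n"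
    "(\<Sum>i<?n. f i * v i) \<noteq> 0"
    using cV unfolding class_bound_def by blast
  obtain w g where w: "\<forall>i. degree (w i) \<le> p' \<and> degree (g i) \<le> q'"
    "\<forall>t. theta W t * poly_col ?m w t = 0\<^sub>m ?m 1 \<and> poly_row ?m g t * theta W t = 0\<^sub>m 1 ?m"
    "(\<Sum>i<?m. g i * w i) \<noteq> 0"
    using cW unfolding class_bound_def by blast
  have "(\<Sum>i<?n * ?m. (f (i div ?m) * g (i mod ?m)) * (v (i div ?m) * w (i mod ?m))) = (\<Sum>i<?n. f i * v i) * (\<Sum>i<?m. g i * w i)"
    using sum_div_mod[of "\<lambda>i j. (f i * g j) * (v i * w j)" ?m ?n] by (simp add: sum_product mult_ac)
  then have "(\<Sum>i<?n * ?m. (f (i div ?m) * g (i mod ?m)) * (v (i div ?m) * w (i mod ?m))) \<noteq> 0"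
    using v(3) w(3) by simp
  moreover have "degree (v i * w j) \<le> p + p'" "degree (f i * g j) \<le> q + q'" for i j
    using degree_mult_le[of "v i" "w j"] degree_mult_le[of "f i" "g j"] v(1) w(1)
    by (meson add_mono order_trans)+
  moreover have "theta (rep_tensor D_H4 V W) t * kronecker (poly_col ?n v t) (poly_col ?m w t) = 0\<^sub>m (?n * ?m) 1"
    "kronecker (poly_row ?n f t) (poly_row ?m g t) * theta (rep_tensor D_H4 V W) t = 0\<^sub>m 1 (?n * ?m)" for t
    unfolding theta_tensor_eq[OF wf bc] using v(2) w(2) by (simp_all add: mat_alg kronecker_alg)
  ultimately show ?thesis unfolding class_bound_def
    by (intro exI[of _ "\<lambda>i. v (i div ?m) * w (i mod ?m)"] exI[of _ "\<lambda>i. f (i div ?m) * g (i mod ?m)"])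
      (simp add: poly_col_tensor poly_row_tensor)
qed

text \<open>Between a cocycle and a cycle both terms of the homotopy identity vanish.\<close>

lemma contractible_pairing_zero:
  fixes V :: "(dh4_gen, 'k::field) rep"
  assumes c: "contractible_at t V" and [simp]: "rep_wf V"
    and x: "x \<in> carrier_mat (rdim V) 1" "theta V t * x = 0\<^sub>m (rdim V) 1"
    and y: "y \<in> carrier_mat 1 (rdim V)" "y * theta V t = 0\<^sub>m 1 (rdim V)"
  shows "y * x = 0\<^sub>m 1 1"
proof -
  obtain s where s: "s \<in> carrier_mat (rdim V) (rdim V)" "theta V t * s + s * theta V t = 1\<^sub>m (rdim V)"
    using c unfolding contractible_at_def by blast
  note [simp] = carrier_matD[OF s(1)] carrier_matD[OF x(1)] carrier_matD[OF y(1)]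
  have "y * x = y * (theta V t * s + s * theta V t) * x" unfolding s(2) by (simp add: mat_one_right)
  also have "\<dots> = (y * theta V t) * s * x + y * s * (theta V t * x)" by (simp add: mat_alg)
  also have "\<dots> = 0\<^sub>m 1 1" unfolding x(2) y(2) by (simp add: mat_alg)
  finally show ?thesis .
qed

lemma poly_zero_cofinite:
  fixes p :: "'k::field poly"
  assumes "infinite (UNIV :: 'k set)" "finite S" "\<And>t. t \<notin> S \<Longrightarrow> poly p t = 0"
  shows "p = 0"
proof (rule ccontr)
  assume "p \<noteq> 0"
  then have "finite {t. poly p t = 0}" by (rule poly_roots_finite)
  moreover have "UNIV \<subseteq> {t. poly p t = 0} \<union> S" using assms(3) by auto
  ultimately show False using assms(1,2) by (meson finite_Un finite_subset)
qed

text \<open>The pairing is a single polynomial; it would vanish at all but finitely many points,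
  hence identically.\<close>

lemma class_bound_not_contractible:
  fixes V :: "(dh4_gen, 'k::field) rep"
  assumes inf: "infinite (UNIV :: 'k set)" and [simp]: "rep_wf V" and cb: "class_bound p q V"
    and fin: "finite {t. \<not> contractible_at t V}"
  shows False
proof -
  let ?n = "rdim V"
  obtain v f where v: "\<forall>t. theta V t * poly_col ?n v t = 0\<^sub>m ?n 1 \<and> poly_row ?n f t * theta V t = 0\<^sub>m 1 ?n"
    "(\<Sum>i<?n. f i * v i) \<noteq> 0"
    using cb unfolding class_bound_def by blast
  have "(\<Sum>i<?n. f i * v i) = 0"
  proof (rule poly_zero_cofinite[OF inf fin])
    fix t assume "t \<notin> {t. \<not> contractible_at t V}"
    then have "poly_row ?n f t * poly_col ?n v t = 0\<^sub>m 1 1"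
      using v(1) by (intro contractible_pairing_zero[of t V]) (auto intro!: carrier_matI)
    then have "(poly_row ?n f t * poly_col ?n v t) $$ (0, 0) = 0" by simp
    then show "poly (\<Sum>i<?n. f i * v i) t = 0" unfolding poly_row_col by simp
  qed
  with v(2) show False ..
qed

text \<open>The cycle is projected to \<open>U\<close> and the cocycle restricted to it by constant
  matrices, so degrees do not grow. The part of the pairing through \<open>Z\<close> vanishes for
  almost all \<open>t\<close>, so the part through \<open>U\<close> cannot vanish
  identically.\<close>

lemma class_bound_summand:
  fixes M :: "(dh4_gen, 'k::field) rep"
  assumes inf: "infinite (UNIV :: 'k set)" and [simp]: "rep_wf M" "rep_wf U" "rep_wf Z"
    and iso: "rep_iso M (rep_sum U Z)" and cb: "class_bound p q M"
    and fin: "finite {t. \<not> contractible_at t Z}"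
  shows "class_bound p q U"
proof -
  let ?n = "rdim M" and ?m = "rdim U"
  obtain i1 i2 p1 p2 where b: "biprod M U Z i1 i2 p1 p2" using iso by (auto simp: rep_iso_sum_iff)
  note [simp] = biprod_dims[OF b]
  obtain v f where v: "\<forall>i. degree (v i) \<le> p \<and> degree (f i) \<le> q"
    "\<And>t. theta M t * poly_col ?n v t = 0\<^sub>m ?n 1" "\<And>t. poly_row ?n f t * theta M t = 0\<^sub>m 1 ?n"
    "(\<Sum>i<?n. f i * v i) \<noteq> 0"
    using cb unfolding class_bound_def by blast
  define w where "w i = (\<Sum>j<?n. Polynomial.smult (p1 $$ (i, j)) (v j))" for i
  define g where "g i = (\<Sum>j<?n. Polynomial.smult (i1 $$ (j, i)) (f j))" for i
  have w: "poly_col ?m w t = p1 * poly_col ?n v t" for t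
    by (rule eq_matI) (auto simp: poly_col_def w_def poly_sum scalar_prod_def lessThan_atLeast0)
  have g: "poly_row ?m g t = poly_row ?n f t * i1" for t
    by (rule eq_matI) (auto simp: poly_row_def g_def poly_sum scalar_prod_def lessThan_atLeast0 mult.commute)
  have "theta U t * (p1 * poly_col ?n v t) = 0\<^sub>m ?m 1" for t
  proof -
    have "theta U t * (p1 * poly_col ?n v t) = p1 * (theta M t * poly_col ?n v t)"
      using theta_hom[OF biprodD(3)[OF b], of t] by (simp add: mat_assoc[symmetric] del: assoc_mult_mat)
    then show ?thesis by (simp add: v mat_zero_right)
  qed
  moreover have "poly_row ?n f t * i1 * theta U t = 0\<^sub>m 1 ?m" for t
  proof -
    have "poly_row ?n f t * i1 * theta U t = (poly_row ?n f t * theta M t) * i1"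
      using theta_hom[OF biprodD(1)[OF b], of t] by (simp add: mat_assoc)
    then show ?thesis by (simp add: v mat_zero_left)
  qed
  moreover have "(\<Sum>i<?m. g i * w i) \<noteq> 0"
  proof
    assume 0: "(\<Sum>i<?m. g i * w i) = 0"
    have "(\<Sum>i<?n. f i * v i) = 0"
    proof (rule poly_zero_cofinite[OF inf fin])
      fix t assume t: "t \<notin> {t. \<not> contractible_at t Z}"
      let ?v = "poly_col ?n v t" and ?f = "poly_row ?n f t"
      have "theta Z t * (p2 * ?v) = p2 * (theta M t * ?v)"
        using theta_hom[OF biprodD(4)[OF b], of t] by (simp add: mat_assoc[symmetric] del: assoc_mult_mat)
      then have z1: "theta Z t * (p2 * ?v) = 0\<^sub>m (rdim Z) 1" by (simp add: v mat_zero_right)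
      have "?f * i2 * theta Z t = (?f * theta M t) * i2"
        using theta_hom[OF biprodD(2)[OF b], of t] by (simp add: mat_assoc)
      then have z2: "?f * i2 * theta Z t = 0\<^sub>m 1 (rdim Z)" by (simp add: v mat_zero_left)
      have z: "(?f * i2) * (p2 * ?v) = 0\<^sub>m 1 1"
        by (rule contractible_pairing_zero[of t Z]) (use t z1 z2 in \<open>auto intro!: carrier_matI\<close>)
      have "(?f * i1) * (p1 * ?v) = mat 1 1 (\<lambda>_. poly (\<Sum>i<?m. g i * w i) t)"
        unfolding w[symmetric] g[symmetric] by (rule poly_row_col)
      then have u: "(?f * i1) * (p1 * ?v) = 0\<^sub>m 1 1" unfolding 0 by (auto intro!: eq_matI)
      have "?f * ?v = ?f * (i1 * p1 + i2 * p2) * ?v" unfolding biprodD[OF b] by (simp add: mat_one_right)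
      also have "\<dots> = (?f * i1) * (p1 * ?v) + (?f * i2) * (p2 * ?v)" by (simp add: mat_alg)
      also have "\<dots> = 0\<^sub>m 1 1" unfolding u z by (simp add: mat_add_zero)
      finally have "(?f * ?v) $$ (0, 0) = 0" by simp
      then show "poly (\<Sum>i<?n. f i * v i) t = 0" unfolding poly_row_col by simp
    qed
    with v(4) show False ..
  qed
  moreover have "degree (w i) \<le> p" "degree (g i) \<le> q" for i
    unfolding w_def g_def using v(1) by (auto intro!: degree_sum_le order_trans[OF degree_smult_le])
  ultimately show ?thesis unfolding class_bound_def
    by (intro exI[of _ w] exI[of _ g]) (simp add: w g)
qed

section \<open>Homology at the parameter 0\<close>

text \<open>For the differential \<open>a\<close> the identity is homotopic to the rank one
  projection \<open>v * f\<close>, so the homology is one-dimensional. Explicit homotopies avoid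
  homology spaces and pass directly to tensor products.\<close>

definition rank_one_at_zero :: "(dh4_gen, 'k::field) rep \<Rightarrow> bool" where
  "rank_one_at_zero V \<longleftrightarrow> (\<exists>v f s. v \<in> carrier_mat (rdim V) 1 \<and> f \<in> carrier_mat 1 (rdim V) \<and> s \<in> carrier_mat (rdim V) (rdim V) \<and>
     act V gen_a * v = 0\<^sub>m (rdim V) 1 \<and> f * act V gen_a = 0\<^sub>m 1 (rdim V) \<and> f * v = 1\<^sub>m 1 \<and>
     1\<^sub>m (rdim V) - v * f = act V gen_a * s + s * act V gen_a)"

lemma rank_one_iso:
  assumes iso: "rep_iso V W" and [simp]: "rep_wf V" "rep_wf W" and r: "rank_one_at_zero V"
  shows "rank_one_at_zero W"
proof -
  obtain P Q where PQ: "P \<in> rep_hom V W" "Q \<in> rep_hom W V" "Q * P = 1\<^sub>m (rdim V)" "P * Q = 1\<^sub>m (rdim W)"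
    using iso assms(2,3) by (rule rep_isoE)
  obtain v f s where v: "v \<in> carrier_mat (rdim V) 1" "f \<in> carrier_mat 1 (rdim V)" "s \<in> carrier_mat (rdim V) (rdim V)"
     "act V gen_a * v = 0\<^sub>m (rdim V) 1" "f * act V gen_a = 0\<^sub>m 1 (rdim V)" "f * v = 1\<^sub>m 1"
     "1\<^sub>m (rdim V) - v * f = act V gen_a * s + s * act V gen_a"
    using r unfolding rank_one_at_zero_def by blast
  note [simp] = rep_homD(1,2)[OF PQ(1)] rep_homD(1,2)[OF PQ(2)] carrier_matD[OF v(1)] carrier_matD[OF v(2)] carrier_matD[OF v(3)]
  let ?a = "act V gen_a" and ?a' = "act W gen_a"
  have aP: "?a' * P = P * ?a" and aQ: "Q * ?a' = ?a * Q" using rep_homD(3)[OF PQ(1)] rep_homD(3)[OF PQ(2)] by simp_all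
  have "?a' * (P * v) = P * (?a * v)" using aP by (simp add: mat_assoc[symmetric] del: assoc_mult_mat)
  then have 1: "?a' * (P * v) = 0\<^sub>m (rdim W) 1" by (simp add: v mat_zero_right)
  have "f * Q * ?a' = (f * ?a) * Q" by (simp add: mat_assoc aQ)
  then have 2: "f * Q * ?a' = 0\<^sub>m 1 (rdim W)" by (simp add: v mat_zero_left)
  have 3: "f * Q * (P * v) = 1\<^sub>m 1" by (simp add: mat_assoc mat_cancel[OF PQ(3)] v)
  have "1\<^sub>m (rdim W) - (P * v) * (f * Q) = P * (1\<^sub>m (rdim V) - v * f) * Q" by (simp add: mat_alg PQ)
  also have "\<dots> = (P * ?a) * s * Q + P * s * (?a * Q)" unfolding v(7) by (simp add: mat_alg)
  also have "\<dots> = ?a' * (P * s * Q) + (P * s * Q) * ?a'" unfolding aP[symmetric] aQ[symmetric] by (simp add: mat_alg)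
  finally show ?thesis unfolding rank_one_at_zero_def
    by (intro exI[of _ "P * v"] exI[of _ "f * Q"] exI[of _ "P * s * Q"]) (use 1 2 3 in \<open>auto intro!: carrier_matI\<close>)
qed

text \<open>A Kuenneth formula at the level of homotopies. The action of \<open>a\<close> on a
  tensor product involves \<open>b\<close> but not \<open>c\<close>, so it applies to arbitrary
  \<open>V\<close> and \<open>W\<close>.\<close>

lemma rank_one_tensor:
  assumes V: "V \<in> reps D_H4" and W: "W \<in> reps D_H4"
    and rV: "rank_one_at_zero V" and rW: "rank_one_at_zero W"
  shows "rank_one_at_zero (rep_tensor D_H4 V W)"
proof -
  note wf[simp] = reps_wf[OF V] reps_wf[OF W]
  interpret W: dh4_mats "rdim W" "act W gen_a" "act W gen_b" "act W gen_c" "act W gen_d"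
    using W by (simp add: reps_D_H4_iff)
  let ?n = "rdim V" and ?m = "rdim W" and ?a = "act V gen_a" and ?a' = "act W gen_a" and ?b = "act W gen_b"
  obtain v f s where v: "v \<in> carrier_mat ?n 1" "f \<in> carrier_mat 1 ?n" "s \<in> carrier_mat ?n ?n"
     "?a * v = 0\<^sub>m ?n 1" "f * ?a = 0\<^sub>m 1 ?n" "f * v = 1\<^sub>m 1" "1\<^sub>m ?n - v * f = ?a * s + s * ?a"
    using rV unfolding rank_one_at_zero_def by blast
  obtain w g r where w: "w \<in> carrier_mat ?m 1" "g \<in> carrier_mat 1 ?m" "r \<in> carrier_mat ?m ?m"
     "?a' * w = 0\<^sub>m ?m 1" "g * ?a' = 0\<^sub>m 1 ?m" "g * w = 1\<^sub>m 1" "1\<^sub>m ?m - w * g = ?a' * r + r * ?a'"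
    using rW unfolding rank_one_at_zero_def by blast
  note [simp] = carrier_matD[OF v(1)] carrier_matD[OF v(2)] carrier_matD[OF v(3)]
    carrier_matD[OF w(1)] carrier_matD[OF w(2)] carrier_matD[OF w(3)]
  let ?A = "kronecker ?a ?b + kronecker (1\<^sub>m ?n) ?a'"
  \<comment> \<open>The first term reduces the left factor to the line of \<open>v\<close>; the
    second then reduces the right factor to the line of \<open>w\<close>.\<close>
  let ?S = "kronecker s ?b + kronecker (v * f) r"
  have 1: "?A * kronecker v w = 0\<^sub>m (?n * ?m) 1" "kronecker f g * ?A = 0\<^sub>m 1 (?n * ?m)"
    by (simp_all add: mat_alg kronecker_alg v w)
  have 2: "kronecker f g * kronecker v w = 1\<^sub>m 1" by (simp add: kronecker_mult v w kronecker_one)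
  have "?A * ?S + ?S * ?A = kronecker (?a * s + s * ?a) (1\<^sub>m ?m) + kronecker (v * f) (?a' * r + r * ?a')"
    by (simp add: mat_alg kronecker_alg v mat_left[OF v(4)] W.rel_ba W.rel_bb)
      (rule eq_matI, auto simp: algebra_simps simp del: index_mult_mat(1))
  also have "\<dots> = 1\<^sub>m (?n * ?m) - kronecker v w * kronecker f g"
    unfolding v(7)[symmetric] w(7)[symmetric]
    by (simp add: mat_alg kronecker_alg) (rule eq_matI, auto simp: algebra_simps simp del: index_mult_mat(1))
  finally have 3: "1\<^sub>m (?n * ?m) - kronecker v w * kronecker f g = ?A * ?S + ?S * ?A" by simp
  show ?thesis unfolding rank_one_at_zero_def act_tensor[OF wf] rdim_tensor
    by (intro exI[of _ "kronecker v w"] exI[of _ "kronecker f g"] exI[of _ ?S]) (use 1 2 3 in \<open>auto intro!: carrier_matI\<close>)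
qed

text \<open>On \<open>M\<close> the pairing of cocycles with cycles factors through \<open>v\<close>
  and \<open>f\<close>, so it has rank one. Classes on two summands would give GX = 1, KY = 1 and GY
  = 0, which a form of rank one does not allow.\<close>

lemma rank_one_two_summands:
  fixes M :: "(dh4_gen, 'k::field) rep"
  assumes M: "rank_one_at_zero M" and U: "rank_one_at_zero U" and U': "rank_one_at_zero U'"
    and [simp]: "rep_wf M" "rep_wf U" "rep_wf U'" "rep_wf Z"
    and iso: "rep_iso M (rep_sum U (rep_sum U' Z))"
  shows False
proof -
  obtain i1 j p1 q where b: "biprod M U (rep_sum U' Z) i1 j p1 q" using iso by (auto simp: rep_iso_sum_iff)
  obtain i2 i3 p2 p3 where c: "biprod (rep_sum U' Z) U' Z i2 i3 p2 p3" by (rule biprod_rep_sum[of U' Z]) auto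
  obtain v f s where v: "v \<in> carrier_mat (rdim M) 1" "f \<in> carrier_mat 1 (rdim M)" "s \<in> carrier_mat (rdim M) (rdim M)"
     "1\<^sub>m (rdim M) - v * f = act M gen_a * s + s * act M gen_a"
    using M unfolding rank_one_at_zero_def by blast
  obtain x g where x: "x \<in> carrier_mat (rdim U) 1" "g \<in> carrier_mat 1 (rdim U)"
     "act U gen_a * x = 0\<^sub>m (rdim U) 1" "g * act U gen_a = 0\<^sub>m 1 (rdim U)" "g * x = 1\<^sub>m 1"
    using U unfolding rank_one_at_zero_def by blast
  obtain y h where y: "y \<in> carrier_mat (rdim U') 1" "h \<in> carrier_mat 1 (rdim U')"
     "act U' gen_a * y = 0\<^sub>m (rdim U') 1" "h * act U' gen_a = 0\<^sub>m 1 (rdim U')" "h * y = 1\<^sub>m 1"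
    using U' unfolding rank_one_at_zero_def by blast
  define X where "X = i1 * x"
  define G where "G = g * p1"
  define Y where "Y = j * i2 * y"
  define K where "K = h * p2 * q"
  note [simp] = carrier_matD[OF v(1)] carrier_matD[OF v(2)] carrier_matD[OF v(3)] carrier_matD[OF x(1)] carrier_matD[OF x(2)]
    carrier_matD[OF y(1)] carrier_matD[OF y(2)] biprod_dims[OF b, simplified] biprod_dims[OF c, simplified]
  note bd = biprodD[OF b, simplified] and cd = biprodD[OF c, simplified]
  let ?a = "act M gen_a"
  have cyc: "X \<in> carrier_mat (rdim M) 1" "Y \<in> carrier_mat (rdim M) 1" "G \<in> carrier_mat 1 (rdim M)" "K \<in> carrier_mat 1 (rdim M)"
    unfolding X_def Y_def G_def K_def by (auto intro!: carrier_matI)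
  note [simp] = carrier_matD[OF cyc(1)] carrier_matD[OF cyc(2)] carrier_matD[OF cyc(3)] carrier_matD[OF cyc(4)]
  have ji: "j * i2 \<in> rep_hom U' M" and pq: "p2 * q \<in> rep_hom M U'"
    by (auto intro: rep_hom_comp bd cd)
  have "?a * X = (?a * i1) * x" unfolding X_def by (simp add: mat_assoc)
  also have "\<dots> = i1 * (act U gen_a * x)" unfolding rep_homD(3)[OF bd(1), symmetric] by (simp add: mat_assoc)
  finally have aX: "?a * X = 0\<^sub>m (rdim M) 1" by (simp add: x mat_zero_right)
  have "?a * Y = (?a * (j * i2)) * y" unfolding Y_def by (simp add: mat_assoc)
  also have "\<dots> = (j * i2) * (act U' gen_a * y)" unfolding rep_homD(3)[OF ji, symmetric] by (simp add: mat_assoc)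
  finally have aY: "?a * Y = 0\<^sub>m (rdim M) 1" by (simp add: y mat_zero_right)
  have "G * ?a = g * (p1 * ?a)" unfolding G_def by (simp add: mat_assoc)
  also have "\<dots> = (g * act U gen_a) * p1" unfolding rep_homD(3)[OF bd(3)] by (simp add: mat_assoc)
  finally have Ga: "G * ?a = 0\<^sub>m 1 (rdim M)" by (simp add: x mat_zero_left)
  have "K * ?a = h * ((p2 * q) * ?a)" unfolding K_def by (simp add: mat_assoc)
  also have "\<dots> = (h * act U' gen_a) * (p2 * q)" unfolding rep_homD(3)[OF pq] by (simp add: mat_assoc)
  finally have Ka: "K * ?a = 0\<^sub>m 1 (rdim M)" by (simp add: y mat_zero_left)
  have GX: "G * X = 1\<^sub>m 1" unfolding X_def G_def by (simp add: mat_assoc mat_cancel[OF bd(5)] x)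
  have KY: "K * Y = 1\<^sub>m 1"
    unfolding Y_def K_def using bd(6) by (simp add: mat_assoc mat_cancel[of q j] mat_cancel[OF cd(5)] y)
  have "G * Y = g * ((p1 * j) * (i2 * y))" unfolding Y_def G_def by (simp add: mat_assoc)
  then have GY: "G * Y = 0\<^sub>m 1 1" unfolding bd(8) by (simp add: mat_alg)
  have split: "F * C = (F * v) * (f * C)"
    if F: "F \<in> carrier_mat 1 (rdim M)" "F * ?a = 0\<^sub>m 1 (rdim M)" and C: "C \<in> carrier_mat (rdim M) 1" "?a * C = 0\<^sub>m (rdim M) 1" for F C
  proof -
    note [simp] = carrier_matD[OF F(1)] carrier_matD[OF C(1)]
    have "F * C - (F * v) * (f * C) = F * (1\<^sub>m (rdim M) - v * f) * C" by (simp add: mat_alg)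
    also have "\<dots> = (F * ?a) * s * C + F * s * (?a * C)" unfolding v(4) by (simp add: mat_alg)
    also have "\<dots> = 0\<^sub>m 1 1" unfolding F(2) C(2) by (simp add: mat_alg)
    finally have e: "F * C - (F * v) * (f * C) = 0\<^sub>m 1 1" .
    show ?thesis
    proof (rule eq_matI)
      fix i k assume "i < dim_row (F * v * (f * C))" "k < dim_col (F * v * (f * C))"
      then show "(F * C) $$ (i, k) = (F * v * (f * C)) $$ (i, k)"
        using arg_cong[OF e, of "\<lambda>m. m $$ (i, k)"] by (simp del: index_mult_mat(1))
    qed auto
  qed
  have sc: "(A * B) $$ (0, 0) = A $$ (0, 0) * B $$ (0, 0)" if "A \<in> carrier_mat 1 1" "B \<in> carrier_mat 1 1" for A B :: "'k mat"
    using that by (subst mult_mat_entry) auto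
  have e: "(F * C) $$ (0, 0) = (F * v) $$ (0, 0) * (f * C) $$ (0, 0)"
    if F: "F \<in> carrier_mat 1 (rdim M)" "F * ?a = 0\<^sub>m 1 (rdim M)" and C: "C \<in> carrier_mat (rdim M) 1" "?a * C = 0\<^sub>m (rdim M) 1" for F C
  proof -
    have "F * v \<in> carrier_mat 1 1" "f * C \<in> carrier_mat 1 1" using F C v by auto
    from sc[OF this] show ?thesis unfolding split[OF F C] .
  qed
  have "(G * v) $$ (0, 0) * (f * X) $$ (0, 0) = 1" "(K * v) $$ (0, 0) * (f * Y) $$ (0, 0) = 1"
    "(G * v) $$ (0, 0) * (f * Y) $$ (0, 0) = 0"
    using e[OF cyc(3) Ga cyc(1) aX] e[OF cyc(4) Ka cyc(2) aY] e[OF cyc(3) Ga cyc(2) aY]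
    unfolding GX KY GY by simp_all
  then show False by auto
qed

section \<open>Modules that are not contractible are Kronecker modules\<close>

lemma mult_mat_entry_sum:
  "i < dim_row A \<Longrightarrow> j < dim_col B \<Longrightarrow> dim_col A = n \<Longrightarrow> dim_row B = n \<Longrightarrow> (A * B) $$ (i, j) = (\<Sum>k<n. A $$ (i, k) * B $$ (k, j))"
  by (subst mult_mat_entry) auto

lemma sum_pick_left: "(\<Sum>k<n. (if k = i then x else 0) * f k) = (if i < n then x * f i else (0::'a::comm_ring_1))" for i :: nat
proof -
  have "(\<Sum>k<n. (if k = i then x else 0) * f k) = (\<Sum>k<n. if k = i then x * f i else 0)" by (rule sum.cong) auto
  then show ?thesis by simp
qed

lemma sum_pick_right: "(\<Sum>k<n. f k * (if k = i then x else 0)) = (if i < n then f i * x else (0::'a::comm_ring_1))" for i :: nat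
  using sum_pick_left[of i x f n] by (simp add: mult.commute)

text \<open>A nonzero entry of \<open>A - A G A\<close> is used as the pivot of a rank one correction of \<open>G\<close>; each
  correction kills one more column.\<close>

lemma generalized_inverse:
  fixes A :: "'k::field mat"
  assumes A: "A \<in> carrier_mat n m"
  obtains G where "G \<in> carrier_mat m n" "A * G * A = A"
proof -
  define Z where "Z B = {j. j < m \<and> (\<exists>i<n. B $$ (i, j) \<noteq> 0)}" for B :: "'k mat"
  note [simp] = carrier_matD[OF A]
  have "\<exists>G'\<in>carrier_mat m n. A * G' * A = A" if "G \<in> carrier_mat m n" for G :: "'k mat"
    using that
  proof (induction "card (Z (A - A * G * A))" arbitrary: G rule: less_induct)
    case less
    note [simp] = carrier_matD[OF less.prems]
    define B where "B = A - A * G * A"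
    have B: "B \<in> carrier_mat n m" unfolding B_def by (auto intro!: carrier_matI)
    note [simp] = carrier_matD[OF B]
    show ?case
    proof (cases "Z B = {}")
      case True
      have "A * G * A = A"
      proof (rule eq_matI)
        fix i j assume "i < dim_row A" "j < dim_col A"
        then have ij: "i < n" "j < m" by auto
        then have "B $$ (i, j) = 0" using True by (auto simp: Z_def)
        then show "(A * G * A) $$ (i, j) = A $$ (i, j)" using ij by (simp add: B_def del: index_mult_mat(1))
      qed auto
      then show ?thesis using less.prems by blast
    next
      case False
      then obtain i j where ij: "i < n" "j < m" "B $$ (i, j) \<noteq> 0" by (auto simp: Z_def)
      define H where "H = mat m n (\<lambda>(p, q). if p = j \<and> q = i then 1 / B $$ (i, j) else 0)"
      have H[simp]: "dim_row H = m" "dim_col H = n" by (simp_all add: H_def)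
      \<comment> \<open>For \<open>B = A - A * G * A\<close> this choice turns the defect into
        \<open>B - B * H * B\<close>, the elimination step with pivot at row \<open>i\<close> and
        column \<open>j\<close>.\<close>
      define G' where "G' = G + (1\<^sub>m m - G * A) * H * (1\<^sub>m n - A * G)"
      have G': "G' \<in> carrier_mat m n" unfolding G'_def by (auto intro!: carrier_matI)
      have "A - A * G' * A = B - B * H * B"
        unfolding G'_def B_def by (simp add: mat_alg) (rule eq_matI, auto simp: algebra_simps simp del: index_mult_mat(1))
      moreover have ent: "(B - B * H * B) $$ (p, l) = B $$ (p, l) - B $$ (p, j) * B $$ (i, l) / B $$ (i, j)"
        if "p < n" "l < m" for p l
      proof -
        have HB: "(H * B) $$ (k, l) = (if k = j then B $$ (i, l) / B $$ (i, j) else 0)" if "k < m" for k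
        proof -
          have "(H * B) $$ (k, l) = (\<Sum>q<n. (if q = i then (if k = j then 1 / B $$ (i, j) else 0) else 0) * B $$ (q, l))"
            using that \<open>l < m\<close> by (subst mult_mat_entry_sum[where n = n]) (auto simp: H_def intro!: sum.cong)
          then show ?thesis using ij by (simp add: sum_pick_left del: index_mult_mat(1))
        qed
        have "(B * (H * B)) $$ (p, l) = (\<Sum>k<m. B $$ (p, k) * (if k = j then B $$ (i, l) / B $$ (i, j) else 0))"
          using that by (subst mult_mat_entry_sum[where n = m]) (auto simp: HB intro!: sum.cong simp del: index_mult_mat(1))
        then have "(B * H * B) $$ (p, l) = B $$ (p, j) * B $$ (i, l) / B $$ (i, j)"
          using ij by (simp add: mat_assoc sum_pick_right del: index_mult_mat(1))
        then show ?thesis using that by (simp del: index_mult_mat(1))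
      qed
      ultimately have ent': "(A - A * G' * A) $$ (p, l) = B $$ (p, l) - B $$ (p, j) * B $$ (i, l) / B $$ (i, j)"
        if "p < n" "l < m" for p l using that by simp
      have "Z (A - A * G' * A) \<subseteq> Z B"
      proof
        fix l assume "l \<in> Z (A - A * G' * A)"
        then obtain p where p: "p < n" "l < m" "B $$ (p, l) - B $$ (p, j) * B $$ (i, l) / B $$ (i, j) \<noteq> 0"
          using ent' by (auto simp: Z_def simp del: index_minus_mat(1))
        then have "B $$ (p, l) \<noteq> 0 \<or> B $$ (i, l) \<noteq> 0" by auto
        then show "l \<in> Z B" using p(1,2) ij(1) unfolding Z_def by blast
      qed
      moreover have "j \<in> Z B" "j \<notin> Z (A - A * G' * A)" using ij ent' by (auto simp: Z_def simp del: index_minus_mat(1))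
      ultimately have Z': "Z (A - A * G' * A) \<subset> Z B" by blast
      have "card (Z (A - A * G' * A)) < card (Z B)"
        by (rule psubset_card_mono[OF _ Z']) (simp add: Z_def)
      from less.hyps[OF this[unfolded B_def] G'] show ?thesis .
    qed
  qed
  from this[of "0\<^sub>m m n"] show ?thesis using that by auto
qed

text \<open>The relative trace (Higman) criterion: every even \<open>T\<close> gives the endomorphism
  \<open>T a d - a T d + d T a + a d T\<close>, which is contracted by \<open>d T - T d\<close>.\<close>

lemma contractible_if_ad_nonzero:
  fixes V :: "(dh4_gen, 'k::field) rep"
  assumes V: "indecomposable D_H4 V" and bc: "act V gen_c = act V gen_b" and two: "(2::'k) \<noteq> 0"
    and ad: "act V gen_a * act V gen_d \<noteq> 0\<^sub>m (rdim V) (rdim V)"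
  shows "contractible V"
proof -
  let ?n = "rdim V" and ?a = "act V gen_a" and ?b = "act V gen_b" and ?d = "act V gen_d"
  note Vr = indecomposable_reps[OF V]
  interpret V: dh4_mats ?n ?a ?b "act V gen_c" ?d using Vr by (simp add: reps_D_H4_iff)
  note [simp] = V.dims reps_wf[OF Vr]
  have da: "?d * ?a = - (?a * ?d)"
    unfolding V.rel_da' bc V.rel_bb by (rule eq_matI) (auto simp del: index_mult_mat(1))
  note nf = V.nf(1-4) V.nf(6-9) da V.rel_ba V.rel_db V.rel_aa V.rel_dd V.rel_bb
    mat_left[OF V.rel_ba] mat_left[OF V.rel_db] mat_left[OF V.rel_aa] mat_left[OF V.rel_dd] mat_left[OF V.rel_bb] mat_left[OF da] mat_alg
  \<comment> \<open>A vector not killed by \<open>a d\<close> is split into its components for the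
    eigenvalues 1 and -1 of \<open>b\<close>; one of them is still not killed because 2 is
    invertible. An eigenvector is needed so that the averaging in \<open>T\<close> keeps the value
    at \<open>u\<close>.\<close>
  obtain v \<sigma> where v: "v \<in> carrier_mat ?n 1" "?a * (?d * v) \<noteq> 0\<^sub>m ?n 1" "?b * v = \<sigma> \<cdot>\<^sub>m v" "\<sigma> * \<sigma> = (1::'k)"
  proof -
    obtain i j where ij: "i < ?n" "j < ?n" "(?a * ?d) $$ (i, j) \<noteq> 0"
    proof (rule ccontr)
      assume "\<not> thesis"
      then have "?a * ?d = 0\<^sub>m ?n ?n" using that by (intro eq_matI) (auto simp del: index_mult_mat(1))
      with ad show False ..
    qed
    define x :: "'k mat" where "x = mat ?n 1 (\<lambda>(k, _). if k = j then 1 else 0)"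
    have [simp]: "dim_row x = ?n" "dim_col x = 1" by (simp_all add: x_def)
    have "((?a * ?d) * x) $$ (i, 0) = (\<Sum>k<?n. (?a * ?d) $$ (i, k) * (if k = j then 1 else 0))"
      using ij by (subst mult_mat_entry_sum[where n = ?n]) (auto simp: x_def intro!: sum.cong simp del: index_mult_mat(1) assoc_mult_mat)
    then have "((?a * ?d) * x) $$ (i, 0) \<noteq> 0" using ij by (simp add: sum_pick_right del: index_mult_mat(1) assoc_mult_mat)
    then have nz: "?a * (?d * x) \<noteq> 0\<^sub>m ?n 1" using ij by (auto simp: mat_assoc simp del: index_mult_mat(1))
    define y where "y = x + ?b * x"
    define z where "z = x - ?b * x"
    have yz[simp]: "dim_row y = ?n" "dim_col y = 1" "dim_row z = ?n" "dim_col z = 1" by (simp_all add: y_def z_def)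
    have b_y: "?b * y = 1 \<cdot>\<^sub>m y" unfolding y_def by (simp add: nf) (rule eq_matI, auto simp del: index_mult_mat(1))
    have b_z: "?b * z = (-1) \<cdot>\<^sub>m z" unfolding z_def by (simp add: nf) (rule eq_matI, auto simp del: index_mult_mat(1))
    have "?a * (?d * y) \<noteq> 0\<^sub>m ?n 1 \<or> ?a * (?d * z) \<noteq> 0\<^sub>m ?n 1"
    proof (rule ccontr)
      assume "\<not> ?thesis"
      then have 0: "?a * (?d * y) = 0\<^sub>m ?n 1" "?a * (?d * z) = 0\<^sub>m ?n 1" by auto
      have "2 \<cdot>\<^sub>m x = y + z" unfolding y_def z_def by (rule eq_matI) (auto simp del: index_mult_mat(1))
      then have "2 \<cdot>\<^sub>m (?a * (?d * x)) = ?a * (?d * (y + z))" by (metis mat_smult_right yz V.dims index_mult_mat(2,3) \<open>dim_row x = ?n\<close>)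
      also have "\<dots> = 0\<^sub>m ?n 1" by (simp add: mat_distrib_left 0)
      finally have e: "2 \<cdot>\<^sub>m (?a * (?d * x)) = 0\<^sub>m ?n 1" .
      have "?a * (?d * x) = 0\<^sub>m ?n 1"
      proof (rule eq_matI)
        fix p q assume "p < dim_row (0\<^sub>m ?n 1 :: 'k mat)" "q < dim_col (0\<^sub>m ?n 1 :: 'k mat)"
        then show "(?a * (?d * x)) $$ (p, q) = 0\<^sub>m ?n 1 $$ (p, q)"
          using arg_cong[OF e, of "\<lambda>M. M $$ (p, q)"] two by (simp del: index_mult_mat(1))
      qed auto
      with nz show False ..
    qed
    then show ?thesis
    proof
      assume "?a * (?d * y) \<noteq> 0\<^sub>m ?n 1"
      then show ?thesis by (intro that[of y 1] b_y) (auto intro!: carrier_matI)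
    next
      assume "?a * (?d * z) \<noteq> 0\<^sub>m ?n 1"
      then show ?thesis by (intro that[of z "-1"] b_z) (auto intro!: carrier_matI)
    qed
  qed
  note [simp] = carrier_matD[OF v(1)]
  define u where "u = ?a * (?d * v)"
  have u[simp]: "dim_row u = ?n" "dim_col u = 1" by (simp_all add: u_def)
  have unz: "u \<noteq> 0\<^sub>m ?n 1" using v(2) by (simp add: u_def)
  obtain i where i: "i < ?n" "u $$ (i, 0) \<noteq> 0"
  proof (rule ccontr)
    assume "\<not> thesis"
    then have "u = 0\<^sub>m ?n 1" using that by (intro eq_matI) auto
    with unz show False ..
  qed
  define f where "f = mat 1 ?n (\<lambda>(_, k). if k = i then 1 / u $$ (i, 0) else 0)"
  have f[simp]: "dim_row f = 1" "dim_col f = ?n" by (simp_all add: f_def)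
  have fu: "f * u = 1\<^sub>m 1"
  proof (rule eq_matI)
    fix p q assume "p < dim_row (1\<^sub>m 1 :: 'k mat)" "q < dim_col (1\<^sub>m 1 :: 'k mat)"
    then have pq: "p = 0" "q = 0" by auto
    have "(f * u) $$ (0, 0) = (\<Sum>k<?n. (if k = i then 1 / u $$ (i, 0) else 0) * u $$ (k, 0))"
      by (subst mult_mat_entry_sum[where n = ?n]) (auto simp: f_def intro!: sum.cong simp del: index_mult_mat(1))
    then show "(f * u) $$ (p, q) = 1\<^sub>m 1 $$ (p, q)" using i pq by (simp add: sum_pick_left del: index_mult_mat(1))
  qed auto
  have bd: "?b * ?d = - (?d * ?b)" unfolding V.rel_db by simp
  have "?b * (?d * v) = (- \<sigma>) \<cdot>\<^sub>m (?d * v)"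
    using mat_left[OF bd, of v] by (simp add: mat_alg v(3)) (rule eq_matI, auto simp del: index_mult_mat(1))
  then have bu: "?b * u = \<sigma> \<cdot>\<^sub>m u"
    unfolding u_def using mat_left[OF V.rel_ba, of "?d * v"] by (simp add: mat_alg) (rule eq_matI, auto simp del: index_mult_mat(1))
  \<comment> \<open>The average of the rank one map \<open>v * f\<close> over \<open>b\<close> is
    even. It still sends \<open>u\<close> to \<open>v\<close> because both are eigenvectors of
    \<open>b\<close> for the same \<sigma>.\<close>
  define T where "T = (1/2) \<cdot>\<^sub>m (v * f + ?b * v * f * ?b)"
  have T[simp]: "dim_row T = ?n" "dim_col T = ?n" by (simp_all add: T_def)
  have bT: "?b * T = T * ?b"
    unfolding T_def by (simp add: nf) (rule eq_matI, auto simp: algebra_simps simp del: index_mult_mat(1))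
  have Tu: "T * u = v"
  proof -
    have "T * u = (1/2) \<cdot>\<^sub>m (v * (f * u) + ?b * v * (f * (?b * u)))" unfolding T_def by (simp add: mat_alg)
    also have "\<dots> = v" unfolding fu bu v(3)
      by (simp add: mat_alg fu) (rule eq_matI, auto simp: two v(4) mult.assoc[symmetric])
    finally show ?thesis .
  qed
  define s where "s = ?d * T - T * ?d"
  define e where "e = T * (?a * ?d) - ?a * T * ?d + ?d * T * ?a + ?a * ?d * T"
  have [simp]: "dim_row s = ?n" "dim_col s = ?n" "dim_row e = ?n" "dim_col e = ?n" by (simp_all add: s_def e_def)
  \<comment> \<open>The terms containing \<open>t\<close> cancel, so one homotopy serves all
    parameters.\<close>
  have hs: "theta V t * s + s * theta V t = e" for t
    unfolding theta_def s_def e_def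
    by (simp add: nf) (rule eq_matI, auto simp: algebra_simps simp del: index_mult_mat(1))
  have bT': "?b * (T * X) = T * (?b * X)" if "dim_row X = ?n" for X
    using mat_left[OF bT, of X] that by (simp add: mat_assoc)
  have eh: "e \<in> rep_hom V V"
  proof (rule rep_homI)
    have ea: "e * ?a = ?a * e" and ed: "e * ?d = ?d * e"
      unfolding e_def
      by (simp_all add: nf bT bT') (rule eq_matI, auto simp: algebra_simps simp del: index_mult_mat(1))+
    have eb: "e * ?b = ?b * e"
      unfolding e_def
      by (simp add: bT bT' V.rel_ba bd mat_left[OF V.rel_ba] mat_left[OF bd] mat_alg)
    show "e * act V g = act V g * e" for g by (cases g) (simp_all add: ea ed eb bc)
  qed (auto intro!: carrier_matI)
  \<comment> \<open>Since \<open>u = a d v\<close> is killed by \<open>a\<close> and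
    \<open>d\<close>, only the last term of \<open>e\<close> survives. A nonzero fixed vector
    excludes nilpotency, so \<open>e\<close> is invertible by Fitting.\<close>
  have eu: "e * u = u"
  proof -
    have [simp]: "- (0\<^sub>m p q :: 'k mat) = 0\<^sub>m p q" for p q by (rule eq_matI) auto
    have au: "?a * u = 0\<^sub>m ?n 1" "?d * u = 0\<^sub>m ?n 1" unfolding u_def by (simp_all add: nf)
    have "e * u = ?a * (?d * (T * u))" unfolding e_def by (simp add: mat_alg au)
    then show ?thesis unfolding Tu by (simp add: u_def)
  qed
  have "unit_mat ?n e"
  proof (rule ccontr)
    assume "\<not> unit_mat ?n e"
    then obtain k where k: "e ^\<^sub>m k = 0\<^sub>m ?n ?n" using indecomposable_fitting[OF V eh] by blast
    have ek: "e ^\<^sub>m k \<in> carrier_mat ?n ?n" for k using rep_homD(4)[OF eh] by simp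
    have "e ^\<^sub>m k * u = u" for k
    proof (induction k)
      case (Suc k)
      have "e ^\<^sub>m Suc k * u = e ^\<^sub>m k * (e * u)" using carrier_matD[OF ek[of k]] by (simp add: mat_assoc)
      then show ?case unfolding eu Suc .
    qed (simp add: mat_one_left)
    from this[of k] unz show False unfolding k by (simp add: mat_zero_left)
  qed
  then obtain g where g: "g \<in> carrier_mat ?n ?n" "g * e = 1\<^sub>m ?n" "e * g = 1\<^sub>m ?n" by (rule unit_matE)
  note [simp] = carrier_matD[OF g(1)]
  have "g \<in> rep_hom V V" by (rule rep_hom_inverse[OF eh g]) simp
  then have gt: "g * theta V 1 = theta V 1 * g" by (rule theta_hom) simp_all
  have "theta V 1 * (s * g) + (s * g) * theta V 1 = (theta V 1 * s + s * theta V 1) * g" by (simp add: mat_alg gt)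
  also have "\<dots> = 1\<^sub>m ?n" unfolding hs by (rule g(3))
  finally have "contractible_at 1 V" unfolding contractible_at_def
    by (intro bexI[of _ "s * g"]) (auto intro!: carrier_matI)
  then show ?thesis unfolding contractible_def using zero_neq_one by metis
qed

text \<open>All products of \<open>a\<close> and \<open>d\<close> vanish, and both reverse the
  parity given by \<open>b\<close>. Reversing that parity on im a + im d yields a grading of
  \<open>V\<close> that \<open>a\<close> and \<open>d\<close> preserve; its projection is an
  idempotent endomorphism, so only one degree occurs, and \<open>a\<close> and \<open>d\<close> live
  on one eigenspace of \<open>b\<close>.\<close>

lemma homogeneous_if_ad_zero:
  fixes V :: "(dh4_gen, 'k::field) rep"
  assumes V: "indecomposable D_H4 V" and bc: "act V gen_c = act V gen_b" and two: "(2::'k) \<noteq> 0"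
    and ad: "act V gen_a * act V gen_d = 0\<^sub>m (rdim V) (rdim V)"
  obtains \<sigma> where "\<sigma> * \<sigma> = (1::'k)" "act V gen_a * act V gen_b = \<sigma> \<cdot>\<^sub>m act V gen_a" "act V gen_d * act V gen_b = \<sigma> \<cdot>\<^sub>m act V gen_d"
proof -
  let ?n = "rdim V" and ?a = "act V gen_a" and ?b = "act V gen_b" and ?d = "act V gen_d"
  note Vr = indecomposable_reps[OF V]
  interpret V: dh4_mats ?n ?a ?b "act V gen_c" ?d using Vr by (simp add: reps_D_H4_iff)
  note [simp] = V.dims
  have da: "?d * ?a = 0\<^sub>m ?n ?n"
    unfolding V.rel_da' bc V.rel_bb ad by (rule eq_matI) auto
  have ba: "?a * ?b = - (?b * ?a)" unfolding V.rel_ba by simp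
  have bd: "?d * ?b = - (?b * ?d)" by (rule V.rel_db)
  note nf = da ad ba bd V.rel_aa V.rel_dd V.rel_bb
    mat_left[OF ba] mat_left[OF bd] mat_left[OF V.rel_aa] mat_left[OF V.rel_dd] mat_left[OF V.rel_bb] mat_left[OF da] mat_left[OF ad] mat_alg
  obtain G where G: "G \<in> carrier_mat ?n ?n" "?a * G * ?a = ?a" by (rule generalized_inverse[OF V.carrier(1)])
  note [simp] = carrier_matD[OF G(1)]
  define e1 where "e1 = ?a * G"
  have [simp]: "dim_row e1 = ?n" "dim_col e1 = ?n" by (simp_all add: e1_def)
  define d' where "d' = ?d - e1 * ?d"
  have d': "d' \<in> carrier_mat ?n ?n" unfolding d'_def by (auto intro!: carrier_matI)
  obtain G' where G': "G' \<in> carrier_mat ?n ?n" "d' * G' * d' = d'" by (rule generalized_inverse[OF d'])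
  note [simp] = carrier_matD[OF G'(1)] carrier_matD[OF d']
  define e2 where "e2 = d' * G'"
  have [simp]: "dim_row e2 = ?n" "dim_col e2 = ?n" by (simp_all add: e2_def)
  \<comment> \<open>\<open>e1\<close> projects onto the image of \<open>a\<close>, \<open>e2\<close>
    onto the image of the remaining part of \<open>d\<close>, and \<open>p\<close> onto the sum of
    the images of \<open>a\<close> and \<open>d\<close>.\<close>
  define p where "p = e1 + e2 - e2 * e1"
  have [simp]: "dim_row p = ?n" "dim_col p = ?n" by (simp_all add: p_def)
  have e1a: "e1 * ?a = ?a" unfolding e1_def by (rule G(2))
  have pa: "p * ?a = ?a"
    unfolding p_def by (simp add: mat_alg e1a) (rule eq_matI, auto simp del: index_mult_mat(1))
  have "e2 * ?d - e2 * (e1 * ?d) = e2 * d'" unfolding d'_def by (simp add: mat_alg)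
  also have "\<dots> = d'" unfolding e2_def by (rule G'(2))
  finally have "e1 * ?d + (e2 * ?d - e2 * (e1 * ?d)) = ?d"
    unfolding d'_def by (intro eq_matI) (auto simp del: index_mult_mat(1))
  moreover have "p * ?d = e1 * ?d + (e2 * ?d - e2 * (e1 * ?d))"
    unfolding p_def by (simp add: mat_alg) (rule eq_matI, auto simp del: index_mult_mat(1))
  ultimately have pd: "p * ?d = ?d" by simp
  have ap: "?a * p = 0\<^sub>m ?n ?n" "?d * p = 0\<^sub>m ?n ?n"
    unfolding p_def e2_def d'_def e1_def by (simp_all add: nf)
  have pp: "p * p = p"
  proof -
    have "p * e1 = e1" using mat_left[OF pa, of G] by (simp add: e1_def)
    moreover have "p * e2 = e2"
      using mat_left[OF pa, of "G * (?d * G')"] mat_left[OF pd, of G']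
      unfolding e2_def d'_def e1_def by (simp add: mat_alg)
    moreover have "p * (e1 + e2 - e2 * e1) = p * e1 + p * e2 - (p * e2) * e1" by (simp add: mat_alg)
    ultimately have "p * (e1 + e2 - e2 * e1) = e1 + e2 - e2 * e1" by simp
    then show ?thesis unfolding p_def[symmetric] .
  qed
  \<comment> \<open>This sum of images is stable under \<open>b\<close>, so the average is again a
    projection onto it, and it commutes with \<open>b\<close>.\<close>
  define r where "r = (1/2) \<cdot>\<^sub>m (p + ?b * p * ?b)"
  have [simp]: "dim_row r = ?n" "dim_col r = ?n" by (simp_all add: r_def)
  have rb: "r * ?b = ?b * r"
    unfolding r_def by (simp add: mat_alg V.rel_bb mat_left[OF V.rel_bb]) (rule eq_matI, auto simp: algebra_simps simp del: index_mult_mat(1))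
  have half: "(1/2) \<cdot>\<^sub>m (X + X) = X" for X :: "'k mat" by (rule eq_matI) (auto simp: two field_simps)
  have pba: "p * (?b * ?a) = ?b * ?a" "p * (?b * ?d) = ?b * ?d"
    using mat_left[OF pa, of ?b] mat_left[OF pd, of ?b] by (simp_all add: nf pa pd)
  have ra: "r * ?a = ?a"
  proof -
    have "r * ?a = (1/2) \<cdot>\<^sub>m (p * ?a + ?b * (p * (?b * ?a)))" unfolding r_def by (simp add: mat_alg)
    also have "\<dots> = ?a" unfolding pa pba by (simp add: mat_left[OF V.rel_bb] mat_one_left half)
    finally show ?thesis .
  qed
  have rd: "r * ?d = ?d"
  proof -
    have "r * ?d = (1/2) \<cdot>\<^sub>m (p * ?d + ?b * (p * (?b * ?d)))" unfolding r_def by (simp add: mat_alg)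
    also have "\<dots> = ?d" unfolding pd pba by (simp add: mat_left[OF V.rel_bb] mat_one_left half)
    finally show ?thesis .
  qed
  have ar: "?a * r = 0\<^sub>m ?n ?n" "?d * r = 0\<^sub>m ?n ?n"
  proof -
    have [simp]: "- (0\<^sub>m p q :: 'k mat) = 0\<^sub>m p q" "x \<cdot>\<^sub>m (0\<^sub>m p q :: 'k mat) = 0\<^sub>m p q" for p q x by (rule eq_matI, auto)+
    show "?a * r = 0\<^sub>m ?n ?n" "?d * r = 0\<^sub>m ?n ?n"
      unfolding r_def by (simp_all add: nf ap mat_left[OF ap(1)] mat_left[OF ap(2)])
  qed
  have rr: "r * r = r"
  proof -
    have "r * e1 = e1" using mat_left[OF ra, of G] by (simp add: e1_def)
    moreover have "r * e2 = e2"
      using mat_left[OF ra, of "G * (?d * G')"] mat_left[OF rd, of G']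
      unfolding e2_def d'_def e1_def by (simp add: mat_alg)
    moreover have "r * p = r * e1 + r * e2 - (r * e2) * e1" unfolding p_def by (simp add: mat_alg)
    ultimately have rp: "r * p = p" by (simp add: p_def)
    have "r * r = (1/2) \<cdot>\<^sub>m (r * p + (r * ?b) * p * ?b)" by (subst (2) r_def) (simp add: mat_alg)
    also have "\<dots> = (1/2) \<cdot>\<^sub>m (p + ?b * (r * p) * ?b)" unfolding rb by (simp add: mat_assoc rp)
    finally show ?thesis unfolding rp r_def[symmetric] .
  qed
  \<comment> \<open>On the image of \<open>r\<close> this is (1 - b)/2, on its kernel (1 +
    b)/2.\<close>
  define e where "e = (1/2) \<cdot>\<^sub>m (1\<^sub>m ?n + ?b) - r * ?b"
  have [simp]: "dim_row e = ?n" "dim_col e = ?n" by (simp_all add: e_def)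
  have ae: "?a * e = (1/2) \<cdot>\<^sub>m (?a + ?a * ?b)" "?d * e = (1/2) \<cdot>\<^sub>m (?d + ?d * ?b)"
    unfolding e_def by (simp_all add: mat_alg mat_left[OF ar(1)] mat_left[OF ar(2)])
  have rba: "r * (?b * ?a) = ?b * ?a" "r * (?b * ?d) = ?b * ?d"
    using mat_left[OF rb, of ?a] mat_left[OF rb, of ?d] by (simp_all add: mat_alg ra rd)
  have ea: "e * ?a = ?a * e"
    unfolding ae unfolding e_def by (simp add: mat_alg rba ba ra) (rule eq_matI, auto simp: field_simps two simp del: index_mult_mat(1))
  have ed: "e * ?d = ?d * e"
    unfolding ae unfolding e_def by (simp add: mat_alg rba bd rd) (rule eq_matI, auto simp: field_simps two simp del: index_mult_mat(1))
  have eb: "e * ?b = ?b * e"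
    unfolding e_def by (simp add: mat_alg rb V.rel_bb mat_left[OF rb])
  have eh: "e \<in> rep_hom V V"
    by (rule rep_homI) (auto intro!: carrier_matI simp: ea ed eb bc split: dh4_gen.splits, metis (full_types) bc dh4_gen.exhaust ea eb ed)
  have ee: "e * e = e"
  proof -
    have rbrb: "r * (?b * (r * ?b)) = r"
      by (simp add: rb rr mat_left[OF rb] mat_left[OF rr] mat_left[OF V.rel_bb] mat_alg)
    show ?thesis unfolding e_def using four_nonzero[OF two] two
      by (simp add: mat_alg rbrb rr V.rel_bb mat_left[OF rb] rb mat_left[OF V.rel_bb])
        (rule eq_matI, auto simp: field_simps simp del: index_mult_mat(1))
  qed
  have dbl: "X * ?b = \<sigma> \<cdot>\<^sub>m X" if "dim_row X = ?n" "dim_col X = ?n" "(1/2) \<cdot>\<^sub>m (X + X * ?b) = ((1 + \<sigma>) / 2) \<cdot>\<^sub>m X" for X \<sigma>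
  proof (rule eq_matI)
    fix i j assume ij: "i < dim_row (\<sigma> \<cdot>\<^sub>m X)" "j < dim_col (\<sigma> \<cdot>\<^sub>m X)"
    have "((1/2) \<cdot>\<^sub>m (X + X * ?b)) $$ (i, j) = (((1 + \<sigma>) / 2) \<cdot>\<^sub>m X) $$ (i, j)" using that(3) by simp
    then show "(X * ?b) $$ (i, j) = (\<sigma> \<cdot>\<^sub>m X) $$ (i, j)"
      using ij that(1,2) two by (simp add: field_simps del: index_mult_mat(1))
  qed (use that in auto)
  from indecomposable_idempotent[OF V eh ee] show ?thesis
  proof
    assume e0: "e = 0\<^sub>m ?n ?n"
    have "(1/2) \<cdot>\<^sub>m (X + X * ?b) = ((1 + - 1) / 2) \<cdot>\<^sub>m X" if "X * e = (1/2) \<cdot>\<^sub>m (X + X * ?b)" "dim_row X = ?n" "dim_col X = ?n" for X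
      unfolding that(1)[symmetric] e0 using that(2,3) by (simp add: mat_alg) (rule eq_matI, auto)
    then show ?thesis using that[of "-1"] dbl[of ?a "-1"] dbl[of ?d "-1"] ae by simp
  next
    assume e1: "e = 1\<^sub>m ?n"
    have "(1/2) \<cdot>\<^sub>m (X + X * ?b) = ((1 + 1) / 2) \<cdot>\<^sub>m X" if "X * e = (1/2) \<cdot>\<^sub>m (X + X * ?b)" "dim_row X = ?n" "dim_col X = ?n" for X
      unfolding that(1)[symmetric] e1 using that(2,3) two by (simp add: mat_alg) (rule eq_matI, auto)
    then show ?thesis using that[of 1] dbl[of ?a 1] dbl[of ?d 1] ae by simp
  qed
qed

section \<open>Singular pencils\<close>

text \<open>For a generalized inverse \<open>G\<close> of \<open>A\<close> the rows of
  \<open>H = 1 - A * G\<close> are relations among the equations, as \<open>H * A = 0\<close>. They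
  annihilate the right-hand side, so \<open>G * B\<close> is a solution. Arbitrary finite index sets
  let systems with several kinds of equations be entered directly.\<close>

lemma fredholm_alternative:
  fixes M :: "'e \<Rightarrow> 'u \<Rightarrow> 'k::field"
  assumes E: "finite E" and U: "finite U"
    and alt: "\<And>g. (\<forall>u\<in>U. (\<Sum>e\<in>E. g e * M e u) = 0) \<Longrightarrow> (\<Sum>e\<in>E. g e * b e) = 0"
  obtains y where "\<forall>e\<in>E. (\<Sum>u\<in>U. M e u * y u) = b e"
proof -
  let ?m = "card E" and ?l = "card U"
  obtain f where f: "bij_betw f {..<?m} E" using ex_bij_betw_nat_finite[OF E] by (auto simp: lessThan_atLeast0)
  obtain h where h: "bij_betw h {..<?l} U" using ex_bij_betw_nat_finite[OF U] by (auto simp: lessThan_atLeast0)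
  define A where "A = mat ?m ?l (\<lambda>(i, j). M (f i) (h j))"
  define B where "B = mat ?m 1 (\<lambda>(i, _). b (f i))"
  have [simp]: "dim_row A = ?m" "dim_col A = ?l" "dim_row B = ?m" "dim_col B = 1" by (simp_all add: A_def B_def)
  obtain G where G: "G \<in> carrier_mat ?l ?m" "A * G * A = A"
    by (rule generalized_inverse[of A ?m ?l]) (auto intro!: carrier_matI)
  note [simp] = carrier_matD[OF G(1)]
  define H where "H = 1\<^sub>m ?m - A * G"
  have [simp]: "dim_row H = ?m" "dim_col H = ?m" by (simp_all add: H_def)
  have HA: "H * A = 0\<^sub>m ?m ?l" unfolding H_def using G(2) by (simp add: mat_alg)
  have HB: "H * B = 0\<^sub>m ?m 1"
  proof (rule eq_matI)
    fix i j assume "i < dim_row (0\<^sub>m ?m 1 :: 'k mat)" "j < dim_col (0\<^sub>m ?m 1 :: 'k mat)"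
    then have ij: "i < ?m" "j = 0" by auto
    define g where "g e = H $$ (i, inv_into {..<?m} f e)" for e
    have gf: "g (f k) = H $$ (i, k)" if "k < ?m" for k
      using that f by (simp add: g_def bij_betw_def inv_into_f_f)
    have "(\<Sum>e\<in>E. g e * M e u) = 0" if "u \<in> U" for u
    proof -
      have "u \<in> h ` {..<?l}" using h that by (simp add: bij_betw_def)
      then obtain k where k: "k < ?l" "u = h k" by auto
      have "(\<Sum>e\<in>E. g e * M e u) = (\<Sum>r<?m. g (f r) * M (f r) u)"
        by (rule sum.reindex_bij_betw[OF f, symmetric])
      also have "\<dots> = (H * A) $$ (i, k)"
        using ij k by (subst mult_mat_entry_sum[where n = ?m]) (auto simp: gf A_def intro!: sum.cong)
      finally show ?thesis using HA ij k by simp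
    qed
    then have "(\<Sum>e\<in>E. g e * b e) = 0" by (intro alt) blast
    also have "(\<Sum>e\<in>E. g e * b e) = (\<Sum>r<?m. g (f r) * b (f r))"
      by (rule sum.reindex_bij_betw[OF f, symmetric])
    also have "\<dots> = (H * B) $$ (i, 0)"
      using ij by (subst mult_mat_entry_sum[where n = ?m]) (auto simp: gf B_def intro!: sum.cong)
    finally show "(H * B) $$ (i, j) = 0\<^sub>m ?m 1 $$ (i, j)" using ij by simp
  qed auto
  define Y where "Y = G * B"
  have [simp]: "dim_row Y = ?l" "dim_col Y = 1" by (simp_all add: Y_def)
  have AY: "(A * Y) $$ (i, 0) = B $$ (i, 0)" if "i < ?m" for i
  proof -
    have "B - A * Y = H * B" unfolding H_def Y_def by (simp add: mat_alg)
    then have "(B - A * Y) $$ (i, 0) = 0" unfolding HB using that by simp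
    then show ?thesis using that by (simp del: index_mult_mat(1))
  qed
  define y where "y u = Y $$ (inv_into {..<?l} h u, 0)" for u
  have yh: "y (h k) = Y $$ (k, 0)" if "k < ?l" for k
    using that h by (simp add: y_def bij_betw_def inv_into_f_f)
  show thesis
  proof (rule that, rule ballI)
    fix e assume "e \<in> E"
    then have "e \<in> f ` {..<?m}" using f by (simp add: bij_betw_def)
    then obtain k where k: "k < ?m" "e = f k" by auto
    have "(\<Sum>u\<in>U. M e u * y u) = (\<Sum>r<?l. M e (h r) * y (h r))"
      by (rule sum.reindex_bij_betw[OF h, symmetric])
    also have "\<dots> = (A * Y) $$ (k, 0)"
      using k by (subst mult_mat_entry_sum[where n = ?l]) (auto simp: yh A_def intro!: sum.cong)
    finally show "(\<Sum>u\<in>U. M e u * y u) = b e" using AY k by (simp add: B_def)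
  qed
qed

text \<open>The coefficients of a polynomial vector in the kernel of \<open>A - t D\<close>, of degree at most \<open>n\<close>.
  Indexing by \<open>int\<close> removes all boundary cases.\<close>

definition pencil_chain :: "nat \<Rightarrow> nat \<Rightarrow> (nat \<Rightarrow> nat \<Rightarrow> 'k::field) \<Rightarrow> (nat \<Rightarrow> nat \<Rightarrow> 'k) \<Rightarrow> int \<Rightarrow> (int \<Rightarrow> nat \<Rightarrow> 'k) \<Rightarrow> bool" where
  "pencil_chain q p A D n x \<longleftrightarrow> (\<forall>m c. c < p \<longrightarrow> x m c \<noteq> 0 \<longrightarrow> 0 \<le> m \<and> m \<le> n) \<and>
     (\<forall>m. \<forall>r<q. (\<Sum>c<p. A r c * x (m + 1) c) = (\<Sum>c<p. D r c * x m c))"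

lemma sum_apply_combination:
  fixes a :: "nat \<Rightarrow> 'k::comm_ring_1"
  shows "(\<Sum>c<p. a c * (z c + (\<Sum>k<N. \<Sum>l<L. e k l * X k l c))) =
    (\<Sum>c<p. a c * z c) + (\<Sum>k<N. \<Sum>l<L. e k l * (\<Sum>c<p. a c * X k l c))"
proof -
  have "(\<Sum>c<p. a c * (z c + (\<Sum>k<N. \<Sum>l<L. e k l * X k l c))) =
    (\<Sum>c<p. a c * z c) + (\<Sum>c<p. \<Sum>k<N. \<Sum>l<L. e k l * (a c * X k l c))"
    by (simp add: distrib_left sum.distrib sum_distrib_left mult.left_commute)
  also have "(\<Sum>c<p. \<Sum>k<N. \<Sum>l<L. e k l * (a c * X k l c)) = (\<Sum>k<N. \<Sum>c<p. \<Sum>l<L. e k l * (a c * X k l c))"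
    by (rule sum.swap)
  also have "\<dots> = (\<Sum>k<N. \<Sum>l<L. \<Sum>c<p. e k l * (a c * X k l c))"
    by (rule sum.cong[OF refl], rule sum.swap)
  finally show ?thesis by (simp add: sum_distrib_left)
qed

text \<open>By the Fredholm alternative the dual chain \<open>y\<close> exists unless some relation
  \<open>A z\<^sub>i - D z\<^sub>i\<^sub>-\<^sub>1 + \<Sum>\<^sub>l s\<^sub>i\<^sub>l D x\<^sub>l = 0\<close> has \<open>\<Sum> s\<^sub>i\<^sub>i \<noteq> 0\<close>.  Adding suitable multiples of the \<open>x\<close>'s turns such a
  \<open>z\<close> into a chain that is shorter than \<open>x\<close> and ends in \<open>(\<Sum> s\<^sub>i\<^sub>i) x\<^sub>n\<close>.\<close>

lemma pencil_chain_trace: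
  fixes A D :: "nat \<Rightarrow> nat \<Rightarrow> 'k::field"
  assumes chain: "pencil_chain q p A D (int N) x" and nz: "c\<^sub>0 < p" "x m\<^sub>0 c\<^sub>0 \<noteq> 0"
    and minimal: "\<And>u. pencil_chain q p A D (int N - 1) u \<Longrightarrow> \<forall>m c. c < p \<longrightarrow> u m c = 0"
    and z: "\<And>i c. i < 0 \<or> int N - 1 \<le> i \<Longrightarrow> z i c = 0"
    and rel: "\<And>i r. r < q \<Longrightarrow> (\<Sum>c<p. A r c * z i c) - (\<Sum>c<p. D r c * z (i - 1) c) +
      (\<Sum>k<N. \<Sum>l<N. if int k = i then s k l * (\<Sum>c<p. D r c * x (int l) c) else 0) = 0"
  shows "(\<Sum>k<N. s k k) = 0"
proof -
  have xz: "x m c = 0" if "c < p" "m < 0 \<or> int N < m" for m c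
  proof (rule ccontr)
    assume "x m c \<noteq> 0"
    with chain that(1) have "0 \<le> m \<and> m \<le> int N" unfolding pencil_chain_def by blast
    with that(2) show False by auto
  qed
  have xr: "(\<Sum>c<p. A r c * x m c) = (\<Sum>c<p. D r c * x (m - 1) c)" if "r < q" for r m
  proof -
    have "\<forall>m. (\<Sum>c<p. A r c * x (m + 1) c) = (\<Sum>c<p. D r c * x m c)" using chain that unfolding pencil_chain_def by blast
    from spec[OF this, of "m - 1"] show ?thesis by simp
  qed
  \<comment> \<open>A step function in \<open>i\<close> that jumps by 1 at \<open>k\<close>,
    normalised to vanish on the left if \<open>k \<le> l\<close> and on the right otherwise. These
    two choices keep \<open>u\<close> supported in degrees 0 to \<open>N - 1\<close>.\<close>
  define K :: "int \<Rightarrow> nat \<Rightarrow> nat \<Rightarrow> 'k" where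
    "K i k l = (if k \<le> l then if int k \<le> i then 1 else 0 else if i < int k then -1 else 0)" for i k l
  have K: "K i k l - K (i - 1) k l = (if int k = i then 1 else 0)" for i k l
    by (auto simp: K_def)
  define u where "u i c = z i c + (\<Sum>k<N. \<Sum>l<N. (s k l * K i k l) * x (int l + 1 + i - int k) c)" for i c
  have u_zero: "u i c = 0" if c: "c < p" and i: "i < 0 \<or> int N \<le> i" for i c
  proof -
    have "K i k l * x (int l + 1 + i - int k) c = 0" if "k < N" for k l
      using i that xz[OF c] by (auto simp: K_def)
    then have "(\<Sum>k<N. \<Sum>l<N. (s k l * K i k l) * x (int l + 1 + i - int k) c) = 0"
      by (auto simp: mult.assoc intro!: sum.neutral)
    moreover have "z i c = 0" using i by (intro z) auto
    ultimately show ?thesis by (simp add: u_def)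
  qed
  have usupp: "0 \<le> m \<and> m \<le> int N - 1" if "c < p" "u m c \<noteq> 0" for m c
    using u_zero[of c m] that by linarith
  have rec: "(\<Sum>c<p. A r c * u i c) = (\<Sum>c<p. D r c * u (i - 1) c)" if r: "r < q" for i r
  proof -
    have "(\<Sum>c<p. D r c * u (i - 1) c) = (\<Sum>c<p. D r c * z (i - 1) c) +
        (\<Sum>k<N. \<Sum>l<N. (s k l * K (i - 1) k l) * (\<Sum>c<p. A r c * x (int l + 1 + i - int k) c))"
      unfolding u_def sum_apply_combination xr[OF r] by (simp add: algebra_simps)
    moreover have "(\<Sum>c<p. A r c * u i c) = (\<Sum>c<p. A r c * z i c) +
        (\<Sum>k<N. \<Sum>l<N. (s k l * K i k l) * (\<Sum>c<p. A r c * x (int l + 1 + i - int k) c))"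
      unfolding u_def sum_apply_combination ..
    moreover have "(\<Sum>k<N. \<Sum>l<N. (s k l * K i k l) * (\<Sum>c<p. A r c * x (int l + 1 + i - int k) c)) -
        (\<Sum>k<N. \<Sum>l<N. (s k l * K (i - 1) k l) * (\<Sum>c<p. A r c * x (int l + 1 + i - int k) c)) =
        (\<Sum>k<N. \<Sum>l<N. s k l * (K i k l - K (i - 1) k l) * (\<Sum>c<p. A r c * x (int l + 1 + i - int k) c))"
      by (simp add: sum_subtractf[symmetric] algebra_simps)
    moreover have "\<dots> = (\<Sum>k<N. \<Sum>l<N. if int k = i then s k l * (\<Sum>c<p. D r c * x (int l) c) else 0)"
      unfolding K xr[OF r] by (intro sum.cong refl) auto
    ultimately show ?thesis using rel[OF r, of i] by (simp add: algebra_simps)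
  qed
  have "pencil_chain q p A D (int N - 1) u"
    unfolding pencil_chain_def using usupp rec[of _ "m + 1" for m] by simp
  from minimal[OF this] have u0: "\<forall>m c. c < p \<longrightarrow> u m c = 0" .
  \<comment> \<open>The top coefficient of \<open>x\<close> is nonzero, since otherwise
    \<open>x\<close> itself would be a nonzero chain of smaller degree.\<close>
  obtain c where c: "c < p" "x (int N) c \<noteq> 0"
  proof (rule ccontr)
    assume "\<not> thesis"
    then have top: "\<forall>c<p. x (int N) c = 0" using that by blast
    have "pencil_chain q p A D (int N - 1) x"
      unfolding pencil_chain_def
    proof (intro conjI allI impI)
      fix m c assume c: "c < p" "x m c \<noteq> 0"
      with chain have "0 \<le> m \<and> m \<le> int N" unfolding pencil_chain_def by blast
      moreover have "m \<noteq> int N" using c top by auto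
      ultimately show "0 \<le> m" "m \<le> int N - 1" by auto
    qed (use xr[of _ "m + 1" for m] in simp)
    with minimal nz show False by blast
  qed
  have "0 = u (int N - 1) c" using u0 c by simp
  also have "\<dots> = (\<Sum>k<N. \<Sum>l<N. (s k l * K (int N - 1) k l) * x (int l + 1 + (int N - 1) - int k) c)"
    using z[of "int N - 1" c] by (simp add: u_def)
  \<comment> \<open>For \<open>l > k\<close> the index of \<open>x\<close> exceeds \<open>N\<close>;
    for \<open>l < k\<close> the coefficient \<open>K\<close> is 0.\<close>
  also have "\<dots> = (\<Sum>k<N. \<Sum>l<N. if l = k then s k k * x (int N) c else 0)"
    by (intro sum.cong refl) (auto simp: K_def intro!: xz[OF c(1)])
  also have "\<dots> = (\<Sum>k<N. s k k) * x (int N) c" by (simp add: sum_distrib_right)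
  finally show ?thesis using c by simp
qed

text \<open>The rows \<open>y i\<close> form a chain dual to the vectors D x_j and will provide the
  retraction onto a block. The only obstruction to solving for them is a trace, and
  \<open>pencil_chain_trace\<close> shows that it vanishes for a chain of minimal degree.\<close>

lemma pencil_dual_chain:
  fixes A D :: "nat \<Rightarrow> nat \<Rightarrow> 'k::field"
  assumes chain: "pencil_chain q p A D (int N) x" and nz: "c\<^sub>0 < p" "x m\<^sub>0 c\<^sub>0 \<noteq> 0"
    and minimal: "\<And>u. pencil_chain q p A D (int N - 1) u \<Longrightarrow> \<forall>m c. c < p \<longrightarrow> u m c = 0"
  obtains y :: "nat \<Rightarrow> nat \<Rightarrow> 'k" where
    "\<forall>i c. Suc i < N \<longrightarrow> c < p \<longrightarrow> (\<Sum>r<q. y i r * A r c) = (\<Sum>r<q. y (Suc i) r * D r c)"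
    "\<forall>i<N. \<forall>j<N. (\<Sum>r<q. y i r * (\<Sum>c<p. D r c * x (int j) c)) = (if i = j then 1 else 0)"
proof -
  define w where "w j r = (\<Sum>c<p. D r c * x (int j) c)" for j r
  \<comment> \<open>\<open>Inl (i, c)\<close> indexes the chain condition between \<open>y i\<close>
    and its successor in column \<open>c\<close>, \<open>Inr (i, j)\<close> the duality
    conditions.\<close>
  define E where "E = ({..<N - 1} \<times> {..<p}) <+> ({..<N} \<times> {..<N})"
  define U where "U = {..<N} \<times> {..<q}"
  define M :: "(nat \<times> nat) + (nat \<times> nat) \<Rightarrow> nat \<times> nat \<Rightarrow> 'k" where
    "M e u = (case u of (i', r) \<Rightarrow> case e of Inl (i, c) \<Rightarrow> (if i' = i then A r c else 0) - (if i' = Suc i then D r c else 0)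
      | Inr (i, j) \<Rightarrow> (if i' = i then w j r else 0))" for e u
  define b :: "(nat \<times> nat) + (nat \<times> nat) \<Rightarrow> 'k" where
    "b e = (case e of Inl _ \<Rightarrow> 0 | Inr (i, j) \<Rightarrow> if i = j then 1 else 0)" for e
  have split: "(\<Sum>e\<in>E. F e) = (\<Sum>i<N - 1. \<Sum>c<p. F (Inl (i, c))) + (\<Sum>k<N. \<Sum>l<N. F (Inr (k, l)))" for F :: "_ \<Rightarrow> 'k"
    unfolding E_def by (subst sum.Plus) (auto simp: sum.cartesian_product)
  have fin: "finite E" "finite U" by (auto simp: E_def U_def)
  have alt: "(\<Sum>e\<in>E. g e * b e) = 0" if g: "\<forall>u\<in>U. (\<Sum>e\<in>E. g e * M e u) = 0" for g
  proof -
    \<comment> \<open>A relation \<open>g\<close> among the equations is read as the data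
      \<open>z\<close>, \<open>s\<close> of \<open>pencil_chain_trace\<close>; its value on the
      right-hand side is the trace of \<open>s\<close>.\<close>
    define z where "z i c = (if 0 \<le> i \<and> i < int N - 1 then g (Inl (nat i, c)) else 0)" for i c
    define s where "s k l = g (Inr (k, l))" for k l
    have rel: "(\<Sum>c<p. A r c * z i c) - (\<Sum>c<p. D r c * z (i - 1) c) + (\<Sum>k<N. \<Sum>l<N. if int k = i then s k l * w l r else 0) = 0"
      if r: "r < q" for i r
    proof (cases "0 \<le> i \<and> i < int N")
      case False
      then have "z i c = 0" "z (i - 1) c = 0" for c by (auto simp: z_def)
      moreover have "(\<Sum>k<N. \<Sum>l<N. if int k = i then s k l * w l r else 0) = 0" using False by (auto intro!: sum.neutral)
      ultimately show ?thesis by simp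
    next
      case True
      then have I: "i = int (nat i)" "nat i < N" by auto
      define I where "I = nat i"
      note I = I[folded I_def]
      have "(\<Sum>j<N - 1. \<Sum>c<p. g (Inl (j, c)) * (if I = j then A r c else 0)) = (\<Sum>c<p. \<Sum>j<N - 1. if I = j then g (Inl (I, c)) * A r c else 0)"
        by (subst sum.swap) (intro sum.cong refl, auto)
      also have "\<dots> = (\<Sum>c<p. A r c * z i c)" using I by (intro sum.cong refl) (auto simp: z_def)
      finally have 1: "(\<Sum>j<N - 1. \<Sum>c<p. g (Inl (j, c)) * (if I = j then A r c else 0)) = (\<Sum>c<p. A r c * z i c)" .
      have "(\<Sum>j<N - 1. \<Sum>c<p. g (Inl (j, c)) * (if I = Suc j then D r c else 0)) = (\<Sum>c<p. \<Sum>j<N - 1. if I = Suc j then g (Inl (I - 1, c)) * D r c else 0)"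
        by (subst sum.swap) (intro sum.cong refl, auto)
      also have "\<dots> = (\<Sum>c<p. D r c * z (i - 1) c)"
        using I by (cases I) (auto simp: z_def nat_diff_distrib' intro!: sum.cong)
      finally have 2: "(\<Sum>j<N - 1. \<Sum>c<p. g (Inl (j, c)) * (if I = Suc j then D r c else 0)) = (\<Sum>c<p. D r c * z (i - 1) c)" .
      have 3: "(\<Sum>k<N. \<Sum>l<N. g (Inr (k, l)) * (if I = k then w l r else 0)) = (\<Sum>k<N. \<Sum>l<N. if int k = i then s k l * w l r else 0)"
        using I by (intro sum.cong refl) (auto simp: s_def)
      have "(\<Sum>e\<in>E. g e * M e (I, r)) = 0" using g I r by (simp add: U_def)
      then have "(\<Sum>j<N - 1. \<Sum>c<p. g (Inl (j, c)) * (if I = j then A r c else 0)) - (\<Sum>j<N - 1. \<Sum>c<p. g (Inl (j, c)) * (if I = Suc j then D r c else 0))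
          + (\<Sum>k<N. \<Sum>l<N. g (Inr (k, l)) * (if I = k then w l r else 0)) = 0"
        unfolding split by (simp add: M_def right_diff_distrib sum_subtractf)
      then show ?thesis unfolding 1 2 3 .
    qed
    have "(\<Sum>k<N. s k k) = 0"
    proof (rule pencil_chain_trace[OF chain nz minimal, of z s])
      show "z i c = 0" if "i < 0 \<or> int N - 1 \<le> i" for i c using that by (auto simp: z_def)
    qed (assumption, rule rel[unfolded w_def])
    moreover have "(\<Sum>e\<in>E. g e * b e) = (\<Sum>k<N. \<Sum>l<N. if k = l then s k k else 0)"
    proof -
      have "g (Inr (k, l)) * b (Inr (k, l)) = (if k = l then s k k else 0)" for k l by (simp add: b_def s_def)
      then show ?thesis unfolding split by (simp add: b_def)
    qed
    ultimately show ?thesis by simp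
  qed
  obtain y where y: "\<forall>e\<in>E. (\<Sum>u\<in>U. M e u * y u) = b e"
    by (rule fredholm_alternative[OF fin, of M b]) (use alt in blast)+
  have U: "(\<Sum>u\<in>U. F u) = (\<Sum>i<N. \<Sum>r<q. F (i, r))" for F :: "_ \<Rightarrow> 'k"
    unfolding U_def by (simp add: sum.cartesian_product)
  have pick: "(\<Sum>i'<N. \<Sum>r<q. (if i' = i then f r else 0) * y (i', r)) = (\<Sum>r<q. y (i, r) * f r)" if "i < N" for i f
  proof -
    have "(\<Sum>i'<N. \<Sum>r<q. (if i' = i then f r else 0) * y (i', r)) = (\<Sum>i'<N. if i' = i then \<Sum>r<q. y (i, r) * f r else 0)"
      by (intro sum.cong refl) (auto simp: mult.commute)
    then show ?thesis using that by simp
  qed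
  show thesis
  proof (rule that[of "\<lambda>i r. y (i, r)"]; intro allI impI)
    fix i c assume ic: "Suc i < N" "c < p"
    then have "Inl (i, c) \<in> E" by (auto simp: E_def)
    then have "(\<Sum>u\<in>U. M (Inl (i, c)) u * y u) = 0" using y by (auto simp: b_def)
    then have "(\<Sum>i'<N. \<Sum>r<q. (if i' = i then A r c else 0) * y (i', r)) - (\<Sum>i'<N. \<Sum>r<q. (if i' = Suc i then D r c else 0) * y (i', r)) = 0"
      unfolding U by (simp add: M_def left_diff_distrib sum_subtractf)
    then show "(\<Sum>r<q. y (i, r) * A r c) = (\<Sum>r<q. y (Suc i, r) * D r c)"
      using ic by (subst (asm) (1 2) pick) auto
  next
    fix i j assume ij: "i < N" "j < N"
    then have "Inr (i, j) \<in> E" by (auto simp: E_def)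
    then have "(\<Sum>u\<in>U. M (Inr (i, j)) u * y u) = (if i = j then 1 else 0)" using y by (auto simp: b_def)
    then show "(\<Sum>r<q. y (i, r) * (\<Sum>c<p. D r c * x (int j) c)) = (if i = j then 1 else 0)"
      unfolding U using ij by (simp add: M_def pick w_def)
  qed
qed

section \<open>Splitting off the blocks L_n\<close>

text \<open>With \<open>kron_incl\<close> this forms L_n: the pencil
  \<open>kron_shift n - t * kron_incl n\<close> maps \<open>v\<close> to the differences v_(i+1) - t
  v_i, and its kernel is spanned by (1, t, ..., t^n).\<close>

definition kron_shift :: "nat \<Rightarrow> 'k::field mat" where
  "kron_shift n = mat n (Suc n) (\<lambda>(i, j). if j = Suc i then 1 else 0)"

definition kron_incl :: "nat \<Rightarrow> 'k::field mat" where
  "kron_incl n = mat n (Suc n) (\<lambda>(i, j). if j = i then 1 else 0)"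

lemma kron_dims[simp]: "dim_row (kron_shift n) = n" "dim_col (kron_shift n) = Suc n"
  "dim_row (kron_incl n) = n" "dim_col (kron_incl n) = Suc n"
  by (simp_all add: kron_shift_def kron_incl_def)

lemma kron_mult_entry:
  fixes M :: "'k::field mat"
  shows "i < n \<Longrightarrow> c < dim_col M \<Longrightarrow> dim_row M = Suc n \<Longrightarrow> (kron_shift n * M) $$ (i, c) = M $$ (Suc i, c)"
    "i < n \<Longrightarrow> c < dim_col M \<Longrightarrow> dim_row M = Suc n \<Longrightarrow> (kron_incl n * M) $$ (i, c) = M $$ (i, c)"
    "r < dim_row M \<Longrightarrow> j < Suc n \<Longrightarrow> dim_col M = n \<Longrightarrow> (M * kron_shift n) $$ (r, j) = (if j = 0 then 0 else M $$ (r, j - 1))"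
    "r < dim_row M \<Longrightarrow> j < Suc n \<Longrightarrow> dim_col M = n \<Longrightarrow> (M * kron_incl n) $$ (r, j) = (if j < n then M $$ (r, j) else 0)"
proof -
  assume a: "i < n" "c < dim_col M" "dim_row M = Suc n"
  have "(kron_shift n * M) $$ (i, c) = (\<Sum>k<Suc n. (if k = Suc i then 1 else 0) * M $$ (k, c))"
    using a by (subst mult_mat_entry_sum[where n = "Suc n"]) (auto simp: kron_shift_def intro!: sum.cong simp del: sum.lessThan_Suc)
  then show "(kron_shift n * M) $$ (i, c) = M $$ (Suc i, c)" using a by (simp only: sum_pick_left) simp
  have "(kron_incl n * M) $$ (i, c) = (\<Sum>k<Suc n. (if k = i then 1 else 0) * M $$ (k, c))"
    using a by (subst mult_mat_entry_sum[where n = "Suc n"]) (auto simp: kron_incl_def intro!: sum.cong simp del: sum.lessThan_Suc)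
  then show "(kron_incl n * M) $$ (i, c) = M $$ (i, c)" using a by (simp only: sum_pick_left) simp
next
  assume a: "r < dim_row M" "j < Suc n" "dim_col M = n"
  have "(M * kron_shift n) $$ (r, j) = (\<Sum>k<n. M $$ (r, k) * (if j = Suc k then 1 else 0))"
    using a by (subst mult_mat_entry_sum[where n = n]) (auto simp: kron_shift_def intro!: sum.cong)
  also have "\<dots> = (if j = 0 then 0 else M $$ (r, j - 1))"
  proof (cases j)
    case (Suc j')
    have "(\<Sum>k<n. M $$ (r, k) * (if j = Suc k then 1 else 0)) = (\<Sum>k<n. M $$ (r, k) * (if k = j' then 1 else 0))"
      by (rule sum.cong) (auto simp: Suc)
    then show ?thesis using a Suc by (simp add: sum_pick_right)
  qed simp
  finally show "(M * kron_shift n) $$ (r, j) = (if j = 0 then 0 else M $$ (r, j - 1))" .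
  have "(M * kron_incl n) $$ (r, j) = (\<Sum>k<n. M $$ (r, k) * (if k = j then 1 else 0))"
    using a by (subst mult_mat_entry_sum[where n = n]) (auto simp: kron_incl_def intro!: sum.cong)
  then show "(M * kron_incl n) $$ (r, j) = (if j < n then M $$ (r, j) else 0)" by (simp add: sum_pick_right)
qed

text \<open>A retraction of representations of the Kronecker quiver: \<open>X\<close>,
  \<open>Y\<close> embed \<open>A'\<close>, \<open>D'\<close> into \<open>A\<close>,
  \<open>D\<close>, and \<open>X'\<close>, \<open>Y'\<close> are left inverse to them.\<close>

definition kron_split :: "'k::field mat \<Rightarrow> 'k mat \<Rightarrow> 'k mat \<Rightarrow> 'k mat \<Rightarrow> bool" where
  "kron_split A D A' D' \<longleftrightarrow> (\<exists>X Y X' Y'. X \<in> carrier_mat (dim_col A) (dim_col A') \<and> Y \<in> carrier_mat (dim_row A) (dim_row A') \<and>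
     X' \<in> carrier_mat (dim_col A') (dim_col A) \<and> Y' \<in> carrier_mat (dim_row A') (dim_row A) \<and>
     A * X = Y * A' \<and> D * X = Y * D' \<and> A' * X' = Y' * A \<and> D' * X' = Y' * D \<and>
     X' * X = 1\<^sub>m (dim_col A') \<and> Y' * Y = 1\<^sub>m (dim_row A'))"

text \<open>For a nonzero chain of least degree n, the vectors x_0, ..., x_n and D x_0, ..., D
  x_(n-1) span a copy of L_n, and the dual chain splits it off.\<close>

lemma kron_split_chain:
  fixes A D :: "'k::field mat"
  assumes A: "A \<in> carrier_mat q p" and D: "D \<in> carrier_mat q p"
    and ex: "pencil_chain q p (\<lambda>r c. A $$ (r, c)) (\<lambda>r c. D $$ (r, c)) (int N) x" "c\<^sub>0 < p" "x m\<^sub>0 c\<^sub>0 \<noteq> 0"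
  shows "\<exists>n. kron_split A D (kron_shift n) (kron_incl n)"
proof -
  note [simp] = carrier_matD[OF A] carrier_matD[OF D]
  let ?A = "\<lambda>r c. A $$ (r, c)" and ?D = "\<lambda>r c. D $$ (r, c)"
  define P where "P n \<longleftrightarrow> (\<exists>x m c. pencil_chain q p ?A ?D (int n) x \<and> c < p \<and> x m c \<noteq> 0)" for n
  define n where "n = (LEAST n. P n)"
  have "P N" using ex unfolding P_def by blast
  then have Pn: "P n" unfolding n_def by (rule LeastI)
  then obtain x m c\<^sub>1 where x: "pencil_chain q p ?A ?D (int n) x" "c\<^sub>1 < p" "x m c\<^sub>1 \<noteq> 0" unfolding P_def by blast
  have minimal: "\<forall>m c. c < p \<longrightarrow> u m c = 0" if u: "pencil_chain q p ?A ?D (int n - 1) u" for u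
  proof (rule ccontr)
    assume "\<not> ?thesis"
    then obtain m c where mc: "c < p" "u m c \<noteq> 0" by blast
    with u have "0 \<le> m \<and> m \<le> int n - 1" unfolding pencil_chain_def by blast
    then obtain n' where n': "n = Suc n'" by (cases n) auto
    with u mc have "P n'" unfolding P_def by auto
    then have "n \<le> n'" unfolding n_def by (rule Least_le)
    with n' show False by simp
  qed
  have xz: "x i c = 0" if "c < p" "i < 0 \<or> int n < i" for i c
  proof (rule ccontr)
    assume "x i c \<noteq> 0"
    with x(1) that(1) have "0 \<le> i \<and> i \<le> int n" unfolding pencil_chain_def by blast
    with that(2) show False by auto
  qed
  have xr: "(\<Sum>c<p. A $$ (r, c) * x i c) = (\<Sum>c<p. D $$ (r, c) * x (i - 1) c)" if "r < q" for r i
  proof -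
    have "\<forall>m. (\<Sum>c<p. A $$ (r, c) * x (m + 1) c) = (\<Sum>c<p. D $$ (r, c) * x m c)" using x(1) that unfolding pencil_chain_def by blast
    from spec[OF this, of "i - 1"] show ?thesis by simp
  qed
  obtain y where y: "\<forall>i c. Suc i < n \<longrightarrow> c < p \<longrightarrow> (\<Sum>r<q. y i r * A $$ (r, c)) = (\<Sum>r<q. y (Suc i) r * D $$ (r, c))"
    "\<forall>i<n. \<forall>j<n. (\<Sum>r<q. y i r * (\<Sum>c<p. D $$ (r, c) * x (int j) c)) = (if i = j then 1 else 0)"
    by (rule pencil_dual_chain[OF x minimal])
  \<comment> \<open>For \<open>n = 0\<close> there are no rows \<open>y\<close>; any functional with
    value 1 on x_0 takes their place.\<close>
  obtain f where f: "(\<Sum>c<p. f c * x (int 0) c) = 1" if "n = 0"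
  proof (cases "n = 0")
    case True
    have "m = 0" using x True xz[of c\<^sub>1 m] by force
    then have "(\<Sum>c<p. (if c = c\<^sub>1 then 1 / x 0 c\<^sub>1 else 0) * x 0 c) = 1" using x by (simp add: sum_pick_left)
    then show ?thesis using that[of "\<lambda>c. if c = c\<^sub>1 then 1 / x 0 c\<^sub>1 else 0"] by simp
  qed (use that in auto)
  define X where "X = mat p (Suc n) (\<lambda>(c, j). x (int j) c)"
  define Y where "Y = mat q n (\<lambda>(r, j). \<Sum>c<p. D $$ (r, c) * x (int j) c)"
  define Y' where "Y' = mat n q (\<lambda>(i, r). y i r)"
  \<comment> \<open>The rows are y_i D; the last one, y_(n-1) A, continues the chain where y_n does
    not exist.\<close>
  define X' where "X' = mat (Suc n) p (\<lambda>(i, c). if i < n then \<Sum>r<q. y i r * D $$ (r, c)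
    else if n = 0 then f c else \<Sum>r<q. y (n - 1) r * A $$ (r, c))"
  have [simp]: "dim_row X = p" "dim_col X = Suc n" "dim_row Y = q" "dim_col Y = n" "dim_row Y' = n" "dim_col Y' = q"
    "dim_row X' = Suc n" "dim_col X' = p" by (simp_all add: X_def Y_def X'_def Y'_def)
  have AX: "(A * X) $$ (r, j) = (\<Sum>c<p. D $$ (r, c) * x (int j - 1) c)" and DX: "(D * X) $$ (r, j) = (\<Sum>c<p. D $$ (r, c) * x (int j) c)"
    if "r < q" "j < Suc n" for r j
    using that by (simp_all add: mult_mat_entry_sum[where n = p] X_def xr[OF that(1), symmetric] del: index_mult_mat(1))
  have YA: "(Y' * A) $$ (i, c) = (\<Sum>r<q. y i r * A $$ (r, c))" and YD: "(Y' * D) $$ (i, c) = (\<Sum>r<q. y i r * D $$ (r, c))"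
    if "i < n" "c < p" for i c
    using that by (simp_all add: mult_mat_entry_sum[where n = q] Y'_def del: index_mult_mat(1))
  have e1: "A * X = Y * kron_shift n"
    by (rule mat_entry_eqI[of _ q "Suc n"])
      (auto intro!: carrier_matI simp: AX kron_mult_entry Y_def xz of_nat_diff simp del: index_mult_mat(1))
  have e2: "D * X = Y * kron_incl n"
  proof (rule mat_entry_eqI[of _ q "Suc n"])
    fix r j assume rj: "r < q" "j < Suc n"
    have "(\<Sum>c<p. D $$ (r, c) * x (int n) c) = 0" using xr[OF rj(1), of "int n + 1"] xz by simp
    then have "(\<Sum>c<p. D $$ (r, c) * x (int j) c) = 0" if "\<not> j < n" using that rj less_antisym by blast
    then show "(D * X) $$ (r, j) = (Y * kron_incl n) $$ (r, j)"
      using rj by (auto simp: DX kron_mult_entry Y_def simp del: index_mult_mat(1))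
  qed (auto intro!: carrier_matI)
  have e3: "kron_shift n * X' = Y' * A"
  proof (rule mat_entry_eqI[of _ n p])
    fix i c assume ic: "i < n" "c < p"
    have "n - Suc 0 = i" if "\<not> Suc i < n" using that ic by simp
    then show "(kron_shift n * X') $$ (i, c) = (Y' * A) $$ (i, c)"
      using ic y(1) by (auto simp: YA kron_mult_entry X'_def simp del: index_mult_mat(1))
  qed (auto intro!: carrier_matI)
  have e4: "kron_incl n * X' = Y' * D"
    by (rule mat_entry_eqI[of _ n p])
      (auto intro!: carrier_matI simp: YD kron_mult_entry X'_def simp del: index_mult_mat(1))
  have e6: "Y' * Y = 1\<^sub>m n"
    by (rule mat_entry_eqI[of _ n n])
      (use y(2) in \<open>auto intro!: carrier_matI simp: mult_mat_entry_sum[where n = q] Y'_def Y_def simp del: index_mult_mat(1)\<close>)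
  \<comment> \<open>\<open>kron_incl n\<close> sees all rows but the last and
    \<open>kron_shift n\<close> all but the first; on both, \<open>X' * X\<close> acts as the
    identity because \<open>Y' * Y\<close> does.\<close>
  have e5: "X' * X = 1\<^sub>m (Suc n)"
  proof (rule mat_entry_eqI[of _ "Suc n" "Suc n"])
    fix i j assume ij: "i < Suc n" "j < Suc n"
    show "(X' * X) $$ (i, j) = 1\<^sub>m (Suc n) $$ (i, j)"
    proof (cases "i < n")
      case True
      have "(X' * X) $$ (i, j) = (kron_incl n * (X' * X)) $$ (i, j)" using True ij by (simp add: kron_mult_entry del: index_mult_mat(1))
      also have "kron_incl n * (X' * X) = kron_incl n"
        using mat_left[OF e4, of X] mat_left[OF e6, of "kron_incl n"] by (simp add: mat_alg e2)
      finally show ?thesis using True ij by (simp add: kron_incl_def)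
    next
      case False
      then have i: "i = n" using ij by simp
      show ?thesis
      proof (cases n)
        case 0
        then have "(X' * X) $$ (i, j) = (\<Sum>c<p. f c * x (int 0) c)"
          using ij i by (subst mult_mat_entry_sum[where n = p]) (auto simp: X'_def X_def)
        then show ?thesis using f[OF 0] ij 0 by simp
      next
        case (Suc n')
        have "(X' * X) $$ (i, j) = (kron_shift n * (X' * X)) $$ (n', j)" using i Suc ij by (simp add: kron_mult_entry del: index_mult_mat(1))
        also have "kron_shift n * (X' * X) = kron_shift n"
          using mat_left[OF e3, of X] mat_left[OF e6, of "kron_shift n"] by (simp add: mat_alg e1)
        finally show ?thesis using Suc ij i by (simp add: kron_shift_def)
      qed
    qed
  qed (auto intro!: carrier_matI)
  show ?thesis unfolding kron_split_def
    by (rule exI[of _ n], rule exI[of _ X], rule exI[of _ Y], rule exI[of _ X'], rule exI[of _ Y'])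
      (auto intro!: carrier_matI simp: e1 e2 e3 e4 e5 e6)
qed

text \<open>Transposition reverses the arrows, so the transposed retraction becomes the embedding
  and conversely.\<close>

lemma kron_split_transpose:
  assumes A: "A \<in> carrier_mat q p" and D: "D \<in> carrier_mat q p" and A': "A' \<in> carrier_mat q' p'" and D': "D' \<in> carrier_mat q' p'"
    and s: "kron_split (transpose_mat A) (transpose_mat D) A' D'"
  shows "kron_split A D (transpose_mat A') (transpose_mat D')"
proof -
  note [simp] = carrier_matD[OF A] carrier_matD[OF D] carrier_matD[OF A'] carrier_matD[OF D']
  obtain X Y X' Y' where c: "X \<in> carrier_mat q p'" "Y \<in> carrier_mat p q'" "X' \<in> carrier_mat p' q" "Y' \<in> carrier_mat q' p"
    and e: "transpose_mat A * X = Y * A'" "transpose_mat D * X = Y * D'" "A' * X' = Y' * transpose_mat A" "D' * X' = Y' * transpose_mat D"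
      "X' * X = 1\<^sub>m p'" "Y' * Y = 1\<^sub>m q'"
    using s unfolding kron_split_def by auto
  note [simp] = carrier_matD[OF c(1)] carrier_matD[OF c(2)] carrier_matD[OF c(3)] carrier_matD[OF c(4)]
  have t: "transpose_mat Q * transpose_mat P = transpose_mat (P * Q)" if "dim_col P = dim_row Q" for P Q :: "'a mat"
    using that by (simp add: mat_transpose_mult)
  show ?thesis unfolding kron_split_def
  proof (rule exI[of _ "transpose_mat Y'"], rule exI[of _ "transpose_mat X'"], rule exI[of _ "transpose_mat Y"],
      rule exI[of _ "transpose_mat X"], intro conjI)
    show "A * transpose_mat Y' = transpose_mat X' * transpose_mat A'" using t[of A' X'] t[of Y' "transpose_mat A"] e(3) by simp
    show "D * transpose_mat Y' = transpose_mat X' * transpose_mat D'" using t[of D' X'] t[of Y' "transpose_mat D"] e(4) by simp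
    show "transpose_mat A' * transpose_mat Y = transpose_mat X * A" using t[of Y A'] t[of "transpose_mat A" X] e(1) by simp
    show "transpose_mat D' * transpose_mat Y = transpose_mat X * D" using t[of Y D'] t[of "transpose_mat D" X] e(2) by simp
    show "transpose_mat Y * transpose_mat Y' = 1\<^sub>m (dim_col (transpose_mat A'))" using t[of Y' Y] e(6) by simp
    show "transpose_mat X * transpose_mat X' = 1\<^sub>m (dim_row (transpose_mat A'))" using t[of X' X] e(5) by simp
  qed (auto intro!: carrier_matI)
qed

text \<open>Padded by zero rows, A - tD becomes a square matrix over the polynomials with
  determinant 0. A kernel vector over this domain has a chain as its coefficients.\<close>

lemma pencil_chain_exists:
  fixes A D :: "'k::field mat"
  assumes A: "A \<in> carrier_mat q p" and D: "D \<in> carrier_mat q p" and inf: "infinite (UNIV :: 'k set)"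
    and sing: "q < p \<or> q = p \<and> (\<forall>t. t \<noteq> 0 \<longrightarrow> det (A - t \<cdot>\<^sub>m D) = 0)"
  obtains N x c m where "pencil_chain q p (\<lambda>r c. A $$ (r, c)) (\<lambda>r c. D $$ (r, c)) (int N) x" "c < p" "x m c \<noteq> 0"
proof -
  note [simp] = carrier_matD[OF A] carrier_matD[OF D]
  define M where "M = mat p p (\<lambda>(i, j). if i < q then [:A $$ (i, j), - D $$ (i, j):] else 0)"
  have M: "M \<in> carrier_mat p p" by (simp add: M_def)
  have "det M = 0"
    using sing
  proof
    assume qp: "q < p"
    have "(\<Prod>i = 0..<p. M $$ (i, \<pi> i)) = 0" if "\<pi> permutes {0..<p}" for \<pi>
    proof (rule prod_zero)
      have "\<pi> q < p" using permutes_in_image[OF that, of q] qp by simp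
      then show "\<exists>i\<in>{0..<p}. M $$ (i, \<pi> i) = 0" using qp by (intro bexI[of _ q]) (auto simp: M_def)
    qed simp
    then show ?thesis unfolding det_def'[OF M] by (intro sum.neutral) auto
  next
    assume s: "q = p \<and> (\<forall>t. t \<noteq> 0 \<longrightarrow> det (A - t \<cdot>\<^sub>m D) = 0)"
    \<comment> \<open>The determinant is known to vanish for nonzero \<open>t\<close> only, which is
      enough for a polynomial over an infinite field.\<close>
    show ?thesis
    proof (rule poly_zero_cofinite[OF inf, of "{0}"])
      fix t :: 'k assume t: "t \<notin> {0}"
      have ev: "comm_ring_hom (\<lambda>p. poly p t)" by unfold_locales auto
      have "map_mat (\<lambda>p. poly p t) M = A - t \<cdot>\<^sub>m D" using s by (intro eq_matI) (auto simp: M_def)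
      then show "poly (det M) t = 0" using s t by (simp add: comm_ring_hom.hom_det[OF ev, symmetric])
    qed simp
  qed
  then obtain v where v: "v \<in> carrier_vec p" "v \<noteq> 0\<^sub>v p" "M *\<^sub>v v = 0\<^sub>v p"
    using det_0_iff_vec_prod_zero[OF M] by auto
  \<comment> \<open>Negative degrees need the explicit value 0, because \<open>nat\<close> would
    send them to the constant coefficient.\<close>
  define x where "x m c = (if m < 0 then 0 else coeff (v $ c) (nat m))" for m c
  define N where "N = Max (insert 0 ((\<lambda>c. degree (v $ c)) ` {..<p}))"
  have bound: "degree (v $ c) \<le> N" if "c < p" for c
    unfolding N_def using that by (intro Max_ge) auto
  have qp: "q \<le> p" using sing by auto
  have eq: "(\<Sum>c<p. [:A $$ (r, c), - D $$ (r, c):] * v $ c) = 0" if r: "r < q" for r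
  proof -
    have "(M *\<^sub>v v) $ r = 0" using v r qp by simp
    then show ?thesis using r qp v(1) by (simp add: M_def scalar_prod_def lessThan_atLeast0)
  qed
  have rec: "(\<Sum>c<p. A $$ (r, c) * x (m + 1) c) = (\<Sum>c<p. D $$ (r, c) * x m c)" if r: "r < q" for r m
  proof -
    have co: "(\<Sum>c<p. coeff ([:A $$ (r, c), - D $$ (r, c):] * v $ c) k) = 0" for k
      using arg_cong[OF eq[OF r], of "\<lambda>p. coeff p k"] by (simp add: coeff_sum)
    consider "m < -1" | "m = -1" | k where "m = int k" using that by (cases "m < -1"; cases "m = -1") (auto intro: that(3)[of "nat m"])
    then show ?thesis
    proof cases
      case 1
      then show ?thesis by (simp add: x_def)
    next
      case 2
      then show ?thesis using co[of 0] by (simp add: x_def)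
    next
      case (3 k)
      have "nat (int k + 1) = Suc k" by simp
      then show ?thesis using co[of "Suc k"] 3 by (simp add: x_def sum_subtractf)
    qed
  qed
  have supp: "0 \<le> m \<and> m \<le> int N" if "c < p" "x m c \<noteq> 0" for m c
  proof -
    have "0 \<le> m" "coeff (v $ c) (nat m) \<noteq> 0" using that(2) by (auto simp: x_def split: if_splits)
    then show ?thesis using le_degree[of "v $ c" "nat m"] bound[OF that(1)] by auto
  qed
  obtain c where c: "c < p" "v $ c \<noteq> 0"
  proof (rule ccontr)
    assume "\<not> thesis"
    then have "v = 0\<^sub>v p" using that v(1) by (intro eq_vecI) auto
    with v(2) show False ..
  qed
  then have "x (int (degree (v $ c))) c \<noteq> 0" by (simp add: x_def)
  with c(1) show thesis
    by (intro that[of N x c]) (use rec supp in \<open>auto simp: pencil_chain_def\<close>)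
qed

text \<open>\<open>P\<close>, \<open>R\<close> embed the eigenspaces of \<open>b\<close> for \<open>\<sigma>\<close> and \<open>-\<sigma>\<close>, and \<open>Q\<close>, \<open>S\<close> are the projections.\<close>

locale kron_rep =
  fixes V :: "(dh4_gen, 'k::field) rep" and \<sigma> :: 'k and p q :: nat and A D P Q R S :: "'k mat"
  assumes A: "A \<in> carrier_mat q p" and D: "D \<in> carrier_mat q p"
    and P: "P \<in> carrier_mat (rdim V) p" and Q: "Q \<in> carrier_mat p (rdim V)"
    and R: "R \<in> carrier_mat (rdim V) q" and S: "S \<in> carrier_mat q (rdim V)"
    and QP: "Q * P = 1\<^sub>m p" and SR: "S * R = 1\<^sub>m q" and SP: "S * P = 0\<^sub>m q p" and QR: "Q * R = 0\<^sub>m p q"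
    and one: "P * Q + R * S = 1\<^sub>m (rdim V)"
    and sigma: "\<sigma> * \<sigma> = 1"
    and act_a: "act V gen_a = R * A * Q" and act_d: "act V gen_d = - (R * D * Q)"
    and act_b: "act V gen_b = \<sigma> \<cdot>\<^sub>m (P * Q - R * S)" and act_c: "act V gen_c = act V gen_b"
begin

lemma dims[simp]: "dim_row A = q" "dim_col A = p" "dim_row D = q" "dim_col D = p" "dim_row P = rdim V" "dim_col P = p"
  "dim_row Q = p" "dim_col Q = rdim V" "dim_row R = rdim V" "dim_col R = q" "dim_row S = q" "dim_col S = rdim V"
  using A D P Q R S by auto

lemmas rules = QP SR SP QR mat_left[OF QP] mat_left[OF SR] mat_left[OF SP] mat_left[OF QR] mat_alg

lemma in_reps: "V \<in> reps D_H4"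
  unfolding reps_D_H4_iff
proof
  have [simp]: "- (0\<^sub>m n m :: 'k mat) = 0\<^sub>m n m" "x \<cdot>\<^sub>m (0\<^sub>m n m :: 'k mat) = 0\<^sub>m n m" for n m x by (rule eq_matI, auto)+
  let ?a = "act V gen_a" and ?b = "act V gen_b" and ?c = "act V gen_c" and ?d = "act V gen_d"
  show "?a \<in> carrier_mat (rdim V) (rdim V)" "?b \<in> carrier_mat (rdim V) (rdim V)"
    "?c \<in> carrier_mat (rdim V) (rdim V)" "?d \<in> carrier_mat (rdim V) (rdim V)"
    unfolding act_c act_a act_b act_d by (auto intro!: carrier_matI)
  show ba: "?b * ?a = - (?a * ?b)" unfolding act_b act_a
    by (simp add: rules) (rule eq_matI, auto simp del: index_mult_mat(1))
  show db: "?d * ?b = - (?b * ?d)" unfolding act_b act_d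
    by (simp add: rules) (rule eq_matI, auto simp del: index_mult_mat(1))
  show "?c * ?a = - (?a * ?c)" "?d * ?c = - (?c * ?d)" "?b * ?c = ?c * ?b" unfolding act_c by (rule ba db refl)+
  show "?a * ?a = 0\<^sub>m (rdim V) (rdim V)" "?d * ?d = 0\<^sub>m (rdim V) (rdim V)" unfolding act_a act_d
    by (simp_all add: rules)
  have bb: "?b * ?b = P * Q + R * S" unfolding act_b
    by (simp add: rules) (rule eq_matI, auto simp: algebra_simps sigma mult.assoc[symmetric] simp del: index_mult_mat(1))
  show "?b * ?b = 1\<^sub>m (rdim V)" "?c * ?c = 1\<^sub>m (rdim V)" unfolding act_c bb one by (rule refl)+
  show "?d * ?a + ?a * ?d = 1\<^sub>m (rdim V) - ?b * ?c"
    unfolding act_c bb one act_a act_d by (simp add: rules)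
qed

text \<open>The minus sign in \<open>act_d\<close> is chosen so that the pencil is A - tD and the
  recursion for chains has no signs.\<close>

lemma theta: "theta V t = R * (A - t \<cdot>\<^sub>m D) * Q"
  unfolding theta_def act_a act_d by (simp add: mat_alg) (rule eq_matI, auto simp del: index_mult_mat(1))

text \<open>The inverse of the pencil, read as a map from the odd part back to the even part, is a
  contraction.\<close>

lemma contractible_if_regular:
  assumes pq: "q = p" and det: "det (A - t \<cdot>\<^sub>m D) \<noteq> 0"
  shows "contractible_at t V"
proof -
  let ?N = "A - t \<cdot>\<^sub>m D"
  have "?N \<in> carrier_mat p p" using pq by (auto intro!: carrier_matI)
  then obtain W where W: "W \<in> carrier_mat p p" "?N * W = 1\<^sub>m p" "W * ?N = 1\<^sub>m p"
    using det by (rule det_nonzero_inverse)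
  note [simp] = carrier_matD[OF W(1)] pq
  define N where "N = ?N"
  have [simp]: "dim_row N = p" "dim_col N = p" by (simp_all add: N_def)
  note W' = W(2,3)[folded N_def]
  have "R * N * Q * (P * W * S) + P * W * S * (R * N * Q) = P * Q + R * S"
    using rules by (simp add: mat_alg mat_left[OF QP] mat_left[OF SR] mat_left[OF W'(1)] mat_left[OF W'(2)] mat_add_ac)
  then show ?thesis
    unfolding contractible_at_def theta N_def[symmetric] one by (intro bexI[of _ "P * W * S"]) (auto intro!: carrier_matI)
qed

end

lemma kron_rep_hom:
  fixes V W :: "(dh4_gen, 'k::field) rep"
  assumes V: "kron_rep V \<sigma> p q A D P Q R S" and W: "kron_rep W \<sigma> p' q' A' D' P' Q' R' S'"
    and X: "X \<in> carrier_mat p p'" "Y \<in> carrier_mat q q'" "A * X = Y * A'" "D * X = Y * D'"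
  shows "P * X * Q' + R * Y * S' \<in> rep_hom W V"
proof -
  interpret V: kron_rep V \<sigma> p q A D P Q R S by fact
  interpret W: kron_rep W \<sigma> p' q' A' D' P' Q' R' S' by fact
  note [simp] = carrier_matD[OF X(1)] carrier_matD[OF X(2)]
  let ?M = "P * X * Q' + R * Y * S'"
  note rules = V.QP V.SR V.SP V.QR mat_left[OF V.QP] mat_left[OF V.SR] mat_left[OF V.SP] mat_left[OF V.QR]
    W.QP W.SR W.SP W.QR mat_left[OF W.QP] mat_left[OF W.SR] mat_left[OF W.SP] mat_left[OF W.QR] mat_alg
  have [simp]: "- (0\<^sub>m n m :: 'k mat) = 0\<^sub>m n m" for n m by (rule eq_matI) auto
  show ?thesis
  proof (rule rep_homI)
    have a: "?M * act W gen_a = act V gen_a * ?M"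
      unfolding V.act_a W.act_a by (simp add: rules mat_left[OF X(3)])
    have d: "?M * act W gen_d = act V gen_d * ?M"
      unfolding V.act_d W.act_d by (simp add: rules mat_left[OF X(4)])
    have b: "?M * act W gen_b = act V gen_b * ?M"
      unfolding V.act_b W.act_b by (simp add: rules) (rule eq_matI, auto simp: algebra_simps simp del: index_mult_mat(1))
    show "?M * act W g = act V g * ?M" for g by (cases g) (simp_all only: a b d V.act_c W.act_c)
  qed (auto intro!: carrier_matI)
qed

text \<open>A retraction of pencils induces one of modules, and a nonzero retract of an
  indecomposable module is all of it.\<close>

lemma kron_rep_iso:
  fixes V W :: "(dh4_gen, 'k::field) rep"
  assumes V: "kron_rep V \<sigma> p q A D P Q R S" and W: "kron_rep W \<sigma> p' q' A' D' P' Q' R' S'"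
    and ind: "indecomposable D_H4 V" and W0: "rdim W \<noteq> 0" and split: "kron_split A D A' D'"
  shows "rep_iso V W"
proof -
  interpret V: kron_rep V \<sigma> p q A D P Q R S by fact
  interpret W: kron_rep W \<sigma> p' q' A' D' P' Q' R' S' by fact
  obtain X Y X' Y' where c: "X \<in> carrier_mat p p'" "Y \<in> carrier_mat q q'" "X' \<in> carrier_mat p' p" "Y' \<in> carrier_mat q' q"
    and e: "A * X = Y * A'" "D * X = Y * D'" "A' * X' = Y' * A" "D' * X' = Y' * D"
      "X' * X = 1\<^sub>m p'" "Y' * Y = 1\<^sub>m q'"
    using split unfolding kron_split_def by auto
  note [simp] = carrier_matD[OF c(1)] carrier_matD[OF c(2)] carrier_matD[OF c(3)] carrier_matD[OF c(4)]
  have "P' * X' * Q + R' * Y' * S \<in> rep_hom V W" "P * X * Q' + R * Y * S' \<in> rep_hom W V"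
    by (rule kron_rep_hom[OF W V c(3,4) e(3,4)]) (rule kron_rep_hom[OF V W c(1,2) e(1,2)])
  moreover have "(P' * X' * Q + R' * Y' * S) * (P * X * Q' + R * Y * S') = P' * Q' + R' * S'"
    by (simp add: V.rules mat_left[OF e(5)] mat_left[OF e(6)])
  ultimately show ?thesis
    using indecomposable_retract[OF ind reps_wf[OF W.in_reps] W0] W.one by simp
qed

text \<open>A module that is not contractible has neither \<open>bc = -1\<close> nor
  \<open>a d \<noteq> 0\<close>. By homogeneity \<open>a\<close> and \<open>d\<close> then map the
  eigenspace of \<open>b\<close> for \<sigma> to the one for -\<sigma> and kill the latter.\<close>

lemma kron_rep_exists:
  fixes V :: "(dh4_gen, 'k::field) rep"
  assumes V: "indecomposable D_H4 V" and two: "(2::'k) \<noteq> 0" and nc: "\<not> contractible V"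
  obtains \<sigma> p q A D P Q R S where "kron_rep V \<sigma> p q A D P Q R S"
proof -
  let ?n = "rdim V" and ?a = "act V gen_a" and ?b = "act V gen_b" and ?d = "act V gen_d"
  note Vr = indecomposable_reps[OF V]
  interpret V: dh4_mats ?n ?a ?b "act V gen_c" ?d using Vr by (simp add: reps_D_H4_iff)
  note [simp] = V.dims
  have "contractible V" if "?b * act V gen_c = - 1\<^sub>m ?n"
    unfolding contractible_def using contractible_at_bc_minus[OF Vr that two, of 1] by (intro exI[of _ 1]) simp
  then have bc: "act V gen_c = ?b" using indecomposable_bc[OF V two] nc by blast
  have "?a * ?d = 0\<^sub>m ?n ?n" using contractible_if_ad_nonzero[OF V bc two] nc by blast
  then obtain \<sigma> where \<sigma>: "\<sigma> * \<sigma> = 1" and ab: "?a * ?b = \<sigma> \<cdot>\<^sub>m ?a" and db: "?d * ?b = \<sigma> \<cdot>\<^sub>m ?d"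
    using homogeneous_if_ad_zero[OF V bc two] by blast
  have ba: "?b * ?a = (- \<sigma>) \<cdot>\<^sub>m ?a" unfolding V.rel_ba ab by (rule eq_matI) auto
  have bd: "?b * ?d = (- \<sigma>) \<cdot>\<^sub>m ?d"
  proof -
    have "?b * ?d = - (?d * ?b)" unfolding V.rel_db by simp
    then show ?thesis unfolding db by (simp del: index_mult_mat(1)) (rule eq_matI, auto)
  qed
  have \<sigma>': "\<sigma> * (\<sigma> * x) = x" for x using \<sigma> by (simp add: mult.assoc[symmetric])
  \<comment> \<open>The projections onto the eigenspaces of \<open>b\<close> for \<sigma> and
    -\<sigma>; here \<sigma> is its own inverse.\<close>
  define E where "E = (1/2) \<cdot>\<^sub>m (1\<^sub>m ?n + \<sigma> \<cdot>\<^sub>m ?b)"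
  define F where "F = (1/2) \<cdot>\<^sub>m (1\<^sub>m ?n - \<sigma> \<cdot>\<^sub>m ?b)"
  have EF[simp]: "dim_row E = ?n" "dim_col E = ?n" "dim_row F = ?n" "dim_col F = ?n" by (simp_all add: E_def F_def)
  have EE: "E * E = E" "F * F = F" "E * F = 0\<^sub>m ?n ?n" "F * E = 0\<^sub>m ?n ?n"
    unfolding E_def F_def using two four_nonzero[OF two]
    by (simp_all add: mat_alg V.rel_bb) (rule eq_matI, auto simp: field_simps \<sigma>' \<sigma> simp del: index_mult_mat(1))+
  have E1: "E + F = 1\<^sub>m ?n"
    unfolding E_def F_def using two by (intro eq_matI) (auto simp: field_simps \<sigma>' \<sigma>)
  have Eb: "\<sigma> \<cdot>\<^sub>m (E - F) = ?b"
    unfolding E_def F_def using two four_nonzero[OF two] by (intro eq_matI) (auto simp: field_simps \<sigma>' \<sigma>)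
  have FaE: "F * ?a * E = ?a" "F * ?d * E = ?d"
    unfolding E_def F_def using two four_nonzero[OF two]
    by (simp_all add: mat_alg ab ba db bd mat_left[OF ba] mat_left[OF bd])
      (rule eq_matI, auto simp: field_simps \<sigma>' \<sigma> simp del: index_mult_mat(1))+
  obtain p P Q where PQ: "P \<in> carrier_mat ?n p" "Q \<in> carrier_mat p ?n" "P * Q = E" "Q * P = 1\<^sub>m p"
    by (rule idempotent_split[OF _ EE(1), of ?n]) (auto intro!: carrier_matI)
  obtain q R S where RS: "R \<in> carrier_mat ?n q" "S \<in> carrier_mat q ?n" "R * S = F" "S * R = 1\<^sub>m q"
    by (rule idempotent_split[OF _ EE(2), of ?n]) (auto intro!: carrier_matI)
  note [simp] = carrier_matD[OF PQ(1)] carrier_matD[OF PQ(2)] carrier_matD[OF RS(1)] carrier_matD[OF RS(2)]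
  have SP: "S * P = 0\<^sub>m q p"
  proof -
    have "S * P = S * (F * E) * P"
      unfolding PQ(3)[symmetric] RS(3)[symmetric] by (simp add: mat_alg PQ(4) RS(4) mat_left[OF RS(4)])
    then show ?thesis unfolding EE by (simp add: mat_alg)
  qed
  have QR: "Q * R = 0\<^sub>m p q"
  proof -
    have "Q * R = Q * (E * F) * R"
      unfolding PQ(3)[symmetric] RS(3)[symmetric] by (simp add: mat_alg PQ(4) RS(4) mat_left[OF PQ(4)])
    then show ?thesis unfolding EE by (simp add: mat_alg)
  qed
  have "kron_rep V \<sigma> p q (S * ?a * P) (- (S * ?d * P)) P Q R S"
  proof
    have "R * (S * ?a * P) * Q = F * ?a * E" "R * (S * ?d * P) * Q = F * ?d * E"
      unfolding PQ(3)[symmetric] RS(3)[symmetric] by (simp_all add: mat_alg)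
    then show "?a = R * (S * ?a * P) * Q" "?d = - (R * (- (S * ?d * P)) * Q)"
      unfolding FaE by (simp_all add: mat_alg)
    show "?b = \<sigma> \<cdot>\<^sub>m (P * Q - R * S)" unfolding PQ(3) RS(3) Eb ..
    show "P * Q + R * S = 1\<^sub>m ?n" unfolding PQ(3) RS(3) E1 ..
  qed (use PQ RS SP QR bc \<sigma> in \<open>auto intro!: carrier_matI\<close>)
  then show thesis by (rule that)
qed

section \<open>Standard models of Kronecker modules\<close>

definition kron_even :: "nat \<Rightarrow> nat \<Rightarrow> 'k::field mat" where
  "kron_even p q = mat (p + q) p (\<lambda>(i, j). if j = i then 1 else 0)"

definition kron_odd :: "nat \<Rightarrow> nat \<Rightarrow> 'k::field mat" where
  "kron_odd p q = mat (p + q) q (\<lambda>(i, j). if p \<le> i then if j = i - p then 1 else 0 else 0)"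

text \<open>The default case covers \<open>b\<close> and \<open>c\<close>, which act alike: by
  \<sigma> on the first \<open>p\<close> coordinates and by -\<sigma> on the others.\<close>

definition kron_module :: "'k::field \<Rightarrow> 'k mat \<Rightarrow> 'k mat \<Rightarrow> (dh4_gen, 'k) rep" where
  "kron_module \<sigma> A D = (let p = dim_col A; q = dim_row A; P = kron_even p q; R = kron_odd p q in
    Rep (p + q) (\<lambda>g. case g of gen_a \<Rightarrow> R * A * transpose_mat P | gen_d \<Rightarrow> - (R * D * transpose_mat P)
      | _ \<Rightarrow> \<sigma> \<cdot>\<^sub>m (P * transpose_mat P - R * transpose_mat R)))"

lemma kron_parts_dims[simp]: "dim_row (kron_even p q) = p + q" "dim_col (kron_even p q) = p"
  "dim_row (kron_odd p q) = p + q" "dim_col (kron_odd p q) = q"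
  by (simp_all add: kron_even_def kron_odd_def)

lemma mult_kron_parts:
  "i < dim_row M \<Longrightarrow> j < p \<Longrightarrow> dim_col M = p + q \<Longrightarrow> (M * kron_even p q) $$ (i, j) = M $$ (i, j)"
  "i < dim_row M \<Longrightarrow> j < q \<Longrightarrow> dim_col M = p + q \<Longrightarrow> (M * kron_odd p q) $$ (i, j) = M $$ (i, p + j)"
  for M :: "'k::field mat"
proof -
  assume a: "i < dim_row M" "j < p" "dim_col M = p + q"
  have "(M * kron_even p q) $$ (i, j) = (\<Sum>k<p + q. M $$ (i, k) * (if k = j then 1 else 0))"
    using a by (subst mult_mat_entry_sum[where n = "p + q"]) (auto simp: kron_even_def intro!: sum.cong)
  then show "(M * kron_even p q) $$ (i, j) = M $$ (i, j)" using a by (simp add: sum_pick_right)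
next
  assume a: "i < dim_row M" "j < q" "dim_col M = p + q"
  have "(M * kron_odd p q) $$ (i, j) = (\<Sum>k<p + q. M $$ (i, k) * (if k = p + j then 1 else 0))"
    using a by (subst mult_mat_entry_sum[where n = "p + q"]) (auto simp: kron_odd_def intro!: sum.cong)
  then show "(M * kron_odd p q) $$ (i, j) = M $$ (i, p + j)" using a by (simp add: sum_pick_right)
qed

lemma kron_parts_entry:
  "i < p + q \<Longrightarrow> j < p \<Longrightarrow> kron_even p q $$ (i, j) = (if j = i then 1 else 0)"
  "i < p + q \<Longrightarrow> j < q \<Longrightarrow> kron_odd p q $$ (i, j) = (if i = p + j then 1 else 0)"
  by (auto simp: kron_even_def kron_odd_def)

lemma kron_parts_mult:
  "j < dim_col M \<Longrightarrow> i < p \<Longrightarrow> dim_row M = p + q \<Longrightarrow> (transpose_mat (kron_even p q) * M) $$ (i, j) = M $$ (i, j)"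
  "j < dim_col M \<Longrightarrow> i < q \<Longrightarrow> dim_row M = p + q \<Longrightarrow> (transpose_mat (kron_odd p q) * M) $$ (i, j) = M $$ (p + i, j)"
  for M :: "'k::field mat"
proof -
  assume a: "j < dim_col M" "i < p" "dim_row M = p + q"
  have "(transpose_mat (kron_even p q) * M) $$ (i, j) = (\<Sum>k<p + q. (if k = i then 1 else 0) * M $$ (k, j))"
    using a by (subst mult_mat_entry_sum[where n = "p + q"]) (auto simp: kron_even_def intro!: sum.cong)
  then show "(transpose_mat (kron_even p q) * M) $$ (i, j) = M $$ (i, j)" using a by (simp add: sum_pick_left)
next
  assume a: "j < dim_col M" "i < q" "dim_row M = p + q"
  have "(transpose_mat (kron_odd p q) * M) $$ (i, j) = (\<Sum>k<p + q. (if k = p + i then 1 else 0) * M $$ (k, j))"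
    using a by (subst mult_mat_entry_sum[where n = "p + q"]) (auto simp: kron_odd_def intro!: sum.cong)
  then show "(transpose_mat (kron_odd p q) * M) $$ (i, j) = M $$ (p + i, j)" using a by (simp add: sum_pick_left)
qed

lemma kron_parts_square:
  assumes "i < p + q" "j < p + q"
  shows "(kron_even p q * transpose_mat (kron_even p q) :: 'k::field mat) $$ (i, j) = (if i < p \<and> i = j then 1 else 0)"
    "(kron_odd p q * transpose_mat (kron_odd p q) :: 'k mat) $$ (i, j) = (if p \<le> i \<and> i = j then 1 else 0)"
proof -
  let ?P = "kron_even p q :: 'k mat" and ?R = "kron_odd p q :: 'k mat"
  have "(?P * transpose_mat ?P) $$ (i, j) = (\<Sum>k<p. (if k = i then 1 else 0) * (if k = j then 1 else 0))"
    using assms by (subst mult_mat_entry_sum[where n = p]) (auto simp: kron_even_def intro!: sum.cong)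
  then show "(?P * transpose_mat ?P) $$ (i, j) = (if i < p \<and> i = j then 1 else 0)" by (simp add: sum_pick_left)
  have "(?R * transpose_mat ?R) $$ (i, j) = (\<Sum>k<q. (if k = i - p then (if p \<le> i then 1 else 0) else 0) * (if p \<le> j then if k = j - p then 1 else 0 else 0))"
    using assms by (subst mult_mat_entry_sum[where n = q]) (auto simp: kron_odd_def intro!: sum.cong)
  then show "(?R * transpose_mat ?R) $$ (i, j) = (if p \<le> i \<and> i = j then 1 else 0)" using assms by (auto simp: sum_pick_left)
qed

lemma kron_module_rep:
  fixes A D :: "'k::field mat"
  assumes "A \<in> carrier_mat q p" "D \<in> carrier_mat q p" "\<sigma> * \<sigma> = 1"
  shows "kron_rep (kron_module \<sigma> A D) \<sigma> p q A D (kron_even p q) (transpose_mat (kron_even p q)) (kron_odd p q) (transpose_mat (kron_odd p q))"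
proof -
  have [simp]: "rdim (kron_module \<sigma> A D) = p + q" using assms by (auto simp: kron_module_def Let_def)
  show ?thesis
  proof
    let ?P = "kron_even p q :: 'k mat" and ?R = "kron_odd p q :: 'k mat"
    show "?P * transpose_mat ?P + ?R * transpose_mat ?R = 1\<^sub>m (rdim (kron_module \<sigma> A D))"
      by (rule eq_matI) (auto simp: kron_parts_square simp del: index_mult_mat(1))
    show "transpose_mat ?P * ?P = 1\<^sub>m p" "transpose_mat ?R * ?R = 1\<^sub>m q"
      by (rule eq_matI, auto simp: kron_parts_mult kron_parts_entry simp del: index_mult_mat(1))+
    show "transpose_mat ?R * ?P = 0\<^sub>m q p" "transpose_mat ?P * ?R = 0\<^sub>m p q"
      by (rule eq_matI, auto simp: kron_parts_mult kron_parts_entry simp del: index_mult_mat(1))+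
  qed (use assms in \<open>auto simp: kron_module_def Let_def\<close>)
qed

text \<open>A square pencil that is invertible at some nonzero \<open>t\<close> would be
  contractible, so a square pencil is singular here. Pencils with more rows than columns are reduced
  to the other case by transposition.\<close>

lemma noncontractible_classification:
  fixes V :: "(dh4_gen, 'k::field) rep"
  assumes V: "indecomposable D_H4 V" and two: "(2::'k) \<noteq> 0" and nc: "\<not> contractible V" and inf: "infinite (UNIV :: 'k set)"
  obtains \<sigma> n A D where "\<sigma> * \<sigma> = 1" "rep_iso V (kron_module \<sigma> A D)"
    "A = kron_shift n \<and> D = kron_incl n \<or> A = transpose_mat (kron_shift n) \<and> D = transpose_mat (kron_incl n)"
proof -
  obtain \<sigma> p q A D P Q R S where form: "kron_rep V \<sigma> p q A D P Q R S" by (rule kron_rep_exists[OF V two nc])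
  interpret kron_rep V \<sigma> p q A D P Q R S by (rule form)
  have sing: "det (A - t \<cdot>\<^sub>m D) = 0" if "q = p" "t \<noteq> 0" for t
    using contractible_if_regular[OF that(1), of t] nc that(2) unfolding contractible_def by blast
  have ki: "(kron_shift n :: 'k mat) \<in> carrier_mat n (Suc n)" "(kron_incl n :: 'k mat) \<in> carrier_mat n (Suc n)" for n
    by (auto intro!: carrier_matI)
  show thesis
  proof (cases "q \<le> p")
    case True
    then have "q < p \<or> q = p \<and> (\<forall>t. t \<noteq> 0 \<longrightarrow> det (A - t \<cdot>\<^sub>m D) = 0)" using sing by auto
    then obtain N x c m where "pencil_chain q p (\<lambda>r c. A $$ (r, c)) (\<lambda>r c. D $$ (r, c)) (int N) x" "c < p" "x m c \<noteq> 0"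
      by (rule pencil_chain_exists[OF A D inf])
    then obtain n where n: "kron_split A D (kron_shift n) (kron_incl n)" using kron_split_chain[OF A D] by blast
    have K: "kron_rep (kron_module \<sigma> (kron_shift n) (kron_incl n)) \<sigma> (Suc n) n (kron_shift n) (kron_incl n) (kron_even (Suc n) n)
       (transpose_mat (kron_even (Suc n) n)) (kron_odd (Suc n) n) (transpose_mat (kron_odd (Suc n) n))"
      by (rule kron_module_rep[OF ki sigma])
    have "rdim (kron_module \<sigma> (kron_shift n) (kron_incl n)) \<noteq> 0" by (simp add: kron_module_def Let_def)
    from kron_rep_iso[OF form K V this n] show thesis by (intro that[OF sigma]) auto
  next
    case False
    have At: "transpose_mat A \<in> carrier_mat p q" "transpose_mat D \<in> carrier_mat p q" by (auto intro!: carrier_matI)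
    from False have "p < q \<or> p = q \<and> (\<forall>t. t \<noteq> 0 \<longrightarrow> det (transpose_mat A - t \<cdot>\<^sub>m transpose_mat D) = 0)" by auto
    then obtain N x c m where "pencil_chain p q (\<lambda>r c. transpose_mat A $$ (r, c)) (\<lambda>r c. transpose_mat D $$ (r, c)) (int N) x" "c < q" "x m c \<noteq> 0"
      by (rule pencil_chain_exists[OF At inf])
    then obtain n where "kron_split (transpose_mat A) (transpose_mat D) (kron_shift n) (kron_incl n)" using kron_split_chain[OF At] by blast
    then have n: "kron_split A D (transpose_mat (kron_shift n)) (transpose_mat (kron_incl n))"
      by (rule kron_split_transpose[OF A D ki])
    have ki': "transpose_mat (kron_shift n :: 'k mat) \<in> carrier_mat (Suc n) n" "transpose_mat (kron_incl n :: 'k mat) \<in> carrier_mat (Suc n) n"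
      by (auto intro!: carrier_matI)
    have "rdim (kron_module \<sigma> (transpose_mat (kron_shift n)) (transpose_mat (kron_incl n))) \<noteq> 0" by (simp add: kron_module_def Let_def)
    from kron_rep_iso[OF form kron_module_rep[OF ki' sigma] V this n] show thesis by (intro that[OF sigma]) auto
  qed
qed

section \<open>Numerical invariants of the modules that are not contractible\<close>

text \<open>The first unit vector, which spans the kernel of \<open>kron_shift n\<close>.\<close>

definition kron_first :: "nat \<Rightarrow> 'k::field mat" where
  "kron_first n = mat (Suc n) 1 (\<lambda>(i, j). if i = 0 then 1 else 0)"

lemma kron_first_dims[simp]: "dim_row (kron_first n) = Suc n" "dim_col (kron_first n) = 1"
  by (simp_all add: kron_first_def)

lemma kron_entry:
  "i < n \<Longrightarrow> j < Suc n \<Longrightarrow> kron_shift n $$ (i, j) = (if j = Suc i then 1 else 0)"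
  "i < n \<Longrightarrow> j < Suc n \<Longrightarrow> kron_incl n $$ (i, j) = (if j = i then 1 else 0)"
  "i < Suc n \<Longrightarrow> j < 1 \<Longrightarrow> kron_first n $$ (i, j) = (if i = 0 then 1 else 0)"
  by (simp_all add: kron_shift_def kron_incl_def kron_first_def)

lemma kron_mult_transpose_entry:
  fixes M :: "'k::field mat"
  shows "i < n \<Longrightarrow> r < dim_row M \<Longrightarrow> dim_col M = Suc n \<Longrightarrow> (M * transpose_mat (kron_shift n)) $$ (r, i) = M $$ (r, Suc i)"
    "i < n \<Longrightarrow> r < dim_row M \<Longrightarrow> dim_col M = Suc n \<Longrightarrow> (M * transpose_mat (kron_incl n)) $$ (r, i) = M $$ (r, i)"
    "c < dim_col M \<Longrightarrow> j < Suc n \<Longrightarrow> dim_row M = n \<Longrightarrow> (transpose_mat (kron_shift n) * M) $$ (j, c) = (if j = 0 then 0 else M $$ (j - 1, c))"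
    "c < dim_col M \<Longrightarrow> j < Suc n \<Longrightarrow> dim_row M = n \<Longrightarrow> (transpose_mat (kron_incl n) * M) $$ (j, c) = (if j < n then M $$ (j, c) else 0)"
proof -
  have t: "(X * Y) $$ (r, i) = (transpose_mat Y * transpose_mat X) $$ (i, r)" if "dim_col X = dim_row Y" "r < dim_row X" "i < dim_col Y" for X Y :: "'k mat" and r i
    using that by (simp add: mat_transpose_mult[symmetric] del: index_mult_mat(1))
  show "i < n \<Longrightarrow> r < dim_row M \<Longrightarrow> dim_col M = Suc n \<Longrightarrow> (M * transpose_mat (kron_shift n)) $$ (r, i) = M $$ (r, Suc i)"
    "i < n \<Longrightarrow> r < dim_row M \<Longrightarrow> dim_col M = Suc n \<Longrightarrow> (M * transpose_mat (kron_incl n)) $$ (r, i) = M $$ (r, i)"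
    "c < dim_col M \<Longrightarrow> j < Suc n \<Longrightarrow> dim_row M = n \<Longrightarrow> (transpose_mat (kron_shift n) * M) $$ (j, c) = (if j = 0 then 0 else M $$ (j - 1, c))"
    "c < dim_col M \<Longrightarrow> j < Suc n \<Longrightarrow> dim_row M = n \<Longrightarrow> (transpose_mat (kron_incl n) * M) $$ (j, c) = (if j < n then M $$ (j, c) else 0)"
    by (subst t; simp add: kron_mult_entry del: index_mult_mat(1))+
qed

lemma kron_first_relations:
  fixes n :: nat
  defines "A \<equiv> kron_shift n :: 'k::field mat" and "e \<equiv> kron_first n :: 'k mat"
  shows "A * transpose_mat A = 1\<^sub>m n" "transpose_mat A * A + e * transpose_mat e = 1\<^sub>m (Suc n)" "transpose_mat e * e = 1\<^sub>m 1"
    "A * e = 0\<^sub>m n 1" "transpose_mat e * transpose_mat A = 0\<^sub>m 1 n"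
proof -
  have [simp]: "dim_row A = n" "dim_col A = Suc n" "dim_row e = Suc n" "dim_col e = 1" by (simp_all add: A_def e_def)
  show "A * transpose_mat A = 1\<^sub>m n"
    unfolding A_def by (rule eq_matI) (auto simp: kron_mult_entry kron_entry simp del: index_mult_mat(1))
  have ee: "(e * transpose_mat e) $$ (i, j) = (if i = 0 \<and> j = 0 then 1 else 0)" if "i < Suc n" "j < Suc n" for i j
    using that by (subst mult_mat_entry_sum[where n = 1]) (auto simp: e_def kron_first_def)
  show "transpose_mat A * A + e * transpose_mat e = 1\<^sub>m (Suc n)"
  proof (rule eq_matI)
    fix i j assume "i < dim_row (1\<^sub>m (Suc n) :: 'k mat)" "j < dim_col (1\<^sub>m (Suc n) :: 'k mat)"
    then show "(transpose_mat A * A + e * transpose_mat e) $$ (i, j) = 1\<^sub>m (Suc n) $$ (i, j)"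
      by (cases i) (auto simp: ee A_def kron_mult_transpose_entry kron_entry simp del: index_mult_mat(1))
  qed auto
  show "A * e = 0\<^sub>m n 1"
    unfolding A_def by (rule eq_matI) (auto simp: kron_mult_entry e_def kron_entry simp del: index_mult_mat(1))
  show "transpose_mat e * transpose_mat A = 0\<^sub>m 1 n"
    unfolding A_def by (rule eq_matI) (auto simp: kron_mult_transpose_entry e_def kron_entry simp del: index_mult_mat(1))
  show "transpose_mat e * e = 1\<^sub>m 1"
  proof (rule eq_matI)
    fix i j assume ij: "i < dim_row (1\<^sub>m 1 :: 'k mat)" "j < dim_col (1\<^sub>m 1 :: 'k mat)"
    have "(transpose_mat e * e) $$ (0, 0) = (\<Sum>k<Suc n. (if k = 0 then 1 else 0) * (if k = 0 then 1 else 0))"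
      by (subst mult_mat_entry_sum[where n = "Suc n"]) (auto simp: e_def kron_first_def intro!: sum.cong simp del: sum.lessThan_Suc)
    then show "(transpose_mat e * e) $$ (i, j) = 1\<^sub>m 1 $$ (i, j)" using ij by (simp only: sum_pick_left) simp
  qed auto
qed

context kron_rep
begin

text \<open>At \<open>t = 0\<close> the pencil is the surjection \<open>kron_shift n\<close>. Its
  transpose is a right inverse and gives the homotopy; the kernel line, in the even part, carries
  the homology.\<close>

lemma rank_one_shift:
  assumes "A = kron_shift n"
  shows "rank_one_at_zero V"
proof -
  have pq[simp]: "p = Suc n" "q = n" using A assms by auto
  let ?e = "kron_first n :: 'k mat"
  note r = kron_first_relations[where 'k = 'k and n = n, folded assms]
  note rr = r(1,3,4,5) mat_left[OF r(1)] mat_left[OF r(3)] mat_left[OF r(4)] mat_left[OF r(5)]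
  have zero: "A * (transpose_mat A * S) = S" by (simp add: mat_left[OF r(1)] mat_alg)
  have t: "act V gen_a * (P * transpose_mat A * S) + P * transpose_mat A * S * act V gen_a + P * ?e * (transpose_mat ?e * Q) = 1\<^sub>m (rdim V)"
  proof -
    have "act V gen_a * (P * transpose_mat A * S) + P * transpose_mat A * S * act V gen_a + P * ?e * (transpose_mat ?e * Q)
      = R * S + P * (transpose_mat A * A + ?e * transpose_mat ?e) * Q"
      unfolding act_a by (simp add: rules rr mat_add_ac)
    also have "\<dots> = P * Q + R * S" unfolding r(2) by (simp add: mat_alg mat_add_ac)
    finally show ?thesis unfolding one .
  qed
  show ?thesis unfolding rank_one_at_zero_def
  proof (rule exI[of _ "P * ?e"], rule exI[of _ "transpose_mat ?e * Q"], rule exI[of _ "P * transpose_mat A * S"], intro conjI)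
    show "act V gen_a * (P * ?e) = 0\<^sub>m (rdim V) 1" "transpose_mat ?e * Q * act V gen_a = 0\<^sub>m 1 (rdim V)"
      "transpose_mat ?e * Q * (P * ?e) = 1\<^sub>m 1"
      unfolding act_a using rr by (simp_all add: rules rr)
    show "1\<^sub>m (rdim V) - P * ?e * (transpose_mat ?e * Q) = act V gen_a * (P * transpose_mat A * S) + P * transpose_mat A * S * act V gen_a"
      unfolding t[symmetric] using act_a by (intro eq_matI) (auto simp del: index_mult_mat(1))
  qed (use act_a in \<open>auto intro!: carrier_matI\<close>)
qed

text \<open>Here the map is injective with a one-dimensional cokernel, so the class sits in the odd
  part.\<close>

lemma rank_one_shift_transpose:
  assumes "A = transpose_mat (kron_shift n)"
  shows "rank_one_at_zero V"
proof -
  have pq[simp]: "p = n" "q = Suc n" using A assms by auto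
  have B: "transpose_mat A = kron_shift n" using assms by simp
  let ?e = "kron_first n :: 'k mat"
  note r = kron_first_relations[where 'k = 'k and n = n, folded B, simplified]
  note rr = r(1,3,4,5) mat_left[OF r(1)] mat_left[OF r(3)] mat_left[OF r(4)] mat_left[OF r(5)]
  have t: "act V gen_a * (P * transpose_mat A * S) + P * transpose_mat A * S * act V gen_a + R * ?e * (transpose_mat ?e * S) = 1\<^sub>m (rdim V)"
  proof -
    have "act V gen_a * (P * transpose_mat A * S) + P * transpose_mat A * S * act V gen_a + R * ?e * (transpose_mat ?e * S)
      = P * Q + R * (A * transpose_mat A + ?e * transpose_mat ?e) * S"
      unfolding act_a by (simp add: rules rr mat_add_ac)
    also have "\<dots> = P * Q + R * S" unfolding r(2) by (simp add: mat_alg mat_add_ac)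
    finally show ?thesis unfolding one .
  qed
  show ?thesis unfolding rank_one_at_zero_def
  proof (rule exI[of _ "R * ?e"], rule exI[of _ "transpose_mat ?e * S"], rule exI[of _ "P * transpose_mat A * S"], intro conjI)
    show "act V gen_a * (R * ?e) = 0\<^sub>m (rdim V) 1" "transpose_mat ?e * S * act V gen_a = 0\<^sub>m 1 (rdim V)"
      "transpose_mat ?e * S * (R * ?e) = 1\<^sub>m 1"
      unfolding act_a using rr by (simp_all add: rules rr)
    show "1\<^sub>m (rdim V) - R * ?e * (transpose_mat ?e * S) = act V gen_a * (P * transpose_mat A * S) + P * transpose_mat A * S * act V gen_a"
      unfolding t[symmetric] using act_a by (intro eq_matI) (auto simp del: index_mult_mat(1))
  qed (use act_a in \<open>auto intro!: carrier_matI\<close>)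
qed

text \<open>Only the even part of a vector enters the cycle condition, and in
  \<open>row_theta\<close> only the odd part of a row; both conditions become equations for the
  pencil.\<close>

lemma theta_col: "dim_row v = rdim V \<Longrightarrow> theta V t * v = 0\<^sub>m (rdim V) (dim_col v) \<longleftrightarrow> (A - t \<cdot>\<^sub>m D) * (Q * v) = 0\<^sub>m q (dim_col v)"
proof
  assume [simp]: "dim_row v = rdim V"
  define N where "N = A - t \<cdot>\<^sub>m D"
  have [simp]: "dim_row N = q" "dim_col N = p" by (simp_all add: N_def)
  show "theta V t * v = 0\<^sub>m (rdim V) (dim_col v)" if z: "(A - t \<cdot>\<^sub>m D) * (Q * v) = 0\<^sub>m q (dim_col v)"
    unfolding theta N_def[symmetric] using z unfolding N_def[symmetric] by (simp add: mat_alg)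
  assume z: "theta V t * v = 0\<^sub>m (rdim V) (dim_col v)"
  have "S * (theta V t * v) = N * (Q * v)" unfolding theta N_def[symmetric] by (simp add: rules)
  then show "(A - t \<cdot>\<^sub>m D) * (Q * v) = 0\<^sub>m q (dim_col v)" unfolding z N_def[symmetric] by (simp add: mat_alg)
qed

lemma row_theta: "dim_col f = rdim V \<Longrightarrow> f * theta V t = 0\<^sub>m (dim_row f) (rdim V) \<longleftrightarrow> (f * R) * (A - t \<cdot>\<^sub>m D) = 0\<^sub>m (dim_row f) p"
proof
  assume [simp]: "dim_col f = rdim V"
  define N where "N = A - t \<cdot>\<^sub>m D"
  have [simp]: "dim_row N = q" "dim_col N = p" by (simp_all add: N_def)
  show "f * theta V t = 0\<^sub>m (dim_row f) (rdim V)" if z: "(f * R) * (A - t \<cdot>\<^sub>m D) = 0\<^sub>m (dim_row f) p"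
  proof -
    have "f * theta V t = (f * R) * N * Q" unfolding theta N_def[symmetric] by (simp add: mat_alg)
    then show ?thesis using z unfolding N_def[symmetric] by (simp add: mat_alg del: assoc_mult_mat mat_assoc)
  qed
  assume z: "f * theta V t = 0\<^sub>m (dim_row f) (rdim V)"
  have "(f * theta V t) * P = (f * R) * N" unfolding theta N_def[symmetric] by (simp add: rules)
  then show "(f * R) * (A - t \<cdot>\<^sub>m D) = 0\<^sub>m (dim_row f) p" unfolding z N_def[symmetric] by (simp add: mat_alg)
qed

end

section \<open>Degrees of classes on the blocks\<close>

text \<open>The first equations force g_i = t^i g_0, the second force all h_j to vanish. A nonzero
  pairing then needs g_0 \<noteq> 0, and g_n has degree at least n. For L_n the \<open>g\<close>
  come from the cycle, for the transposed block from the cocycle.\<close>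

lemma pencil_degree:
  fixes g h :: "nat \<Rightarrow> 'k::field poly"
  assumes inf: "infinite (UNIV :: 'k set)"
    and g: "\<And>i t. i < n \<Longrightarrow> poly (g (Suc i)) t - t * poly (g i) t = 0"
    and h: "\<And>j t. j < Suc n \<Longrightarrow> (if j = 0 then 0 else poly (h (j - 1)) t) - t * (if j < n then poly (h j) t else 0) = 0"
    and nz: "(\<Sum>i<Suc n. g i * u i) + (\<Sum>j<n. h j * w j) \<noteq> 0"
    and deg: "degree (g n) \<le> d"
  shows "n \<le> d"
proof -
  have eqI: "p = q" if "\<And>t. poly p t = poly q t" for p q :: "'k poly"
    using poly_zero_cofinite[OF inf, of "{}" "p - q"] that by simp
  have g': "g (Suc i) = [:0, 1:] * g i" if "i < n" for i
    by (rule eqI) (use g[OF that] in simp)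
  have gi: "g i = monom 1 i * g 0" if "i \<le> n" for i
    using that
  proof (induction i)
    case (Suc i)
    then have "g (Suc i) = [:0, 1:] * (monom 1 i * g 0)" using g'[of i] by simp
    also have "\<dots> = monom 1 (Suc i) * g 0" by (simp add: monom_Suc mult.assoc)
    finally show ?case .
  qed simp
  have hj: "h j = 0" if "j < n" for j
    using that
  proof (induction j)
    case 0
    then have "[:0, 1:] * h 0 = 0" by (intro eqI) (use h[of 0] in auto)
    then show ?case by simp
  next
    case (Suc j)
    then have "[:0, 1:] * h (Suc j) = h j" by (intro eqI) (use h[of "Suc j"] in auto)
    then show ?case using Suc by simp
  qed
  have "g 0 \<noteq> 0"
  proof
    assume z: "g 0 = 0"
    have "g i = 0" if "i \<le> n" for i by (subst gi[OF that]) (simp add: z)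
    then have "(\<Sum>i<Suc n. g i * u i) = 0" "(\<Sum>j<n. h j * w j) = 0" using hj by (auto intro!: sum.neutral)
    with nz show False by simp
  qed
  then have "degree (g n) = n + degree (g 0)" by (subst gi[OF order_refl]) (simp add: degree_mult_eq degree_monom_eq)
  with deg show ?thesis by simp
qed

lemma rdim_kron_module: "rdim (kron_module \<sigma> A D) = dim_col A + dim_row A"
  by (simp add: kron_module_def Let_def)

lemma kron_parts_poly:
  "j < p \<Longrightarrow> (transpose_mat (kron_even p q) * poly_col (p + q) v t) $$ (j, 0) = poly (v j) t"
  "j < q \<Longrightarrow> (poly_row (p + q) f t * kron_odd p q) $$ (0, j) = poly (f (p + j)) t"
  by (simp_all add: kron_parts_mult mult_kron_parts poly_col_def poly_row_def del: index_mult_mat(1))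

lemma sum_lessThan_add: "(\<Sum>i<p + q. F i) = (\<Sum>i<p. F i) + (\<Sum>j<q. F (p + j))" for F :: "nat \<Rightarrow> 'a::comm_monoid_add"
  by (induction q) (auto simp: add.assoc)

lemma pencil_mult_entry:
  fixes B C M :: "'k::field mat"
  assumes "dim_row C = dim_row B" "dim_col C = dim_col B"
  shows "i < dim_row B \<Longrightarrow> j < dim_col M \<Longrightarrow> dim_row M = dim_col B \<Longrightarrow>
      ((B - t \<cdot>\<^sub>m C) * M) $$ (i, j) = (B * M) $$ (i, j) - t * (C * M) $$ (i, j)"
    "i < dim_row M \<Longrightarrow> j < dim_col B \<Longrightarrow> dim_col M = dim_row B \<Longrightarrow>
      (M * (B - t \<cdot>\<^sub>m C)) $$ (i, j) = (M * B) $$ (i, j) - t * (M * C) $$ (i, j)"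
  using assms by (simp_all add: mat_alg del: index_mult_mat(1))

lemma class_bound_shift:
  fixes \<sigma> :: "'k::field" and n :: nat
  assumes \<sigma>: "\<sigma> * \<sigma> = 1" and inf: "infinite (UNIV :: 'k set)"
  defines "K \<equiv> kron_module \<sigma> (kron_shift n) (kron_incl n)"
  shows "class_bound n 0 K" "class_bound d d' K \<Longrightarrow> n \<le> d"
proof -
  have c: "(kron_shift n :: 'k mat) \<in> carrier_mat n (Suc n)" "(kron_incl n :: 'k mat) \<in> carrier_mat n (Suc n)"
    by (auto intro!: carrier_matI)
  interpret kron_rep K \<sigma> "Suc n" n "kron_shift n" "kron_incl n" "kron_even (Suc n) n" "transpose_mat (kron_even (Suc n) n)"
      "kron_odd (Suc n) n" "transpose_mat (kron_odd (Suc n) n)"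
    unfolding K_def by (rule kron_module_rep[OF c \<sigma>])
  have dim: "rdim K = Suc n + n" by (simp add: K_def rdim_kron_module)
  let ?N = "\<lambda>t. kron_shift n - t \<cdot>\<^sub>m kron_incl n :: 'k mat"
  have col: "(?N t * (transpose_mat (kron_even (Suc n) n) * poly_col (rdim K) v t)) $$ (i, 0) = poly (v (Suc i)) t - t * poly (v i) t" if "i < n" for v t i
    using that by (simp add: dim pencil_mult_entry kron_mult_entry kron_parts_poly del: index_mult_mat(1) add_Suc)
  have row: "((poly_row (rdim K) f t * kron_odd (Suc n) n) * ?N t) $$ (0, j) =
      (if j = 0 then 0 else poly (f (Suc n + (j - 1))) t) - t * (if j < n then poly (f (Suc n + j)) t else 0)" if "j < Suc n" for f t j
    using that by (simp add: dim pencil_mult_entry kron_mult_entry kron_parts_poly del: index_mult_mat(1) assoc_mult_mat add_Suc)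
  show "class_bound n 0 K"
    unfolding class_bound_def
  \<comment> \<open>The cycle is (1, t, ..., t^n) in the even part, the cocycle is the first
    coordinate, which vanishes on the odd part; they pair to 1.\<close>
  proof (rule exI[of _ "\<lambda>i. if i \<le> n then monom 1 i else 0"], rule exI[of _ "\<lambda>i. if i = 0 then 1 else 0"], intro conjI allI)
    fix t :: 'k
    let ?v = "\<lambda>i. if i \<le> n then monom 1 i else 0 :: 'k poly" and ?f = "\<lambda>i. if i = 0 then 1 else 0 :: 'k poly"
    have "?N t * (transpose_mat (kron_even (Suc n) n) * poly_col (rdim K) ?v t) = 0\<^sub>m n 1"
      by (rule mat_entry_eqI[of _ n 1]) (auto intro!: carrier_matI simp: col poly_monom simp del: index_mult_mat(1))
    then show "theta K t * poly_col (rdim K) ?v t = 0\<^sub>m (rdim K) 1" using theta_col[of "poly_col (rdim K) ?v t" t] by simp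
    have "(poly_row (rdim K) ?f t * kron_odd (Suc n) n) * ?N t = 0\<^sub>m 1 (Suc n)"
      by (rule mat_entry_eqI[of _ 1 "Suc n"]) (auto intro!: carrier_matI simp: row simp del: index_mult_mat(1) assoc_mult_mat)
    then show "poly_row (rdim K) ?f t * theta K t = 0\<^sub>m 1 (rdim K)" using row_theta[of "poly_row (rdim K) ?f t" t] by simp
    show "(\<Sum>i<rdim K. ?f i * ?v i) \<noteq> 0" by (simp only: sum_pick_left) (simp add: dim)
  qed (auto simp: degree_monom_eq)
  show "n \<le> d" if cb: "class_bound d d' K"
  proof -
    obtain v f where vf: "\<forall>i. degree (v i) \<le> d \<and> degree (f i) \<le> d'"
      "\<forall>t. theta K t * poly_col (rdim K) v t = 0\<^sub>m (rdim K) 1 \<and> poly_row (rdim K) f t * theta K t = 0\<^sub>m 1 (rdim K)"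
      "(\<Sum>i<rdim K. f i * v i) \<noteq> 0" using cb unfolding class_bound_def by blast
    show ?thesis
    proof (rule pencil_degree[OF inf, of n v "\<lambda>j. f (Suc n + j)" f "\<lambda>j. v (Suc n + j)"])
      show "poly (v (Suc i)) t - t * poly (v i) t = 0" if "i < n" for i t
        using vf(2) theta_col[of "poly_col (rdim K) v t" t] col[OF that, of t v] that by simp
      show "(if j = 0 then 0 else poly (f (Suc n + (j - 1))) t) - t * (if j < n then poly (f (Suc n + j)) t else 0) = 0" if "j < Suc n" for j t
        using vf(2) row_theta[of "poly_row (rdim K) f t" t] row[OF that, of f t] that by simp
      show "(\<Sum>i<Suc n. v i * f i) + (\<Sum>j<n. f (Suc n + j) * v (Suc n + j)) \<noteq> 0"
        using vf(3) unfolding dim sum_lessThan_add by (simp only: mult.commute not_False_eq_True)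
    qed (use vf(1) in blast)
  qed
qed

lemma class_bound_shift_transpose:
  fixes \<sigma> :: "'k::field" and n :: nat
  assumes \<sigma>: "\<sigma> * \<sigma> = 1" and inf: "infinite (UNIV :: 'k set)"
  defines "K \<equiv> kron_module \<sigma> (transpose_mat (kron_shift n)) (transpose_mat (kron_incl n))"
  shows "class_bound 0 n K" "class_bound d d' K \<Longrightarrow> n \<le> d'"
proof -
  have c: "transpose_mat (kron_shift n :: 'k mat) \<in> carrier_mat (Suc n) n" "transpose_mat (kron_incl n :: 'k mat) \<in> carrier_mat (Suc n) n"
    by (auto intro!: carrier_matI)
  interpret kron_rep K \<sigma> n "Suc n" "transpose_mat (kron_shift n)" "transpose_mat (kron_incl n)" "kron_even n (Suc n)"
      "transpose_mat (kron_even n (Suc n))" "kron_odd n (Suc n)" "transpose_mat (kron_odd n (Suc n))"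
    unfolding K_def by (rule kron_module_rep[OF c \<sigma>])
  have dim: "rdim K = n + Suc n" by (simp add: K_def rdim_kron_module)
  let ?N = "\<lambda>t. transpose_mat (kron_shift n) - t \<cdot>\<^sub>m transpose_mat (kron_incl n) :: 'k mat"
  have col: "(?N t * (transpose_mat (kron_even n (Suc n)) * poly_col (n + Suc n) v t)) $$ (j, 0) =
      (if j = 0 then 0 else poly (v (j - 1)) t) - t * (if j < n then poly (v j) t else 0)" if "j < Suc n" for v t j
    using that by (simp add: pencil_mult_entry kron_mult_transpose_entry kron_parts_poly del: index_mult_mat(1) add_Suc_right)
  have row: "((poly_row (n + Suc n) f t * kron_odd n (Suc n)) * ?N t) $$ (0, i) = poly (f (n + Suc i)) t - t * poly (f (n + i)) t" if "i < n" for f t i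
    using that by (simp add: pencil_mult_entry kron_mult_transpose_entry kron_parts_poly del: index_mult_mat(1) assoc_mult_mat add_Suc_right)
  show "class_bound 0 n K"
    unfolding class_bound_def
  \<comment> \<open>The roles are exchanged: the first odd basis vector is a constant cycle, killed
    by \<open>theta\<close>, and the powers of \<open>t\<close> sit in the cocycle.\<close>
  proof (rule exI[of _ "\<lambda>i. if i = n then 1 else 0"], rule exI[of _ "\<lambda>i. if n \<le> i \<and> i \<le> n + n then monom 1 (i - n) else 0"], intro conjI allI)
    fix t :: 'k
    let ?v = "\<lambda>i. if i = n then 1 else 0 :: 'k poly" and ?f = "\<lambda>i. if n \<le> i \<and> i \<le> n + n then monom 1 (i - n) else 0 :: 'k poly"
    have "?N t * (transpose_mat (kron_even n (Suc n)) * poly_col (rdim K) ?v t) = 0\<^sub>m (Suc n) 1"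
      unfolding dim by (rule mat_entry_eqI[of _ "Suc n" 1]) (auto intro!: carrier_matI simp: col simp del: index_mult_mat(1) add_Suc_right)
    then show "theta K t * poly_col (rdim K) ?v t = 0\<^sub>m (rdim K) 1" using theta_col[of "poly_col (rdim K) ?v t" t] by simp
    have "(poly_row (rdim K) ?f t * kron_odd n (Suc n)) * ?N t = 0\<^sub>m 1 n"
      unfolding dim by (rule mat_entry_eqI[of _ 1 n])
        (auto intro!: carrier_matI simp: row poly_monom simp del: index_mult_mat(1) assoc_mult_mat add_Suc_right)
    then show "poly_row (rdim K) ?f t * theta K t = 0\<^sub>m 1 (rdim K)" using row_theta[of "poly_row (rdim K) ?f t" t] by simp
    show "(\<Sum>i<rdim K. ?f i * ?v i) \<noteq> 0" by (simp only: sum_pick_right) (simp add: dim)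
  qed (auto simp: degree_monom_eq)
  show "n \<le> d'" if cb: "class_bound d d' K"
  proof -
    obtain v f where vf: "\<forall>i. degree (v i) \<le> d \<and> degree (f i) \<le> d'"
      "\<forall>t. theta K t * poly_col (rdim K) v t = 0\<^sub>m (rdim K) 1 \<and> poly_row (rdim K) f t * theta K t = 0\<^sub>m 1 (rdim K)"
      "(\<Sum>i<rdim K. f i * v i) \<noteq> 0" using cb unfolding class_bound_def by blast
    show ?thesis
    proof (rule pencil_degree[OF inf, of n "\<lambda>i. f (n + i)" v "\<lambda>i. v (n + i)" f])
      show "poly (f (n + Suc i)) t - t * poly (f (n + i)) t = 0" if "i < n" for i t
        using vf(2) row_theta[of "poly_row (rdim K) f t" t] row[OF that, of f t] that by (simp add: dim del: add_Suc_right)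
      show "(if j = 0 then 0 else poly (v (j - 1)) t) - t * (if j < n then poly (v j) t else 0) = 0" if "j < Suc n" for j t
        using vf(2) theta_col[of "poly_col (rdim K) v t" t] col[OF that, of t v] that by (simp add: dim del: add_Suc_right)
      show "(\<Sum>i<Suc n. f (n + i) * v (n + i)) + (\<Sum>j<n. v j * f j) \<noteq> 0"
        using vf(3) unfolding dim sum_lessThan_add by (simp only: mult.commute add.commute not_False_eq_True)
    qed (use vf(1) in blast)
  qed
qed

section \<open>Splitting the unit off a module tensored with its dual\<close>

text \<open>Row-major vectorisation, matching the index convention of \<open>kronecker\<close>; with
  it a Kronecker product acts on matrices by multiplication from both sides.\<close>

definition vec_col :: "nat \<Rightarrow> 'k::field mat \<Rightarrow> 'k mat" where
  "vec_col n M = mat (n * n) 1 (\<lambda>(i, _). M $$ (i div n, i mod n))"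

lemma vec_col_dims[simp]: "dim_row (vec_col n M) = n * n" "dim_col (vec_col n M) = 1"
  by (simp_all add: vec_col_def)

lemma kronecker_vec_col:
  fixes A B M :: "'k::field mat"
  assumes "A \<in> carrier_mat n n" "B \<in> carrier_mat n n" "M \<in> carrier_mat n n"
  shows "kronecker A B * vec_col n M = vec_col n (A * M * transpose_mat B)"
proof (rule mat_entry_eqI[of _ "n * n" 1])
  note [simp] = assms[THEN carrier_matD(1)] assms[THEN carrier_matD(2)]
  fix i j assume ij: "i < n * n" "j < (1::nat)"
  note b = kronecker_bounds[OF ij(1)]
  have "(kronecker A B * vec_col n M) $$ (i, 0) = (\<Sum>k<n * n. A $$ (i div n, k div n) * B $$ (i mod n, k mod n) * M $$ (k div n, k mod n))"
    using ij by (subst mult_mat_entry_sum[where n = "n * n"]) (auto simp: kronecker_entry vec_col_def intro!: sum.cong)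
  also have "\<dots> = (\<Sum>x<n. \<Sum>y<n. A $$ (i div n, x) * B $$ (i mod n, y) * M $$ (x, y))" by (rule sum_div_mod)
  also have "\<dots> = (\<Sum>y<n. \<Sum>x<n. A $$ (i div n, x) * B $$ (i mod n, y) * M $$ (x, y))" by (rule sum.swap)
  also have "\<dots> = (\<Sum>y<n. (A * M) $$ (i div n, y) * transpose_mat B $$ (y, i mod n))"
    using b by (intro sum.cong refl) (simp add: mult_mat_entry_sum[where n = n] sum_distrib_left sum_distrib_right mult_ac del: index_mult_mat(1))
  also have "\<dots> = (A * M * transpose_mat B) $$ (i div n, i mod n)"
    using b by (subst mult_mat_entry_sum[where n = n and A = "A * M"]) auto
  finally show "(kronecker A B * vec_col n M) $$ (i, j) = vec_col n (A * M * transpose_mat B) $$ (i, j)"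
    using ij by (simp add: vec_col_def del: index_mult_mat(1))
qed (use assms in \<open>auto intro!: carrier_matI\<close>)

text \<open>The unit is split off by the coevaluation \<open>vec 1\<close> and the evaluation twisted by \<open>b\<close>, whose composite is the trace of \<open>b\<close>.\<close>

lemma unit_summand:
  fixes V :: "(dh4_gen, 'k::field) rep"
  assumes V: "V \<in> reps D_H4" and bc: "act V gen_c = act V gen_b" and tr: "(\<Sum>i<rdim V. act V gen_b $$ (i, i)) \<noteq> 0"
  obtains W where "W \<in> reps D_H4" "rep_iso (rep_tensor D_H4 V (rep_dual D_H4 V)) (rep_sum (rep_unit D_H4) W)"
proof -
  let ?n = "rdim V" and ?a = "act V gen_a" and ?b = "act V gen_b" and ?d = "act V gen_d"
  interpret V: dh4_mats ?n ?a ?b "act V gen_c" ?d using V by (simp add: reps_D_H4_iff)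
  note [simp] = V.dims reps_wf[OF V] reps_wf[OF reps_dual[OF V]]
  let ?M = "rep_tensor D_H4 V (rep_dual D_H4 V)" and ?T = "transpose_mat"
  have M: "?M \<in> reps D_H4" by (intro reps_tensor reps_dual V)
  define \<tau> where "\<tau> = (\<Sum>i<?n. ?b $$ (i, i))"
  note [simp] = reps_wf[OF M]
  define \<phi> where "\<phi> = vec_col ?n (1\<^sub>m ?n :: 'k mat)"
  \<comment> \<open>The twist by \<open>b\<close> is needed because the square of the antipode is
    conjugation by \<open>b\<close>; division by the trace normalises the composite with
    \<open>\<phi>\<close> to 1.\<close>
  define \<psi> where "\<psi> = (1 / \<tau>) \<cdot>\<^sub>m ?T (vec_col ?n (?T ?b))"
  have [simp]: "dim_row \<phi> = ?n * ?n" "dim_col \<phi> = 1" "dim_row \<psi> = 1" "dim_col \<psi> = ?n * ?n" by (simp_all add: \<phi>_def \<psi>_def)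
  have vadd: "vec_col ?n X + vec_col ?n Y = vec_col ?n (X + Y)"
    if "dim_row X = ?n" "dim_col X = ?n" "dim_row Y = ?n" "dim_col Y = ?n" for X Y :: "'k mat"
    using that kronecker_bounds[of _ ?n ?n] by (intro eq_matI) (auto simp: vec_col_def)
  have vzero: "vec_col ?n (0\<^sub>m ?n ?n :: 'k mat) = 0\<^sub>m (?n * ?n) 1"
    using kronecker_bounds[of _ ?n ?n] by (intro eq_matI) (auto simp: vec_col_def)
  have k: "kronecker A B * vec_col ?n X = vec_col ?n (A * X * ?T B)"
    if "dim_row A = ?n" "dim_col A = ?n" "dim_row B = ?n" "dim_col B = ?n" "dim_row X = ?n" "dim_col X = ?n" for A B X :: "'k mat"
    using that by (intro kronecker_vec_col) (auto intro!: carrier_matI)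
  have dual: "?T (act (rep_dual D_H4 V) gen_a) = - (?a * ?b)" "?T (act (rep_dual D_H4 V) gen_b) = ?b"
    "?T (act (rep_dual D_H4 V) gen_c) = ?b" "?T (act (rep_dual D_H4 V) gen_d) = - (?d * ?b)"
    by (simp_all add: act_dual bc transpose_uminus mat_transpose_mult)
  have addz: "X + - X = 0\<^sub>m ?n ?n" if "dim_row X = ?n" "dim_col X = ?n" for X :: "'k mat"
    using that by (intro eq_matI) auto
  have \<phi>: "act ?M g * \<phi> = \<phi> * act (rep_unit D_H4) g" for g
  proof -
    have 1: "act ?M gen_a * \<phi> = 0\<^sub>m (?n * ?n) 1" "act ?M gen_d * \<phi> = 0\<^sub>m (?n * ?n) 1"
      unfolding \<phi>_def
      by (simp_all add: act_tensor mat_distrib_right k dual mat_one_left mat_one_right bc vadd vzero addz)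
    have 2: "act ?M gen_b * \<phi> = \<phi>" "act ?M gen_c * \<phi> = \<phi>"
      unfolding \<phi>_def by (simp_all add: act_tensor k dual mat_one_left mat_one_right bc V.rel_bb)
    show ?thesis by (cases g) (simp_all add: 1 2 rep_unit_D_H4 mat_alg)
  qed
  have kt: "?T (vec_col ?n X) * kronecker A B = ?T (vec_col ?n (?T A * X * B))"
    if "dim_row A = ?n" "dim_col A = ?n" "dim_row B = ?n" "dim_col B = ?n" "dim_row X = ?n" "dim_col X = ?n" for A B X :: "'k mat"
    using that k[of "?T A" "?T B" X] mat_transpose_mult[of "kronecker (?T A) (?T B)" "vec_col ?n X"] by (simp add: kronecker_transpose)
  have bTbT: "?T ?b * ?T ?b = 1\<^sub>m ?n" using arg_cong[OF V.rel_bb, of ?T] by (simp add: mat_transpose_mult)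
  have dual': "act (rep_dual D_H4 V) gen_a = - (?T ?b * ?T ?a)" "act (rep_dual D_H4 V) gen_b = ?T ?b"
    "act (rep_dual D_H4 V) gen_c = ?T ?b" "act (rep_dual D_H4 V) gen_d = - (?T ?b * ?T ?d)"
    by (simp_all add: act_dual bc)
  have tadd: "?T (vec_col ?n X) + ?T (vec_col ?n (- X)) = 0\<^sub>m 1 (?n * ?n)" if "dim_row X = ?n" "dim_col X = ?n" for X :: "'k mat"
  proof (rule eq_matI)
    fix i j assume "i < dim_row (0\<^sub>m 1 (?n * ?n) :: 'k mat)" "j < dim_col (0\<^sub>m 1 (?n * ?n) :: 'k mat)"
    then show "(?T (vec_col ?n X) + ?T (vec_col ?n (- X))) $$ (i, j) = 0\<^sub>m 1 (?n * ?n) $$ (i, j)"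
      using that kronecker_bounds[of j ?n ?n] by (simp add: vec_col_def)
  qed auto
  have vs: "?T (vec_col ?n (?T ?b)) * act ?M gen_a = 0\<^sub>m 1 (?n * ?n)" "?T (vec_col ?n (?T ?b)) * act ?M gen_d = 0\<^sub>m 1 (?n * ?n)"
    "?T (vec_col ?n (?T ?b)) * act ?M gen_b = ?T (vec_col ?n (?T ?b))" "?T (vec_col ?n (?T ?b)) * act ?M gen_c = ?T (vec_col ?n (?T ?b))"
    by (simp_all add: act_tensor mat_distrib_left kt dual' bc bTbT mat_left[OF bTbT] mat_one_left mat_one_right mat_uminus_right mat_assoc tadd)
  have \<psi>: "\<psi> * act ?M g = act (rep_unit D_H4) g * \<psi>" for g
    by (cases g) (simp_all add: \<psi>_def vs rep_unit_D_H4 mat_alg)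
  have "(?T (vec_col ?n (?T ?b)) * \<phi>) $$ (0, 0) = (\<Sum>k<?n * ?n. ?b $$ (k mod ?n, k div ?n) * (if k div ?n = k mod ?n then 1 else 0))"
    using kronecker_bounds[of _ ?n ?n] unfolding \<phi>_def
    by (subst mult_mat_entry_sum[where n = "?n * ?n"]) (auto simp: vec_col_def intro!: sum.cong)
  also have "\<dots> = (\<Sum>x<?n. \<Sum>y<?n. ?b $$ (y, x) * (if x = y then 1 else 0))" by (rule sum_div_mod)
  also have "\<dots> = (\<Sum>x<?n. \<Sum>y<?n. ?b $$ (y, x) * (if y = x then 1 else 0))" by (intro sum.cong refl) auto
  also have "\<dots> = \<tau>" by (simp add: sum_pick_right \<tau>_def)
  finally have "(?T (vec_col ?n (?T ?b)) * \<phi>) $$ (0, 0) = \<tau>" .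
  then have "\<psi> * \<phi> = 1\<^sub>m 1"
    using tr unfolding \<psi>_def \<tau>_def[symmetric] by (intro eq_matI) (auto simp: mat_smult_left simp del: index_mult_mat(1))
  then have "\<psi> * \<phi> = 1\<^sub>m (rdim (rep_unit D_H4 :: (dh4_gen, 'k) rep))" by (simp add: rep_unit_D_H4)
  moreover have "\<phi> \<in> rep_hom (rep_unit D_H4) ?M"
    by (rule rep_homI) (auto intro!: carrier_matI simp: \<phi> rep_unit_D_H4(5))
  moreover have "\<psi> \<in> rep_hom ?M (rep_unit D_H4)"
    by (rule rep_homI) (auto intro!: carrier_matI simp: \<psi> rep_unit_D_H4(5))
  ultimately show thesis using retract_split[OF M] that reps_wf dh4.unit_closed by blast
qed

lemma class_bound_iso:
  fixes V W :: "(dh4_gen, 'k::field) rep"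
  assumes inf: "infinite (UNIV :: 'k set)" and iso: "rep_iso V W" and wf: "rep_wf V" "rep_wf W" and cb: "class_bound p q V"
  shows "class_bound p q W"
proof (rule class_bound_summand[OF inf wf, of rep_zero])
  show "rep_iso V (rep_sum W rep_zero)" using iso wf by (simp add: rep_sum_zero)
  show "finite {t. \<not> contractible_at t (rep_zero :: (dh4_gen, 'k) rep)}" by (simp add: contractible_at_zero)
qed (use cb in auto)

text \<open>For L_n and its transpose the difference of the two dimensions is 1 or -1, so this trace
  is nonzero in every characteristic.\<close>

lemma trace_kron_module:
  fixes A D :: "'k::field mat"
  assumes A: "A \<in> carrier_mat q p" and D: "D \<in> carrier_mat q p" and \<sigma>: "\<sigma> * \<sigma> = 1"
  shows "(\<Sum>i<rdim (kron_module \<sigma> A D). act (kron_module \<sigma> A D) gen_b $$ (i, i)) = \<sigma> * (of_nat p - of_nat q)"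
proof -
  interpret kron_rep "kron_module \<sigma> A D" \<sigma> p q A D "kron_even p q" "transpose_mat (kron_even p q)" "kron_odd p q" "transpose_mat (kron_odd p q)"
    by (rule kron_module_rep[OF assms])
  have dim: "rdim (kron_module \<sigma> A D) = p + q" using A by (simp add: rdim_kron_module)
  have "act (kron_module \<sigma> A D) gen_b $$ (i, i) = (if i < p then \<sigma> else - \<sigma>)" if "i < p + q" for i
    unfolding act_b using that by (simp add: kron_parts_square del: index_mult_mat(1))
  then have "(\<Sum>i<rdim (kron_module \<sigma> A D). act (kron_module \<sigma> A D) gen_b $$ (i, i)) = (\<Sum>i<p + q. if i < p then \<sigma> else - \<sigma>)"
    unfolding dim by (intro sum.cong) auto
  then show ?thesis unfolding sum_lessThan_add by (simp add: algebra_simps)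
qed

text \<open>A class on L_n has degrees (n, 0), one on the transposed block (0, n), and the dimension
  is 2n + 1. By the fourth claim these degrees are least possible, so a class of small degree bounds
  the dimension. The last claim speaks of the standard model \<open>K\<close>, which has the same
  class in the Green ring as \<open>V\<close>.\<close>

lemma noncontractible_invariants:
  fixes V :: "(dh4_gen, 'k::field) rep"
  assumes V: "indecomposable D_H4 V" and two: "(2::'k) \<noteq> 0" and nc: "\<not> contractible V" and inf: "infinite (UNIV :: 'k set)"
  shows "act V gen_c = act V gen_b" "rank_one_at_zero V" "\<exists>p q. class_bound p q V \<and> rdim V = 2 * (p + q) + 1"
    "class_bound p q V \<Longrightarrow> rdim V \<le> 2 * (p + q) + 1"
    "\<exists>K\<in>reps D_H4. rep_iso V K \<and> (\<exists>W\<in>reps D_H4. rep_iso (rep_tensor D_H4 K (rep_dual D_H4 K)) (rep_sum (rep_unit D_H4) W))"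
proof -
  note Vr = indecomposable_reps[OF V]
  have wf: "rep_wf V" by (rule reps_wf[OF Vr])
  show "act V gen_c = act V gen_b"
    using kron_rep_exists[OF V two nc] kron_rep.act_c by metis
  obtain \<sigma> n A D where s: "\<sigma> * \<sigma> = 1" and iso: "rep_iso V (kron_module \<sigma> A D)"
    and AD: "A = kron_shift n \<and> D = kron_incl n \<or> A = transpose_mat (kron_shift n) \<and> D = transpose_mat (kron_incl n)"
    by (rule noncontractible_classification[OF V two nc inf])
  let ?K = "kron_module \<sigma> A D"
  obtain p' q' where c: "A \<in> carrier_mat q' p'" "D \<in> carrier_mat q' p'" and pq: "p' = Suc n \<and> q' = n \<or> p' = n \<and> q' = Suc n"
  proof (rule that)
    show "A \<in> carrier_mat (dim_row A) (dim_col A)" "D \<in> carrier_mat (dim_row A) (dim_col A)"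
      "dim_col A = Suc n \<and> dim_row A = n \<or> dim_col A = n \<and> dim_row A = Suc n"
      using AD by (auto intro!: carrier_matI)
  qed
  interpret K: kron_rep ?K \<sigma> p' q' A D "kron_even p' q'" "transpose_mat (kron_even p' q')"
      "kron_odd p' q'" "transpose_mat (kron_odd p' q')"
    by (rule kron_module_rep[OF c s])
  have Kr: "?K \<in> reps D_H4" by (rule K.in_reps)
  note Kwf = reps_wf[OF Kr]
  have osi: "rep_iso ?K V" by (rule rep_iso_sym[OF iso wf Kwf])
  have dim: "rdim V = 2 * n + 1" using rep_iso_dim[OF iso] pq by (auto simp: rdim_kron_module)
  have "rank_one_at_zero ?K" using AD K.rank_one_shift[of n] K.rank_one_shift_transpose[of n] by auto
  then show "rank_one_at_zero V" by (rule rank_one_iso[OF osi Kwf wf])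
  have "class_bound n 0 ?K \<or> class_bound 0 n ?K"
    using AD
  proof
    assume "A = kron_shift n \<and> D = kron_incl n"
    then show ?thesis using class_bound_shift(1)[OF s inf, of n] by simp
  next
    assume "A = transpose_mat (kron_shift n) \<and> D = transpose_mat (kron_incl n)"
    then show ?thesis using class_bound_shift_transpose(1)[OF s inf, of n] by simp
  qed
  then show "\<exists>p q. class_bound p q V \<and> rdim V = 2 * (p + q) + 1"
  proof
    assume "class_bound n 0 ?K"
    from class_bound_iso[OF inf osi Kwf wf this] show ?thesis by (intro exI conjI, assumption) (simp add: dim)
  next
    assume "class_bound 0 n ?K"
    from class_bound_iso[OF inf osi Kwf wf this] show ?thesis by (intro exI conjI, assumption) (simp add: dim)
  qed
  show "rdim V \<le> 2 * (p + q) + 1" if "class_bound p q V"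
  proof -
    have "class_bound p q ?K" by (rule class_bound_iso[OF inf iso wf Kwf that])
    with AD have "n \<le> p \<or> n \<le> q"
      using class_bound_shift(2)[OF s inf, of p q n] class_bound_shift_transpose(2)[OF s inf, of p q n] by auto
    then show ?thesis using dim by auto
  qed
  have "(of_nat p' - of_nat q' :: 'k) = 1 \<or> (of_nat p' - of_nat q' :: 'k) = - 1" using pq by auto
  moreover have "\<sigma> \<noteq> 0" using s by auto
  ultimately have "(\<Sum>i<rdim ?K. act ?K gen_b $$ (i, i)) \<noteq> 0" unfolding trace_kron_module[OF c s] by auto
  then obtain W where "W \<in> reps D_H4" "rep_iso (rep_tensor D_H4 ?K (rep_dual D_H4 ?K)) (rep_sum (rep_unit D_H4) W)"
    using unit_summand[OF Kr K.act_c] by blast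
  then show "\<exists>K\<in>reps D_H4. rep_iso V K \<and> (\<exists>W\<in>reps D_H4. rep_iso (rep_tensor D_H4 K (rep_dual D_H4 K)) (rep_sum (rep_unit D_H4) W))"
    using Kr iso by blast
qed

section \<open>Asymptotics of powers in the Green ring\<close>

lemma contractible_at_sum_iff:
  assumes wf: "rep_wf A" "rep_wf B"
  shows "contractible_at t (rep_sum A B) \<longleftrightarrow> contractible_at t A \<and> contractible_at t B"
proof
  assume c: "contractible_at t (rep_sum A B)"
  obtain i1 i2 p1 p2 where b: "biprod (rep_sum A B) A B i1 i2 p1 p2" by (rule biprod_rep_sum[OF wf])
  show "contractible_at t A \<and> contractible_at t B"
    using contractible_at_retract[OF c biprodD(1)[OF b] biprodD(3)[OF b] biprodD(5)[OF b]]
      contractible_at_retract[OF c biprodD(2)[OF b] biprodD(4)[OF b] biprodD(6)[OF b]] wf by simp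
qed (use contractible_at_sum wf in blast)

lemma contractible_at_sums:
  assumes "\<forall>U\<in>set Us. rep_wf U"
  shows "contractible_at t (rep_sums Us) \<longleftrightarrow> (\<forall>U\<in>set Us. contractible_at t U)"
  using assms by (induction Us) (auto simp: contractible_at_zero contractible_at_sum_iff)

lemma rep_sums_filter:
  assumes "\<forall>U\<in>set Us. rep_wf U"
  shows "rep_iso (rep_sums Us) (rep_sum (rep_sums (filter P Us)) (rep_sums (filter (\<lambda>U. \<not> P U) Us)))"
  using assms
proof (induction Us)
  case Nil
  then show ?case by (simp add: rep_sum_zero rep_iso_refl)
next
  case (Cons U Us)
  let ?A = "rep_sums (filter P Us)" and ?B = "rep_sums (filter (\<lambda>U. \<not> P U) Us)"
  have [simp]: "rep_wf U" "rep_wf ?A" "rep_wf ?B" "rep_wf (rep_sums Us)" using Cons.prems by (auto intro!: rep_wf_sums)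
  have iso: "rep_iso (rep_sum U (rep_sums Us)) (rep_sum U (rep_sum ?A ?B))"
    using Cons by (intro rep_sum_cong rep_iso_refl) auto
  show ?case
  proof (cases "P U")
    case True
    then show ?thesis using iso by (simp add: rep_sum_assoc)
  next
    case False
    have "rep_iso (rep_sum (rep_sum U ?A) ?B) (rep_sum (rep_sum ?A U) ?B)"
      by (rule rep_sum_cong[OF rep_sum_comm rep_iso_refl]) auto
    then have "rep_iso (rep_sum U (rep_sum ?A ?B)) (rep_sum ?A (rep_sum U ?B))" by (simp add: rep_sum_assoc)
    from rep_iso_trans[OF iso this] False show ?thesis by simp
  qed
qed

lemma tensor_decomposition:
  fixes V W :: "(dh4_gen, 'k::field) rep"
  assumes two: "(2::'k) \<noteq> 0" and inf: "infinite (UNIV :: 'k set)"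
    and V: "indecomposable D_H4 V" "\<not> contractible V" and W: "indecomposable D_H4 W" "\<not> contractible W"
  obtains K Zs where "indecomposable D_H4 K" "\<not> contractible K" "\<forall>Z\<in>set Zs. indecomposable D_H4 Z \<and> contractible Z"
    "rep_iso (rep_tensor D_H4 V W) (rep_sums (K # Zs))" "rdim K + 1 \<le> rdim V + rdim W"
proof -
  let ?M = "rep_tensor D_H4 V W"
  note Vr = indecomposable_reps[OF V(1)] and Wr = indecomposable_reps[OF W(1)]
  note Mr = reps_tensor[OF Vr Wr]
  note Mwf = reps_wf[OF Mr]
  note inv = noncontractible_invariants[OF _ two _ inf]
  obtain Us where Us: "\<forall>U\<in>set Us. indecomposable D_H4 U" "rep_iso ?M (rep_sums Us)"
    using rep_decomposition[OF Mr] by blast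
  then have Uwf: "\<forall>U\<in>set Us. rep_wf U" by (auto intro: indecomposable_wf)
  define Ns where "Ns = filter (\<lambda>U. \<not> contractible U) Us"
  define Zs where "Zs = filter (\<lambda>U. \<not> \<not> contractible U) Us"
  have Zi: "\<forall>Z\<in>set Zs. indecomposable D_H4 Z \<and> contractible Z" and Ni: "\<forall>N\<in>set Ns. indecomposable D_H4 N \<and> \<not> contractible N"
    using Us(1) by (auto simp: Zs_def Ns_def)
  then have NZwf: "\<forall>Z\<in>set Zs. rep_wf Z" "\<forall>Z\<in>set Ns. rep_wf Z" by (auto intro: indecomposable_wf)
  have wf: "rep_wf (rep_sums Zs)" "rep_wf (rep_sums Ns)" "rep_wf (rep_sums Us)" using NZwf Uwf by (auto intro!: rep_wf_sums)
  have iso: "rep_iso ?M (rep_sum (rep_sums Ns) (rep_sums Zs))"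
    using rep_iso_trans[OF Us(2) rep_sums_filter[OF Uwf, of "\<lambda>U. \<not> contractible U"]] Mwf wf by (simp add: Ns_def Zs_def)
  obtain p q where pq: "class_bound p q V" "rdim V = 2 * (p + q) + 1" using inv(3)[OF V] by blast
  obtain p' q' where pq': "class_bound p' q' W" "rdim W = 2 * (p' + q') + 1" using inv(3)[OF W] by blast
  have cb: "class_bound (p + p') (q + q') ?M" by (rule class_bound_tensor[OF Vr Wr inv(1)[OF W] pq(1) pq'(1)])
  have "finite (\<Union>Z\<in>set Zs. {t. \<not> contractible_at t Z})"
    using Zi contractible_generic[OF _ two] by (intro finite_UN_I) auto
  moreover have "{t. \<not> contractible_at t (rep_sums Zs)} = (\<Union>Z\<in>set Zs. {t. \<not> contractible_at t Z})"
    using contractible_at_sums[OF NZwf(1)] by auto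
  ultimately have fin: "finite {t. \<not> contractible_at t (rep_sums Zs)}" by simp
  \<comment> \<open>All contractible summands together have only finitely many exceptional
    parameters, so the class of the tensor product survives on \<open>Ns\<close>.\<close>
  have cbN: "class_bound (p + p') (q + q') (rep_sums Ns)" by (rule class_bound_summand[OF inf Mwf wf(2,1) iso cb fin])
  consider "Ns = []" | K where "Ns = [K]" | K K' Ns' where "Ns = K # K' # Ns'" by (cases Ns rule: remdups_adj.cases) auto
  then show thesis
  proof cases
    case 1
    then have "rep_sums Ns = rep_zero" by simp
    then show ?thesis using class_bound_not_contractible[OF inf wf(2) cbN] by (simp add: contractible_at_zero)
  next
    case (2 K)
    have Kwf: "rep_wf K" using NZwf 2 by simp
    have K: "indecomposable D_H4 K" "\<not> contractible K" using Ni 2 by auto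
    have "class_bound (p + p') (q + q') K" using cbN Kwf by (simp add: 2 rep_sum_zero)
    then have "rdim K \<le> 2 * (p + p' + (q + q')) + 1" by (rule inv(4)[OF K])
    \<comment> \<open>The bound 2(p + p' + q + q') + 1 is one less than the sum of the dimensions of
      \<open>V\<close> and \<open>W\<close>.\<close>
    then have "rdim K + 1 \<le> rdim V + rdim W" using pq(2) pq'(2) by simp
    moreover have "rep_iso ?M (rep_sums (K # Zs))" using iso Kwf by (simp add: 2 rep_sum_zero)
    ultimately show ?thesis using K Zi that by blast
  next
    case (3 K K' Ns')
    have wf3: "rep_wf K" "rep_wf K'" "rep_wf (rep_sums Ns')" using NZwf 3 by (auto intro!: rep_wf_sums)
    have r: "rank_one_at_zero ?M" by (rule rank_one_tensor[OF Vr Wr inv(2)[OF V] inv(2)[OF W]])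
    have rK: "rank_one_at_zero K" "rank_one_at_zero K'" using Ni 3 inv(2) by auto
    have "rep_iso ?M (rep_sum K (rep_sum K' (rep_sum (rep_sums Ns') (rep_sums Zs))))"
      using iso wf wf3 by (simp add: 3 rep_sum_assoc)
    then have False by (rule rank_one_two_summands[OF r rK Mwf wf3(1,2), rotated]) (use wf wf3 in simp)
    then show ?thesis ..
  qed
qed

section \<open>Facts on the field and on growth rates\<close>

text \<open>Over a finite field the polynomial 1 + \<Prod> (X - a) has positive degree and takes the
  value 1 everywhere.\<close>

lemma infinite_alg_closed: "infinite (UNIV :: 'k::alg_closed_field set)"
proof
  assume fin: "finite (UNIV :: 'k set)"
  define p :: "'k poly" where "p = 1 + (\<Prod>a\<in>UNIV. [:- a, 1:])"
  have "degree (\<Prod>a\<in>(UNIV :: 'k set). [:- a, 1:]) = card (UNIV :: 'k set)"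
    by (subst degree_prod_eq_sum_degree) auto
  moreover have "0 < card (UNIV :: 'k set)" using fin by (simp add: card_gt_0_iff)
  ultimately have "0 < degree p" unfolding p_def using degree_add_eq_right[of 1 "\<Prod>a\<in>(UNIV :: 'k set). [:- a, 1:]"] by simp
  then obtain x where x: "poly p x = 0" using alg_closed_imp_poly_has_root by blast
  have "(\<Prod>a\<in>UNIV. poly [:- a, 1:] x) = 0" using fin by (intro prod_zero bexI[of _ x]) auto
  then have "poly p x = 1" unfolding p_def by (simp only: poly_add poly_1 poly_prod) simp
  with x show False by simp
qed

lemma two_nonzero_if_CHAR: "CHAR('k::field) \<noteq> 2 \<Longrightarrow> (2::'k) \<noteq> 0"
proof
  assume c: "CHAR('k) \<noteq> 2" and "(2::'k) = 0"
  then have "CHAR('k) dvd 2" using of_nat_eq_0_iff_char_dvd[of 2, where 'a = 'k] by simp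
  then have "CHAR('k) = 1 \<or> CHAR('k) = 2" using two_is_prime_nat unfolding prime_nat_iff by blast
  with c show False by simp
qed

lemma formal_eval_frag_extend: "formal_eval \<phi> (frag_extend F a) = formal_eval (\<lambda>i. formal_eval \<phi> (F i)) a"
  by (simp add: formal_eval_extend frag_extend_frag_extend) (simp add: frag_extend_def lookup_sum formal_eval_extend)

lemma formal_eval_cong: "(\<And>i. i \<in> Poly_Mapping.keys a \<Longrightarrow> \<phi> i = \<psi> i) \<Longrightarrow> formal_eval \<phi> a = formal_eval \<psi> a"
  unfolding formal_eval_def by (intro sum.cong) auto

lemma formal_eval_mult_right: "formal_eval (\<lambda>i. \<phi> i * c) a = formal_eval \<phi> a * c"
  unfolding formal_eval_def by (simp add: sum_distrib_right mult.assoc)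

lemma formal_eval_mult_left: "formal_eval (\<lambda>i. c * \<phi> i) a = c * formal_eval \<phi> a"
  unfolding formal_eval_def by (simp add: sum_distrib_left mult.left_commute)

text \<open>A factor linear in \<open>n\<close> disappears under the root because
  \<open>root n n\<close> tends to 1.\<close>

lemma limsup_root_squeeze:
  fixes h :: int and d :: "nat \<Rightarrow> int"
  assumes h: "0 \<le> h" and B: "0 \<le> B" and bounds: "\<And>n. 0 < n \<Longrightarrow> h ^ n \<le> d n \<and> d n \<le> h ^ n * (int n * B + 1)"
  shows "limsup (\<lambda>n. ereal (root n (of_int (d n)))) = ereal (of_int h)"
proof -
  let ?r = "real_of_int h" and ?B = "real_of_int B"
  have "(\<lambda>n. ?r * (root n n * root n (?B + 1))) \<longlonglongrightarrow> ?r * (1 * 1)"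
    using B by (intro tendsto_intros LIMSEQ_root LIMSEQ_root_const) auto
  then have up: "(\<lambda>n. ?r * (root n n * root n (?B + 1))) \<longlonglongrightarrow> ?r" by simp
  have "(\<lambda>n. root n (of_int (d n))) \<longlonglongrightarrow> ?r"
  proof (rule tendsto_sandwich[OF _ _ tendsto_const up])
    show "\<forall>\<^sub>F n in sequentially. ?r \<le> root n (of_int (d n))"
      using eventually_gt_at_top[of 0]
    proof eventually_elim
      case (elim n)
      have "?r ^ n \<le> of_int (d n)" using bounds[OF elim] by (metis of_int_le_iff of_int_power)
      then have "root n (?r ^ n) \<le> root n (of_int (d n))" using elim by simp
      then show ?case using elim h by (simp add: real_root_power_cancel)
    qed
    show "\<forall>\<^sub>F n in sequentially. root n (of_int (d n)) \<le> ?r * (root n n * root n (?B + 1))"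
      using eventually_gt_at_top[of 0]
    proof eventually_elim
      case (elim n)
      have "real_of_int (d n) \<le> of_int (h ^ n * (int n * B + 1))" using bounds[OF elim] of_int_le_iff by blast
      also have "\<dots> = ?r ^ n * (real n * ?B + 1)" by simp
      \<comment> \<open>For \<open>n \<ge> 1\<close> one has nB + 1 \<le> n(B + 1), and the root of
        this product splits into factors with known limits.\<close>
      also have "\<dots> \<le> ?r ^ n * (real n * (?B + 1))"
        using elim h by (intro mult_left_mono) (auto simp: algebra_simps)
      finally have "root n (of_int (d n)) \<le> root n (?r ^ n * (real n * (?B + 1)))" using elim by simp
      then show ?case using elim h by (simp add: real_root_mult real_root_power_cancel)
    qed
  qed
  then have "(\<lambda>n. ereal (root n (of_int (d n)))) \<longlonglongrightarrow> ereal ?r" by simp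
  then show ?thesis by (intro lim_imp_Limsup) auto
qed

section \<open>The maximal representation ideal\<close>

text \<open>The definition uses chosen representatives; \<open>green_class_contractible\<close>
  shows that the choice is immaterial.\<close>

definition contractible_classes :: "((dh4_gen, 'k::field) rep \<Rightarrow>\<^sub>0 int) set set" where
  "contractible_classes = {i \<in> green_basis D_H4. contractible (basis_rep D_H4 i)}"

lemma green_class_contractible:
  fixes U :: "(dh4_gen, 'k::field) rep"
  assumes U: "indecomposable D_H4 U"
  shows "green_class D_H4 U \<in> contractible_classes \<longleftrightarrow> contractible U"
proof -
  have b: "green_class D_H4 U \<in> green_basis D_H4" using U by (auto simp: green_basis_def)
  have "rep_iso (basis_rep D_H4 (green_class D_H4 U)) U"
    using green_class_eq_iff[OF basis_rep(1)[OF b] U] basis_rep(2)[OF b] by simp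
  then show ?thesis
    using b contractible_iso[of "basis_rep D_H4 (green_class D_H4 U)" U] indecomposable_wf[OF basis_rep(1)[OF b]] indecomposable_wf[OF U]
    by (auto simp: contractible_classes_def)
qed

text \<open>All indecomposable summands are contractible at the same parameter as the module
  itself.\<close>

lemma keys_rep_coeffs_contractible:
  fixes V :: "(dh4_gen, 'k::field) rep"
  assumes V: "V \<in> reps D_H4" and c: "contractible V"
  shows "Poly_Mapping.keys (rep_coeffs D_H4 V) \<subseteq> contractible_classes"
proof -
  obtain t where t: "t \<noteq> 0" "contractible_at t V" using c unfolding contractible_def by blast
  obtain Us where Us: "\<forall>U\<in>set Us. indecomposable D_H4 U" "rep_iso V (rep_sums Us)" using rep_decomposition[OF V] by blast
  have wf: "\<forall>U\<in>set Us. rep_wf U" using Us(1) by (auto intro: indecomposable_wf)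
  have "contractible_at t (rep_sums Us)" by (rule contractible_at_iso[OF Us(2) reps_wf[OF V] _ t(2)]) (use wf in auto)
  then have "\<forall>U\<in>set Us. contractible U" using t(1) contractible_at_sums[OF wf] unfolding contractible_def by blast
  then have "\<forall>U\<in>set Us. green_class D_H4 U \<in> contractible_classes" using Us(1) green_class_contractible by blast
  then show ?thesis unfolding rep_coeffs_eq[OF V Us] class_sum_def
    by (induction Us) (auto dest!: subsetD[OF Poly_Mapping.keys_add] simp: keys_frag_of)
qed

lemma basis_tensor:
  fixes i j :: "((dh4_gen, 'k::field) rep \<Rightarrow>\<^sub>0 int) set"
  assumes "i \<in> green_basis D_H4" "j \<in> green_basis D_H4"
  shows "green_coeffs D_H4 (i \<otimes>\<^bsub>green_ring D_H4\<^esub> j) = rep_coeffs D_H4 (rep_tensor D_H4 (basis_rep D_H4 i) (basis_rep D_H4 j))"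
  using dh4.green_class_tensor[of "basis_rep D_H4 i" "basis_rep D_H4 j"] green_coeffs_class[OF reps_tensor[of "basis_rep D_H4 i" "basis_rep D_H4 j"]]
    assms by (simp add: basis_rep basis_rep_reps)

lemma keys_tensor_contractible:
  fixes i j :: "((dh4_gen, 'k::field) rep \<Rightarrow>\<^sub>0 int) set"
  assumes two: "(2::'k) \<noteq> 0" and ij: "i \<in> green_basis D_H4" "j \<in> green_basis D_H4" "i \<in> contractible_classes \<or> j \<in> contractible_classes"
  shows "Poly_Mapping.keys (green_coeffs D_H4 (i \<otimes>\<^bsub>green_ring D_H4\<^esub> j)) \<subseteq> contractible_classes"
  unfolding basis_tensor[OF ij(1,2)]
  by (rule keys_rep_coeffs_contractible[OF reps_tensor contractible_tensor[OF _ _ two]])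
    (use ij in \<open>auto simp: basis_rep basis_rep_reps contractible_classes_def\<close>)

lemma max_rep_index_D_H4:
  assumes two: "(2::'k::field) \<noteq> 0" and inf: "infinite (UNIV :: 'k set)"
  shows "max_rep_index (D_H4 :: (dh4_gen, 'k) hopf_presentation) = contractible_classes"
proof (rule dh4.max_rep_index_eqI)
  let ?D = "D_H4 :: (dh4_gen, 'k) hopf_presentation" and ?u = "rep_unit D_H4 :: (dh4_gen, 'k) rep"
  show sub: "contractible_classes \<subseteq> green_basis ?D" by (auto simp: contractible_classes_def)
  show "rep_ideal ?D (generate (add_monoid (green_ring ?D)) contractible_classes)"
  proof (rule dh4.span_ideal)
    have u: "indecomposable ?D ?u" by (rule indecomposable_dim_one[OF dh4.unit_closed rep_unit_D_H4(5)])
    \<comment> \<open>On the unit \<open>theta\<close> is zero, so the unit lies outside and the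
      ideal is proper.\<close>
    have "\<not> contractible_at t ?u" for t
    proof
      assume "contractible_at t ?u"
      then obtain s :: "'k mat" where s: "s \<in> carrier_mat 1 1" "theta ?u t * s + s * theta ?u t = 1\<^sub>m 1"
        unfolding contractible_at_def rep_unit_D_H4 by blast
      have "theta ?u t = 0\<^sub>m 1 1" unfolding theta_def rep_unit_D_H4 by (rule eq_matI) auto
      then have "1\<^sub>m 1 = (0\<^sub>m 1 1 :: 'k mat)" using s by simp
      then have "(1\<^sub>m 1 :: 'k mat) $$ (0, 0) = 0\<^sub>m 1 1 $$ (0, 0)" by simp
      then show False by simp
    qed
    then have "green_class ?D ?u \<notin> contractible_classes" using green_class_contractible[OF u] by (simp add: contractible_def)
    moreover have "green_class ?D ?u \<in> green_basis ?D" using u by (auto simp: green_basis_def)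
    ultimately show "contractible_classes \<subset> green_basis ?D" using sub by blast
    fix i assume i: "i \<in> (contractible_classes :: ((dh4_gen, 'k) rep \<Rightarrow>\<^sub>0 int) set set)"
    then have ib: "i \<in> green_basis ?D" and ic: "contractible (basis_rep ?D i)" by (auto simp: contractible_classes_def)
    have "green_dual ?D i = green_class ?D (rep_dual ?D (basis_rep ?D i))"
      using dh4.green_dual_class[OF basis_rep_reps[OF ib]] by (simp add: basis_rep(2)[OF ib])
    moreover have r: "rep_dual ?D (basis_rep ?D i) \<in> reps ?D" by (rule reps_dual[OF basis_rep_reps[OF ib]])
    ultimately show "Poly_Mapping.keys (green_coeffs ?D (green_dual ?D i)) \<subseteq> contractible_classes"
      using keys_rep_coeffs_contractible[OF r contractible_dual[OF basis_rep(1)[OF ib] two ic]] by (simp add: green_coeffs_class)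
  qed (rule keys_tensor_contractible[OF two])
  fix I and i :: "((dh4_gen, 'k) rep \<Rightarrow>\<^sub>0 int) set"
  assume I: "rep_ideal ?D I" and i: "i \<in> green_basis ?D" "i \<in> I"
  show "i \<in> contractible_classes"
  proof (rule ccontr)
    assume "i \<notin> contractible_classes"
    then have nc: "\<not> contractible (basis_rep ?D i)" using i by (auto simp: contractible_classes_def)
    note V = basis_rep(1)[OF i(1)]
    obtain K W where K: "K \<in> reps ?D" "rep_iso (basis_rep ?D i) K"
      and W: "W \<in> reps ?D" "rep_iso (rep_tensor ?D K (rep_dual ?D K)) (rep_sum (rep_unit ?D) W)"
      using noncontractible_invariants(5)[OF V two nc inf] by blast
    \<comment> \<open>The unit is split off for the standard model \<open>K\<close>, which
      represents the same basis element.\<close>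
    have "green_class ?D K = i"
      using green_class_iso[OF indecomposable_reps[OF V] K] basis_rep(2)[OF i(1)] by simp
    then show False using dh4.rep_ideal_unit_summand[OF I K(1) _ W] i(2) by simp
  qed
qed

section \<open>Counting the summands outside the ideal\<close>

text \<open>The number of summands outside the ideal, extended additively to differences of modules;
  this will be the growth rate.\<close>

definition core_count :: "((dh4_gen, 'k::field) rep \<Rightarrow>\<^sub>0 int) set \<Rightarrow> int" where
  "core_count x = formal_eval (\<lambda>i. if i \<in> contractible_classes then 0 else 1) (green_coeffs D_H4 x)"

text \<open>The bound is on the dimension minus 1, the quantity that is subadditive under products
  by \<open>tensor_core\<close>.\<close>

definition core_bounded :: "((dh4_gen, 'k::field) rep \<Rightarrow>\<^sub>0 int) set \<Rightarrow> int \<Rightarrow> bool" where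
  "core_bounded x B \<longleftrightarrow> x \<in> green_nonneg D_H4 \<and>
     (\<forall>i\<in>Poly_Mapping.keys (green_coeffs D_H4 x) - contractible_classes. green_dim i \<le> B + 1)"

lemma green_nonneg_lookup:
  "x \<in> green_nonneg H \<longleftrightarrow> x \<in> carrier (green_ring H) \<and> (\<forall>i. 0 \<le> Poly_Mapping.lookup (green_coeffs H x) i)"
proof -
  have "0 \<le> Poly_Mapping.lookup (green_coeffs H x) i" if "x \<in> carrier (green_ring H)" "i \<notin> green_basis H" for i
    using keys_green_coeffs[OF that(1)] that(2) by (metis in_keys_iff order_refl subsetD)
  then show ?thesis unfolding green_nonneg_def by blast
qed

lemma rep_coeffs_nonneg: "V \<in> reps H \<Longrightarrow> 0 \<le> Poly_Mapping.lookup (rep_coeffs H V) i"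
proof -
  assume V: "V \<in> reps H"
  show ?thesis
  proof (cases "i \<in> green_basis H")
    case True
    then show ?thesis using lookup_rep_coeffs[OF V basis_rep(1)[OF True]] basis_rep(2)[OF True] by simp
  next
    case False
    then show ?thesis using keys_rep_coeffs[OF V] by (metis in_keys_iff order_refl subsetD)
  qed
qed

lemma lookup_frag_extend: "Poly_Mapping.lookup (frag_extend F a) k = (\<Sum>i\<in>Poly_Mapping.keys a. Poly_Mapping.lookup a i * Poly_Mapping.lookup (F i) k)"
  unfolding frag_extend_def by (simp add: lookup_sum)

lemma tensor_core:
  fixes i j :: "((dh4_gen, 'k::field) rep \<Rightarrow>\<^sub>0 int) set"
  assumes two: "(2::'k) \<noteq> 0" and inf: "infinite (UNIV :: 'k set)"
    and i: "i \<in> green_basis D_H4 - contractible_classes" and j: "j \<in> green_basis D_H4 - contractible_classes"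
  obtains k r where "green_coeffs D_H4 (i \<otimes>\<^bsub>green_ring D_H4\<^esub> j) = frag_of k + r" "k \<notin> contractible_classes"
    "Poly_Mapping.keys r \<subseteq> contractible_classes" "green_dim k + 1 \<le> green_dim i + green_dim j"
proof -
  have ib: "i \<in> green_basis D_H4" "j \<in> green_basis D_H4" using i j by auto
  let ?V = "basis_rep D_H4 i" and ?W = "basis_rep D_H4 j"
  have nc: "\<not> contractible ?V" "\<not> contractible ?W" using i j by (auto simp: contractible_classes_def)
  obtain K Zs where K: "indecomposable D_H4 K" "\<not> contractible K" and Z: "\<forall>Z\<in>set Zs. indecomposable D_H4 Z \<and> contractible Z"
    and iso: "rep_iso (rep_tensor D_H4 ?V ?W) (rep_sums (K # Zs))" and dim: "rdim K + 1 \<le> rdim ?V + rdim ?W"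
    by (rule tensor_decomposition[OF two inf basis_rep(1)[OF ib(1)] nc(1) basis_rep(1)[OF ib(2)] nc(2)])
  have "rep_coeffs D_H4 (rep_tensor D_H4 ?V ?W) = class_sum D_H4 (K # Zs)"
    by (rule rep_coeffs_eq[OF reps_tensor _ iso]) (use K Z ib basis_rep_reps in auto)
  then have e: "green_coeffs D_H4 (i \<otimes>\<^bsub>green_ring D_H4\<^esub> j) = frag_of (green_class D_H4 K) + class_sum D_H4 Zs"
    unfolding basis_tensor[OF ib] by (simp add: class_sum_def)
  have "\<forall>Z\<in>set Zs. green_class D_H4 Z \<in> contractible_classes" using Z green_class_contractible by blast
  then have "Poly_Mapping.keys (class_sum D_H4 Zs) \<subseteq> contractible_classes" unfolding class_sum_def
    by (induction Zs) (auto dest!: subsetD[OF Poly_Mapping.keys_add] simp: keys_frag_of)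
  moreover have "green_dim (green_class D_H4 K) + 1 \<le> green_dim i + green_dim j"
    using dim green_dim_class[of D_H4 ?V] green_dim_class[of D_H4 ?W] green_dim_class[of D_H4 K] ib by (simp add: basis_rep(2))
  ultimately show thesis using that[OF e] green_class_contractible[OF K(1)] K(2) by blast
qed

lemma formal_eval_core:
  "Poly_Mapping.keys r \<subseteq> contractible_classes \<Longrightarrow> formal_eval (\<lambda>i. if i \<in> contractible_classes then 0 else 1) r = 0"
  unfolding formal_eval_def by (intro sum.neutral) auto

text \<open>Both sides are bilinear. A product of basis elements has exactly one summand outside the
  ideal if both factors lie outside, and none otherwise.\<close>

lemma core_count_mult:
  fixes x y :: "((dh4_gen, 'k::field) rep \<Rightarrow>\<^sub>0 int) set"
  assumes two: "(2::'k) \<noteq> 0" and inf: "infinite (UNIV :: 'k set)"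
    and x: "x \<in> carrier (green_ring D_H4)" and y: "y \<in> carrier (green_ring D_H4)"
  shows "core_count (x \<otimes>\<^bsub>green_ring D_H4\<^esub> y) = core_count x * core_count y"
proof -
  let ?c = "\<lambda>i :: ((dh4_gen, 'k) rep \<Rightarrow>\<^sub>0 int) set. if i \<in> contractible_classes then 0 else 1 :: int"
  have basis: "formal_eval ?c (green_coeffs D_H4 (i \<otimes>\<^bsub>green_ring D_H4\<^esub> j)) = ?c i * ?c j"
    if ij: "i \<in> green_basis D_H4" "j \<in> green_basis D_H4" for i j
  proof (cases "i \<in> contractible_classes \<or> j \<in> contractible_classes")
    case True
    then show ?thesis using formal_eval_core[OF keys_tensor_contractible[OF two ij True]] by auto
  next
    case False
    then obtain k r where "green_coeffs D_H4 (i \<otimes>\<^bsub>green_ring D_H4\<^esub> j) = frag_of k + r" "k \<notin> contractible_classes"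
      "Poly_Mapping.keys r \<subseteq> contractible_classes"
      using tensor_core[OF two inf, of i j] ij by blast
    then show ?thesis using False by (simp add: formal_eval_add formal_eval_core)
  qed
  have "core_count (x \<otimes>\<^bsub>green_ring D_H4\<^esub> y) =
      formal_eval (\<lambda>i. formal_eval (\<lambda>j. formal_eval ?c (green_coeffs D_H4 (i \<otimes>\<^bsub>green_ring D_H4\<^esub> j))) (green_coeffs D_H4 y)) (green_coeffs D_H4 x)"
    unfolding core_count_def dh4.green_coeffs_mult[OF x y] formal_eval_frag_extend ..
  also have "\<dots> = formal_eval (\<lambda>i. formal_eval (\<lambda>j. ?c i * ?c j) (green_coeffs D_H4 y)) (green_coeffs D_H4 x)"
    using keys_green_coeffs[OF x] keys_green_coeffs[OF y] by (intro formal_eval_cong basis) auto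
  also have "\<dots> = core_count x * core_count y"
    unfolding core_count_def by (simp only: formal_eval_mult_left formal_eval_mult_right)
  finally show ?thesis .
qed

lemma core_bounded_mult:
  fixes x y :: "((dh4_gen, 'k::field) rep \<Rightarrow>\<^sub>0 int) set"
  assumes two: "(2::'k) \<noteq> 0" and inf: "infinite (UNIV :: 'k set)"
    and bx: "core_bounded x B" and cy: "core_bounded y C"
  shows "core_bounded (x \<otimes>\<^bsub>green_ring D_H4\<^esub> y) (B + C)"
proof -
  have x: "x \<in> carrier (green_ring D_H4)" "\<And>i. 0 \<le> Poly_Mapping.lookup (green_coeffs D_H4 x) i"
    and y: "y \<in> carrier (green_ring D_H4)" "\<And>i. 0 \<le> Poly_Mapping.lookup (green_coeffs D_H4 y) i"
    using bx cy by (auto simp: core_bounded_def green_nonneg_lookup)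
  note kx = keys_green_coeffs[OF x(1)] and ky = keys_green_coeffs[OF y(1)]
  note co = dh4.green_coeffs_mult[OF x(1) y(1)]
  have "0 \<le> Poly_Mapping.lookup (green_coeffs D_H4 (x \<otimes>\<^bsub>green_ring D_H4\<^esub> y)) k" for k
    unfolding co lookup_frag_extend
  proof (intro sum_nonneg mult_nonneg_nonneg x y)
    fix i j assume "i \<in> Poly_Mapping.keys (green_coeffs D_H4 x)" "j \<in> Poly_Mapping.keys (green_coeffs D_H4 y)"
    then have ij: "i \<in> green_basis D_H4" "j \<in> green_basis D_H4" using kx ky by auto
    show "0 \<le> Poly_Mapping.lookup (green_coeffs D_H4 (i \<otimes>\<^bsub>green_ring D_H4\<^esub> j)) k"
      unfolding basis_tensor[OF ij] by (intro rep_coeffs_nonneg reps_tensor basis_rep_reps ij)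
  qed
  moreover have "green_dim k \<le> B + C + 1"
    if k: "k \<in> Poly_Mapping.keys (green_coeffs D_H4 (x \<otimes>\<^bsub>green_ring D_H4\<^esub> y)) - contractible_classes" for k
  proof -
    have "k \<in> Poly_Mapping.keys (green_coeffs D_H4 (x \<otimes>\<^bsub>green_ring D_H4\<^esub> y))" using k by simp
    from subsetD[OF keys_frag_extend this[unfolded co]] obtain i where i: "i \<in> Poly_Mapping.keys (green_coeffs D_H4 x)"
      "k \<in> Poly_Mapping.keys (frag_extend (\<lambda>j. green_coeffs D_H4 (i \<otimes>\<^bsub>green_ring D_H4\<^esub> j)) (green_coeffs D_H4 y))"
      by auto
    from subsetD[OF keys_frag_extend i(2)] obtain j where j: "j \<in> Poly_Mapping.keys (green_coeffs D_H4 y)" "k \<in> Poly_Mapping.keys (green_coeffs D_H4 (i \<otimes>\<^bsub>green_ring D_H4\<^esub> j))"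
      by auto
    have ij: "i \<in> green_basis D_H4" "j \<in> green_basis D_H4" using i j kx ky by auto
    \<comment> \<open>A summand outside the ideal arises only from two factors outside it.\<close>
    have nc: "i \<notin> contractible_classes" "j \<notin> contractible_classes"
      using keys_tensor_contractible[OF two ij] j(2) k by auto
    obtain k' r where kr: "green_coeffs D_H4 (i \<otimes>\<^bsub>green_ring D_H4\<^esub> j) = frag_of k' + r"
      "Poly_Mapping.keys r \<subseteq> contractible_classes" "green_dim k' + 1 \<le> green_dim i + green_dim j"
      using tensor_core[OF two inf, of i j] ij nc by blast
    have "k \<in> Poly_Mapping.keys (frag_of k') \<union> Poly_Mapping.keys r"
      using j(2) Poly_Mapping.keys_add[of "frag_of k'" r] unfolding kr(1) by blast
    then have "k = k'" using kr(2) k by (auto simp: keys_frag_of)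
    moreover have "green_dim i \<le> B + 1" "green_dim j \<le> C + 1" using bx cy i j nc by (auto simp: core_bounded_def)
    ultimately show ?thesis using kr(3) by simp
  qed
  ultimately show ?thesis unfolding core_bounded_def green_nonneg_lookup using dh4.green.m_closed[OF x(1) y(1)] by blast
qed

text \<open>There are \<open>core_count x\<close> summands in the core, and each contributes at
  least 1 and at most \<open>B + 1\<close> to the dimension.\<close>

lemma core_dim_bounds:
  fixes x :: "((dh4_gen, 'k::field) rep \<Rightarrow>\<^sub>0 int) set"
  assumes two: "(2::'k) \<noteq> 0" and inf: "infinite (UNIV :: 'k set)" and b: "core_bounded x B"
  shows "core_count x \<le> green_dim (core_max D_H4 x)" "green_dim (core_max D_H4 x) \<le> core_count x * (B + 1)" "0 \<le> core_count x"
proof -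
  have x: "x \<in> carrier (green_ring D_H4)" "\<And>i. 0 \<le> Poly_Mapping.lookup (green_coeffs D_H4 x) i"
    using b by (auto simp: core_bounded_def green_nonneg_lookup)
  let ?a = "Poly_Mapping.lookup (green_coeffs D_H4 x)" and ?K = "Poly_Mapping.keys (green_coeffs D_H4 x) - contractible_classes"
  have d: "green_dim (core_max D_H4 x) = (\<Sum>i\<in>?K. ?a i * green_dim i)"
    using core_max_dim[OF x(1)] unfolding max_rep_index_D_H4[OF two inf] .
  have h: "core_count x = (\<Sum>i\<in>?K. ?a i)"
    unfolding core_count_def formal_eval_def by (rule sum.mono_neutral_cong_right) auto
  have pos: "1 \<le> green_dim i" if "i \<in> ?K" for i
  proof -
    have "i \<in> green_basis D_H4" using that keys_green_coeffs[OF x(1)] by auto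
    then show ?thesis using green_dim_class[of D_H4 "basis_rep D_H4 i"] indecomposable_dim[OF basis_rep(1)] basis_rep(2) by fastforce
  qed
  show "core_count x \<le> green_dim (core_max D_H4 x)"
    unfolding h d
  proof (rule sum_mono)
    fix i assume "i \<in> ?K"
    from mult_left_mono[OF pos[OF this] x(2)[of i]] show "?a i \<le> ?a i * green_dim i" by simp
  qed
  show "green_dim (core_max D_H4 x) \<le> core_count x * (B + 1)"
    unfolding h d sum_distrib_right using x(2) b by (intro sum_mono mult_left_mono) (auto simp: core_bounded_def)
  show "0 \<le> core_count x" unfolding h by (intro sum_nonneg x)
qed

lemma core_bounded_exists:
  assumes x: "x \<in> green_nonneg D_H4"
  obtains B where "core_bounded x B" "0 \<le> B"
proof -
  define B where "B = Max (insert 0 (green_dim ` Poly_Mapping.keys (green_coeffs D_H4 x)))"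
  have "green_dim i \<le> B + 1" if "i \<in> Poly_Mapping.keys (green_coeffs D_H4 x)" for i
  proof -
    have "green_dim i \<le> B" unfolding B_def using that by (intro Max_ge) auto
    then show ?thesis by simp
  qed
  moreover have "0 \<le> B" unfolding B_def by (intro Max_ge) auto
  ultimately show thesis using that x unfolding core_bounded_def by blast
qed

text \<open>The n-th power has \<open>core_count x ^ n\<close> summands in its core, each of
  dimension at most nB + 1, so the roots are squeezed to \<open>core_count x\<close>.\<close>

lemma gamma_max_eq_core_count:
  fixes x :: "((dh4_gen, 'k::field) rep \<Rightarrow>\<^sub>0 int) set"
  assumes two: "(2::'k) \<noteq> 0" and inf: "infinite (UNIV :: 'k set)" and x: "x \<in> green_nonneg D_H4"
  shows "gamma_max D_H4 x = ereal (of_int (core_count x))" "0 \<le> core_count x"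
proof -
  have xc: "x \<in> carrier (green_ring D_H4)" using x by (simp add: green_nonneg_lookup)
  obtain B where b: "core_bounded x B" and B: "0 \<le> B" by (rule core_bounded_exists[OF x])
  show nonneg: "0 \<le> core_count x" by (rule core_dim_bounds(3)[OF two inf b])
  \<comment> \<open>The induction starts at exponent 1, where the bound is the given one for
    \<open>x\<close>; the limit superior does not see exponent 0.\<close>
  have pow: "core_bounded (x [^]\<^bsub>green_ring D_H4\<^esub> Suc n) (int (Suc n) * B) \<and> core_count (x [^]\<^bsub>green_ring D_H4\<^esub> Suc n) = core_count x ^ Suc n" for n
  proof (induction n)
    case 0
    have "x [^]\<^bsub>green_ring D_H4\<^esub> Suc 0 = x" using xc by simp
    then show ?case using b by simp
  next
    case (Suc n)
    have s: "x [^]\<^bsub>green_ring D_H4\<^esub> Suc (Suc n) = (x [^]\<^bsub>green_ring D_H4\<^esub> Suc n) \<otimes>\<^bsub>green_ring D_H4\<^esub> x" by simp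
    have "core_bounded (x [^]\<^bsub>green_ring D_H4\<^esub> Suc (Suc n)) (int (Suc n) * B + B)"
      unfolding s using core_bounded_mult[OF two inf _ b] Suc by blast
    moreover have "core_count (x [^]\<^bsub>green_ring D_H4\<^esub> Suc (Suc n)) = core_count (x [^]\<^bsub>green_ring D_H4\<^esub> Suc n) * core_count x"
      unfolding s by (rule core_count_mult[OF two inf dh4.green.nat_pow_closed[OF xc] xc])
    ultimately show ?case using Suc by (simp add: algebra_simps)
  qed
  show "gamma_max D_H4 x = ereal (of_int (core_count x))"
    unfolding gamma_max_def
  proof (rule limsup_root_squeeze[OF nonneg B])
    fix n :: nat assume "0 < n"
    then obtain m where n: "n = Suc m" by (cases n) auto
    from pow[of m] have p: "core_bounded (x [^]\<^bsub>green_ring D_H4\<^esub> n) (int n * B)" "core_count (x [^]\<^bsub>green_ring D_H4\<^esub> n) = core_count x ^ n"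
      unfolding n by (rule conjunct1, rule conjunct2)
    show "core_count x ^ n \<le> green_dim (core_max D_H4 (x [^]\<^bsub>green_ring D_H4\<^esub> n)) \<and>
      green_dim (core_max D_H4 (x [^]\<^bsub>green_ring D_H4\<^esub> n)) \<le> core_count x ^ n * (int n * B + 1)"
      using core_dim_bounds(1,2)[OF two inf p(1)] unfolding p(2) by (rule conjI)
  qed
qed

theorem theorem3p4:
  assumes "CHAR('k::alg_closed_field) \<noteq> 2"
  defines "D \<equiv> (D_H4 :: (dh4_gen, 'k) hopf_presentation)"
  shows "(\<forall>x\<in>green_nonneg D. \<exists>m::nat. gamma_max D x = ereal (real m)) \<and>
    (\<forall>x\<in>green_nonneg D. \<forall>y\<in>green_nonneg D.
       gamma_max D (x \<oplus>\<^bsub>green_ring D\<^esub> y) = gamma_max D x + gamma_max D y \<and>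
       gamma_max D (x \<otimes>\<^bsub>green_ring D\<^esub> y) = gamma_max D x * gamma_max D y)"
proof -
  note two = two_nonzero_if_CHAR[OF assms(1)] and inf = infinite_alg_closed[where 'k = 'k]
  note gamma = gamma_max_eq_core_count[OF two inf]
  have "\<exists>m::nat. gamma_max D x = ereal (real m)" if "x \<in> green_nonneg D" for x
    using gamma[of x] that unfolding D_def by (intro exI[of _ "nat (core_count x)"]) simp
  moreover have "gamma_max D (x \<oplus>\<^bsub>green_ring D\<^esub> y) = gamma_max D x + gamma_max D y \<and>
      gamma_max D (x \<otimes>\<^bsub>green_ring D\<^esub> y) = gamma_max D x * gamma_max D y"
    if xy: "x \<in> green_nonneg D" "y \<in> green_nonneg D" for x y
  proof
    have x: "x \<in> carrier (green_ring D)" "\<And>i. 0 \<le> Poly_Mapping.lookup (green_coeffs D x) i"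
      and y: "y \<in> carrier (green_ring D)" "\<And>i. 0 \<le> Poly_Mapping.lookup (green_coeffs D y) i"
      using xy by (auto simp: green_nonneg_lookup)
    have "x \<oplus>\<^bsub>green_ring D\<^esub> y \<in> green_nonneg D"
      unfolding green_nonneg_lookup using x y
      by (simp add: green_coeffs_add lookup_add D_def dh4.green.a_closed)
    moreover have "core_count (x \<oplus>\<^bsub>green_ring D\<^esub> y) = core_count x + core_count y"
      using x(1) y(1) unfolding core_count_def D_def by (simp add: green_coeffs_add formal_eval_add)
    ultimately show "gamma_max D (x \<oplus>\<^bsub>green_ring D\<^esub> y) = gamma_max D x + gamma_max D y"
      using gamma(1) xy unfolding D_def by simp
    \<comment> \<open>The bounds enter through \<open>core_bounded_mult\<close>, which also yields
      that the product is non-negative.\<close>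
    obtain B C where BC: "core_bounded x B" "core_bounded y C"
      by (rule core_bounded_exists[OF xy(1)[unfolded D_def]], rule core_bounded_exists[OF xy(2)[unfolded D_def]])
    have "x \<otimes>\<^bsub>green_ring D\<^esub> y \<in> green_nonneg D"
      using core_bounded_mult[OF two inf BC] unfolding core_bounded_def D_def by (rule conjunct1)
    then show "gamma_max D (x \<otimes>\<^bsub>green_ring D\<^esub> y) = gamma_max D x * gamma_max D y"
      using gamma(1) xy core_count_mult[OF two inf] x(1) y(1) unfolding D_def by simp
  qed
  ultimately show ?thesis by blast
qed

end
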